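(* Let $\mathcal{T}$ be an effective $1$-h-minimal theory of equicharacteristic zero valued fields and $K$ a sufficiently saturated model. Let $R\subseteq(\mathrm{RV}^\times)^n$, $S\subseteq(\mathrm{RV}^\times)^m$ and $f\colon R\to(\mathrm{RV}^\times)^k$ be $\emptyset$-definable. Then: (1) $\dim_{\mathrm{RV}}R>0$ iff $R$ is infinite. (2) If $n=m$ then $\dim_{\mathrm{RV}}(R\cup S)=\max\{\dim_{\mathrm{RV}}R,\dim_{\mathrm{RV}}S\}$. (3) There is a partition of $R$ into finitely many $\emptyset$-definable $R_i$ and for each $i$ a coordinate projection $\pi_i\colon\mathrm{RV}^n\to\mathrm{RV}^{\dim_{\mathrm{RV}}R}$ which is finite-to-one on $R_i$. (4) $\dim_{\mathrm{RV}}R=n$ iff $R$ contains a full-dimensional point. (5) For $A\subseteq K$, the RV-dimension of $R$ computed in the language $\mathcal{L}(A)$ equals $\dim_{\mathrm{RV}}R$. (6) $\dim_{\mathrm{RV}}R\ge\dim_{\mathrm{RV}}f(R)$. (7) If $(T_\xi)_{\xi\in R}$ is a $\emptyset$-definable family of subsets of $(\mathrm{RV}^\times)^{n'}$ and $q$ a positive integer, then $R_q=\{\xi\in R:\dim_{\mathrm{RV}}T_\xi=q\}$ is $\emptyset$-definable and $\{(\xi,\eta)\in\mathrm{RV}^n\times\mathrm{RV}^{n'}:\xi\in R_q,\eta\in T_\xi\}$ has RV-dimension $q+\dim_{\mathrm{RV}}R_q$. (8) If $\dim_{\mathrm{RV}}f^{-1}(\xi)=q$ for all $\xi\in f(R)$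 then $\dim_{\mathrm{RV}}R=\dim_{\mathrm{RV}}f(R)+q$. (9) If $f$ is finite-to-one then $\dim_{\mathrm{RV}}R=\dim_{\mathrm{RV}}f(R)$. (10) $\dim_{\mathrm{RV}}(R\times S)=\dim_{\mathrm{RV}}R+\dim_{\mathrm{RV}}S$. (11) There exists $\xi\in R$ with $\dim_{\mathrm{RV}}(R\cap\xi(k^\times)^n)=\dim_{\mathrm{RV}}R$.
   Context: $K$: valued field of characteristic $0$, residue field $k$ of characteristic $0$, valuation ring $\mathcal{O}_K$ with maximal ideal $\mathcal{M}_K$, multiplicative valuation $|\cdot|$; $\mathrm{RV}=K^\times/(1+\mathcal{M}_K)\cup\{0\}$, $\operatorname{rv}\colon K\to\mathrm{RV}$, $\mathrm{RV}^\times=\mathrm{RV}\setminus\{0\}$, and $k^\times\subseteq\mathrm{RV}^\times$ is the kernel of $|\cdot|\colon\mathrm{RV}^\times\to\Gamma_K^\times$; $\xi(k^\times)^n$ is the coordinatewise coset. $\mathcal{L}\supseteq\{0,1,+,-,\cdot,\mathcal{O}\}$, $1$-h-minimal in the sense of Cluckers–Halupczok–Rideau-Kikuchi. $\mathcal{T}$ effective: for every model $K$ and every $A\subseteq K$, every $\xi\in\mathrm{RV}$ that is $\emptyset$-definable in a model of $\operatorname{Th}_{\mathcal{L}(A)}(K)$ is $\operatorname{rv}$ of a $\emptyset$-definable element of that model. $\operatorname{acl}$ is model-theoretic algebraic closure (in $K^{\mathrm{eq}}$). RV-dimension: for a definable $R\subseteq(\mathrm{RV}^\times)^n$, $\dim_{\mathrm{RV}}R$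 is the largest $m$ such that there are $i_1<\dots<i_m$ and $a\in R$ with $a_{i_j}\notin\operatorname{acl}(a_{i_1},\dots,a_{i_{j-1}})$ for all $j$ (over the relevant parameters, in a sufficiently saturated model). A point $\xi\in(\mathrm{RV}^\times)^n$ is full-dimensional if for every set $X\subseteq K^n$ definable with parameters from $\mathrm{RV}$, either $X\cap\operatorname{rv}^{-1}(\xi)=\emptyset$ or $\operatorname{rv}^{-1}(\xi)\subseteq X$. *)

theory Defs
  imports
    "HOL-Algebra.QuotRing"
    "HOL-Algebra.Subrings"
    "HOL-Library.Disjoint_Sets"
    "HOL-Library.Extended_Real"
begin

section \<open>Languages and structures\<close>

text \<open>
  A language containing \<open>{0, 1, +, -, \<cdot>, \<O>}\<close>; \<open>'f\<close> and \<open>'r\<close> name the additional function and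
  relation symbols. A symbol applied to different numbers of arguments counts as different
  symbols, so no arity function is needed: a symbol of fixed arity is interpreted trivially at
  all other arities. Variables are de Bruijn indices.
\<close>

datatype 'f trm =
    TVar nat
  | TZero
  | TOne
  | TPlus "'f trm" "'f trm"
  | TMinus "'f trm" "'f trm"
  | TTimes "'f trm" "'f trm"
  | TApp 'f "'f trm list"

datatype ('f, 'r) fm =
    FEq "'f trm" "'f trm"
  | FVal "'f trm"
  | FRel 'r "'f trm list"
  | FNot "('f, 'r) fm"
  | FAnd "('f, 'r) fm" "('f, 'r) fm"
  | FEx "('f, 'r) fm"

record ('a, 'f, 'r) vstr = "'a ring" +
  vring :: "'a set"
  func :: "'f \<Rightarrow> 'a list \<Rightarrow> 'a"
  reln :: "'r \<Rightarrow> 'a list \<Rightarrow> bool"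

text \<open>
  Environments are tuples. A variable pointing beyond the end of the tuple is read as the term
  \<open>0\<close>, so that every formula can be evaluated at every tuple (it then stands for one of its
  substitution instances) and free variables need no bookkeeping. In particular
  \<open>sat K \<phi> []\<close> is satisfaction of a sentence.
\<close>

primrec trm_val :: "('a, 'f, 'r) vstr \<Rightarrow> 'a list \<Rightarrow> 'f trm \<Rightarrow> 'a" where
  "trm_val K xs (TVar i) = (if i < length xs then xs ! i else \<zero>\<^bsub>K\<^esub>)"
| "trm_val K xs TZero = \<zero>\<^bsub>K\<^esub>"
| "trm_val K xs TOne = \<one>\<^bsub>K\<^esub>"
| "trm_val K xs (TPlus s t) = trm_val K xs s \<oplus>\<^bsub>K\<^esub> trm_val K xs t"
| "trm_val K xs (TMinus s t) = trm_val K xs s \<ominus>\<^bsub>K\<^esub> trm_val K xs t"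
| "trm_val K xs (TTimes s t) = trm_val K xs s \<otimes>\<^bsub>K\<^esub> trm_val K xs t"
| "trm_val K xs (TApp g ts) = func K g (map (trm_val K xs) ts)"

primrec sat :: "('a, 'f, 'r) vstr \<Rightarrow> ('f, 'r) fm \<Rightarrow> 'a list \<Rightarrow> bool" where
  "sat K (FEq s t) xs \<longleftrightarrow> trm_val K xs s = trm_val K xs t"
| "sat K (FVal t) xs \<longleftrightarrow> trm_val K xs t \<in> vring K"
| "sat K (FRel p ts) xs \<longleftrightarrow> reln K p (map (trm_val K xs) ts)"
| "sat K (FNot \<phi>) xs \<longleftrightarrow> \<not> sat K \<phi> xs"
| "sat K (FAnd \<phi> \<psi>) xs \<longleftrightarrow> sat K \<phi> xs \<and> sat K \<psi> xs"
| "sat K (FEx \<phi>) xs \<longleftrightarrow> (\<exists>x\<in>carrier K. sat K \<phi> (x # xs))"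


section \<open>Valued fields of equicharacteristic zero\<close>

definition char_zero :: "('a, 'm) ring_scheme \<Rightarrow> bool" where
  "char_zero R \<longleftrightarrow> (\<forall>n::nat. n > 0 \<longrightarrow> [n] \<cdot>\<^bsub>R\<^esub> \<one>\<^bsub>R\<^esub> \<noteq> \<zero>\<^bsub>R\<^esub>)"

definition maxid :: "('a, 'f, 'r) vstr \<Rightarrow> 'a set" where
  "maxid K = vring K - Units (K\<lparr>carrier := vring K\<rparr>)"

definition residue_field :: "('a, 'f, 'r) vstr \<Rightarrow> 'a set ring" where
  "residue_field K = (K\<lparr>carrier := vring K\<rparr>) Quot (maxid K)"

text \<open>
  As in the work of Cluckers, Halupczok and Rideau-Kikuchi, the valuation is non-trivial.
\<close>

definition valued_field :: "('a, 'f, 'r) vstr \<Rightarrow> bool" where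
  "valued_field K \<longleftrightarrow>
     field K \<and> char_zero K \<and>
     subring (vring K) K \<and> vring K \<noteq> carrier K \<and>
     (\<forall>x\<in>carrier K - {\<zero>\<^bsub>K\<^esub>}. x \<in> vring K \<or> inv\<^bsub>K\<^esub> x \<in> vring K) \<and>
     char_zero (residue_field K) \<and>
     (\<forall>g xs. set xs \<subseteq> carrier K \<longrightarrow> func K g xs \<in> carrier K)"

text \<open>
  The axioms of non-trivially valued fields of equicharacteristic zero are tacitly part of
  every theory \<open>T\<close>.
\<close>

definition model :: "('f, 'r) fm set \<Rightarrow> ('a, 'f, 'r) vstr \<Rightarrow> bool" where
  "model T K \<longleftrightarrow> valued_field K \<and> (\<forall>\<phi>\<in>T. sat K \<phi> [])"

text \<open>\<open>|x| \<le> |y|\<close> and \<open>|x| < |y|\<close> for the multiplicative valuation \<open>K \<rightarrow> K\<^sup>\<times>/\<O>\<^sup>\<times> \<union> {0}\<close>.\<close>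

definition vle :: "('a, 'f, 'r) vstr \<Rightarrow> 'a \<Rightarrow> 'a \<Rightarrow> bool" where
  "vle K x y \<longleftrightarrow> (\<exists>a\<in>vring K. x = a \<otimes>\<^bsub>K\<^esub> y)"

definition veq :: "('a, 'f, 'r) vstr \<Rightarrow> 'a \<Rightarrow> 'a \<Rightarrow> bool" where
  "veq K x y \<longleftrightarrow> vle K x y \<and> vle K y x"

definition vlt :: "('a, 'f, 'r) vstr \<Rightarrow> 'a \<Rightarrow> 'a \<Rightarrow> bool" where
  "vlt K x y \<longleftrightarrow> vle K x y \<and> \<not> vle K y x"


section \<open>Definability in \<open>K\<close>-eq\<close>

text \<open>
  An imaginary sort is the quotient of some \<open>K\<^sup>n\<close> by a \<open>\<emptyset>\<close>-definable equivalence relation. Its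
  elements are equivalence classes, i.e. sets of \<open>n\<close>-tuples; \<open>K\<close> itself is the sort of the
  singletons \<open>{[x]}\<close>.
\<close>

type_synonym 'a imag = "'a list set"

definition tuples :: "('a, 'f, 'r) vstr \<Rightarrow> nat \<Rightarrow> 'a list set" where
  "tuples K n = {xs. length xs = n \<and> set xs \<subseteq> carrier K}"

definition imaginary_sort :: "('a, 'f, 'r) vstr \<Rightarrow> 'a imag set \<Rightarrow> bool" where
  "imaginary_sort K S \<longleftrightarrow>
     (\<exists>n \<phi> E. E = {(xs, ys). xs \<in> tuples K n \<and> ys \<in> tuples K n \<and> sat K \<phi> (xs @ ys)} \<and>
        equiv (tuples K n) E \<and> S = tuples K n // E)"

definition pt :: "'a \<Rightarrow> 'a imag" where
  "pt x = {[x]}"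

text \<open>
  \<open>sat_eq K \<phi> [e\<^sub>1, \<dots>, e\<^sub>r]\<close> is the \<open>K\<close>-eq formula stating that \<open>\<phi>\<close> holds for some representatives
  of \<open>e\<^sub>1, \<dots>, e\<^sub>r\<close>. Every formula of \<open>K\<close>-eq with free variables in given sorts is equivalent to
  one of this kind (take for \<open>\<phi>\<close> its pull-back to \<open>K\<close>).
\<close>

definition sat_eq :: "('a, 'f, 'r) vstr \<Rightarrow> ('f, 'r) fm \<Rightarrow> 'a imag list \<Rightarrow> bool" where
  "sat_eq K \<phi> es \<longleftrightarrow> (\<exists>rs. list_all2 (\<in>) rs es \<and> sat K \<phi> (concat rs))"

text \<open>
  \<open>definable K Ss P X\<close>: \<open>X\<close> is a subset, definable with parameters from the set \<open>P\<close> of (possibly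
  imaginary) elements, of the product of the sorts (or definable subsets of sorts) listed in \<open>Ss\<close>.
\<close>

definition definable ::
  "('a, 'f, 'r) vstr \<Rightarrow> 'a imag set list \<Rightarrow> 'a imag set \<Rightarrow> 'a imag list set \<Rightarrow> bool" where
  "definable K Ss P X \<longleftrightarrow>
     (\<exists>\<phi> ps. set ps \<subseteq> P \<and> X = {es \<in> listset Ss. sat_eq K \<phi> (es @ ps)})"

definition definableK ::
  "('a, 'f, 'r) vstr \<Rightarrow> nat \<Rightarrow> 'a imag set \<Rightarrow> 'a list set \<Rightarrow> bool" where
  "definableK K n P X \<longleftrightarrow> definable K (replicate n (pt ` carrier K)) P (map pt ` X)"

definition acl :: "('a, 'f, 'r) vstr \<Rightarrow> 'a imag set \<Rightarrow> 'a imag set" where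
  "acl K P =
     {e. \<exists>S X. imaginary_sort K S \<and> X \<subseteq> S \<and> finite X \<and> e \<in> X \<and>
               definable K [S] P ((\<lambda>e'. [e']) ` X)}"


section \<open>Leading terms\<close>

definition rv :: "('a, 'f, 'r) vstr \<Rightarrow> 'a \<Rightarrow> 'a imag" where
  "rv K x = {[x \<otimes>\<^bsub>K\<^esub> (\<one>\<^bsub>K\<^esub> \<oplus>\<^bsub>K\<^esub> m)] | m. m \<in> maxid K}"

definition RV :: "('a, 'f, 'r) vstr \<Rightarrow> 'a imag set" where
  "RV K = rv K ` carrier K"

definition RVx :: "('a, 'f, 'r) vstr \<Rightarrow> 'a imag set" where
  "RVx K = rv K ` (carrier K - {\<zero>\<^bsub>K\<^esub>})"

definition RVx_pow :: "('a, 'f, 'r) vstr \<Rightarrow> nat \<Rightarrow> 'a imag list set" where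
  "RVx_pow K n = listset (replicate n (RVx K))"

abbreviation definableRV ::
  "('a, 'f, 'r) vstr \<Rightarrow> nat \<Rightarrow> 'a imag set \<Rightarrow> 'a imag list set \<Rightarrow> bool" where
  "definableRV K n P X \<equiv> definable K (replicate n (RV K)) P X"

definition rv_mult :: "('a, 'f, 'r) vstr \<Rightarrow> 'a imag \<Rightarrow> 'a imag \<Rightarrow> 'a imag" where
  "rv_mult K \<xi> \<zeta> = {[x \<otimes>\<^bsub>K\<^esub> y] | x y. [x] \<in> \<xi> \<and> [y] \<in> \<zeta>}"

text \<open>\<open>k\<^sup>\<times>\<close> as the kernel of \<open>|\<cdot>|\<close> on \<open>RV\<^sup>\<times>\<close>, and the coset \<open>\<xi>(k\<^sup>\<times>)\<^sup>n\<close>.\<close>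

definition kx :: "('a, 'f, 'r) vstr \<Rightarrow> 'a imag set" where
  "kx K = {rv K u | u. u \<in> carrier K - {\<zero>\<^bsub>K\<^esub>} \<and> veq K u \<one>\<^bsub>K\<^esub>}"

definition kx_coset :: "('a, 'f, 'r) vstr \<Rightarrow> 'a imag list \<Rightarrow> 'a imag list set" where
  "kx_coset K \<xi> = {map2 (rv_mult K) \<xi> us | us. us \<in> listset (replicate (length \<xi>) (kx K))}"

text \<open>
  For \<open>\<lambda> = |t| \<noteq> 0\<close>, \<open>rv_lam K t x\<close> is the class of \<open>x\<close> in
  \<open>RV\<^sub>\<lambda> = K\<^sup>\<times>/{1 + b | |b| < \<lambda>} \<union> {0}\<close>. The additional coordinate \<open>s\<close> records \<open>\<lambda>\<close>, so that the
  elements of all the \<open>RV\<^sub>\<lambda>\<close> together belong to a single imaginary sort of pairs \<open>(\<lambda>, \<xi>)\<close>.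
\<close>

definition rv_lam :: "('a, 'f, 'r) vstr \<Rightarrow> 'a \<Rightarrow> 'a \<Rightarrow> 'a imag" where
  "rv_lam K t x =
     {[s, x \<otimes>\<^bsub>K\<^esub> (\<one>\<^bsub>K\<^esub> \<oplus>\<^bsub>K\<^esub> b)] | s b. s \<in> carrier K \<and> veq K s t \<and> b \<in> carrier K \<and> vlt K b t}"


section \<open>Hensel minimality and effectivity\<close>

definition prepares :: "('a, 'f, 'r) vstr \<Rightarrow> 'a \<Rightarrow> 'a set \<Rightarrow> 'a set \<Rightarrow> bool" where
  "prepares K t C X \<longleftrightarrow>
     (\<forall>x\<in>carrier K. \<forall>x'\<in>carrier K.
        (\<forall>c\<in>C. rv_lam K t (x \<ominus>\<^bsub>K\<^esub> c) = rv_lam K t (x' \<ominus>\<^bsub>K\<^esub> c)) \<longrightarrow> (x \<in> X \<longleftrightarrow> x' \<in> X))"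

text \<open>
  The type argument is the universe from which the models of \<open>T\<close> are taken, since HOL cannot
  quantify over all types. Failures of \<open>l\<close>-h-minimality and of effectivity only involve
  finitely many elements (the finitely many parameters actually used) and a type over the empty
  set, so they occur in every sufficiently saturated model of the same complete theory: as soon
  as \<open>'a\<close> carries such a model, nothing is lost for its theory.
\<close>

definition h_minimal :: "'a itself \<Rightarrow> nat \<Rightarrow> ('f, 'r) fm set \<Rightarrow> bool" where
  "h_minimal _ l T \<longleftrightarrow>
     (\<forall>(K :: ('a, 'f, 'r) vstr) t A A' X.
        model T K \<longrightarrow>
        t \<in> carrier K - {\<zero>\<^bsub>K\<^esub>} \<longrightarrow> vle K t \<one>\<^bsub>K\<^esub> \<longrightarrow>
        A \<subseteq> carrier K \<longrightarrow>
        A' \<subseteq> rv_lam K t ` carrier K \<longrightarrow> finite A' \<longrightarrow> card A' \<le> l \<longrightarrow>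
        X \<subseteq> carrier K \<longrightarrow> definableK K 1 (pt ` A \<union> RV K \<union> A') ((\<lambda>x. [x]) ` X) \<longrightarrow>
        (\<exists>C. C \<subseteq> carrier K \<and> finite C \<and> definableK K 1 (pt ` A) ((\<lambda>x. [x]) ` C) \<and>
             prepares K t C X))"

text \<open>
  \<open>elementary K A h K'\<close>: the expansion of \<open>K'\<close> in which the constant for \<open>a \<in> A\<close> is interpreted
  by \<open>h a\<close> is a model of the \<open>L(A)\<close>-theory of \<open>K\<close>. For \<open>A = carrier K\<close>, \<open>h\<close> is an elementary
  embedding.
\<close>

definition elementary ::
  "('a, 'f, 'r) vstr \<Rightarrow> 'a set \<Rightarrow> ('a \<Rightarrow> 'b) \<Rightarrow> ('b, 'f, 'r) vstr \<Rightarrow> bool" where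
  "elementary K A h K' \<longleftrightarrow>
     h ` A \<subseteq> carrier K' \<and> (\<forall>\<phi> xs. set xs \<subseteq> A \<longrightarrow> (sat K \<phi> xs \<longleftrightarrow> sat K' \<phi> (map h xs)))"

definition effective :: "'a itself \<Rightarrow> ('f, 'r) fm set \<Rightarrow> bool" where
  "effective _ T \<longleftrightarrow>
     (\<forall>(K :: ('a, 'f, 'r) vstr) A (K' :: ('a, 'f, 'r) vstr) h \<xi>.
        model T K \<longrightarrow> A \<subseteq> carrier K \<longrightarrow> model T K' \<longrightarrow> elementary K A h K' \<longrightarrow>
        \<xi> \<in> RV K' \<longrightarrow> definableRV K' 1 (pt ` h ` A) {[\<xi>]} \<longrightarrow>
        (\<exists>x\<in>carrier K'. definableK K' 1 (pt ` h ` A) {[x]} \<and> rv K' x = \<xi>))"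

text \<open>
  \<open>saturated K A\<close>: \<open>K\<close> is \<open>\<kappa>\<^sup>+\<close>-saturated, where \<open>\<kappa>\<close> is the number of \<open>L(A)\<close>-formulas, i.e.
  \<open>\<kappa> = |L(A)| + \<aleph>\<^sub>0\<close>. An element of \<open>\<Sigma>\<close> is a formula together with a tuple of parameters.
\<close>

definition saturated :: "('a, 'f, 'r) vstr \<Rightarrow> 'a set \<Rightarrow> bool" where
  "saturated K A \<longleftrightarrow>
     (\<forall>B \<Sigma>. B \<subseteq> carrier K \<longrightarrow>
        ordLeq3 (card_of B) (card_of ((UNIV :: ('f, 'r) fm set) \<times> lists A)) \<longrightarrow>
        \<Sigma> \<subseteq> (UNIV :: ('f, 'r) fm set) \<times> lists B \<longrightarrow>
        (\<forall>\<Sigma>0. finite \<Sigma>0 \<longrightarrow> \<Sigma>0 \<subseteq> \<Sigma> \<longrightarrow> (\<exists>x\<in>carrier K. \<forall>(\<phi>, bs)\<in>\<Sigma>0. sat K \<phi> (x # bs))) \<longrightarrow>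
        (\<exists>x\<in>carrier K. \<forall>(\<phi>, bs)\<in>\<Sigma>. sat K \<phi> (x # bs)))"
  for K :: "('a, 'f, 'r) vstr"


section \<open>RV-dimension\<close>

text \<open>
  The dimension over the parameter set \<open>P\<close>, to be used when the structure is sufficiently
  saturated over \<open>P\<close>. The index set \<open>I\<close> is \<open>{i\<^sub>1 < \<dots> < i\<^sub>m}\<close>. The supremum is a maximum unless
  \<open>X\<close> is empty, in which case it is \<open>-\<infinity>\<close>.
\<close>

definition dimRV :: "('a, 'f, 'r) vstr \<Rightarrow> 'a imag set \<Rightarrow> 'a imag list set \<Rightarrow> ereal" where
  "dimRV K P X =
     Sup {ereal (real (card I)) | I. \<exists>a\<in>X. I \<subseteq> {..<length a} \<and>
            (\<forall>i\<in>I. a ! i \<notin> acl K (P \<union> {a ! j | j. j \<in> I \<and> j < i}))}"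

definition full_dimensional :: "('a, 'f, 'r) vstr \<Rightarrow> nat \<Rightarrow> 'a imag list \<Rightarrow> bool" where
  "full_dimensional K n \<xi> \<longleftrightarrow>
     \<xi> \<in> RVx_pow K n \<and>
     (\<forall>X. X \<subseteq> tuples K n \<longrightarrow> definableK K n (RV K) X \<longrightarrow>
        X \<inter> {x \<in> tuples K n. map (rv K) x = \<xi>} = {} \<or> {x \<in> tuples K n. map (rv K) x = \<xi>} \<subseteq> X)"

end

theory Submission
  imports Defs
begin

text \<open>
  Only \<open>0\<close>-h-minimality (no parameter from \<open>RV\<^sub>\<lambda>\<close> is ever needed) and effectivity enter.

  If \<open>\<xi> \<in> RV\<^sup>\<times>\<close> is algebraic over \<open>A \<subseteq> K\<close>, then its fibre \<open>rv\<^sup>-\<^sup>1(\<xi>)\<close> contains a point algebraic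
  over \<open>A\<close>: in a minimal finite \<open>A\<close>-definable set of leading terms containing \<open>\<xi>\<close>, the coefficients
  of the monic polynomial with these roots are lifted to \<open>K\<close> by effectivity, and the lifted
  polynomial is not constant modulo \<open>rv\<close> on the fibre, so a finite set preparing it meets the fibre.
  Conversely, if \<open>\<xi>\<close> is not algebraic over \<open>A\<close>, no set definable over \<open>A \<union> RV\<close> splits the fibre. Hence
  a tuple is independent for \<open>acl\<close> (taken in the given order) iff it is full-dimensional, a
  condition that is invariant under permutations of the coordinates. So \<open>acl\<close> satisfies exchange
  on \<open>RV\<^sup>\<times>\<close>, and dimension is the maximal rank of a pregeometry.

  The geometry eliminates the quantifier ``infinitely many'': if a definable \<open>D \<subseteq> RV\<^sup>\<times>\<close> is infinite,
  then inside a coset of \<open>k\<^sup>\<times>\<close> the difference quotients of \<open>D\<close> exhaust the residue field, since a pair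
  of independent elements cannot be determined by a single element. With compactness this gives
  uniform finiteness, so that ``there is a tuple in \<open>X\<close> of rank at least \<open>q\<close>'' is first-order and
  does not depend on the parameters over which the rank is computed. All items follow from this and the
  additivity of rank.
\<close>

section \<open>Formulas with substitution\<close>

text \<open>Dimension is defined by \<open>acl\<close> along the given order of coordinates, so no
  coordinate can be moved before exchange is known; exchange in turn is read off from
  \<open>unsplit\<close>, in which the coordinates are merely variables of a formula. Two obstacles
  shape the lifting of algebraic leading terms. Leading terms cannot be added, so a polynomial with
  prescribed roots makes sense only inside one coset of \<open>kx K\<close>; a definable set of
  least size lies in such a coset, and rescaling the coefficients by powers of a root makes them
  independent of the root. A coefficient may vanish modulo the maximal ideal; it then has no
  well-determined leading term and is lifted by zero. For (5) the second structure lives on a type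
  about which h-minimality says nothing, so definability is proved for two structures at once and
  the finiteness bounds found in \<open>K\<close> are carried over as sentences. In (11) the coset
  has to be named by parameters that do not swallow the rank of the point; an independent tuple of
  the same coset serves for this.\<close>

primrec tval :: "('a, 'f, 'r) vstr \<Rightarrow> (nat \<Rightarrow> 'a) \<Rightarrow> 'f trm \<Rightarrow> 'a" where
  "tval K e (TVar i) = e i"
| "tval K e TZero = \<zero>\<^bsub>K\<^esub>"
| "tval K e TOne = \<one>\<^bsub>K\<^esub>"
| "tval K e (TPlus s t) = tval K e s \<oplus>\<^bsub>K\<^esub> tval K e t"
| "tval K e (TMinus s t) = tval K e s \<ominus>\<^bsub>K\<^esub> tval K e t"
| "tval K e (TTimes s t) = tval K e s \<otimes>\<^bsub>K\<^esub> tval K e t"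
| "tval K e (TApp g ts) = func K g (map (tval K e) ts)"

text \<open>Environments are total functions here, so that entering a binder is a
  \<open>case_nat\<close> and substitution is composition; the default of \<open>sat\<close> at
  missing variables is recovered by \<open>env\<close>.\<close>

primrec holds :: "('a, 'f, 'r) vstr \<Rightarrow> (nat \<Rightarrow> 'a) \<Rightarrow> ('f, 'r) fm \<Rightarrow> bool" where
  "holds K e (FEq s t) \<longleftrightarrow> tval K e s = tval K e t"
| "holds K e (FVal t) \<longleftrightarrow> tval K e t \<in> vring K"
| "holds K e (FRel p ts) \<longleftrightarrow> reln K p (map (tval K e) ts)"
| "holds K e (FNot \<phi>) \<longleftrightarrow> \<not> holds K e \<phi>"
| "holds K e (FAnd \<phi> \<psi>) \<longleftrightarrow> holds K e \<phi> \<and> holds K e \<psi>"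
| "holds K e (FEx \<phi>) \<longleftrightarrow> (\<exists>x\<in>carrier K. holds K (case_nat x e) \<phi>)"

definition env :: "('a, 'f, 'r) vstr \<Rightarrow> 'a list \<Rightarrow> nat \<Rightarrow> 'a" where
  "env K xs i = (if i < length xs then xs ! i else \<zero>\<^bsub>K\<^esub>)"

lemma env_Cons: "env K (x # xs) = case_nat x (env K xs)"
  by (auto simp: env_def fun_eq_iff split: nat.split)

lemma trm_val_env: "trm_val K xs t = tval K (env K xs) t"
proof (induction t)
  case (TApp g ts)
  then have "map (trm_val K xs) ts = map (tval K (env K xs)) ts" by simp
  then show ?case by (metis trm_val.simps(7) tval.simps(7))
qed (simp_all add: env_def)

lemma sat_env: "sat K \<phi> xs \<longleftrightarrow> holds K (env K xs) \<phi>"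
proof (induction \<phi> arbitrary: xs)
  case (FRel p ts)
  have "map (trm_val K xs) ts = map (tval K (env K xs)) ts" by (simp add: trm_val_env)
  then show ?case by (metis sat.simps(3) holds.simps(3))
qed (simp_all add: trm_val_env env_Cons)

primrec tsubst :: "(nat \<Rightarrow> 'f trm) \<Rightarrow> 'f trm \<Rightarrow> 'f trm" where
  "tsubst \<sigma> (TVar i) = \<sigma> i"
| "tsubst \<sigma> TZero = TZero"
| "tsubst \<sigma> TOne = TOne"
| "tsubst \<sigma> (TPlus s t) = TPlus (tsubst \<sigma> s) (tsubst \<sigma> t)"
| "tsubst \<sigma> (TMinus s t) = TMinus (tsubst \<sigma> s) (tsubst \<sigma> t)"
| "tsubst \<sigma> (TTimes s t) = TTimes (tsubst \<sigma> s) (tsubst \<sigma> t)"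
| "tsubst \<sigma> (TApp g ts) = TApp g (map (tsubst \<sigma>) ts)"

definition up :: "(nat \<Rightarrow> 'f trm) \<Rightarrow> nat \<Rightarrow> 'f trm" where
  "up \<sigma> = case_nat (TVar 0) (\<lambda>i. tsubst (\<lambda>j. TVar (Suc j)) (\<sigma> i))"

primrec fsubst :: "('f, 'r) fm \<Rightarrow> (nat \<Rightarrow> 'f trm) \<Rightarrow> ('f, 'r) fm" where
  "fsubst (FEq s t) \<sigma> = FEq (tsubst \<sigma> s) (tsubst \<sigma> t)"
| "fsubst (FVal t) \<sigma> = FVal (tsubst \<sigma> t)"
| "fsubst (FRel p ts) \<sigma> = FRel p (map (tsubst \<sigma>) ts)"
| "fsubst (FNot \<phi>) \<sigma> = FNot (fsubst \<phi> \<sigma>)"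
| "fsubst (FAnd \<phi> \<psi>) \<sigma> = FAnd (fsubst \<phi> \<sigma>) (fsubst \<psi> \<sigma>)"
| "fsubst (FEx \<phi>) \<sigma> = FEx (fsubst \<phi> (up \<sigma>))"

lemma tval_tsubst: "tval K e (tsubst \<sigma> t) = tval K (\<lambda>i. tval K e (\<sigma> i)) t"
proof (induction t)
  case (TApp g ts)
  then have "map (tval K e \<circ> tsubst \<sigma>) ts = map (tval K (\<lambda>i. tval K e (\<sigma> i))) ts" by simp
  then show ?case by (metis tsubst.simps(7) tval.simps(7) map_map)
qed simp_all

lemma up_env: "(\<lambda>i. tval K (case_nat x e) (up \<sigma> i)) = case_nat x (\<lambda>i. tval K e (\<sigma> i))"
  by (auto simp: up_def fun_eq_iff tval_tsubst split: nat.split)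

lemma holds_fsubst: "holds K e (fsubst \<phi> \<sigma>) \<longleftrightarrow> holds K (\<lambda>i. tval K e (\<sigma> i)) \<phi>"
proof (induction \<phi> arbitrary: e \<sigma>)
  case (FRel p ts)
  have "map (tval K e \<circ> tsubst \<sigma>) ts = map (tval K (\<lambda>i. tval K e (\<sigma> i))) ts"
    by (simp add: tval_tsubst)
  then show ?case by (metis fsubst.simps(3) holds.simps(3) map_map)
qed (simp_all add: tval_tsubst up_env)

lemma tval_closed:
  assumes "valued_field K" "range e \<subseteq> carrier K"
  shows "tval K e t \<in> carrier K"
proof -
  interpret field K using assms(1) by (simp add: valued_field_def)
  show ?thesis
  proof (induction t)
    case (TApp g ts)
    then have "set (map (tval K e) ts) \<subseteq> carrier K" by auto
    then show ?case using assms(1) unfolding valued_field_def tval.simps by blast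
  qed (use assms(2) in auto)
qed

text \<open>A term given by its values: closure rules for functions of the environment replace the
  writing of de Bruijn terms. Agreement is demanded only for environments inside the carrier, which
  quantifiers never leave.\<close>

definition coterm :: "('a, 'f, 'r) vstr \<Rightarrow> ('b, 'f, 'r) vstr \<Rightarrow>
    ((nat \<Rightarrow> 'a) \<Rightarrow> 'a) \<Rightarrow> ((nat \<Rightarrow> 'b) \<Rightarrow> 'b) \<Rightarrow> bool" where
  "coterm K K' t t' \<longleftrightarrow> (\<exists>\<tau>. (\<forall>e. range e \<subseteq> carrier K \<longrightarrow> t e = tval K e \<tau>) \<and>
                          (\<forall>e. range e \<subseteq> carrier K' \<longrightarrow> t' e = tval K' e \<tau>))"

text \<open>
  One formula, read in two structures. This is what the comparison of \<open>K\<close> with an elementary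
  extension needs; the case of a single structure is recovered on the diagonal.
\<close>

definition codef :: "('a, 'f, 'r) vstr \<Rightarrow> ('b, 'f, 'r) vstr \<Rightarrow>
    ((nat \<Rightarrow> 'a) \<Rightarrow> bool) \<Rightarrow> ((nat \<Rightarrow> 'b) \<Rightarrow> bool) \<Rightarrow> bool" where
  "codef K K' P P' \<longleftrightarrow> (\<exists>\<phi>. (\<forall>e. range e \<subseteq> carrier K \<longrightarrow> P e = holds K e \<phi>) \<and>
                          (\<forall>e. range e \<subseteq> carrier K' \<longrightarrow> P' e = holds K' e \<phi>))"

text \<open>The length is fixed at every environment, also outside the carrier, so that entries and
  lengths can be rewritten unconditionally.\<close>

definition cotermL :: "('a, 'f, 'r) vstr \<Rightarrow> ('b, 'f, 'r) vstr \<Rightarrow> nat \<Rightarrow>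
    ((nat \<Rightarrow> 'a) \<Rightarrow> 'a list) \<Rightarrow> ((nat \<Rightarrow> 'b) \<Rightarrow> 'b list) \<Rightarrow> bool" where
  "cotermL K K' n s s' \<longleftrightarrow> (\<forall>e. length (s e) = n) \<and> (\<forall>e. length (s' e) = n) \<and>
     (\<forall>i<n. coterm K K' (\<lambda>e. s e ! i) (\<lambda>e. s' e ! i))"

locale vfield_pair =
  fixes K :: "('a, 'f, 'r) vstr" and K' :: "('b, 'f, 'r) vstr"
  assumes vf1: "valued_field K" and vf2: "valued_field K'"
begin

abbreviation "CD \<equiv> codef K K'"
abbreviation "CT \<equiv> coterm K K'"
abbreviation "CTL \<equiv> cotermL K K'"

lemma CT_var: "CT (\<lambda>e. e i) (\<lambda>e. e i)"
  unfolding coterm_def by (rule exI[of _ "TVar i"]) simp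
lemma CT_zero: "CT (\<lambda>e. \<zero>\<^bsub>K\<^esub>) (\<lambda>e. \<zero>\<^bsub>K'\<^esub>)"
  unfolding coterm_def by (rule exI[of _ TZero]) simp
lemma CT_one: "CT (\<lambda>e. \<one>\<^bsub>K\<^esub>) (\<lambda>e. \<one>\<^bsub>K'\<^esub>)"
  unfolding coterm_def by (rule exI[of _ TOne]) simp
lemma CT_plus:
  "CT t t' \<Longrightarrow> CT s s' \<Longrightarrow> CT (\<lambda>e. t e \<oplus>\<^bsub>K\<^esub> s e) (\<lambda>e. t' e \<oplus>\<^bsub>K'\<^esub> s' e)"
  unfolding coterm_def
proof (elim exE)
  fix \<tau> \<rho>
  assume "(\<forall>e. range e \<subseteq> carrier K \<longrightarrow> t e = tval K e \<tau>) \<and> (\<forall>e. range e \<subseteq> carrier K' \<longrightarrow> t' e = tval K' e \<tau>)"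
    "(\<forall>e. range e \<subseteq> carrier K \<longrightarrow> s e = tval K e \<rho>) \<and> (\<forall>e. range e \<subseteq> carrier K' \<longrightarrow> s' e = tval K' e \<rho>)"
  then show "\<exists>\<tau>. (\<forall>e. range e \<subseteq> carrier K \<longrightarrow> t e \<oplus>\<^bsub>K\<^esub> s e = tval K e \<tau>) \<and>
      (\<forall>e. range e \<subseteq> carrier K' \<longrightarrow> t' e \<oplus>\<^bsub>K'\<^esub> s' e = tval K' e \<tau>)"
    by (intro exI[of _ "TPlus \<tau> \<rho>"]) simp
qed
lemma CT_minus:
  "CT t t' \<Longrightarrow> CT s s' \<Longrightarrow> CT (\<lambda>e. t e \<ominus>\<^bsub>K\<^esub> s e) (\<lambda>e. t' e \<ominus>\<^bsub>K'\<^esub> s' e)"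
  unfolding coterm_def
proof (elim exE)
  fix \<tau> \<rho>
  assume "(\<forall>e. range e \<subseteq> carrier K \<longrightarrow> t e = tval K e \<tau>) \<and> (\<forall>e. range e \<subseteq> carrier K' \<longrightarrow> t' e = tval K' e \<tau>)"
    "(\<forall>e. range e \<subseteq> carrier K \<longrightarrow> s e = tval K e \<rho>) \<and> (\<forall>e. range e \<subseteq> carrier K' \<longrightarrow> s' e = tval K' e \<rho>)"
  then show "\<exists>\<tau>. (\<forall>e. range e \<subseteq> carrier K \<longrightarrow> t e \<ominus>\<^bsub>K\<^esub> s e = tval K e \<tau>) \<and>
      (\<forall>e. range e \<subseteq> carrier K' \<longrightarrow> t' e \<ominus>\<^bsub>K'\<^esub> s' e = tval K' e \<tau>)"
    by (intro exI[of _ "TMinus \<tau> \<rho>"]) simp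
qed
lemma CT_times:
  "CT t t' \<Longrightarrow> CT s s' \<Longrightarrow> CT (\<lambda>e. t e \<otimes>\<^bsub>K\<^esub> s e) (\<lambda>e. t' e \<otimes>\<^bsub>K'\<^esub> s' e)"
  unfolding coterm_def
proof (elim exE)
  fix \<tau> \<rho>
  assume "(\<forall>e. range e \<subseteq> carrier K \<longrightarrow> t e = tval K e \<tau>) \<and> (\<forall>e. range e \<subseteq> carrier K' \<longrightarrow> t' e = tval K' e \<tau>)"
    "(\<forall>e. range e \<subseteq> carrier K \<longrightarrow> s e = tval K e \<rho>) \<and> (\<forall>e. range e \<subseteq> carrier K' \<longrightarrow> s' e = tval K' e \<rho>)"
  then show "\<exists>\<tau>. (\<forall>e. range e \<subseteq> carrier K \<longrightarrow> t e \<otimes>\<^bsub>K\<^esub> s e = tval K e \<tau>) \<and>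
      (\<forall>e. range e \<subseteq> carrier K' \<longrightarrow> t' e \<otimes>\<^bsub>K'\<^esub> s' e = tval K' e \<tau>)"
    by (intro exI[of _ "TTimes \<tau> \<rho>"]) simp
qed

lemma CTL_Nil: "CTL 0 (\<lambda>e. []) (\<lambda>e. [])"
  by (simp add: cotermL_def)
lemma CTL_Cons: "CT t t' \<Longrightarrow> CTL n s s' \<Longrightarrow> CTL (Suc n) (\<lambda>e. t e # s e) (\<lambda>e. t' e # s' e)"
  by (auto simp: cotermL_def less_Suc_eq_0_disj)
lemma CTL_append:
  "CTL n s s' \<Longrightarrow> CTL m t t' \<Longrightarrow> CTL (n + m) (\<lambda>e. s e @ t e) (\<lambda>e. s' e @ t' e)"
  unfolding cotermL_def
proof (intro conjI allI impI; elim conjE)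
  fix i
  assume *: "\<forall>e. length (s e) = n" "\<forall>e. length (s' e) = n" "\<forall>i<n. CT (\<lambda>e. s e ! i) (\<lambda>e. s' e ! i)"
    "\<forall>e. length (t e) = m" "\<forall>e. length (t' e) = m" "\<forall>i<m. CT (\<lambda>e. t e ! i) (\<lambda>e. t' e ! i)" "i < n + m"
  show "CT (\<lambda>e. (s e @ t e) ! i) (\<lambda>e. (s' e @ t' e) ! i)"
    using * by (cases "i < n") (simp_all add: nth_append)
qed simp_all
lemma CTL_map:
  "(\<And>i. CT (\<lambda>e. f e i) (\<lambda>e. f' e i)) \<Longrightarrow>
   CTL (b - a) (\<lambda>e. map (f e) [a..<b]) (\<lambda>e. map (f' e) [a..<b])"
  by (auto simp: cotermL_def)
lemma CT_nth: "CTL n s s' \<Longrightarrow> i < n \<Longrightarrow> CT (\<lambda>e. s e ! i) (\<lambda>e. s' e ! i)"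
  by (simp add: cotermL_def)

lemma CD_eq: "CT t t' \<Longrightarrow> CT s s' \<Longrightarrow> CD (\<lambda>e. t e = s e) (\<lambda>e. t' e = s' e)"
  unfolding coterm_def codef_def
proof (elim exE)
  fix \<tau> \<rho>
  assume "(\<forall>e. range e \<subseteq> carrier K \<longrightarrow> t e = tval K e \<tau>) \<and> (\<forall>e. range e \<subseteq> carrier K' \<longrightarrow> t' e = tval K' e \<tau>)"
    "(\<forall>e. range e \<subseteq> carrier K \<longrightarrow> s e = tval K e \<rho>) \<and> (\<forall>e. range e \<subseteq> carrier K' \<longrightarrow> s' e = tval K' e \<rho>)"
  then show "\<exists>\<phi>. (\<forall>e. range e \<subseteq> carrier K \<longrightarrow> (t e = s e) = holds K e \<phi>) \<and>
      (\<forall>e. range e \<subseteq> carrier K' \<longrightarrow> (t' e = s' e) = holds K' e \<phi>)"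
    by (intro exI[of _ "FEq \<tau> \<rho>"]) simp
qed
lemma CD_vring: "CT t t' \<Longrightarrow> CD (\<lambda>e. t e \<in> vring K) (\<lambda>e. t' e \<in> vring K')"
  unfolding coterm_def codef_def
proof (elim exE)
  fix \<tau>
  assume "(\<forall>e. range e \<subseteq> carrier K \<longrightarrow> t e = tval K e \<tau>) \<and> (\<forall>e. range e \<subseteq> carrier K' \<longrightarrow> t' e = tval K' e \<tau>)"
  then show "\<exists>\<phi>. (\<forall>e. range e \<subseteq> carrier K \<longrightarrow> (t e \<in> vring K) = holds K e \<phi>) \<and>
      (\<forall>e. range e \<subseteq> carrier K' \<longrightarrow> (t' e \<in> vring K') = holds K' e \<phi>)"
    by (intro exI[of _ "FVal \<tau>"]) simp
qed
lemma CD_not: "CD P P' \<Longrightarrow> CD (\<lambda>e. \<not> P e) (\<lambda>e. \<not> P' e)"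
  unfolding codef_def
proof (elim exE)
  fix \<phi>
  assume "(\<forall>e. range e \<subseteq> carrier K \<longrightarrow> P e = holds K e \<phi>) \<and> (\<forall>e. range e \<subseteq> carrier K' \<longrightarrow> P' e = holds K' e \<phi>)"
  then show "\<exists>\<phi>. (\<forall>e. range e \<subseteq> carrier K \<longrightarrow> (\<not> P e) = holds K e \<phi>) \<and>
      (\<forall>e. range e \<subseteq> carrier K' \<longrightarrow> (\<not> P' e) = holds K' e \<phi>)"
    by (intro exI[of _ "FNot \<phi>"]) simp
qed
lemma CD_and: "CD P P' \<Longrightarrow> CD Q Q' \<Longrightarrow> CD (\<lambda>e. P e \<and> Q e) (\<lambda>e. P' e \<and> Q' e)"
  unfolding codef_def
proof (elim exE)
  fix \<phi> \<psi>
  assume "(\<forall>e. range e \<subseteq> carrier K \<longrightarrow> P e = holds K e \<phi>) \<and> (\<forall>e. range e \<subseteq> carrier K' \<longrightarrow> P' e = holds K' e \<phi>)"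
    "(\<forall>e. range e \<subseteq> carrier K \<longrightarrow> Q e = holds K e \<psi>) \<and> (\<forall>e. range e \<subseteq> carrier K' \<longrightarrow> Q' e = holds K' e \<psi>)"
  then show "\<exists>\<phi>. (\<forall>e. range e \<subseteq> carrier K \<longrightarrow> (P e \<and> Q e) = holds K e \<phi>) \<and>
      (\<forall>e. range e \<subseteq> carrier K' \<longrightarrow> (P' e \<and> Q' e) = holds K' e \<phi>)"
    by (intro exI[of _ "FAnd \<phi> \<psi>"]) simp
qed
lemma CD_True: "CD (\<lambda>e. True) (\<lambda>e. True)"
  using CD_eq[OF CT_zero CT_zero] by simp
lemma CD_const: "CD (\<lambda>e. b) (\<lambda>e. b)"
  using CD_True CD_not[OF CD_True] by (cases b) simp_all
lemma CD_or: "CD P P' \<Longrightarrow> CD Q Q' \<Longrightarrow> CD (\<lambda>e. P e \<or> Q e) (\<lambda>e. P' e \<or> Q' e)"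
  using CD_not[OF CD_and[OF CD_not CD_not]] by simp
lemma CD_imp: "CD P P' \<Longrightarrow> CD Q Q' \<Longrightarrow> CD (\<lambda>e. P e \<longrightarrow> Q e) (\<lambda>e. P' e \<longrightarrow> Q' e)"
  using CD_not[OF CD_and[OF _ CD_not, of P P' Q Q']] by simp
lemma CD_iff: "CD P P' \<Longrightarrow> CD Q Q' \<Longrightarrow> CD (\<lambda>e. P e \<longleftrightarrow> Q e) (\<lambda>e. P' e \<longleftrightarrow> Q' e)"
  using CD_and[OF CD_imp[of P P' Q Q'] CD_imp[of Q Q' P P']]
  unfolding iff_conv_conj_imp .

text \<open>\<open>Q\<close> receives the bound element and the remaining environment separately;
  higher-order unification then strips a quantifier by mere resolution with this rule.\<close>

lemma CD_ex:
  assumes "CD (\<lambda>e. Q (e 0) (\<lambda>n. e (Suc n))) (\<lambda>e. Q' (e 0) (\<lambda>n. e (Suc n)))"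
  shows "CD (\<lambda>e. \<exists>x\<in>carrier K. Q x e) (\<lambda>e. \<exists>x\<in>carrier K'. Q' x e)"
proof -
  obtain \<phi> where \<phi>: "\<And>e. range e \<subseteq> carrier K \<Longrightarrow> Q (e 0) (\<lambda>n. e (Suc n)) = holds K e \<phi>"
    "\<And>e. range e \<subseteq> carrier K' \<Longrightarrow> Q' (e 0) (\<lambda>n. e (Suc n)) = holds K' e \<phi>"
    using assms unfolding codef_def by blast
  have r1: "Q x e = holds K (case_nat x e) \<phi>"
    if "range e \<subseteq> carrier K" "x \<in> carrier K" for x e
  proof -
    have "range (case_nat x e) \<subseteq> carrier K" using that by (auto simp: image_subset_iff split: nat.split)
    from \<phi>(1)[OF this] show ?thesis by simp
  qed
  have r2: "Q' x e = holds K' (case_nat x e) \<phi>"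
    if "range e \<subseteq> carrier K'" "x \<in> carrier K'" for x e
  proof -
    have "range (case_nat x e) \<subseteq> carrier K'" using that by (auto simp: image_subset_iff split: nat.split)
    from \<phi>(2)[OF this] show ?thesis by simp
  qed
  show ?thesis unfolding codef_def
    by (rule exI[of _ "FEx \<phi>"]) (use r1 r2 in auto)
qed

lemma CD_all:
  assumes "CD (\<lambda>e. Q (e 0) (\<lambda>n. e (Suc n))) (\<lambda>e. Q' (e 0) (\<lambda>n. e (Suc n)))"
  shows "CD (\<lambda>e. \<forall>x\<in>carrier K. Q x e) (\<lambda>e. \<forall>x\<in>carrier K'. Q' x e)"
  using CD_not[OF CD_ex[OF CD_not[OF assms]]] by simp

lemma CD_subst:
  assumes "CD P P'" "\<And>i. CT (\<lambda>e. s e i) (\<lambda>e. s' e i)"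
  shows "CD (\<lambda>e. P (s e)) (\<lambda>e. P' (s' e))"
proof -
  obtain \<phi> where \<phi>: "\<And>e. range e \<subseteq> carrier K \<Longrightarrow> P e = holds K e \<phi>"
    "\<And>e. range e \<subseteq> carrier K' \<Longrightarrow> P' e = holds K' e \<phi>"
    using assms(1) unfolding codef_def by blast
  obtain \<sigma> where \<sigma>: "\<And>i e. range e \<subseteq> carrier K \<Longrightarrow> s e i = tval K e (\<sigma> i)"
    "\<And>i e. range e \<subseteq> carrier K' \<Longrightarrow> s' e i = tval K' e (\<sigma> i)"
    using assms(2) unfolding coterm_def by metis
  have "P (s e) = holds K e (fsubst \<phi> \<sigma>)" if e: "range e \<subseteq> carrier K" for e
  proof -
    have "s e = (\<lambda>i. tval K e (\<sigma> i))" using \<sigma>(1)[OF e] by auto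
    moreover have "range (\<lambda>i. tval K e (\<sigma> i)) \<subseteq> carrier K" using tval_closed[OF vf1 e] by auto
    ultimately show ?thesis using \<phi>(1) by (simp add: holds_fsubst)
  qed
  moreover have "P' (s' e) = holds K' e (fsubst \<phi> \<sigma>)" if e: "range e \<subseteq> carrier K'" for e
  proof -
    have "s' e = (\<lambda>i. tval K' e (\<sigma> i))" using \<sigma>(2)[OF e] by auto
    moreover have "range (\<lambda>i. tval K' e (\<sigma> i)) \<subseteq> carrier K'" using tval_closed[OF vf2 e] by auto
    ultimately show ?thesis using \<phi>(2) by (simp add: holds_fsubst)
  qed
  ultimately show ?thesis unfolding codef_def by blast
qed

lemma CD_list:
  assumes "CD (\<lambda>e. \<Phi> (map e [0..<n])) (\<lambda>e. \<Phi>' (map e [0..<n]))" "CTL n s s'"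
  shows "CD (\<lambda>e. \<Phi> (s e)) (\<lambda>e. \<Phi>' (s' e))"
proof -
  have len: "length (s e) = n" "length (s' e') = n" for e e' using assms(2) by (auto simp: cotermL_def)
  \<comment> \<open>Substitution asks for a term at every index; beyond \<open>n\<close> the
    constant zero is supplied.\<close>
  have "CT (\<lambda>e. if i < n then s e ! i else \<zero>\<^bsub>K\<^esub>) (\<lambda>e. if i < n then s' e ! i else \<zero>\<^bsub>K'\<^esub>)" for i
    using CT_zero CT_nth[OF assms(2)] by (cases "i < n") simp_all
  from CD_subst[OF assms(1) this]
  have "CD (\<lambda>e. \<Phi> (map (\<lambda>i. if i < n then s e ! i else \<zero>\<^bsub>K\<^esub>) [0..<n]))
           (\<lambda>e. \<Phi>' (map (\<lambda>i. if i < n then s' e ! i else \<zero>\<^bsub>K'\<^esub>) [0..<n]))" .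
  moreover have "map (\<lambda>i. if i < n then s e ! i else \<zero>\<^bsub>K\<^esub>) [0..<n] = s e" for e
    by (rule nth_equalityI) (simp_all add: len)
  moreover have "map (\<lambda>i. if i < n then s' e ! i else \<zero>\<^bsub>K'\<^esub>) [0..<n] = s' e" for e
    by (rule nth_equalityI) (simp_all add: len)
  ultimately show ?thesis by simp
qed

lemma CD_tuples_ex:
  assumes "CD (\<lambda>e. Q (map e [0..<r]) (\<lambda>n. e (n + r))) (\<lambda>e. Q' (map e [0..<r]) (\<lambda>n. e (n + r)))"
  shows "CD (\<lambda>e. \<exists>xs\<in>tuples K r. Q xs e) (\<lambda>e. \<exists>xs\<in>tuples K' r. Q' xs e)"
  using assms
proof (induction r arbitrary: Q Q')
  case 0
  then show ?case by (simp add: tuples_def)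
next
  case (Suc r)
  \<comment> \<open>The last entry is bound outermost: below the \<open>r\<close> inner quantifiers
    it stands at index \<open>r\<close>, where \<open>map e [0..<Suc r]\<close> expects it.\<close>
  have eq: "(\<exists>xs\<in>tuples L (Suc r). R xs e) = (\<exists>x\<in>carrier L. \<exists>xs\<in>tuples L r. R (xs @ [x]) e)"
    for R :: "'c list \<Rightarrow> 'd \<Rightarrow> bool" and e and L :: "('c, 'f, 'r) vstr"
  proof safe
    fix xs assume "xs \<in> tuples L (Suc r)" "R xs e"
    then show "\<exists>x\<in>carrier L. \<exists>xs\<in>tuples L r. R (xs @ [x]) e"
      by (cases xs rule: rev_cases) (auto simp: tuples_def)
  next
    fix x xs assume "x \<in> carrier L" "xs \<in> tuples L r" "R (xs @ [x]) e"
    then show "\<exists>xs\<in>tuples L (Suc r). R xs e"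
      by (intro bexI[of _ "xs @ [x]"]) (auto simp: tuples_def)
  qed
  have sh: "(\<lambda>n. e (n + Suc r)) = (\<lambda>n. e (Suc n + r))" for e :: "nat \<Rightarrow> 'c" by simp
  have "CD (\<lambda>e. \<exists>xs\<in>tuples K r. (\<lambda>xs e. Q (xs @ [e 0]) (\<lambda>n. e (Suc n))) xs e)
           (\<lambda>e. \<exists>xs\<in>tuples K' r. (\<lambda>xs e. Q' (xs @ [e 0]) (\<lambda>n. e (Suc n))) xs e)"
    by (rule Suc.IH) (use Suc.prems in simp)
  then have "CD (\<lambda>e. \<exists>xs\<in>tuples K r. Q (xs @ [e 0]) (\<lambda>n. e (Suc n)))
           (\<lambda>e. \<exists>xs\<in>tuples K' r. Q' (xs @ [e 0]) (\<lambda>n. e (Suc n)))" by simp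
  from CD_ex[of "\<lambda>x e. \<exists>xs\<in>tuples K r. Q (xs @ [x]) e"
      "\<lambda>x e. \<exists>xs\<in>tuples K' r. Q' (xs @ [x]) e", OF this]
  show ?case by (simp add: eq)
qed

lemma CD_tuples_all:
  assumes "CD (\<lambda>e. Q (map e [0..<r]) (\<lambda>n. e (n + r))) (\<lambda>e. Q' (map e [0..<r]) (\<lambda>n. e (n + r)))"
  shows "CD (\<lambda>e. \<forall>xs\<in>tuples K r. Q xs e) (\<lambda>e. \<forall>xs\<in>tuples K' r. Q' xs e)"
  using CD_not[OF CD_tuples_ex[OF CD_not[OF assms]]] by simp

lemma CD_finite_all:
  assumes "\<And>i::nat. i < n \<Longrightarrow> CD (Q i) (Q' i)"
  shows "CD (\<lambda>e. \<forall>i<n. Q i e) (\<lambda>e. \<forall>i<n. Q' i e)"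
  using assms
proof (induction n)
  case 0
  then show ?case using CD_True by simp
next
  case (Suc n)
  have "CD (\<lambda>e. (\<forall>i<n. Q i e) \<and> Q n e) (\<lambda>e. (\<forall>i<n. Q' i e) \<and> Q' n e)"
    by (rule CD_and[OF Suc.IH]) (use Suc.prems in auto)
  then show ?case by (simp add: All_less_Suc conj_commute)
qed

lemma CD_finite_ex:
  assumes "\<And>i::nat. i < n \<Longrightarrow> CD (Q i) (Q' i)"
  shows "CD (\<lambda>e. \<exists>i<n. Q i e) (\<lambda>e. \<exists>i<n. Q' i e)"
  using CD_not[OF CD_finite_all[of n "\<lambda>i e. \<not> Q i e" "\<lambda>i e. \<not> Q' i e"]] CD_not assms by simp

end

section \<open>Valued fields and leading terms\<close>

locale vfield =
  fixes K :: "('a, 'f, 'r) vstr" (structure)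
  assumes vf: "valued_field K"

sublocale vfield \<subseteq> field K
  using vf by (simp add: valued_field_def)

sublocale vfield \<subseteq> pair: vfield_pair K K
  by unfold_locales (rule vf)+

context vfield
begin

abbreviation "\<O> \<equiv> vring K"
abbreviation "\<M> \<equiv> maxid K"

section \<open>Arithmetic of the field, the valuation ring and its maximal ideal\<close>

lemma diff_eq_eq: "a \<in> carrier K \<Longrightarrow> b \<in> carrier K \<Longrightarrow> c \<in> carrier K \<Longrightarrow> a \<ominus> b = c \<longleftrightarrow> a = c \<oplus> b"
  by (auto simp: a_minus_def a_assoc l_neg r_neg)
lemma eq_diff_eq: "a \<in> carrier K \<Longrightarrow> b \<in> carrier K \<Longrightarrow> c \<in> carrier K \<Longrightarrow> c = a \<ominus> b \<longleftrightarrow> c \<oplus> b = a"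
  using diff_eq_eq[of a b c] by auto
lemma add_diff_eq: "a \<in> carrier K \<Longrightarrow> b \<in> carrier K \<Longrightarrow> c \<in> carrier K \<Longrightarrow> a \<oplus> (b \<ominus> c) = (a \<oplus> b) \<ominus> c"
  by (simp add: a_minus_def a_assoc)
lemma diff_add_eq: "a \<in> carrier K \<Longrightarrow> b \<in> carrier K \<Longrightarrow> c \<in> carrier K \<Longrightarrow> (a \<ominus> b) \<oplus> c = (a \<oplus> c) \<ominus> b"
  by (simp add: a_minus_def a_ac)
lemma diff_diff_eq: "a \<in> carrier K \<Longrightarrow> b \<in> carrier K \<Longrightarrow> c \<in> carrier K \<Longrightarrow> (a \<ominus> b) \<ominus> c = a \<ominus> (b \<oplus> c)"
  by (simp add: a_minus_def a_assoc minus_add)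
lemma diff_diff_eq2: "a \<in> carrier K \<Longrightarrow> b \<in> carrier K \<Longrightarrow> c \<in> carrier K \<Longrightarrow> a \<ominus> (b \<ominus> c) = (a \<oplus> c) \<ominus> b"
  by (simp add: a_minus_def a_ac minus_add)
lemma uminus_diff: "a \<in> carrier K \<Longrightarrow> b \<in> carrier K \<Longrightarrow> \<ominus> (a \<ominus> b) = b \<ominus> a"
  by (simp add: a_minus_def minus_add a_comm)
lemma l_diff_distr: "a \<in> carrier K \<Longrightarrow> b \<in> carrier K \<Longrightarrow> c \<in> carrier K \<Longrightarrow> (a \<ominus> b) \<otimes> c = a \<otimes> c \<ominus> b \<otimes> c"
  by (simp add: a_minus_def l_distr l_minus)
lemma r_diff_distr: "a \<in> carrier K \<Longrightarrow> b \<in> carrier K \<Longrightarrow> c \<in> carrier K \<Longrightarrow> c \<otimes> (a \<ominus> b) = c \<otimes> a \<ominus> c \<otimes> b"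
  by (simp add: a_minus_def r_distr r_minus)
lemma diff_self [simp]: "a \<in> carrier K \<Longrightarrow> a \<ominus> a = \<zero>" "a \<in> carrier K \<Longrightarrow> a \<ominus> \<zero> = a"
  by (simp_all add: a_minus_def r_neg)

lemmas ring_arith = diff_eq_eq eq_diff_eq add_diff_eq diff_add_eq diff_diff_eq diff_diff_eq2
  uminus_diff l_diff_distr r_diff_distr l_distr r_distr a_ac m_ac

lemma O_subring: "subring \<O> K" and O_ne: "\<O> \<noteq> carrier K"
  and O_val: "x \<in> carrier K \<Longrightarrow> x \<noteq> \<zero> \<Longrightarrow> x \<in> \<O> \<or> inv x \<in> \<O>"
  using vf unfolding valued_field_def by auto

lemma O_carrier [simp]: "x \<in> \<O> \<Longrightarrow> x \<in> carrier K"
  using subringE(1)[OF O_subring] by auto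
lemma O_simps [simp]: "\<zero> \<in> \<O>" "\<one> \<in> \<O>" "x \<in> \<O> \<Longrightarrow> \<ominus> x \<in> \<O>"
  "x \<in> \<O> \<Longrightarrow> y \<in> \<O> \<Longrightarrow> x \<otimes> y \<in> \<O>" "x \<in> \<O> \<Longrightarrow> y \<in> \<O> \<Longrightarrow> x \<oplus> y \<in> \<O>"
  "x \<in> \<O> \<Longrightarrow> y \<in> \<O> \<Longrightarrow> x \<ominus> y \<in> \<O>"
  using subringE[OF O_subring] by (auto simp: a_minus_def)

lemma inv_simps [simp]:
  assumes "x \<in> carrier K" "x \<noteq> \<zero>"
  shows "inv x \<in> carrier K" "inv x \<noteq> \<zero>" "x \<otimes> inv x = \<one>" "inv x \<otimes> x = \<one>"
    "inv (inv x) = x"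
proof -
  have u: "x \<in> Units K" using assms by (simp add: field_Units)
  then show "inv x \<in> carrier K" "x \<otimes> inv x = \<one>" "inv x \<otimes> x = \<one>" "inv (inv x) = x" by simp_all
  have "inv x \<in> Units K" using u by simp
  then show "inv x \<noteq> \<zero>" by (simp add: field_Units)
qed

lemma inv_prod: "x \<in> carrier K \<Longrightarrow> y \<in> carrier K \<Longrightarrow> x \<noteq> \<zero> \<Longrightarrow> y \<noteq> \<zero> \<Longrightarrow>
    inv (x \<otimes> y) = inv x \<otimes> inv y"
proof (rule comm_inv_char)
  assume a: "x \<in> carrier K" "y \<in> carrier K" "x \<noteq> \<zero>" "y \<noteq> \<zero>"
  have "x \<otimes> y \<otimes> (inv x \<otimes> inv y) = (x \<otimes> inv x) \<otimes> (y \<otimes> inv y)"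
    using a by (simp add: m_ac del: inv_simps(3,4))
  then show "x \<otimes> y \<otimes> (inv x \<otimes> inv y) = \<one>" using a by simp
qed simp_all

lemma prod_nonzero [simp]: "x \<in> carrier K \<Longrightarrow> y \<in> carrier K \<Longrightarrow> (x \<otimes> y = \<zero>) = (x = \<zero> \<or> y = \<zero>)"
  using integral_iff by blast

text \<open>An inverse inside \<open>\<O>\<close> is the inverse in \<open>K\<close>, so the
  non-units of the subring can be recognised by \<open>inv\<close>.\<close>

lemma M_iff: "x \<in> \<M> \<longleftrightarrow> x \<in> \<O> \<and> (x = \<zero> \<or> inv x \<notin> \<O>)"
proof -
  have "x \<in> Units (K\<lparr>carrier := \<O>\<rparr>) \<longleftrightarrow> x \<noteq> \<zero> \<and> inv x \<in> \<O>" if x: "x \<in> \<O>"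
  proof
    assume "x \<in> Units (K\<lparr>carrier := \<O>\<rparr>)"
    then obtain y where y: "y \<in> \<O>" "y \<otimes> x = \<one>" by (auto simp: Units_def)
    then have "x \<noteq> \<zero>" using x by auto
    moreover have "inv x = y" using y x by (simp add: comm_inv_char m_comm)
    ultimately show "x \<noteq> \<zero> \<and> inv x \<in> \<O>" using y by simp
  next
    assume "x \<noteq> \<zero> \<and> inv x \<in> \<O>"
    then show "x \<in> Units (K\<lparr>carrier := \<O>\<rparr>)" using x by (auto simp: Units_def intro!: bexI[of _ "inv x"])
  qed
  then show ?thesis unfolding maxid_def by auto
qed

lemma M_zero [simp]: "\<zero> \<in> \<M>" by (simp add: M_iff)
lemma one_notin_M [simp]: "\<one> \<notin> \<M>" by (simp add: M_iff)

lemma unitD: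
  assumes "x \<in> \<O>" "x \<notin> \<M>" shows "x \<noteq> \<zero>" "inv x \<in> \<O>" "inv x \<notin> \<M>"
  using assms by (auto simp: M_iff)

lemma inv_in_M: "x \<in> carrier K \<Longrightarrow> x \<notin> \<O> \<Longrightarrow> inv x \<in> \<M>"
  using O_val[of x] M_iff[of "inv x"] inv_simps[of x] O_simps(1) by metis

lemma M_O [simp]: "x \<in> \<M> \<Longrightarrow> x \<in> \<O>"
  using M_iff[of x] by blast

text \<open>If \<open>x \<otimes> y\<close> were a unit of \<open>\<O>\<close>, then
  \<open>y \<otimes> inv (x \<otimes> y)\<close> would be an inverse of \<open>x\<close> in
  \<open>\<O>\<close>.\<close>

lemma M_times [simp]: assumes "x \<in> \<M>" "y \<in> \<O>" shows "x \<otimes> y \<in> \<M>" "y \<otimes> x \<in> \<M>"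
proof -
  show *: "x \<otimes> y \<in> \<M>"
  proof (rule ccontr)
    assume n: "x \<otimes> y \<notin> \<M>"
    have O: "x \<otimes> y \<in> \<O>" using assms by auto
    have nz: "x \<noteq> \<zero>" "y \<noteq> \<zero>" using unitD(1)[OF O n] assms by auto
    have "y \<otimes> inv (x \<otimes> y) = inv x"
      using nz assms m_lcomm[of y "inv x" "inv y"] by (simp add: inv_prod)
    then have "inv x \<in> \<O>" using unitD(2)[OF O n] assms by (metis O_simps(4))
    then show False using assms nz M_iff[of x] by blast
  qed
  then show "y \<otimes> x \<in> \<M>" using assms by (simp add: m_comm)
qed

lemma M_uminus [simp]: "x \<in> \<M> \<Longrightarrow> \<ominus> x \<in> \<M>"
  using M_times[of x "\<ominus> \<one>"] by (simp add: r_minus)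

text \<open>One of the two quotients of \<open>x\<close> and \<open>y\<close> lies in
  \<open>\<O>\<close>; factoring out the larger element writes the sum as an element of
  \<open>\<M>\<close> times one of \<open>\<O>\<close>.\<close>

lemma M_plus [simp]: assumes "x \<in> \<M>" "y \<in> \<M>" shows "x \<oplus> y \<in> \<M>"
proof -
  have *: "x \<oplus> y \<in> \<M>" if "x \<in> \<M>" "y \<in> \<M>" "y \<noteq> \<zero>" "x \<otimes> inv y \<in> \<O>" for x y
  proof -
    have "y \<otimes> (x \<otimes> inv y \<oplus> \<one>) = x \<oplus> y"
      using that by (simp add: r_distr m_lcomm)
    then show ?thesis using M_times(1)[of y "x \<otimes> inv y \<oplus> \<one>"] that by (metis O_simps(2,5))
  qed
  show ?thesis
  proof (cases "x = \<zero> \<or> y = \<zero>")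
    case True then show ?thesis using assms by auto
  next
    case False
    then have "x \<otimes> inv y \<in> \<O> \<or> inv (x \<otimes> inv y) \<in> \<O>" using assms by (intro O_val) auto
    moreover have "inv (x \<otimes> inv y) = y \<otimes> inv x" using False assms by (simp add: inv_prod m_comm)
    ultimately show ?thesis using *[of x y] *[of y x] assms False by (auto simp: a_comm)
  qed
qed

lemma M_minus [simp]: "x \<in> \<M> \<Longrightarrow> y \<in> \<M> \<Longrightarrow> x \<ominus> y \<in> \<M>"
  by (simp add: a_minus_def)

lemma M_times_cancel: "x \<in> \<O> \<Longrightarrow> x \<notin> \<M> \<Longrightarrow> y \<in> carrier K \<Longrightarrow> x \<otimes> y \<in> \<M> \<Longrightarrow> y \<in> \<M>"
  using M_times(2)[of "x \<otimes> y" "inv x"] unitD[of x] by (simp add: m_assoc[symmetric])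

lemma add_sub_cancel: "x \<in> carrier K \<Longrightarrow> y \<in> carrier K \<Longrightarrow> x \<oplus> y \<ominus> x = y"
  "x \<in> carrier K \<Longrightarrow> y \<in> carrier K \<Longrightarrow> x \<oplus> (y \<ominus> x) = y"
  "x \<in> carrier K \<Longrightarrow> y \<in> carrier K \<Longrightarrow> x \<oplus> y \<ominus> y = x"
  by (simp_all add: ring_arith)

lemma unit_plus_M: assumes "x \<in> \<O>" "x \<notin> \<M>" "m \<in> \<M>" shows "x \<oplus> m \<notin> \<M>"
proof
  assume "x \<oplus> m \<in> \<M>"
  then have "x \<oplus> m \<ominus> m \<in> \<M>" using assms by auto
  then show False using assms add_sub_cancel(3)[of x m] by simp
qed

lemma one_plus_M: "m \<in> \<M> \<Longrightarrow> \<one> \<oplus> m \<in> \<O>" "m \<in> \<M> \<Longrightarrow> \<one> \<oplus> m \<notin> \<M>" "m \<in> \<M> \<Longrightarrow> \<one> \<oplus> m \<noteq> \<zero>"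
  using unit_plus_M[of \<one> m] by auto

text \<open>\<open>sm a b\<close> is \<open>|a| < |b|\<close>, except that it also holds for \<open>a = b = 0\<close>.\<close>

definition sm :: "'a \<Rightarrow> 'a \<Rightarrow> bool" where
  "sm a b \<longleftrightarrow> (\<exists>m\<in>\<M>. a = m \<otimes> b)"

lemma sm_zero [simp]: "b \<in> carrier K \<Longrightarrow> sm \<zero> b"
  by (auto simp: sm_def intro!: bexI[of _ \<zero>])
lemma sm_add: "sm a c \<Longrightarrow> sm b c \<Longrightarrow> c \<in> carrier K \<Longrightarrow> sm (a \<oplus> b) c"
  unfolding sm_def by (metis M_O M_plus O_carrier l_distr)
lemma sm_uminus: "sm a c \<Longrightarrow> c \<in> carrier K \<Longrightarrow> sm (\<ominus> a) c"
  unfolding sm_def by (metis M_O M_uminus O_carrier l_minus)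
lemma sm_diff: "sm a c \<Longrightarrow> sm b c \<Longrightarrow> c \<in> carrier K \<Longrightarrow> sm (a \<ominus> b) c"
  unfolding a_minus_def by (intro sm_add sm_uminus)
lemma sm_O: "sm a b \<Longrightarrow> u \<in> \<O> \<Longrightarrow> b \<in> carrier K \<Longrightarrow> sm (u \<otimes> a) b"
  unfolding sm_def by (metis M_O M_times(2) O_carrier m_assoc)
lemma sm_M: "m \<in> \<M> \<Longrightarrow> sm (m \<otimes> b) b"
  unfolding sm_def by auto
lemma sm_cancel: "sm (u \<otimes> a) (u \<otimes> b) \<Longrightarrow> u \<in> carrier K \<Longrightarrow> u \<noteq> \<zero> \<Longrightarrow> a \<in> carrier K \<Longrightarrow> b \<in> carrier K \<Longrightarrow> sm a b"
  unfolding sm_def by (metis M_O O_carrier m_closed m_lcancel m_lcomm)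
text \<open>From \<open>a = m \<otimes> a\<close> it follows that
  \<open>\<one> \<oplus> \<ominus> m\<close>, which is not zero, annihilates
  \<open>a\<close>.\<close>

lemma sm_self: assumes "sm a a" "a \<in> carrier K" shows "a = \<zero>"
proof -
  obtain m where m: "m \<in> \<M>" "a = m \<otimes> a" using assms by (auto simp: sm_def)
  have "(\<one> \<oplus> \<ominus> m) \<otimes> a = a \<ominus> m \<otimes> a" using m(1) assms by (simp add: l_distr a_minus_def l_minus)
  also have "\<dots> = \<zero>" using m assms by (metis r_right_minus_eq)
  finally have "\<one> \<oplus> \<ominus> m = \<zero> \<or> a = \<zero>" using m(1) assms by (subst (asm) prod_nonzero) auto
  then show ?thesis using one_plus_M(3)[of "\<ominus> m"] m(1) by auto
qed

section \<open>Leading terms: equality, products, translations\<close>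

lemma rv_mem: "[y] \<in> rv K x \<longleftrightarrow> (\<exists>m\<in>\<M>. y = x \<otimes> (\<one> \<oplus> m))"
  by (auto simp: rv_def)

lemma rv_mem_sm: assumes "x \<in> carrier K"
  shows "[y] \<in> rv K x \<longleftrightarrow> y \<in> carrier K \<and> sm (y \<ominus> x) x"
proof
  assume "[y] \<in> rv K x"
  then obtain m where m: "m \<in> \<M>" "y = x \<otimes> (\<one> \<oplus> m)" by (auto simp: rv_mem)
  have "y \<in> carrier K" using m assms by auto
  moreover have "y \<ominus> x = m \<otimes> x" using m assms by (simp add: r_distr add_sub_cancel m_comm)
  ultimately show "y \<in> carrier K \<and> sm (y \<ominus> x) x" using m(1) sm_M by simp
next
  assume y: "y \<in> carrier K \<and> sm (y \<ominus> x) x"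
  then obtain m where m: "m \<in> \<M>" "y \<ominus> x = m \<otimes> x" by (auto simp: sm_def)
  have "y = x \<oplus> m \<otimes> x" using m(2) add_sub_cancel(2)[of x y] assms y by simp
  also have "\<dots> = x \<otimes> (\<one> \<oplus> m)" using m(1) assms by (simp add: r_distr m_comm)
  finally show "[y] \<in> rv K x" using m(1) by (auto simp: rv_mem)
qed

lemma rv_self: "x \<in> carrier K \<Longrightarrow> [x] \<in> rv K x"
  by (simp add: rv_mem_sm)

text \<open>A factor \<open>\<one> \<oplus> m\<close> with \<open>m\<close> in \<open>\<M>\<close>
  preserves absolute values, because its inverse lies in \<open>\<O>\<close> again.\<close>

lemma sm_right_cong:
  assumes "sm a x" "sm (y \<ominus> x) x" "x \<in> carrier K" "y \<in> carrier K" shows "sm a y"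
proof -
  have "[y] \<in> rv K x" using assms by (simp add: rv_mem_sm)
  then obtain m where m: "m \<in> \<M>" "y = x \<otimes> (\<one> \<oplus> m)" by (auto simp: rv_mem)
  obtain l where l: "l \<in> \<M>" "a = l \<otimes> x" using assms by (auto simp: sm_def)
  let ?w = "inv (\<one> \<oplus> m)"
  have w: "?w \<in> \<O>" "(\<one> \<oplus> m) \<otimes> ?w = \<one>" using one_plus_M[OF m(1)] unitD by simp_all
  have "x = y \<otimes> ?w" using m w assms(3) one_plus_M[OF m(1)] by (simp add: m_assoc)
  then have "a = (l \<otimes> ?w) \<otimes> y" using l w assms by (metis M_O O_carrier m_assoc m_comm)
  then show ?thesis using l w by (auto simp: sm_def)
qed

lemma rv_eq_iff:
  assumes "x \<in> carrier K" "y \<in> carrier K"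
  shows "rv K x = rv K y \<longleftrightarrow> sm (y \<ominus> x) x"
proof
  assume "rv K x = rv K y"
  then show "sm (y \<ominus> x) x" using rv_self[OF assms(2)] rv_mem_sm[OF assms(1)] by auto
next
  have *: "rv K y \<subseteq> rv K x" if xy: "x \<in> carrier K" "y \<in> carrier K" "sm (y \<ominus> x) x" "sm (x \<ominus> y) y" for x y
  proof
    fix l assume l: "l \<in> rv K y"
    then obtain z where z: "l = [z]" by (auto simp: rv_def)
    then have "z \<in> carrier K" "sm (z \<ominus> y) y" using l xy by (auto simp: rv_mem_sm)
    moreover have "sm (z \<ominus> y) x" by (rule sm_right_cong[OF \<open>sm (z \<ominus> y) y\<close> xy(4)]) (use xy in auto)
    moreover have "z \<ominus> x = (z \<ominus> y) \<oplus> (y \<ominus> x)" using \<open>z \<in> carrier K\<close> xy by (simp add: ring_arith)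
    ultimately show "l \<in> rv K x" using xy z sm_add by (simp add: rv_mem_sm)
  qed
  assume s: "sm (y \<ominus> x) x"
  have "sm (\<ominus> (y \<ominus> x)) y" by (rule sm_right_cong[OF sm_uminus[OF s]]) (use s assms in auto)
  moreover have "\<ominus> (y \<ominus> x) = x \<ominus> y" using assms by (simp add: ring_arith)
  ultimately show "rv K x = rv K y" using *[of x y] *[of y x] s assms by simp
qed

lemma rv_mem_iff: "x \<in> carrier K \<Longrightarrow> [y] \<in> rv K x \<longleftrightarrow> y \<in> carrier K \<and> rv K x = rv K y"
  using rv_mem_sm[of x y] rv_eq_iff[of x y] by auto

lemma rv_zero_iff: "x \<in> carrier K \<Longrightarrow> rv K x = rv K \<zero> \<longleftrightarrow> x = \<zero>"
proof
  assume x: "x \<in> carrier K" "rv K x = rv K \<zero>"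
  then have "sm (x \<ominus> \<zero>) \<zero>" using rv_eq_iff[of \<zero> x] by simp
  then show "x = \<zero>" using x by (auto simp: sm_def)
qed simp

lemma rv_mult_unit: "x \<in> carrier K \<Longrightarrow> m \<in> \<M> \<Longrightarrow> rv K (x \<otimes> (\<one> \<oplus> m)) = rv K x"
  using rv_mem_iff[of x "x \<otimes> (\<one> \<oplus> m)"] rv_mem[of "x \<otimes> (\<one> \<oplus> m)" x] by auto

lemma rv_times_cong:
  assumes "x \<in> carrier K" "y \<in> carrier K" "x' \<in> carrier K" "y' \<in> carrier K" "rv K x = rv K x'" "rv K y = rv K y'"
  shows "rv K (x \<otimes> y) = rv K (x' \<otimes> y')"
proof -
  obtain m where m: "m \<in> \<M>" "x' = x \<otimes> (\<one> \<oplus> m)" using rv_mem_iff[OF assms(1), of x'] rv_mem[of x' x] assms by auto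
  obtain l where l: "l \<in> \<M>" "y' = y \<otimes> (\<one> \<oplus> l)" using rv_mem_iff[OF assms(2), of y'] rv_mem[of y' y] assms by auto
  have "x' \<otimes> y' = x \<otimes> y \<otimes> (\<one> \<oplus> m) \<otimes> (\<one> \<oplus> l)" using m l assms by (simp add: m_ac)
  then show ?thesis using rv_mult_unit[of "x \<otimes> y" m] rv_mult_unit[of "x \<otimes> y \<otimes> (\<one> \<oplus> m)" l] m l assms
    by (metis M_O O_carrier m_closed one_plus_M(1))
qed

lemma rv_mult_rv: assumes "x \<in> carrier K" "y \<in> carrier K"
  shows "rv_mult K (rv K x) (rv K y) = rv K (x \<otimes> y)"
proof (intro equalityI subsetI)
  fix l assume "l \<in> rv_mult K (rv K x) (rv K y)"
  then obtain u v where uv: "l = [u \<otimes> v]" "[u] \<in> rv K x" "[v] \<in> rv K y" unfolding rv_mult_def by blast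
  then show "l \<in> rv K (x \<otimes> y)" using assms rv_times_cong[of x y u v] by (simp add: rv_mem_iff)
next
  fix l assume l: "l \<in> rv K (x \<otimes> y)"
  then obtain m where m: "m \<in> \<M>" "l = [x \<otimes> y \<otimes> (\<one> \<oplus> m)]" by (auto simp: rv_def)
  then have "l = [x \<otimes> (y \<otimes> (\<one> \<oplus> m))]" using assms by (simp add: m_ac)
  moreover have "[y \<otimes> (\<one> \<oplus> m)] \<in> rv K y" using m by (auto simp: rv_mem)
  ultimately show "l \<in> rv_mult K (rv K x) (rv K y)"
    using rv_self[OF assms(1)] by (auto simp: rv_mult_def)
qed

text \<open>Different leading terms of \<open>c\<close> and \<open>x\<close> mean that
  \<open>x \<ominus> c\<close> is not smaller than \<open>x\<close>, whereas
  \<open>y \<ominus> x\<close> is strictly smaller and hence negligible against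
  \<open>x \<ominus> c\<close>. So only a centre inside the ball over \<open>rv K x\<close> can tell
  two of its points apart; this is how preparation is exploited.\<close>

lemma rv_shift:
  assumes "x \<in> carrier K" "y \<in> carrier K" "c \<in> carrier K" "rv K x = rv K y" "rv K c \<noteq> rv K x"
  shows "rv K (x \<ominus> c) = rv K (y \<ominus> c)"
proof -
  have s: "sm (y \<ominus> x) x" using assms by (simp add: rv_eq_iff)
  have n: "\<not> sm (c \<ominus> x) x" using assms rv_eq_iff[of x c] by auto
  have e: "(y \<ominus> c) \<ominus> (x \<ominus> c) = y \<ominus> x" using assms by (simp add: ring_arith)
  have "sm (y \<ominus> x) (x \<ominus> c)"
  proof (cases "x = \<zero>")
    case True
    then have "y \<ominus> x = \<zero>" using s by (auto simp: sm_def)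
    then show ?thesis using assms by simp
  next
    case False
    let ?q = "(x \<ominus> c) \<otimes> inv x"
    have qx: "?q \<otimes> x = x \<ominus> c" using False assms by (simp add: m_assoc)
    have q: "?q \<in> carrier K" using False assms by simp
    have nm: "?q \<notin> \<M>"
    proof
      assume "?q \<in> \<M>"
      then have "sm (x \<ominus> c) x" using qx by (auto simp: sm_def intro!: bexI[of _ ?q])
      then have "sm (\<ominus> (x \<ominus> c)) x" using assms sm_uminus by blast
      moreover have "\<ominus> (x \<ominus> c) = c \<ominus> x" using assms by (simp add: ring_arith)
      ultimately show False using n by simp
    qed
    then have q0: "?q \<noteq> \<zero>" by auto
    have i: "inv ?q \<in> \<O>" using nm O_val[OF q q0] M_iff[of ?q] by blast
    have "x = inv ?q \<otimes> (x \<ominus> c)"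
      using q q0 qx assms(1) by (metis inv_simps(1,4) l_one m_assoc)
    moreover obtain m where "m \<in> \<M>" "y \<ominus> x = m \<otimes> x" using s by (auto simp: sm_def)
    ultimately have "y \<ominus> x = (m \<otimes> inv ?q) \<otimes> (x \<ominus> c)" "m \<in> \<M>"
      using i assms by (metis M_O O_carrier minus_closed m_assoc, simp)
    then show ?thesis using i by (auto simp: sm_def)
  qed
  then show ?thesis using assms e by (simp add: rv_eq_iff)
qed

text \<open>The residue map sends \<open>[n] \<cdot> \<one>\<close> to the same multiple of the unit
  of \<open>residue_field K\<close>; membership in \<open>\<M>\<close> would make that multiple
  vanish in characteristic zero.\<close>

lemma nat_notin_M: assumes "n > 0" shows "[(n::nat)] \<cdot> \<one> \<notin> \<M>"
proof
  assume M: "[n] \<cdot> \<one> \<in> \<M>"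
  let ?A = "K\<lparr>carrier := \<O>\<rparr>"
  interpret A: ring ?A by (rule subring_is_ring[OF O_subring])
  have mi: "\<ominus>\<^bsub>?A\<^esub> x = \<ominus> x" if "x \<in> \<O>" for x
    by (rule A.minus_equality) (use that in \<open>auto simp: l_neg\<close>)
  have "ideal \<M> ?A"
  proof (rule idealI[OF A.ring_axioms])
    show "subgroup \<M> (add_monoid ?A)"
      unfolding subgroup_def using mi[unfolded a_inv_def[of ?A], simplified] by auto
  qed auto
  then interpret I: ideal \<M> ?A .
  interpret h: ring_hom_ring ?A "?A Quot \<M>" "(+>\<^bsub>?A\<^esub>) \<M>" by (rule I.rcos_ring_hom_ring)
  have pos: "[k] \<cdot> \<one> \<in> \<O>" for k :: nat by (induction k) (auto simp: add_pow_def)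
  have hom: "[k] \<cdot>\<^bsub>?A Quot \<M>\<^esub> \<one>\<^bsub>?A Quot \<M>\<^esub> = \<M> +>\<^bsub>?A\<^esub> ([k] \<cdot> \<one>)" for k :: nat
  proof (induction k)
    case 0
    then show ?case using h.hom_zero by (simp add: add_pow_def nat_pow_def)
  next
    case (Suc k)
    have "\<M> +>\<^bsub>?A\<^esub> ([k] \<cdot> \<one> \<oplus>\<^bsub>?A\<^esub> \<one>\<^bsub>?A\<^esub>) = (\<M> +>\<^bsub>?A\<^esub> ([k] \<cdot> \<one>)) \<oplus>\<^bsub>?A Quot \<M>\<^esub> (\<M> +>\<^bsub>?A\<^esub> \<one>\<^bsub>?A\<^esub>)"
      by (rule h.hom_add) (use pos in auto)
    then show ?case using Suc h.hom_one by (simp add: add_pow_def)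
  qed
  have "\<M> +>\<^bsub>?A\<^esub> ([n] \<cdot> \<one>) = \<M>" using M by (rule I.a_rcos_const)
  then have "[n] \<cdot>\<^bsub>residue_field K\<^esub> \<one>\<^bsub>residue_field K\<^esub> = \<zero>\<^bsub>residue_field K\<^esub>"
    using hom[of n] by (simp add: residue_field_def FactRing_def)
  then show False using vf assms unfolding valued_field_def char_zero_def by blast
qed

section \<open>Definability over unary imaginaries\<close>

abbreviation "Def P \<equiv> codef K K P P"
abbreviation "Tm t \<equiv> coterm K K t t"
abbreviation "TmL n s \<equiv> cotermL K K n s s"

lemma tm_intros:
  "Tm (\<lambda>e. e i)" "Tm (\<lambda>e. \<zero>)" "Tm (\<lambda>e. \<one>)"
  "Tm t \<Longrightarrow> Tm s \<Longrightarrow> Tm (\<lambda>e. t e \<oplus> s e)"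
  "Tm t \<Longrightarrow> Tm s \<Longrightarrow> Tm (\<lambda>e. t e \<ominus> s e)"
  "Tm t \<Longrightarrow> Tm s \<Longrightarrow> Tm (\<lambda>e. t e \<otimes> s e)"
  by (fact pair.CT_var pair.CT_zero pair.CT_one pair.CT_plus pair.CT_minus pair.CT_times)+

lemma TmL_map0: "(\<And>i. Tm (\<lambda>e. f e i)) \<Longrightarrow> k = n \<Longrightarrow> TmL k (\<lambda>e. map (f e) [0..<n])"
  using pair.CTL_map[of f f n 0] by simp

lemma Tm_nth: "TmL n l \<Longrightarrow> i < n \<Longrightarrow> Tm (\<lambda>e. l e ! i)"
  by (rule pair.CT_nth)

lemma Tm_nth_map: "(\<And>j. Tm (\<lambda>e. f e j)) \<Longrightarrow> i < n \<Longrightarrow> Tm (\<lambda>e. map (f e) [0..<n] ! i)"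
  by (rule Tm_nth[OF TmL_map0[OF _ refl]])

lemma TmL_drop: "TmL n s \<Longrightarrow> k = n - d \<Longrightarrow> TmL k (\<lambda>e. drop d (s e))"
  unfolding cotermL_def by (cases "d \<le> n") auto

lemma TmL_tl: "TmL k s \<Longrightarrow> k = Suc n \<Longrightarrow> TmL n (\<lambda>e. tl (s e))"
proof -
  assume "TmL k s" "k = Suc n"
  then have "TmL n (\<lambda>e. drop 1 (s e))" by (intro TmL_drop[of k]) simp_all
  then show ?thesis by (simp only: One_nat_def drop_Suc drop_0)
qed

lemma tml_intros0:
  "k = 0 \<Longrightarrow> TmL k (\<lambda>e. [])"
  "Tm t \<Longrightarrow> TmL n s \<Longrightarrow> k = Suc n \<Longrightarrow> TmL k (\<lambda>e. t e # s e)"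
  "TmL n s \<Longrightarrow> TmL m l \<Longrightarrow> k = n + m \<Longrightarrow> TmL k (\<lambda>e. s e @ l e)"
  by (simp_all add: pair.CTL_Nil pair.CTL_Cons pair.CTL_append)

lemma Def_basic:
  "Tm t \<Longrightarrow> Tm s \<Longrightarrow> Def (\<lambda>e. t e = s e)"
  "Tm t \<Longrightarrow> Def (\<lambda>e. t e \<in> \<O>)"
  "Def P \<Longrightarrow> Def (\<lambda>e. \<not> P e)"
  "Def P \<Longrightarrow> Def Q \<Longrightarrow> Def (\<lambda>e. P e \<and> Q e)"
  "Def P \<Longrightarrow> Def Q \<Longrightarrow> Def (\<lambda>e. P e \<or> Q e)"
  "Def P \<Longrightarrow> Def Q \<Longrightarrow> Def (\<lambda>e. P e \<longrightarrow> Q e)"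
  "Def P \<Longrightarrow> Def Q \<Longrightarrow> Def (\<lambda>e. P e \<longleftrightarrow> Q e)"
  "Def (\<lambda>e. b)"
  by (fact pair.CD_eq pair.CD_vring pair.CD_not pair.CD_and pair.CD_or pair.CD_imp pair.CD_iff pair.CD_const)+

lemma Def_quant:
  "Def (\<lambda>e. Q (e 0) (\<lambda>n. e (Suc n))) \<Longrightarrow> Def (\<lambda>e. \<exists>x\<in>carrier K. Q x e)"
  "Def (\<lambda>e. Q (e 0) (\<lambda>n. e (Suc n))) \<Longrightarrow> Def (\<lambda>e. \<forall>x\<in>carrier K. Q x e)"
  "Def (\<lambda>e. Q' (map e [0..<r]) (\<lambda>n. e (n + r))) \<Longrightarrow> Def (\<lambda>e. \<exists>xs\<in>tuples K r. Q' xs e)"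
  "Def (\<lambda>e. Q' (map e [0..<r]) (\<lambda>n. e (n + r))) \<Longrightarrow> Def (\<lambda>e. \<forall>xs\<in>tuples K r. Q' xs e)"
  by (fact pair.CD_ex pair.CD_all pair.CD_tuples_ex pair.CD_tuples_all)+

lemma Def_finite_all: "(\<And>i::nat. i < m \<Longrightarrow> Def (P i)) \<Longrightarrow> Def (\<lambda>e. \<forall>i<m. P i e)"
  by (rule pair.CD_finite_all)

lemma Def_finite_ex: "(\<And>i::nat. i < m \<Longrightarrow> Def (P i)) \<Longrightarrow> Def (\<lambda>e. \<exists>i<m. P i e)"
  by (rule pair.CD_finite_ex)

lemma Def_cong:
  assumes "Def P" "\<And>e. range e \<subseteq> carrier K \<Longrightarrow> P e = Q e" shows "Def Q"
  using assms unfolding codef_def by (elim exE) (rule exI, auto)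

lemma Tm_closed: "Tm t \<Longrightarrow> range e \<subseteq> carrier K \<Longrightarrow> t e \<in> carrier K"
  unfolding coterm_def using tval_closed[OF vf] by auto

lemma Tm_shift: assumes "Tm t" shows "Tm (\<lambda>e. t (\<lambda>n. e (Suc n)))"
proof -
  obtain \<tau> where \<tau>: "\<And>e. range e \<subseteq> carrier K \<Longrightarrow> t e = tval K e \<tau>" using assms unfolding coterm_def by blast
  have "t (\<lambda>n. e (Suc n)) = tval K e (tsubst (\<lambda>n. TVar (Suc n)) \<tau>)" if "range e \<subseteq> carrier K" for e
    using \<tau>[of "\<lambda>n. e (Suc n)"] that by (auto simp: tval_tsubst image_subset_iff)
  then show ?thesis unfolding coterm_def by blast
qed

text \<open>The language has no inverse and no symbol for \<open>\<M>\<close>; non-invertibility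
  inside \<open>\<O>\<close> is therefore written with a quantifier over the carrier, as the closure
  rules require.\<close>

lemma M_char: assumes "t \<in> carrier K"
  shows "t \<in> \<M> \<longleftrightarrow> t \<in> \<O> \<and> \<not> (\<exists>u\<in>carrier K. u \<in> \<O> \<and> t \<otimes> u = \<one>)"
proof (cases "t \<in> \<O>")
  case True
  have "(\<exists>u\<in>carrier K. u \<in> \<O> \<and> t \<otimes> u = \<one>) \<longleftrightarrow> t \<notin> \<M>"
  proof
    assume "\<exists>u\<in>carrier K. u \<in> \<O> \<and> t \<otimes> u = \<one>"
    then obtain u where u: "u \<in> \<O>" "t \<otimes> u = \<one>" by blast
    show "t \<notin> \<M>"
    proof
      assume "t \<in> \<M>"
      from M_times(1)[OF this u(1)] show False using u(2) one_notin_M by simp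
    qed
  next
    assume "t \<notin> \<M>"
    then show "\<exists>u\<in>carrier K. u \<in> \<O> \<and> t \<otimes> u = \<one>"
      using unitD(1,2)[OF True] O_carrier[OF True] inv_simps[of t] by blast
  qed
  then show ?thesis using True by blast
next
  case False
  then show ?thesis using M_O by blast
qed

lemma Def_M: assumes "Tm t" shows "Def (\<lambda>e. t e \<in> \<M>)"
proof (rule Def_cong)
  show "Def (\<lambda>e. t e \<in> \<O> \<and> \<not> (\<exists>u\<in>carrier K. u \<in> \<O> \<and> t e \<otimes> u = \<one>))"
    by (intro Def_basic Def_quant tm_intros assms Tm_shift)
qed (rule M_char[OF Tm_closed[OF assms], symmetric])

lemma Def_app2: "Def (\<lambda>e. P (e 0) (e 1)) \<Longrightarrow> Tm t \<Longrightarrow> Tm s \<Longrightarrow> Def (\<lambda>e. P (t e) (s e))"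
  using pair.CD_list[of "\<lambda>l. P (l ! 0) (l ! 1)" 2 "\<lambda>l. P (l ! 0) (l ! 1)" "\<lambda>e. [t e, s e]" "\<lambda>e. [t e, s e]"]
    pair.CTL_Cons[OF _ pair.CTL_Cons[OF _ pair.CTL_Nil], of t t s s] by (simp add: numeral_2_eq_2)

lemma Def_sm: "Tm t \<Longrightarrow> Tm s \<Longrightarrow> Def (\<lambda>e. sm (t e) (s e))"
proof (rule Def_app2)
  have "Def (\<lambda>e. \<exists>m\<in>carrier K. m \<in> \<M> \<and> e 0 = m \<otimes> e 1)"
    by (intro Def_basic Def_quant Def_M tm_intros)
  then show "Def (\<lambda>e. sm (e 0) (e 1))"
    by (rule Def_cong) (auto simp: sm_def)
qed

lemma Def_rv: "Tm t \<Longrightarrow> Tm s \<Longrightarrow> Def (\<lambda>e. rv K (t e) = rv K (s e))"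
proof (rule Def_app2)
  have "Def (\<lambda>e. sm (e 1 \<ominus> e 0) (e 0))"
    by (intro Def_sm tm_intros)
  then show "Def (\<lambda>e. rv K (e 0) = rv K (e 1))"
    by (rule Def_cong) (auto simp: rv_eq_iff image_subset_iff)
qed

text \<open>The working notion of a formula in \<open>n\<close> variables: only the values on tuples
  from the carrier count, and parameters are appended as further entries.\<close>

definition LDef :: "nat \<Rightarrow> ('a list \<Rightarrow> bool) \<Rightarrow> bool" where
  "LDef n \<Phi> \<longleftrightarrow> Def (\<lambda>e. \<Phi> (map e [0..<n]))"

lemma LDef_app: "LDef n \<Phi> \<Longrightarrow> TmL n s \<Longrightarrow> Def (\<lambda>e. \<Phi> (s e))"
  unfolding LDef_def by (rule pair.CD_list)

lemmas tml_intros = TmL_map0 tml_intros0 TmL_drop TmL_tl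

lemmas def_intros = Def_rv Def_basic Def_quant Def_finite_all Def_finite_ex Def_sm Def_M tm_intros Tm_nth_map

lemma tuples_iff: "xs \<in> tuples K n \<longleftrightarrow> length xs = n \<and> set xs \<subseteq> carrier K"
  by (simp add: tuples_def)

lemma map_tuples: "range e \<subseteq> carrier K \<Longrightarrow> map e [a..<b] \<in> tuples K (b - a)"
  by (auto simp: tuples_def)

lemma env_range: "set xs \<subseteq> carrier K \<Longrightarrow> range (env K xs) \<subseteq> carrier K"
  by (auto simp: env_def set_conv_nth)

lemma LDef_iff: "LDef n \<Phi> \<longleftrightarrow> (\<exists>\<phi>. \<forall>xs\<in>tuples K n. \<Phi> xs \<longleftrightarrow> sat K \<phi> xs)"
proof
  assume "LDef n \<Phi>"
  then obtain \<phi> where \<phi>: "\<And>e. range e \<subseteq> carrier K \<Longrightarrow> \<Phi> (map e [0..<n]) = holds K e \<phi>"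
    unfolding LDef_def codef_def by blast
  have "\<Phi> xs \<longleftrightarrow> sat K \<phi> xs" if xs: "xs \<in> tuples K n" for xs
  proof -
    have "map (env K xs) [0..<n] = xs" using xs by (intro nth_equalityI) (auto simp: env_def tuples_iff)
    then show ?thesis using \<phi>[OF env_range, of xs] xs by (simp add: tuples_iff sat_env)
  qed
  then show "\<exists>\<phi>. \<forall>xs\<in>tuples K n. \<Phi> xs \<longleftrightarrow> sat K \<phi> xs" by blast
next
  assume "\<exists>\<phi>. \<forall>xs\<in>tuples K n. \<Phi> xs \<longleftrightarrow> sat K \<phi> xs"
  then obtain \<phi> where \<phi>: "\<And>xs. xs \<in> tuples K n \<Longrightarrow> \<Phi> xs \<longleftrightarrow> sat K \<phi> xs" by blast
  \<comment> \<open>Variables beyond the end of the tuple are zero for \<open>sat\<close>; the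
    substitution writes this default into the formula itself.\<close>
  let ?\<sigma> = "\<lambda>i. if i < n then TVar i else TZero"
  have "\<Phi> (map e [0..<n]) = holds K e (fsubst \<phi> ?\<sigma>)" if e: "range e \<subseteq> carrier K" for e
  proof -
    have "env K (map e [0..<n]) = (\<lambda>i. tval K e (?\<sigma> i))" by (auto simp: env_def fun_eq_iff)
    moreover have "map e [0..<n] \<in> tuples K n" using map_tuples[OF e, of 0 n] by simp
    ultimately show ?thesis using \<phi> by (simp only: holds_fsubst sat_env)
  qed
  then show "LDef n \<Phi>" unfolding LDef_def codef_def by blast
qed

text \<open>
  Elements of \<open>K\<close> (as \<open>pt x\<close>) and of \<open>RV\<close> are treated on the same footing: a unary imaginary is
  a class \<open>\<kappa> x\<close> with \<open>\<kappa> = pt\<close> or \<open>\<kappa> = rv\<close>.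
\<close>

definition kap :: "('a \<Rightarrow> 'a imag) \<Rightarrow> bool" where
  "kap \<kappa> \<longleftrightarrow> \<kappa> = pt \<or> \<kappa> = rv K"

definition PRV :: "'a imag set" where
  "PRV = pt ` carrier K \<union> RV K"

text \<open>Members of a unary imaginary are one-element lists, so a list of such imaginaries is
  represented by a plain list over the field.\<close>

definition rep :: "'a list \<Rightarrow> 'a imag list \<Rightarrow> bool" where
  "rep ws ps \<longleftrightarrow> list_all2 (\<lambda>w p. [w] \<in> p) ws ps"

lemma kap_mem: "kap \<kappa> \<Longrightarrow> x \<in> carrier K \<Longrightarrow> [y] \<in> \<kappa> x \<longleftrightarrow> y \<in> carrier K \<and> \<kappa> x = \<kappa> y"
  unfolding kap_def by (elim disjE) (simp_all add: pt_def rv_mem_iff, blast)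

lemma kap_self: "kap \<kappa> \<Longrightarrow> x \<in> carrier K \<Longrightarrow> [x] \<in> \<kappa> x"
  by (simp add: kap_mem)

lemma kap_elt: "kap \<kappa> \<Longrightarrow> x \<in> carrier K \<Longrightarrow> l \<in> \<kappa> x \<Longrightarrow> \<exists>y\<in>carrier K. l = [y]"
  by (auto simp: kap_def pt_def rv_def dest!: one_plus_M(1))

lemma kap_PRV: "kap \<kappa> \<Longrightarrow> x \<in> carrier K \<Longrightarrow> \<kappa> x \<in> PRV"
  by (auto simp: kap_def PRV_def RV_def)

lemma PRV_kap: "p \<in> PRV \<Longrightarrow> \<exists>\<kappa> x. kap \<kappa> \<and> x \<in> carrier K \<and> p = \<kappa> x"
  by (auto simp: kap_def PRV_def RV_def)

lemma kap_simps [simp]: "kap pt" "kap (rv K)" by (auto simp: kap_def)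

lemma Def_kap: "kap \<kappa> \<Longrightarrow> Tm t \<Longrightarrow> Tm s \<Longrightarrow> Def (\<lambda>e. \<kappa> (t e) = \<kappa> (s e))"
  using Def_rv[of t s] Def_basic(1)[of t s] by (auto simp: kap_def pt_def)

lemma rep_tuples: assumes "set ps \<subseteq> PRV" "rep ws ps" shows "ws \<in> tuples K (length ps)"
proof -
  have len: "length ws = length ps" using assms by (auto simp: rep_def list_all2_lengthD)
  have "ws ! i \<in> carrier K" if i: "i < length ps" for i
  proof -
    have "[ws ! i] \<in> ps ! i" using assms i by (auto simp: rep_def list_all2_conv_all_nth)
    moreover have "ps ! i \<in> PRV" using assms i by auto
    ultimately show ?thesis using PRV_kap kap_elt by blast
  qed
  then show ?thesis using len by (auto simp: tuples_iff set_conv_nth)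
qed

lemma rep_ex: assumes "set ps \<subseteq> PRV" shows "\<exists>ws. rep ws ps"
  using assms
proof (induction ps)
  case (Cons p ps)
  then obtain ws where "rep ws ps" by auto
  moreover obtain w where "[w] \<in> p" using Cons.prems PRV_kap[of p] kap_self by auto
  ultimately show ?case by (intro exI[of _ "w # ws"]) (simp add: rep_def)
qed (simp add: rep_def)

lemma rep_append: "length ws = length ps \<Longrightarrow> rep (ws @ vs) (ps @ qs) \<longleftrightarrow> rep ws ps \<and> rep vs qs"
  by (simp add: rep_def list_all2_append)

lemma rep_append_ex: "rep us (ps @ qs) \<Longrightarrow> \<exists>ws vs. us = ws @ vs \<and> rep ws ps \<and> rep vs qs"
  by (auto simp: rep_def list_all2_append2)

lemma rep_split: "rep us (ps @ qs) \<longleftrightarrow> (\<exists>ws vs. us = ws @ vs \<and> rep ws ps \<and> rep vs qs)"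
proof
  assume "\<exists>ws vs. us = ws @ vs \<and> rep ws ps \<and> rep vs qs"
  then obtain ws vs where *: "us = ws @ vs" "rep ws ps" "rep vs qs" by blast
  then have "length ws = length ps" by (simp add: rep_def list_all2_lengthD)
  then show "rep us (ps @ qs)" using * by (simp add: rep_append)
qed (rule rep_append_ex)

lemma rep_Cons [simp]: "rep (w # ws) (p # ps) \<longleftrightarrow> [w] \<in> p \<and> rep ws ps" "rep [] []"
  by (simp_all add: rep_def)

lemma rep_map: "kap \<kappa> \<Longrightarrow> set xs \<subseteq> carrier K \<Longrightarrow> rep ys (map \<kappa> xs) \<longleftrightarrow> ys \<in> tuples K (length xs) \<and> map \<kappa> ys = map \<kappa> xs"
proof (induction xs arbitrary: ys)
  case (Cons x xs)
  then show ?case by (cases ys) (auto simp: rep_def kap_mem tuples_iff)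
qed (auto simp: rep_def tuples_iff)

lemma rep_pt: "set xs \<subseteq> carrier K \<Longrightarrow> rep ys (map pt xs) \<longleftrightarrow> ys = xs"
proof (induction xs arbitrary: ys)
  case (Cons x xs)
  then show ?case by (cases ys) (auto simp: rep_def pt_def)
qed (auto simp: rep_def)

lemma PRV_elt: assumes "p \<in> PRV" "l \<in> p" shows "\<exists>y\<in>carrier K. l = [y]"
proof -
  obtain \<kappa> x where "kap \<kappa>" "x \<in> carrier K" "p = \<kappa> x" using PRV_kap[OF assms(1)] by blast
  then show ?thesis using kap_elt[of \<kappa> x l] assms(2) by simp
qed

lemma sat_eq_rep:
  assumes "set es \<subseteq> PRV"
  shows "sat_eq K \<phi> es \<longleftrightarrow> (\<exists>ws. rep ws es \<and> sat K \<phi> ws)"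
proof -
  have 1: "\<exists>ws. rep ws es \<and> rs = map (\<lambda>w. [w]) ws" if "list_all2 (\<in>) rs es" for rs
    using that assms
  proof (induction rule: list_all2_induct)
    case (Cons r rs e es)
    then obtain ws where "rep ws es" "rs = map (\<lambda>w. [w]) ws" by auto
    moreover obtain y where "r = [y]" using PRV_elt[of e r] Cons by auto
    ultimately show ?case using Cons by (intro exI[of _ "y # ws"]) simp
  qed (auto simp: rep_def)
  have 2: "list_all2 (\<in>) (map (\<lambda>w. [w]) ws) es" if "rep ws es" for ws
    using that by (simp add: rep_def list_all2_map1)
  have c: "concat (map (\<lambda>w. [w]) ws) = ws" for ws :: "'a list" by (induction ws) auto
  show ?thesis unfolding sat_eq_def using 1 2 c by metis
qed

text \<open>The sort of each parameter is decided outside the formula. The class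
  \<open>rv K \<zero>\<close> equals \<open>pt \<zero>\<close> and falls under the first case, with
  the same effect.\<close>

definition sims :: "'a imag list \<Rightarrow> 'a list \<Rightarrow> 'a list \<Rightarrow> bool" where
  "sims ps ws vs \<longleftrightarrow> (\<forall>i<length ps. if ps ! i \<in> pt ` carrier K then ws ! i = vs ! i else rv K (ws ! i) = rv K (vs ! i))"

lemma rep_sims:
  assumes "set ps \<subseteq> PRV" "rep ws ps"
  shows "rep vs ps \<longleftrightarrow> vs \<in> tuples K (length ps) \<and> sims ps ws vs"
proof -
  have "([vs ! i] \<in> ps ! i) \<longleftrightarrow> vs ! i \<in> carrier K \<and> (if ps ! i \<in> pt ` carrier K then ws ! i = vs ! i else rv K (ws ! i) = rv K (vs ! i))"
    if i: "i < length ps" for i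
  proof -
    have w: "[ws ! i] \<in> ps ! i" using assms i by (auto simp: rep_def list_all2_conv_all_nth)
    have "ws ! i \<in> set ws" using rep_tuples[OF assms] i by (simp add: tuples_iff)
    then have wc: "ws ! i \<in> carrier K" using rep_tuples[OF assms] tuples_iff by blast
    show ?thesis
    proof (cases "ps ! i \<in> pt ` carrier K")
      case True
      then obtain a where "a \<in> carrier K" "ps ! i = pt a" by blast
      then show ?thesis using w wc True by (simp add: pt_def) blast
    next
      case False
      then obtain x where x: "x \<in> carrier K" "ps ! i = rv K x" using assms i by (auto simp: PRV_def RV_def dest!: nth_mem)
      then show ?thesis using False w wc by (auto simp: rv_mem_iff)
    qed
  qed
  then show ?thesis using assms
    by (auto simp: rep_def list_all2_conv_all_nth tuples_iff sims_def set_conv_nth)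
qed

lemma Def_sims: "TmL (length ps) s \<Longrightarrow> TmL (length ps) l \<Longrightarrow> Def (\<lambda>e. sims ps (s e) (l e))"
  unfolding sims_def
proof (intro def_intros)
  fix i assume "TmL (length ps) s" "TmL (length ps) l" "i < length ps"
  then have "Tm (\<lambda>e. s e ! i)" "Tm (\<lambda>e. l e ! i)" by (auto intro: Tm_nth)
  then show "Def (\<lambda>e. if ps ! i \<in> pt ` carrier K then s e ! i = l e ! i else rv K (s e ! i) = rv K (l e ! i))"
    by (cases "ps ! i \<in> pt ` carrier K") (auto intro: def_intros)
qed

lemma listset_replicate: "listset (replicate n A) = {es. length es = n \<and> set es \<subseteq> A}"
proof (induction n)
  case (Suc n)
  then show ?case by (auto simp: set_Cons_def length_Suc_conv)
qed auto

lemma map_kap_ex: "set es \<subseteq> \<kappa> ` carrier K \<Longrightarrow> \<exists>ys\<in>tuples K (length es). es = map \<kappa> ys"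
proof (induction es)
  case (Cons x es)
  then obtain ys y where "ys \<in> tuples K (length es)" "es = map \<kappa> ys" "y \<in> carrier K" "x = \<kappa> y" by auto
  then show ?case by (intro bexI[of _ "y # ys"]) (auto simp: tuples_iff)
qed (auto simp: tuples_iff)

text \<open>Normal form of definability for all that follows: whereas \<open>sat_eq\<close> asks for
  some representatives, here the formula takes the correct truth value at all of them.\<close>

lemma definable_iff:
  assumes "kap \<kappa>" "P \<subseteq> PRV" "X \<subseteq> listset (replicate n (\<kappa> ` carrier K))"
  shows "definable K (replicate n (\<kappa> ` carrier K)) P X \<longleftrightarrow>
    (\<exists>ps \<Phi>. set ps \<subseteq> P \<and> LDef (n + length ps) \<Phi> \<and>
       (\<forall>ys\<in>tuples K n. \<forall>ws. rep ws ps \<longrightarrow> (map \<kappa> ys \<in> X \<longleftrightarrow> \<Phi> (ys @ ws))))" (is "?L \<longleftrightarrow> ?R")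
proof
  assume ?L
  then obtain \<phi> ps where ps: "set ps \<subseteq> P" and
    X: "X = {es \<in> listset (replicate n (\<kappa> ` carrier K)). sat_eq K \<phi> (es @ ps)}"
    unfolding definable_def by blast
  let ?m = "length ps"
  \<comment> \<open>The solution set of \<open>\<phi>\<close>, closed under changing the
    representatives of the variables and of the parameters; afterwards one choice of
    \<open>ws\<close> is as good as any other.\<close>
  let ?\<Phi> = "\<lambda>l. \<exists>ys\<in>tuples K n. \<exists>ws\<in>tuples K ?m.
      (\<forall>i<n. \<kappa> (l ! i) = \<kappa> (ys ! i)) \<and> sims ps (drop n l) ws \<and> sat K \<phi> (ys @ ws)"
  have sL: "LDef (n + ?m) (sat K \<phi>)" unfolding LDef_iff by blast
  have "LDef (n + ?m) ?\<Phi>" unfolding LDef_def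
    by (intro def_intros Def_kap[OF assms(1)] Def_sims LDef_app[OF sL] tml_intros) ((rule refl | simp)+)?
  moreover have "map \<kappa> ys \<in> X \<longleftrightarrow> ?\<Phi> (ys @ ws)" if ys: "ys \<in> tuples K n" and ws: "rep ws ps" for ys ws
  proof -
    have len: "length ys = n" using ys by (simp add: tuples_iff)
    have P1: "set (map \<kappa> ys @ ps) \<subseteq> PRV" using ys ps assms kap_PRV by (auto simp: tuples_iff)
    have "map \<kappa> ys \<in> listset (replicate n (\<kappa> ` carrier K))"
      using ys by (auto simp: listset_replicate tuples_iff)
    then have "map \<kappa> ys \<in> X \<longleftrightarrow> (\<exists>us. rep us (map \<kappa> ys @ ps) \<and> sat K \<phi> us)"
      unfolding X using sat_eq_rep[OF P1] by simp
    also have "\<dots> \<longleftrightarrow> (\<exists>zs vs. rep zs (map \<kappa> ys) \<and> rep vs ps \<and> sat K \<phi> (zs @ vs))"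
      unfolding rep_split by blast
    also have "\<dots> \<longleftrightarrow> (\<exists>zs\<in>tuples K n. \<exists>vs\<in>tuples K ?m. map \<kappa> zs = map \<kappa> ys \<and> sims ps ws vs \<and> sat K \<phi> (zs @ vs))"
    proof -
      have A: "rep zs (map \<kappa> ys) \<longleftrightarrow> zs \<in> tuples K n \<and> map \<kappa> zs = map \<kappa> ys" for zs
        using rep_map[OF assms(1), of ys zs] ys len by (simp add: tuples_iff)
      have B: "rep vs ps \<longleftrightarrow> vs \<in> tuples K ?m \<and> sims ps ws vs" for vs
        by (rule rep_sims[OF _ ws]) (use ps assms(2) in blast)
      show ?thesis unfolding A B by blast
    qed
    also have "\<dots> \<longleftrightarrow> ?\<Phi> (ys @ ws)"
    proof -
      have C: "map \<kappa> zs = map \<kappa> ys \<longleftrightarrow> (\<forall>i<n. \<kappa> ((ys @ ws) ! i) = \<kappa> (zs ! i))" if "zs \<in> tuples K n" for zs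
        using that len by (auto simp: list_eq_iff_nth_eq tuples_iff nth_append)
      show ?thesis by (rule bex_cong[OF refl], rule bex_cong[OF refl]) (simp add: C len)
    qed
    finally show ?thesis .
  qed
  ultimately show ?R using ps by blast
next
  assume ?R
  then obtain ps \<Phi> where ps: "set ps \<subseteq> P" and L: "LDef (n + length ps) \<Phi>"
    and \<Phi>: "\<And>ys ws. ys \<in> tuples K n \<Longrightarrow> rep ws ps \<Longrightarrow> map \<kappa> ys \<in> X \<longleftrightarrow> \<Phi> (ys @ ws)" by blast
  obtain \<phi> where \<phi>: "\<And>xs. xs \<in> tuples K (n + length ps) \<Longrightarrow> \<Phi> xs \<longleftrightarrow> sat K \<phi> xs"
    using L unfolding LDef_iff by blast
  have "es \<in> X \<longleftrightarrow> sat_eq K \<phi> (es @ ps)" if es: "es \<in> listset (replicate n (\<kappa> ` carrier K))" for es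
  proof -
    obtain ys where ys: "ys \<in> tuples K n" "es = map \<kappa> ys"
    proof -
      have "length es = n" "set es \<subseteq> \<kappa> ` carrier K" using es by (auto simp: listset_replicate)
      then show thesis using that map_kap_ex[of es \<kappa>] by blast
    qed
    have P1: "set (es @ ps) \<subseteq> PRV" using ys ps assms kap_PRV by (auto simp: tuples_iff)
    have tup: "zs @ vs \<in> tuples K (n + length ps)" if "rep zs es" "rep vs ps" for zs vs
    proof -
      have "zs \<in> tuples K (length es)" "vs \<in> tuples K (length ps)" using that P1 rep_tuples by auto
      then show ?thesis using ys by (auto simp: tuples_iff)
    qed
    have "sat_eq K \<phi> (es @ ps) \<longleftrightarrow> (\<exists>zs vs. rep zs es \<and> rep vs ps \<and> sat K \<phi> (zs @ vs))"
      unfolding sat_eq_rep[OF P1] rep_split by blast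
    also have "\<dots> \<longleftrightarrow> (\<exists>zs vs. rep zs es \<and> rep vs ps \<and> \<Phi> (zs @ vs))"
      using tup \<phi> by blast
    also have "\<dots> \<longleftrightarrow> (\<exists>zs vs. rep zs es \<and> rep vs ps \<and> es \<in> X)"
    proof -
      have "\<Phi> (zs @ vs) \<longleftrightarrow> es \<in> X" if "rep zs es" "rep vs ps" for zs vs
      proof -
        have "zs \<in> tuples K n" "map \<kappa> zs = es" using that(1) rep_map[OF assms(1), of ys zs] ys by (auto simp: tuples_iff)
        then show ?thesis using \<Phi>[of zs vs] that by blast
      qed
      then show ?thesis by blast
    qed
    also have "\<dots> \<longleftrightarrow> es \<in> X"
      using rep_ex[of es] rep_ex[of ps] P1 by auto
    finally show ?thesis by simp
  qed
  then show ?L unfolding definable_def using ps assms(3) by blast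
qed

section \<open>Algebraic elements\<close>

lemma definableI:
  assumes "kap \<kappa>" "P \<subseteq> PRV" "X \<subseteq> listset (replicate n (\<kappa> ` carrier K))" "set ps \<subseteq> P" "LDef (n + length ps) \<Phi>"
    "\<And>ys ws. ys \<in> tuples K n \<Longrightarrow> rep ws ps \<Longrightarrow> map \<kappa> ys \<in> X \<longleftrightarrow> \<Phi> (ys @ ws)"
  shows "definable K (replicate n (\<kappa> ` carrier K)) P X"
  unfolding definable_iff[OF assms(1-3)] using assms(4-6) by blast

lemma map_ex: "set ts \<subseteq> f ` Y \<Longrightarrow> \<exists>ys. set ys \<subseteq> Y \<and> map f ys = ts"
proof (induction ts)
  case (Cons t ts)
  then obtain ys y where "set ys \<subseteq> Y" "map f ys = ts" "y \<in> Y" "t = f y" by auto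
  then show ?case by (intro exI[of _ "y # ys"]) simp
qed simp

section \<open>Counting as a first-order condition, and algebraic elements\<close>

lemma card_le_iff: "finite S \<and> card S \<le> N \<longleftrightarrow> \<not> (\<exists>T\<subseteq>S. finite T \<and> card T = Suc N)"
proof
  assume "finite S \<and> card S \<le> N"
  then show "\<not> (\<exists>T\<subseteq>S. finite T \<and> card T = Suc N)" by (auto dest: card_mono)
next
  assume n: "\<not> (\<exists>T\<subseteq>S. finite T \<and> card T = Suc N)"
  have "finite S"
  proof (rule ccontr)
    assume "infinite S"
    from infinite_arbitrarily_large[OF this, of "Suc N"] n show False by blast
  qed
  moreover have "card S \<le> N"
  proof (rule ccontr)
    assume "\<not> card S \<le> N"
    then have "Suc N \<le> card S" by simp
    from obtain_subset_with_card_n[OF this] n show False by metis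
  qed
  ultimately show "finite S \<and> card S \<le> N" ..
qed

text \<open>A list of \<open>Suc N\<close> points with pairwise different images is a configuration
  that a formula can describe, which makes the bound \<open>N\<close> on the number of classes
  first-order.\<close>

lemma image_card_le_iff:
  "finite (f ` Y) \<and> card (f ` Y) \<le> N \<longleftrightarrow>
   \<not> (\<exists>ys. length ys = Suc N \<and> set ys \<subseteq> Y \<and> (\<forall>i<Suc N. \<forall>j<Suc N. i \<noteq> j \<longrightarrow> f (ys ! i) \<noteq> f (ys ! j)))"
proof -
  have "(\<exists>T\<subseteq>f ` Y. finite T \<and> card T = Suc N) \<longleftrightarrow> (\<exists>ys. length ys = Suc N \<and> set ys \<subseteq> Y \<and> distinct (map f ys))"
  proof
    assume "\<exists>T\<subseteq>f ` Y. finite T \<and> card T = Suc N"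
    then obtain T where T: "T \<subseteq> f ` Y" "finite T" "card T = Suc N" by blast
    obtain ts where ts: "set ts = T" "distinct ts" using finite_distinct_list[OF T(2)] by blast
    obtain ys where ys: "set ys \<subseteq> Y" "map f ys = ts" using map_ex[of ts f Y] T ts by auto
    have "length ys = Suc N" using ts T ys distinct_card[of ts] by (metis length_map)
    then show "\<exists>ys. length ys = Suc N \<and> set ys \<subseteq> Y \<and> distinct (map f ys)" using ys ts by blast
  next
    assume "\<exists>ys. length ys = Suc N \<and> set ys \<subseteq> Y \<and> distinct (map f ys)"
    then obtain ys where "length ys = Suc N" "set ys \<subseteq> Y" "distinct (map f ys)" by blast
    then show "\<exists>T\<subseteq>f ` Y. finite T \<and> card T = Suc N"
      using distinct_card[of "map f ys"] by (intro exI[of _ "f ` set ys"]) auto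
  qed
  note A = this
  have B: "distinct (map f ys) \<longleftrightarrow> (\<forall>i<Suc N. \<forall>j<Suc N. i \<noteq> j \<longrightarrow> f (ys ! i) \<noteq> f (ys ! j))" if "length ys = Suc N" for ys
    using that by (simp add: distinct_conv_nth)
  show ?thesis unfolding card_le_iff A
    by (rule arg_cong[where f = Not], rule ex_cong1, rule conj_cong[OF refl], rule conj_cong[OF refl], rule B, assumption)
qed

text \<open>Finiteness is stated separately because \<open>card\<close> of an infinite set is
  \<open>0\<close>.\<close>

definition few :: "('a \<Rightarrow> 'a imag) \<Rightarrow> nat \<Rightarrow> ('a list \<Rightarrow> bool) \<Rightarrow> 'a list \<Rightarrow> bool" where
  "few \<kappa> N \<Phi> ws \<longleftrightarrow> finite (\<kappa> ` {y \<in> carrier K. \<Phi> (y # ws)}) \<and> card (\<kappa> ` {y \<in> carrier K. \<Phi> (y # ws)}) \<le> N"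

lemma few_iff:
  "few \<kappa> N \<Phi> ws \<longleftrightarrow> \<not> (\<exists>ys\<in>tuples K (Suc N). (\<forall>i<Suc N. \<Phi> (ys ! i # ws)) \<and>
     (\<forall>i<Suc N. \<forall>j<Suc N. i \<noteq> j \<longrightarrow> \<kappa> (ys ! i) \<noteq> \<kappa> (ys ! j)))"
proof -
  have "length ys = Suc N \<and> set ys \<subseteq> {y \<in> carrier K. \<Phi> (y # ws)} \<longleftrightarrow>
      ys \<in> tuples K (Suc N) \<and> (\<forall>i<Suc N. \<Phi> (ys ! i # ws))" for ys
  proof -
    have "set ys \<subseteq> {y \<in> carrier K. \<Phi> (y # ws)} \<longleftrightarrow> set ys \<subseteq> carrier K \<and> (\<forall>y\<in>set ys. \<Phi> (y # ws))" by blast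
    then show ?thesis by (auto simp: tuples_iff all_set_conv_all_nth)
  qed
  then show ?thesis unfolding few_def image_card_le_iff by (simp only: Bex_def conj_assoc[symmetric])
qed

lemma Def_few: assumes "kap \<kappa>" "LDef (Suc m) \<Phi>" "TmL m s" shows "Def (\<lambda>e. few \<kappa> N \<Phi> (s e))"
proof -
  have "LDef m (few \<kappa> N \<Phi>)" unfolding LDef_def few_iff
    by (intro def_intros Def_kap[OF assms(1)] LDef_app[OF assms(2)] tml_intros) ((rule refl | simp)+)?
  then show ?thesis by (rule LDef_app[OF _ assms(3)])
qed

lemma few_mono: "few \<kappa> N \<Phi> ws \<Longrightarrow> (\<And>y. y \<in> carrier K \<Longrightarrow> \<Psi> (y # ws) \<Longrightarrow> \<Phi> (y # ws)) \<Longrightarrow> few \<kappa> N \<Psi> ws"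
proof -
  assume f: "few \<kappa> N \<Phi> ws" and "\<And>y. y \<in> carrier K \<Longrightarrow> \<Psi> (y # ws) \<Longrightarrow> \<Phi> (y # ws)"
  then have "\<kappa> ` {y \<in> carrier K. \<Psi> (y # ws)} \<subseteq> \<kappa> ` {y \<in> carrier K. \<Phi> (y # ws)}" by blast
  then show ?thesis using f card_mono unfolding few_def by (meson finite_subset order_trans)
qed

text \<open>
  The witnessing formula has at most \<open>N\<close> solutions modulo \<open>\<kappa>\<close> at \<^emph>\<open>every\<close> value of the
  parameters, not only at representatives of \<open>ps\<close>.
\<close>

definition alg :: "('a \<Rightarrow> 'a imag) \<Rightarrow> 'a imag list \<Rightarrow> 'a imag \<Rightarrow> bool" where
  "alg \<kappa> ps \<xi> \<longleftrightarrow> (\<exists>\<Phi> N. LDef (Suc (length ps)) \<Phi> \<and> (\<forall>ws\<in>tuples K (length ps). few \<kappa> N \<Phi> ws) \<and>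
      (\<forall>ws y. rep ws ps \<longrightarrow> [y] \<in> \<xi> \<longrightarrow> \<Phi> (y # ws)))"

text \<open>A bound at every parameter value is enforced by conjoining to the formula the condition
  that its own fibre is small. At representatives of \<open>ps\<close> this condition holds anyway,
  the fibre lying in \<open>X\<close>, so nothing is lost there.\<close>

lemma alg_intro:
  assumes \<kappa>: "kap \<kappa>" and ps: "set ps \<subseteq> PRV" and L: "LDef (Suc (length ps)) \<Phi>" and X: "finite X"
    and in_X: "\<And>ws y. rep ws ps \<Longrightarrow> y \<in> carrier K \<Longrightarrow> \<Phi> (y # ws) \<Longrightarrow> \<kappa> y \<in> X"
    and ex: "rep ws0 ps" "y0 \<in> carrier K" "\<Phi> (y0 # ws0)"
  shows "alg \<kappa> ps (\<kappa> y0)"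
proof -
  let ?m = "length ps"
  \<comment> \<open>Closed under changing \<open>y\<close> in its class and \<open>ws\<close> among
    the representatives, so that the single witness \<open>y0\<close>, \<open>ws0\<close> serves all
    of them.\<close>
  define \<Phi>1 where "\<Phi>1 = (\<lambda>l. \<exists>y\<in>carrier K. \<exists>ws\<in>tuples K ?m. \<kappa> (l ! 0) = \<kappa> y \<and> sims ps (tl l) ws \<and> \<Phi> (y # ws))"
  define \<Phi>2 where "\<Phi>2 = (\<lambda>l. \<Phi>1 l \<and> few \<kappa> (card X) \<Phi>1 (tl l))"
  have L1: "LDef (Suc ?m) \<Phi>1" unfolding LDef_def \<Phi>1_def
    by (intro def_intros Def_kap[OF \<kappa>] Def_sims LDef_app[OF L] tml_intros) ((rule refl | simp)+)?
  have L2: "LDef (Suc ?m) \<Phi>2" unfolding LDef_def \<Phi>2_def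
    by (intro def_intros LDef_app[OF L1] Def_few[OF \<kappa> L1] tml_intros) ((rule refl | simp)+)?
  have few1: "few \<kappa> (card X) \<Phi>1 ws" if ws: "rep ws ps" for ws
  proof -
    have "\<kappa> y \<in> X" if y: "y \<in> carrier K" "\<Phi>1 (y # ws)" for y
    proof -
      obtain y' vs where *: "y' \<in> carrier K" "vs \<in> tuples K ?m" "\<kappa> y = \<kappa> y'" "sims ps ws vs" "\<Phi> (y' # vs)"
        using y(2) unfolding \<Phi>1_def by auto
      then have "rep vs ps" using rep_sims[OF ps ws] by blast
      then show ?thesis using in_X[of vs y'] * by simp
    qed
    then have "\<kappa> ` {y \<in> carrier K. \<Phi>1 (y # ws)} \<subseteq> X" by blast
    then show ?thesis unfolding few_def using X by (meson card_mono finite_subset)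
  qed
  have "few \<kappa> (card X) \<Phi>2 ws" for ws
  proof (cases "few \<kappa> (card X) \<Phi>1 ws")
    case True
    then show ?thesis by (rule few_mono) (simp add: \<Phi>2_def)
  next
    case False
    then have "{y \<in> carrier K. \<Phi>2 (y # ws)} = {}" by (auto simp: \<Phi>2_def)
    then show ?thesis unfolding few_def by (simp only: image_empty finite.emptyI card.empty le0 simp_thms)
  qed
  moreover have "\<Phi>2 (y # ws)" if "rep ws ps" "[y] \<in> \<kappa> y0" for ws y
  proof -
    have "\<kappa> y = \<kappa> y0" using that(2) kap_mem[OF \<kappa> ex(2)] by simp
    moreover have "sims ps ws ws0" "ws0 \<in> tuples K ?m" using rep_sims[OF ps that(1)] ex(1) by auto
    ultimately have "\<Phi>1 (y # ws)" unfolding \<Phi>1_def using ex by auto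
    then show ?thesis using few1[OF that(1)] by (simp add: \<Phi>2_def)
  qed
  ultimately show ?thesis unfolding alg_def using L2 by blast
qed

lemma sort_kap: assumes \<kappa>: "kap \<kappa>" shows "imaginary_sort K (\<kappa> ` carrier K)"
proof -
  have "LDef 2 (\<lambda>l. \<kappa> (l ! 0) = \<kappa> (l ! 1))" unfolding LDef_def
    by (intro def_intros Def_kap[OF \<kappa>] tml_intros) ((rule refl | simp)+)?
  then obtain \<phi> where \<phi>: "\<And>l. l \<in> tuples K 2 \<Longrightarrow> \<kappa> (l ! 0) = \<kappa> (l ! 1) \<longleftrightarrow> sat K \<phi> l"
    unfolding LDef_iff by blast
  define E where "E = {(xs, ys). xs \<in> tuples K 1 \<and> ys \<in> tuples K 1 \<and> sat K \<phi> (xs @ ys)}"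
  have t1: "xs \<in> tuples K 1 \<longleftrightarrow> (\<exists>x\<in>carrier K. xs = [x])" for xs
    by (auto simp: tuples_iff length_Suc_conv)
  have E: "E = {([x], [y]) | x y. x \<in> carrier K \<and> y \<in> carrier K \<and> \<kappa> x = \<kappa> y}"
  proof -
    have "sat K \<phi> [x, y] \<longleftrightarrow> \<kappa> x = \<kappa> y" if "x \<in> carrier K" "y \<in> carrier K" for x y
      using \<phi>[of "[x, y]"] that by (simp add: tuples_iff)
    then show ?thesis unfolding E_def t1 by auto
  qed
  have eq: "equiv (tuples K 1) E"
    unfolding equiv_def refl_on_def sym_def trans_def E by (auto simp: t1 simp del: One_nat_def)
  have cl: "E `` {[x]} = \<kappa> x" if "x \<in> carrier K" for x
  proof (rule Set.set_eqI)
    fix l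
    have "l \<in> E `` {[x]} \<longleftrightarrow> (\<exists>y. l = [y] \<and> y \<in> carrier K \<and> \<kappa> x = \<kappa> y)" using that unfolding E by auto
    also have "\<dots> \<longleftrightarrow> (\<exists>y. l = [y] \<and> [y] \<in> \<kappa> x)" by (simp add: kap_mem[OF \<kappa> that])
    also have "\<dots> \<longleftrightarrow> l \<in> \<kappa> x" using kap_elt[OF \<kappa> that] by blast
    finally show "l \<in> E `` {[x]} \<longleftrightarrow> l \<in> \<kappa> x" .
  qed
  have T: "tuples K 1 = (\<lambda>x. [x]) ` carrier K" using t1 by blast
  have "tuples K 1 // E = (\<lambda>l. E `` {l}) ` tuples K 1"
    unfolding quotient_def by (rule UNION_singleton_eq_range)
  also have "\<dots> = (\<lambda>x. E `` {[x]}) ` carrier K"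
    unfolding T image_image ..
  also have "\<dots> = \<kappa> ` carrier K" by (rule image_cong) (simp_all add: cl)
  finally have q: "tuples K 1 // E = \<kappa> ` carrier K" .
  show ?thesis unfolding imaginary_sort_def
    by (intro exI[of _ 1] exI[of _ \<phi>] exI[of _ E] conjI E_def eq q[symmetric])
qed

text \<open>\<open>acl\<close> admits every imaginary sort in which the set
  \<open>\<kappa> x0\<close> happens to occur as a class, possibly for an equivalence relation other
  than that of \<open>\<kappa>\<close>. The forward direction therefore compares the classes of the
  two relations as sets.\<close>

lemma acl_iff:
  assumes \<kappa>: "kap \<kappa>" and P: "P \<subseteq> PRV" and x0: "x0 \<in> carrier K"
  shows "\<kappa> x0 \<in> acl K P \<longleftrightarrow> (\<exists>ps. set ps \<subseteq> P \<and> alg \<kappa> ps (\<kappa> x0))"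
proof
  assume "\<exists>ps. set ps \<subseteq> P \<and> alg \<kappa> ps (\<kappa> x0)"
  then obtain ps \<Phi> N where ps: "set ps \<subseteq> P" and L: "LDef (Suc (length ps)) \<Phi>"
    and fw: "\<And>ws. ws \<in> tuples K (length ps) \<Longrightarrow> few \<kappa> N \<Phi> ws"
    and \<Phi>: "\<And>ws y. rep ws ps \<Longrightarrow> [y] \<in> \<kappa> x0 \<Longrightarrow> \<Phi> (y # ws)"
    unfolding alg_def by blast
  let ?m = "length ps"
  have psP: "set ps \<subseteq> PRV" using ps P by blast
  define D where "D = {\<xi> \<in> \<kappa> ` carrier K. \<forall>ws y. rep ws ps \<longrightarrow> [y] \<in> \<xi> \<longrightarrow> \<Phi> (y # ws)}"
  obtain ws0 where ws0: "rep ws0 ps" using rep_ex[OF psP] by blast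
  have "D \<subseteq> \<kappa> ` {y \<in> carrier K. \<Phi> (y # ws0)}"
    using ws0 kap_self[OF \<kappa>] unfolding D_def by blast
  then have finD: "finite D" using fw[OF rep_tuples[OF psP ws0]] unfolding few_def by (meson finite_subset)
  have x0D: "\<kappa> x0 \<in> D" using \<Phi> x0 unfolding D_def by blast
  let ?\<Psi> = "\<lambda>l. \<forall>y\<in>carrier K. \<forall>ws\<in>tuples K ?m. \<kappa> (l ! 0) = \<kappa> y \<and> sims ps (tl l) ws \<longrightarrow> \<Phi> (y # ws)"
  have "LDef (1 + ?m) ?\<Psi>" unfolding LDef_def
    by (intro def_intros Def_kap[OF \<kappa>] Def_sims LDef_app[OF L] tml_intros) ((rule refl | simp)+)?
  moreover have "map \<kappa> ys \<in> (\<lambda>e. [e]) ` D \<longleftrightarrow> ?\<Psi> (ys @ ws)" if ys: "ys \<in> tuples K 1" and ws: "rep ws ps" for ys ws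
  proof -
    obtain y where y: "ys = [y]" "y \<in> carrier K" using ys by (auto simp: tuples_iff length_Suc_conv)
    have "map \<kappa> ys \<in> (\<lambda>e. [e]) ` D \<longleftrightarrow> \<kappa> y \<in> D" using y by auto
    also have "\<dots> \<longleftrightarrow> (\<forall>vs z. vs \<in> tuples K ?m \<and> sims ps ws vs \<longrightarrow> z \<in> carrier K \<and> \<kappa> y = \<kappa> z \<longrightarrow> \<Phi> (z # vs))"
      unfolding D_def using y(2) by (simp add: kap_mem[OF \<kappa> y(2)] rep_sims[OF psP ws])
    also have "\<dots> \<longleftrightarrow> ?\<Psi> (ys @ ws)" using y by auto
    finally show ?thesis .
  qed
  moreover have "(\<lambda>e. [e]) ` D \<subseteq> listset (replicate 1 (\<kappa> ` carrier K))"
    by (auto simp: listset_replicate D_def)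
  ultimately have "definable K (replicate 1 (\<kappa> ` carrier K)) P ((\<lambda>e. [e]) ` D)"
    using definableI[OF \<kappa> P _ ps] by blast
  then have "definable K [\<kappa> ` carrier K] P ((\<lambda>e. [e]) ` D)" by simp
  then show "\<kappa> x0 \<in> acl K P" unfolding acl_def using sort_kap[OF \<kappa>] finD x0D
    by (intro CollectI exI[of _ "\<kappa> ` carrier K"] exI[of _ D]) (auto simp: D_def)
next
  assume "\<kappa> x0 \<in> acl K P"
  then obtain S Y where S: "imaginary_sort K S" and Y: "Y \<subseteq> S" "finite Y" "\<kappa> x0 \<in> Y"
    and dY: "definable K [S] P ((\<lambda>e. [e]) ` Y)" unfolding acl_def by blast
  obtain n \<phi> E where E: "E = {(xs, ys). xs \<in> tuples K n \<and> ys \<in> tuples K n \<and> sat K \<phi> (xs @ ys)}"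
    "equiv (tuples K n) E" "S = tuples K n // E" using S unfolding imaginary_sort_def by blast
  obtain \<psi> ps where ps: "set ps \<subseteq> P" and X: "(\<lambda>e. [e]) ` Y = {es \<in> listset [S]. sat_eq K \<psi> (es @ ps)}"
    using dY unfolding definable_def by blast
  have psP: "set ps \<subseteq> PRV" using ps P by blast
  let ?m = "length ps"
  have Y_iff: "e \<in> Y \<longleftrightarrow> sat_eq K \<psi> (e # ps)" if "e \<in> S" for e
  proof -
    have "[e] \<in> (\<lambda>e. [e]) ` Y \<longleftrightarrow> sat_eq K \<psi> (e # ps)" unfolding X using that by (simp add: set_Cons_def)
    then show ?thesis by auto
  qed
  have cls: "e = E `` {a}" if "e \<in> S" "a \<in> e" for e a
  proof -
    obtain b where "b \<in> tuples K n" "e = E `` {b}" using \<open>e \<in> S\<close> unfolding E(3) by (rule quotientE)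
    then show ?thesis using equiv_class_eq[OF E(2), of b a] \<open>a \<in> e\<close> by simp
  qed
  have x0S: "\<kappa> x0 \<in> S" using Y by blast
  have "[x0] \<in> E `` {[x0]}" using cls[OF x0S kap_self[OF \<kappa> x0]] kap_self[OF \<kappa> x0] by blast
  \<comment> \<open>A class of \<open>S\<close> contains the one-element list \<open>[x0]\<close>,
    so that \<open>S\<close> is a quotient of the field itself.\<close>
  then have "n = 1" unfolding E(1) by (simp add: tuples_iff)
  have cl: "[v] \<in> E `` {[z]} \<longleftrightarrow> v \<in> carrier K \<and> sat K \<phi> [z, v]" if "z \<in> carrier K" for z v
    using that unfolding E(1) \<open>n = 1\<close> by (auto simp: tuples_iff)
  have cl1: "l \<in> E `` {[z]} \<Longrightarrow> \<exists>v. l = [v]" for z l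
    unfolding E(1) \<open>n = 1\<close> by (auto simp: tuples_iff length_Suc_conv)
  \<comment> \<open>Holds at \<open>y\<close> if the class \<open>\<kappa> y\<close> coincides with
    the \<open>E\<close>-class of some \<open>z\<close> satisfying \<open>\<psi>\<close>; equality
    of classes is spelled out pointwise in \<open>v\<close>.\<close>
  define \<Theta> where "\<Theta> = (\<lambda>l. \<exists>z\<in>carrier K. sat K \<psi> (z # tl l) \<and> (\<forall>v\<in>carrier K. \<kappa> v = \<kappa> (l ! 0) \<longleftrightarrow> sat K \<phi> [z, v]))"
  have L1: "LDef (Suc ?m) (sat K \<psi>)" and L2: "LDef 2 (sat K \<phi>)" unfolding LDef_iff by blast+
  have L: "LDef (Suc ?m) \<Theta>" unfolding LDef_def \<Theta>_def
    by (intro def_intros Def_kap[OF \<kappa>] LDef_app[OF L1] LDef_app[OF L2] tml_intros) ((rule refl | simp)+)?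
  have in_Y: "\<kappa> y \<in> Y" if ws: "rep ws ps" and y: "y \<in> carrier K" "\<Theta> (y # ws)" for ws y
  proof -
    obtain z where z: "z \<in> carrier K" "sat K \<psi> (z # ws)"
      and zv: "\<And>v. v \<in> carrier K \<Longrightarrow> \<kappa> v = \<kappa> y \<longleftrightarrow> sat K \<phi> [z, v]"
      using y(2) unfolding \<Theta>_def list.sel nth_Cons_0 by blast
    have ztup: "[z] \<in> tuples K n" using z \<open>n = 1\<close> by (simp add: tuples_iff)
    have "[v] \<in> E `` {[z]} \<longleftrightarrow> [v] \<in> \<kappa> y" for v
      using cl[OF z(1)] zv kap_mem[OF \<kappa> y(1)] by metis
    then have e: "E `` {[z]} = \<kappa> y" using cl1[of _ z] kap_elt[OF \<kappa> y(1)] by (metis subsetI subset_antisym)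
    then have S: "\<kappa> y \<in> S" unfolding E(3) using ztup by (metis quotientI)
    have "[z] \<in> \<kappa> y" using e equiv_class_self[OF E(2) ztup] by simp
    then have "rep (z # ws) (\<kappa> y # ps)" using ws by simp
    then have "sat_eq K \<psi> (\<kappa> y # ps)" using z(2) sat_eq_rep[of "\<kappa> y # ps" \<psi>] psP kap_PRV[OF \<kappa> y(1)] by auto
    then show ?thesis using Y_iff[OF S] by simp
  qed
  have "sat_eq K \<psi> (\<kappa> x0 # ps)" using Y_iff[OF x0S] Y by blast
  then obtain us where us: "rep us (\<kappa> x0 # ps)" "sat K \<psi> us"
    using sat_eq_rep[of "\<kappa> x0 # ps" \<psi>] psP kap_PRV[OF \<kappa> x0] by auto
  then obtain z ws where zw: "us = z # ws" "[z] \<in> \<kappa> x0" "rep ws ps"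
    by (auto simp: rep_def list_all2_Cons2)
  have zc: "z \<in> carrier K" using zw(2) kap_mem[OF \<kappa> x0] by blast
  have e: "\<kappa> x0 = E `` {[z]}" by (rule cls[OF x0S zw(2)])
  have H: "\<kappa> v = \<kappa> x0 \<longleftrightarrow> sat K \<phi> [z, v]" if "v \<in> carrier K" for v
  proof -
    have "\<kappa> v = \<kappa> x0 \<longleftrightarrow> [v] \<in> \<kappa> x0" using kap_mem[OF \<kappa> x0, of v] that by auto
    then show ?thesis using cl[OF zc, of v] that e by simp
  qed
  have \<Theta>0: "\<Theta> (x0 # ws)" unfolding \<Theta>_def
    by (rule bexI[OF _ zc], intro conjI ballI)
       (simp_all only: list.sel nth_Cons_0 us(2)[unfolded zw(1)] H)
  have "alg \<kappa> ps (\<kappa> x0)"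
    by (rule alg_intro[OF \<kappa> psP L Y(2) _ zw(3) x0 \<Theta>0]) (rule in_Y)
  with ps
  show "\<exists>ps. set ps \<subseteq> P \<and> alg \<kappa> ps (\<kappa> x0)" by blast
qed

declare O_carrier [simp del] M_O [simp del]

lemma algE:
  assumes "alg \<kappa> ps \<xi>"
  obtains \<Phi> N where "LDef (Suc (length ps)) \<Phi>" "\<And>ws. ws \<in> tuples K (length ps) \<Longrightarrow> few \<kappa> N \<Phi> ws"
    "\<And>ws y. rep ws ps \<Longrightarrow> [y] \<in> \<xi> \<Longrightarrow> \<Phi> (y # ws)"
  using assms unfolding alg_def by blast

lemma definableE:
  assumes "kap \<kappa>" "P \<subseteq> PRV" "X \<subseteq> listset (replicate n (\<kappa> ` carrier K))" "definable K (replicate n (\<kappa> ` carrier K)) P X"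
  obtains ps \<Phi> where "set ps \<subseteq> P" "LDef (n + length ps) \<Phi>"
    "\<And>ys ws. ys \<in> tuples K n \<Longrightarrow> rep ws ps \<Longrightarrow> map \<kappa> ys \<in> X \<longleftrightarrow> \<Phi> (ys @ ws)"
  using assms(4)[unfolded definable_iff[OF assms(1-3)]]
  by (elim exE conjE) (rule that, assumption+, blast)

lemma pt_singletons: assumes "C \<subseteq> carrier K" shows "map pt ` (\<lambda>x. [x]) ` C \<subseteq> listset (replicate 1 (pt ` carrier K))"
  unfolding image_image listset_replicate
proof (rule image_subsetI)
  fix x assume "x \<in> C"
  then have "x \<in> carrier K" using assms by blast
  then show "map pt [x] \<in> {es. length es = 1 \<and> set es \<subseteq> pt ` carrier K}" by simp
qed

lemma pt_singleton_mem: "map pt [y] \<in> map pt ` (\<lambda>x. [x]) ` C \<longleftrightarrow> y \<in> C"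
  unfolding image_image image_iff by (simp add: pt_def)

section \<open>Closure laws for algebraic elements\<close>

lemma alg_refl: assumes "kap \<kappa>" "set ps \<subseteq> PRV" "x \<in> carrier K" "\<kappa> x \<in> set ps" shows "alg \<kappa> ps (\<kappa> x)"
proof -
  obtain i where i: "i < length ps" "ps ! i = \<kappa> x" using assms(4) by (auto simp: in_set_conv_nth)
  obtain ws where ws: "rep ws ps" using rep_ex[OF assms(2)] by blast
  have *: "vs ! i \<in> carrier K \<and> \<kappa> (vs ! i) = \<kappa> x" if "rep vs ps" for vs
  proof -
    have "[vs ! i] \<in> \<kappa> x" using that i by (auto simp: rep_def list_all2_conv_all_nth)
    then show ?thesis using kap_mem[OF assms(1,3)] by simp
  qed
  define \<Phi> where "\<Phi> = (\<lambda>l::'a list. \<kappa> (l ! 0) = \<kappa> (l ! Suc i))"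
  have L: "LDef (Suc (length ps)) \<Phi>" unfolding LDef_def \<Phi>_def
    by (intro def_intros Def_kap[OF assms(1)] tml_intros) ((rule refl | simp add: i)+)?
  show ?thesis
  proof (rule alg_intro[OF assms(1,2) L, of "{\<kappa> x}" ws])
    show "\<kappa> y \<in> {\<kappa> x}" if "rep vs ps" "y \<in> carrier K" "\<Phi> (y # vs)" for vs y
      using *[OF that(1)] that(3) by (simp add: \<Phi>_def)
    show "\<Phi> (x # ws)" using *[OF ws] by (simp add: \<Phi>_def)
  qed (use ws assms(3) in simp_all)
qed

lemma alg_weaken:
  assumes "alg \<kappa> ps \<xi>" "set ps \<subseteq> set qs" "set qs \<subseteq> PRV" shows "alg \<kappa> qs \<xi>"
proof -
  obtain \<Phi> N where L: "LDef (Suc (length ps)) \<Phi>" and f: "\<And>ws. ws \<in> tuples K (length ps) \<Longrightarrow> few \<kappa> N \<Phi> ws"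
    and \<Phi>: "\<And>ws y. rep ws ps \<Longrightarrow> [y] \<in> \<xi> \<Longrightarrow> \<Phi> (y # ws)" using assms(1) unfolding alg_def by blast
  have "\<exists>g. \<forall>i<length ps. g i < length qs \<and> qs ! g i = ps ! i"
  proof -
    have "\<exists>j. j < length qs \<and> qs ! j = ps ! i" if "i < length ps" for i
      using that assms(2) by (metis in_set_conv_nth nth_mem subsetD)
    then show ?thesis by metis
  qed
  then obtain g where g: "\<And>i. i < length ps \<Longrightarrow> g i < length qs \<and> qs ! g i = ps ! i" by blast
  define h where "h = (\<lambda>ws::'a list. map (\<lambda>i. ws ! g i) [0..<length ps])"
  define \<Psi> where "\<Psi> = (\<lambda>l. \<Phi> (l ! 0 # h (tl l)))"
  have hT: "TmL (length ps) (\<lambda>e. h (map (\<lambda>n. e (Suc n)) [0..<length qs]))"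
    unfolding h_def cotermL_def
  proof (intro conjI allI impI)
    fix i assume i: "i < length ps"
    have "Tm (\<lambda>e. e (Suc (g i)))" by (rule tm_intros)
    moreover have "(\<lambda>e. map (\<lambda>i. map (\<lambda>n. e (Suc n)) [0..<length qs] ! g i) [0..<length ps] ! i) = (\<lambda>e::nat\<Rightarrow>'a. e (Suc (g i)))"
      using g[OF i] i by (simp add: fun_eq_iff)
    ultimately show "Tm (\<lambda>e. map (\<lambda>i. map (\<lambda>n. e (Suc n)) [0..<length qs] ! g i) [0..<length ps] ! i)" by simp
  qed simp_all
  have tlmap: "tl (map e [0..<Suc n]) = map (\<lambda>i. e (Suc i)) [0..<n]" for e :: "nat \<Rightarrow> 'a" and n
    by (simp add: map_tl[symmetric] map_Suc_upt[symmetric] del: upt_Suc)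
  have L': "LDef (Suc (length qs)) \<Psi>" unfolding LDef_def \<Psi>_def tlmap
    by (rule LDef_app[OF L], rule tml_intros0(2), rule Tm_nth_map, rule tm_intros(1), simp, rule hT, rule refl)
  have h_tup: "h ws \<in> tuples K (length ps)" if "ws \<in> tuples K (length qs)" for ws
  proof -
    have "ws ! g i \<in> carrier K" if "i < length ps" for i
      using g[OF that] \<open>ws \<in> tuples K (length qs)\<close> by (auto simp: tuples_iff)
    then show ?thesis by (auto simp: h_def tuples_iff)
  qed
  have few': "few \<kappa> N \<Psi> ws" if "ws \<in> tuples K (length qs)" for ws
    using f[OF h_tup[OF that]] unfolding few_def \<Psi>_def by simp
  have "\<Psi> (y # ws)" if "rep ws qs" "[y] \<in> \<xi>" for ws y
  proof -
    have "rep (h ws) ps" using that(1) g unfolding rep_def h_def list_all2_conv_all_nth by (auto, metis)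
    then show ?thesis using \<Phi> that(2) by (simp add: \<Psi>_def)
  qed
  then show ?thesis unfolding alg_def using L' few' by blast
qed

text \<open>Smaller classes, such as \<open>pt x\<close> inside \<open>rv K x\<close>, have fewer
  representatives, so the formula has to hold at fewer parameter values.\<close>

lemma alg_finer:
  assumes "alg \<kappa> ps \<xi>" "list_all2 (\<subseteq>) qs ps" shows "alg \<kappa> qs \<xi>"
proof -
  have "rep ws ps" if "rep ws qs" for ws
    unfolding rep_def by (rule list_all2_trans[OF _ that[unfolded rep_def] assms(2)]) blast
  moreover have "length qs = length ps" using assms(2) by (rule list_all2_lengthD)
  ultimately show ?thesis using assms(1) unfolding alg_def by metis
qed

text \<open>The bound is \<open>N' * N\<close>: there are at most \<open>N'\<close> classes of
  \<open>z\<close>, and each leaves at most \<open>N\<close> classes of \<open>y\<close>.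
  Quantifying over all \<open>z'\<close> in the class of \<open>z\<close> lets one representative of
  each class do the counting.\<close>

lemma alg_trans:
  assumes \<kappa>: "kap \<kappa>" "kap \<kappa>'" and z0: "z0 \<in> carrier K" and a: "alg \<kappa> (\<kappa>' z0 # ps) \<xi>" and b: "alg \<kappa>' ps (\<kappa>' z0)"
  shows "alg \<kappa> ps \<xi>"
proof -
  let ?m = "length ps"
  obtain \<Phi> N where L: "LDef (Suc (Suc ?m)) \<Phi>" and f: "\<And>ws. ws \<in> tuples K (Suc ?m) \<Longrightarrow> few \<kappa> N \<Phi> ws"
    and \<Phi>: "\<And>ws y. rep ws (\<kappa>' z0 # ps) \<Longrightarrow> [y] \<in> \<xi> \<Longrightarrow> \<Phi> (y # ws)"
    by (rule algE[OF a, unfolded length_Cons], rule that)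
  obtain \<Psi> N' where L': "LDef (Suc ?m) \<Psi>" and f': "\<And>ws. ws \<in> tuples K ?m \<Longrightarrow> few \<kappa>' N' \<Psi> ws"
    and \<Psi>: "\<And>ws y. rep ws ps \<Longrightarrow> [y] \<in> \<kappa>' z0 \<Longrightarrow> \<Psi> (y # ws)"
    by (rule algE[OF b], rule that)
  define \<Theta> where "\<Theta> = (\<lambda>l. \<exists>z\<in>carrier K. \<Psi> (z # tl l) \<and> (\<forall>z'\<in>carrier K. \<kappa>' z' = \<kappa>' z \<longrightarrow> \<Phi> (l ! 0 # z' # tl l)))"
  have "LDef (Suc ?m) \<Theta>" unfolding LDef_def \<Theta>_def
    by (intro def_intros Def_kap[OF \<kappa>(2)] LDef_app[OF L] LDef_app[OF L'] tml_intros) ((rule refl | simp)+)?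
  moreover have "few \<kappa> (N' * N) \<Theta> ws" if ws: "ws \<in> tuples K ?m" for ws
  proof -
    define Z where "Z = \<kappa>' ` {z \<in> carrier K. \<Psi> (z # ws)}"
    have Z: "finite Z" "card Z \<le> N'" using f'[OF ws] unfolding few_def Z_def by auto
    have "\<exists>s. \<forall>\<zeta>\<in>Z. s \<zeta> \<in> carrier K \<and> \<kappa>' (s \<zeta>) = \<zeta>" unfolding Z_def by (intro bchoice) blast
    then obtain s where s: "\<And>\<zeta>. \<zeta> \<in> Z \<Longrightarrow> s \<zeta> \<in> carrier K \<and> \<kappa>' (s \<zeta>) = \<zeta>" by blast
    define Y where "Y = (\<lambda>\<zeta>. \<kappa> ` {y \<in> carrier K. \<Phi> (y # s \<zeta> # ws)})"
    have Y: "finite (Y \<zeta>)" "card (Y \<zeta>) \<le> N" if "\<zeta> \<in> Z" for \<zeta>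
    proof -
      have "s \<zeta> # ws \<in> tuples K (Suc ?m)" using s[OF that] ws by (simp add: tuples_iff)
      then show "finite (Y \<zeta>)" "card (Y \<zeta>) \<le> N" using f unfolding few_def Y_def by blast+
    qed
    have sub: "\<kappa> ` {y \<in> carrier K. \<Theta> (y # ws)} \<subseteq> (\<Union>\<zeta>\<in>Z. Y \<zeta>)"
    proof
      fix \<eta> assume "\<eta> \<in> \<kappa> ` {y \<in> carrier K. \<Theta> (y # ws)}"
      then obtain y where y: "y \<in> carrier K" "\<Theta> (y # ws)" "\<eta> = \<kappa> y" by blast
      then obtain z where z: "z \<in> carrier K" "\<Psi> (z # ws)" and
        zz: "\<And>z'. z' \<in> carrier K \<Longrightarrow> \<kappa>' z' = \<kappa>' z \<Longrightarrow> \<Phi> (y # z' # ws)" unfolding \<Theta>_def by auto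
      have zZ: "\<kappa>' z \<in> Z" unfolding Z_def using z by blast
      have "\<Phi> (y # s (\<kappa>' z) # ws)" using zz s[OF zZ] by blast
      then show "\<eta> \<in> (\<Union>\<zeta>\<in>Z. Y \<zeta>)" using zZ y unfolding Y_def by blast
    qed
    have "card (\<Union>\<zeta>\<in>Z. Y \<zeta>) \<le> (\<Sum>\<zeta>\<in>Z. card (Y \<zeta>))" by (rule card_UN_le[OF Z(1)])
    also have "\<dots> \<le> card Z * N" using sum_bounded_above[of Z "\<lambda>\<zeta>. card (Y \<zeta>)" N] Y(2) by simp
    also have "\<dots> \<le> N' * N" using Z(2) by simp
    finally have "card (\<Union>\<zeta>\<in>Z. Y \<zeta>) \<le> N' * N" .
    moreover have "finite (\<Union>\<zeta>\<in>Z. Y \<zeta>)" using Z Y by blast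
    ultimately show ?thesis unfolding few_def using sub by (meson card_mono finite_subset order_trans)
  qed
  moreover have "\<Theta> (y # ws)" if ws: "rep ws ps" and y: "[y] \<in> \<xi>" for ws y
    unfolding \<Theta>_def
  proof (intro bexI[OF _ z0] conjI ballI impI)
    show "\<Psi> (z0 # tl (y # ws))" using \<Psi>[OF ws kap_self[OF \<kappa>(2) z0]] by simp
    fix z' assume "z' \<in> carrier K" "\<kappa>' z' = \<kappa>' z0"
    then have "[z'] \<in> \<kappa>' z0" using kap_mem[OF \<kappa>(2) z0] by simp
    then show "\<Phi> ((y # ws) ! 0 # z' # tl (y # ws))" using \<Phi>[of "z' # ws"] ws y by simp
  qed
  ultimately show ?thesis unfolding alg_def by blast
qed

definition algover :: "'a imag set \<Rightarrow> ('a \<Rightarrow> 'a imag) \<Rightarrow> 'a \<Rightarrow> bool" where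
  "algover P \<kappa> x \<longleftrightarrow> (\<exists>ps. set ps \<subseteq> P \<and> alg \<kappa> ps (\<kappa> x))"

lemma algover_mono: "algover P \<kappa> x \<Longrightarrow> P \<subseteq> Q \<Longrightarrow> algover Q \<kappa> x"
  unfolding algover_def by blast

lemma algover_refl: "kap \<kappa> \<Longrightarrow> x \<in> carrier K \<Longrightarrow> \<kappa> x \<in> P \<Longrightarrow> algover P \<kappa> x"
  unfolding algover_def using alg_refl[of \<kappa> "[\<kappa> x]" x] kap_PRV by (intro exI[of _ "[\<kappa> x]"]) simp

lemma algover_trans:
  assumes "kap \<kappa>" "kap \<kappa>'" "P \<subseteq> PRV" "z \<in> carrier K" "algover (insert (\<kappa>' z) P) \<kappa> x" "algover P \<kappa>' z"
  shows "algover P \<kappa> x"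
proof -
  obtain ps where ps: "set ps \<subseteq> insert (\<kappa>' z) P" "alg \<kappa> ps (\<kappa> x)" using assms(5) unfolding algover_def by blast
  obtain qs where qs: "set qs \<subseteq> P" "alg \<kappa>' qs (\<kappa>' z)" using assms(6) unfolding algover_def by blast
  define rs where "rs = filter (\<lambda>p. p \<in> P) ps @ qs"
  have rs: "set rs \<subseteq> P" unfolding rs_def using qs by auto
  have zP: "\<kappa>' z \<in> PRV" using kap_PRV assms by blast
  have "alg \<kappa> (\<kappa>' z # rs) (\<kappa> x)"
    by (rule alg_weaken[OF ps(2)]) (use ps(1) rs zP assms(3) in \<open>auto simp: rs_def\<close>)
  moreover have "alg \<kappa>' rs (\<kappa>' z)"
    by (rule alg_weaken[OF qs(2)]) (use rs assms(3) in \<open>auto simp: rs_def\<close>)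
  ultimately have "alg \<kappa> rs (\<kappa> x)" using alg_trans[OF assms(1,2,4)] by blast
  then show ?thesis unfolding algover_def using rs by blast
qed

text \<open>\<open>acl\<close> confined to non-zero leading terms. Intersecting the parameters with
  \<open>PRV\<close> makes the closure laws hold for arbitrary sets, as
  \<open>closure_operator\<close> demands.\<close>

definition cl :: "'a imag set \<Rightarrow> 'a imag set" where
  "cl P = {\<xi> \<in> RVx K. \<exists>ps. set ps \<subseteq> P \<inter> PRV \<and> alg (rv K) ps \<xi>}"

lemma RVx_iff: "x \<in> carrier K \<Longrightarrow> rv K x \<in> RVx K \<longleftrightarrow> x \<noteq> \<zero>"
  unfolding RVx_def using rv_zero_iff by force

lemma RVx_PRV: "RVx K \<subseteq> PRV" "RV K \<subseteq> PRV" "pt ` carrier K \<subseteq> PRV" "RVx K \<subseteq> RV K"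
  by (auto simp: RVx_def PRV_def RV_def)

lemma cl_algover: "x \<in> carrier K \<Longrightarrow> P \<subseteq> PRV \<Longrightarrow> rv K x \<in> cl P \<longleftrightarrow> x \<noteq> \<zero> \<and> algover P (rv K) x"
  by (auto simp: cl_def algover_def RVx_iff Int_absorb2)

lemma acl_cl: "P \<subseteq> PRV \<Longrightarrow> \<xi> \<in> RVx K \<Longrightarrow> \<xi> \<in> acl K P \<longleftrightarrow> \<xi> \<in> cl P"
  using acl_iff[of "rv K" P] cl_algover[of _ P] unfolding RVx_def algover_def by auto

lemma cl_mono: "P \<subseteq> Q \<Longrightarrow> cl P \<subseteq> cl Q"
  unfolding cl_def by blast

lemma cl_ext: "P \<inter> RVx K \<subseteq> cl P"
proof
  fix \<xi> assume x: "\<xi> \<in> P \<inter> RVx K"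
  then obtain x where "x \<in> carrier K" "\<xi> = rv K x" unfolding RVx_def by blast
  then have "alg (rv K) [\<xi>] \<xi>" using alg_refl[of "rv K" "[\<xi>]" x] kap_PRV by simp
  then show "\<xi> \<in> cl P" unfolding cl_def using x RVx_PRV by (intro CollectI conjI exI[of _ "[\<xi>]"]) auto
qed

lemma cl_Int: "cl P = cl (P \<inter> PRV)"
  unfolding cl_def by blast

lemma cl_trans: assumes "\<xi> \<in> cl (insert \<eta> P)" "\<eta> \<in> cl P" shows "\<xi> \<in> cl P"
proof -
  obtain x where x: "x \<in> carrier K" "\<xi> = rv K x" "x \<noteq> \<zero>" using assms unfolding cl_def RVx_def by blast
  obtain z where z: "z \<in> carrier K" "\<eta> = rv K z" "z \<noteq> \<zero>" using assms unfolding cl_def RVx_def by blast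
  let ?P = "P \<inter> PRV"
  have i: "insert \<eta> P \<inter> PRV = insert (rv K z) ?P" using z kap_PRV[of "rv K" z] by auto
  have "algover (insert (rv K z) ?P) (rv K) x"
    using assms(1) cl_Int[of "insert \<eta> P"] i cl_algover[OF x(1), of "insert (rv K z) ?P"] x z kap_PRV[of "rv K" z] by auto
  moreover have "algover ?P (rv K) z" using assms(2) cl_Int[of P] cl_algover[OF z(1), of ?P] z by auto
  ultimately have "algover ?P (rv K) x" by (intro algover_trans[of "rv K" "rv K" ?P z x]) (use z in auto)
  then show ?thesis using cl_Int[of P] cl_algover[OF x(1), of ?P] x by auto
qed

section \<open>The instance \<lambda> = 1 of preparation\<close>

lemma vle_one: "b \<in> carrier K \<Longrightarrow> vle K b \<one> \<longleftrightarrow> b \<in> \<O>"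
  unfolding vle_def by force

lemma vlt_one: assumes "b \<in> carrier K" shows "vlt K b \<one> \<longleftrightarrow> b \<in> \<M>"
proof -
  have "(\<exists>a\<in>\<O>. \<one> = a \<otimes> b) \<longleftrightarrow> b \<notin> \<M>" if b: "b \<in> \<O>"
  proof
    assume "\<exists>a\<in>\<O>. \<one> = a \<otimes> b"
    then obtain a where a: "a \<in> \<O>" "\<one> = a \<otimes> b" by blast
    show "b \<notin> \<M>"
    proof
      assume "b \<in> \<M>"
      then have "a \<otimes> b \<in> \<M>" using a(1) by (rule M_times(2))
      then show False using a(2) one_notin_M by simp
    qed
  next
    assume "b \<notin> \<M>"
    note u = unitD[OF b this]
    then have "\<one> = inv b \<otimes> b" using O_carrier[OF b] by simp
    then show "\<exists>a\<in>\<O>. \<one> = a \<otimes> b" using u(2) by blast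
  qed
  then show ?thesis unfolding vlt_def using vle_one[OF assms] M_O[of b] unfolding vle_def by blast
qed

text \<open>At \<lambda> = 1 the condition on \<open>b\<close> is membership in \<open>\<M>\<close>,
  and the range of \<open>s\<close> is the same for all \<open>x\<close>; so equal leading terms
  have equal \<open>rv_lam\<close>.\<close>

lemma rv_lam_one: "x \<in> carrier K \<Longrightarrow> rv_lam K \<one> x = {[s, y] | s y. s \<in> carrier K \<and> veq K s \<one> \<and> [y] \<in> rv K x}"
proof -
  have "(\<exists>b. y = x \<otimes> (\<one> \<oplus> b) \<and> b \<in> carrier K \<and> vlt K b \<one>) \<longleftrightarrow> [y] \<in> rv K x" for y
    unfolding rv_mem Bex_def using vlt_one M_O O_carrier by blast
  then show ?thesis unfolding rv_lam_def by blast
qed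

end

section \<open>Consequences of h-minimality and effectivity\<close>

locale hmodel = vfield K for K :: "('a, 'f, 'r) vstr" (structure) +
  fixes T :: "('f, 'r) fm set"
  assumes hmin: "h_minimal TYPE('a) 1 T" and eff: "effective TYPE('a) T" and mod: "model T K"
begin

lemma definableK_algover:
  assumes A: "A \<subseteq> carrier K" and C: "C \<subseteq> carrier K" "finite C" "definableK K 1 (pt ` A) ((\<lambda>x. [x]) ` C)" "c \<in> C"
  shows "algover (pt ` A) pt c"
proof -
  have P: "pt ` A \<subseteq> PRV" using A RVx_PRV by blast
  have sub: "map pt ` (\<lambda>x. [x]) ` C \<subseteq> listset (replicate 1 (pt ` carrier K))"
    by (rule pt_singletons[OF C(1)])
  obtain ps \<Phi> where ps: "set ps \<subseteq> pt ` A" "LDef (1 + length ps) \<Phi>"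
    and \<Phi>: "\<And>ys ws. ys \<in> tuples K 1 \<Longrightarrow> rep ws ps \<Longrightarrow> map pt ys \<in> map pt ` (\<lambda>x. [x]) ` C \<longleftrightarrow> \<Phi> (ys @ ws)"
    using definableE[OF kap_simps(1) P sub C(3)[unfolded definableK_def]] by blast
  have \<Phi>': "\<Phi> (y # ws) \<longleftrightarrow> y \<in> C" if "y \<in> carrier K" "rep ws ps" for y ws
  proof -
    have "[y] \<in> tuples K 1" using that by (simp add: tuples_iff)
    from \<Phi>[OF this that(2)] show ?thesis unfolding pt_singleton_mem by simp
  qed
  have psP: "set ps \<subseteq> PRV" using ps P by blast
  obtain ws where ws: "rep ws ps" using rep_ex[OF psP] by blast
  have L: "LDef (Suc (length ps)) \<Phi>" using ps(2) by simp
  have "alg pt ps (pt c)"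
    by (rule alg_intro[OF kap_simps(1) psP L finite_imageI[OF C(2), of pt] _ ws])
       (use \<Phi>' C(1,4) ws in auto)
  then show ?thesis unfolding algover_def using ps by blast
qed

text \<open>
  A definable set that splits the ball \<open>rv\<^sup>-\<^sup>1(\<xi>)\<close> forces every finite set preparing it to meet the ball.
\<close>

lemma split_center:
  assumes A: "A \<subseteq> carrier K" and ps: "set ps \<subseteq> pt ` A \<union> RV K" and L: "LDef (Suc (length ps)) \<Phi>"
    and X: "\<And>x ws. x \<in> carrier K \<Longrightarrow> rep ws ps \<Longrightarrow> x \<in> X \<longleftrightarrow> \<Phi> (x # ws)" "X \<subseteq> carrier K"
    and x: "x \<in> X" "x' \<in> carrier K" "x' \<notin> X" "rv K x = rv K x'"
  shows "\<exists>c\<in>carrier K. rv K c = rv K x \<and> algover (pt ` A) pt c"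
proof -
  have P: "pt ` A \<union> RV K \<union> {} \<subseteq> PRV" using A RVx_PRV by blast
  have xc: "x \<in> carrier K" using x X by blast
  have sub: "map pt ` (\<lambda>x. [x]) ` X \<subseteq> listset (replicate 1 (pt ` carrier K))"
    by (rule pt_singletons[OF X(2)])
  have "definable K (replicate 1 (pt ` carrier K)) (pt ` A \<union> RV K \<union> {}) (map pt ` (\<lambda>x. [x]) ` X)"
  proof (rule definableI[OF kap_simps(1) P sub, of ps \<Phi>])
    fix ys ws assume ys: "ys \<in> tuples K 1" and ws: "rep ws ps"
    then obtain y where y: "ys = [y]" "y \<in> carrier K" by (auto simp: tuples_iff length_Suc_conv)
    have "map pt ys \<in> map pt ` (\<lambda>x. [x]) ` X \<longleftrightarrow> y \<in> X" unfolding y(1) by (rule pt_singleton_mem)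
    then show "map pt ys \<in> map pt ` (\<lambda>x. [x]) ` X \<longleftrightarrow> \<Phi> (ys @ ws)" using X(1)[OF y(2) ws] y by simp
  qed (use ps L in auto)
  then have dX: "definableK K 1 (pt ` A \<union> RV K \<union> {}) ((\<lambda>x. [x]) ` X)" unfolding definableK_def .
  have "\<exists>C. C \<subseteq> carrier K \<and> finite C \<and> definableK K 1 (pt ` A) ((\<lambda>x. [x]) ` C) \<and> prepares K \<one> C X"
    using hmin[unfolded h_minimal_def, rule_format, of K \<one> A "{}" X] mod A X(2) dX vle_one[of \<one>] by simp
  then obtain C where C: "C \<subseteq> carrier K" "finite C" "definableK K 1 (pt ` A) ((\<lambda>x. [x]) ` C)" "prepares K \<one> C X" by blast
  obtain c where c: "c \<in> C" "rv_lam K \<one> (x \<ominus> c) \<noteq> rv_lam K \<one> (x' \<ominus> c)"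
    using C(4) x xc unfolding prepares_def by blast
  have cc: "c \<in> carrier K" using c C by blast
  have "rv K (x \<ominus> c) \<noteq> rv K (x' \<ominus> c)" using c(2) rv_lam_one[of "x \<ominus> c"] rv_lam_one[of "x' \<ominus> c"] cc xc x(2) by auto
  \<comment> \<open>A centre with another leading term would see \<open>x\<close> and
    \<open>x'\<close> in the same class.\<close>
  then have "rv K c = rv K x" using rv_shift[OF xc x(2) cc x(4)] by blast
  then show ?thesis using cc definableK_algover[OF A C(1-3) c(1)] by blast
qed

text \<open>Effectivity is applied to \<open>K\<close> as a model of its own theory with constants
  for \<open>A\<close>, with \<open>h\<close> the identity; the definable lift is in particular
  algebraic.\<close>

lemma effective_lift:
  assumes A: "A \<subseteq> carrier K" and ps: "set ps \<subseteq> pt ` A" and L: "LDef (Suc (length ps)) \<Phi>" and x0: "x0 \<in> carrier K"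
    and \<Phi>: "\<And>y ws. y \<in> carrier K \<Longrightarrow> rep ws ps \<Longrightarrow> \<Phi> (y # ws) \<longleftrightarrow> rv K y = rv K x0"
  shows "\<exists>x\<in>carrier K. rv K x = rv K x0 \<and> algover (pt ` A) pt x"
proof -
  have P: "pt ` A \<subseteq> PRV" using A RVx_PRV by blast
  have sub: "{[rv K x0]} \<subseteq> listset (replicate 1 (rv K ` carrier K))"
    using x0 by (auto simp: listset_replicate)
  have "definable K (replicate 1 (rv K ` carrier K)) (pt ` A) {[rv K x0]}"
  proof (rule definableI[OF kap_simps(2) P sub, of ps \<Phi>])
    fix ys ws assume ys: "ys \<in> tuples K 1" and ws: "rep ws ps"
    then obtain y where y: "ys = [y]" "y \<in> carrier K" by (auto simp: tuples_iff length_Suc_conv)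
    then show "map (rv K) ys \<in> {[rv K x0]} \<longleftrightarrow> \<Phi> (ys @ ws)" using \<Phi>[OF y(2) ws] by simp
  qed (use ps L in auto)
  then have d: "definableRV K 1 (pt ` id ` A) {[rv K x0]}" unfolding RV_def by simp
  have el: "elementary K A id K" unfolding elementary_def using A by simp
  have "rv K x0 \<in> RV K" using x0 unfolding RV_def by blast
  then obtain x where x: "x \<in> carrier K" "definableK K 1 (pt ` id ` A) {[x]}" "rv K x = rv K x0"
    using eff[unfolded effective_def, rule_format, of K A K id "rv K x0"] mod A el d by blast
  have "definableK K 1 (pt ` A) ((\<lambda>x. [x]) ` {x})" using x(2) by simp
  then have "algover (pt ` A) pt x" using definableK_algover[OF A, of "{x}" x] x(1) by simp
  then show ?thesis using x by blast
qed

end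

section \<open>Independence and rank\<close>

primrec indl :: "('e set \<Rightarrow> 'e set) \<Rightarrow> 'e set \<Rightarrow> 'e list \<Rightarrow> bool" where
  "indl c P [] \<longleftrightarrow> True"
| "indl c P (a # as) \<longleftrightarrow> a \<notin> c P \<and> indl c (insert a P) as"

text \<open>Counts the entries that are new over their predecessors. For a general closure operator
  the count depends on the order; exchange removes this dependence.\<close>

primrec rnk :: "('e set \<Rightarrow> 'e set) \<Rightarrow> 'e set \<Rightarrow> 'e list \<Rightarrow> nat" where
  "rnk c P [] = 0"
| "rnk c P (a # as) = (if a \<in> c P then 0 else 1) + rnk c (insert a P) as"

lemma indl_append: "indl c P (as @ bs) \<longleftrightarrow> indl c P as \<and> indl c (P \<union> set as) bs"
  by (induction as arbitrary: P) simp_all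

lemma rnk_append: "rnk c P (as @ bs) = rnk c P as + rnk c (P \<union> set as) bs"
  by (induction as arbitrary: P) simp_all

lemma rnk_le_length: "rnk c P as \<le> length as"
proof (induction as arbitrary: P)
  case (Cons a as)
  show ?case using Cons[of "insert a P"] by simp
qed simp

lemma indl_rnk: "indl c P as \<longleftrightarrow> rnk c P as = length as"
proof (induction as arbitrary: P)
  case (Cons a as)
  show ?case using Cons[of "insert a P"] rnk_le_length[of c "insert a P" as] by simp
qed simp

text \<open>Translates the condition on index sets in \<open>dimRV\<close> into independence of a
  subsequence.\<close>

lemma indl_nths:
  assumes "I \<subseteq> {..<length as}"
  shows "indl c P (nths as I) \<longleftrightarrow> (\<forall>i\<in>I. as ! i \<notin> c (P \<union> {as ! j | j. j \<in> I \<and> j < i}))"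
  using assms
proof (induction as arbitrary: P I)
  case Nil
  then show ?case by simp
next
  case (Cons x xs)
  let ?J = "{j. Suc j \<in> I}"
  let ?P = "if 0 \<in> I then insert x P else P"
  have J: "?J \<subseteq> {..<length xs}" using Cons.prems by auto
  have set: "P \<union> {(x # xs) ! k | k. k \<in> I \<and> k < Suc j} = ?P \<union> {xs ! l | l. l \<in> ?J \<and> l < j}" for j
  proof -
    have ex: "(\<exists>k. Q k) \<longleftrightarrow> Q 0 \<or> (\<exists>l. Q (Suc l))" for Q :: "nat \<Rightarrow> bool"
      by (metis not0_implies_Suc)
    have "(\<exists>k. y = (x # xs) ! k \<and> k \<in> I \<and> k < Suc j) \<longleftrightarrow> (y = x \<and> 0 \<in> I) \<or> (\<exists>l. y = xs ! l \<and> Suc l \<in> I \<and> l < j)" for y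
      using ex[of "\<lambda>k. y = (x # xs) ! k \<and> k \<in> I \<and> k < Suc j"] by simp
    then have "{(x # xs) ! k | k. k \<in> I \<and> k < Suc j} = {y. (y = x \<and> 0 \<in> I) \<or> (\<exists>l. y = xs ! l \<and> Suc l \<in> I \<and> l < j)}"
      by simp
    then show ?thesis by auto
  qed
  have split: "(\<forall>i\<in>I. Q i) \<longleftrightarrow> (0 \<in> I \<longrightarrow> Q 0) \<and> (\<forall>j\<in>?J. Q (Suc j))" for Q
    by (metis mem_Collect_eq not0_implies_Suc)
  have "(\<forall>i\<in>I. (x # xs) ! i \<notin> c (P \<union> {(x # xs) ! j | j. j \<in> I \<and> j < i})) \<longleftrightarrow>
     (0 \<in> I \<longrightarrow> x \<notin> c P) \<and> (\<forall>j\<in>?J. xs ! j \<notin> c (?P \<union> {xs ! l | l. l \<in> ?J \<and> l < j}))"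
    unfolding split set by simp
  also have "\<dots> \<longleftrightarrow> (0 \<in> I \<longrightarrow> x \<notin> c P) \<and> indl c ?P (nths xs ?J)"
    using Cons.IH[OF J, of ?P] by simp
  also have "\<dots> \<longleftrightarrow> indl c P (nths (x # xs) I)"
    by (auto simp: nths_Cons)
  finally show ?case by simp
qed

text \<open>\<open>E\<close> collects the elements that belong to the closure of any set containing
  them; parameter sets may contain other things, such as points of the field. Idempotence is stated
  for one added element and extended to finite sets by induction.\<close>

locale closure_operator =
  fixes E :: "'e set" and cl :: "'e set \<Rightarrow> 'e set"
  assumes mono: "P \<subseteq> Q \<Longrightarrow> cl P \<subseteq> cl Q"
    and extensive: "P \<inter> E \<subseteq> cl P"
    and trans: "x \<in> cl (insert y P) \<Longrightarrow> y \<in> cl P \<Longrightarrow> x \<in> cl P"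
begin

lemma in_cl_mono: "x \<in> cl P \<Longrightarrow> P \<subseteq> Q \<Longrightarrow> x \<in> cl Q"
  using mono by blast

text \<open>Equality of closures after adding any further parameters: this form survives insertion
  of an element, as the induction along a tuple requires.\<close>

definition eqv :: "'e set \<Rightarrow> 'e set \<Rightarrow> bool" where
  "eqv P P' \<longleftrightarrow> (\<forall>R. cl (P \<union> R) = cl (P' \<union> R))"

lemma eqv_insert: "eqv P P' \<Longrightarrow> eqv (insert a P) (insert a P')"
proof -
  assume "eqv P P'"
  then have "cl (P \<union> insert a R) = cl (P' \<union> insert a R)" for R unfolding eqv_def by blast
  then show ?thesis unfolding eqv_def by simp
qed

lemma eqv_cl: "eqv P P' \<Longrightarrow> cl P = cl P'"
  unfolding eqv_def by (metis Un_empty_right)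

lemma eqv_absorb: "a \<in> cl P \<Longrightarrow> eqv (insert a P) P"
  unfolding eqv_def
proof
  fix R assume a: "a \<in> cl P"
  have "x \<in> cl (P \<union> R)" if "x \<in> cl (insert a P \<union> R)" for x
  proof -
    have "a \<in> cl (P \<union> R)" using a in_cl_mono by blast
    moreover have "x \<in> cl (insert a (P \<union> R))" using that by simp
    ultimately show ?thesis using trans by blast
  qed
  then show "cl (insert a P \<union> R) = cl (P \<union> R)"
    using mono[of "P \<union> R" "insert a P \<union> R"] by blast
qed

lemma rnk_eqv: "eqv P P' \<Longrightarrow> rnk cl P as = rnk cl P' as"
proof (induction as arbitrary: P P')
  case (Cons a as)
  then show ?case using eqv_cl[OF Cons.prems] Cons.IH[OF eqv_insert[OF Cons.prems]] by simp
qed simp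

lemma rnk_anti: "P \<subseteq> P' \<Longrightarrow> rnk cl P' as \<le> rnk cl P as"
proof (induction as arbitrary: P P')
  case (Cons a as)
  have "rnk cl (insert a P') as \<le> rnk cl (insert a P) as"
    by (rule Cons.IH) (use Cons.prems in blast)
  then show ?case using mono[OF Cons.prems] by auto
qed simp

lemma rnk_zero: "set bs \<subseteq> cl P \<Longrightarrow> rnk cl P bs = 0"
proof (induction bs)
  case (Cons b bs)
  then show ?case using rnk_eqv[OF eqv_absorb, of b P bs] by simp
qed simp

lemma rnk_absorb: "set bs \<subseteq> cl (P \<union> set as) \<Longrightarrow> rnk cl P (as @ bs) = rnk cl P as"
  by (simp add: rnk_append rnk_zero)

lemma subset_cl: "S \<subseteq> E \<Longrightarrow> S \<subseteq> P \<Longrightarrow> S \<subseteq> cl P"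
  using extensive by blast

lemma cl_trans_finite: "finite S \<Longrightarrow> S \<subseteq> cl P \<Longrightarrow> x \<in> cl (P \<union> S) \<Longrightarrow> x \<in> cl P"
proof (induction S arbitrary: x rule: finite_induct)
  case (insert s S)
  have "s \<in> cl P" using insert.prems(1) by simp
  from in_cl_mono[OF this Un_upper1] have "s \<in> cl (P \<union> S)" .
  moreover have "x \<in> cl (insert s (P \<union> S))" using insert.prems(2) by simp
  ultimately have "x \<in> cl (P \<union> S)" using trans by blast
  then show ?case using insert by blast
qed simp

text \<open>Greedy choice: the positions counted by \<open>rnk\<close> form a basis, since a skipped
  entry already lies in the closure of what precedes it.\<close>

lemma basis_nths:
  assumes "set as \<subseteq> E"
  shows "\<exists>I. I \<subseteq> {..<length as} \<and> card I = rnk cl P as \<and> indl cl P (nths as I) \<and> set as \<subseteq> cl (P \<union> set (nths as I))"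
  using assms
proof (induction as arbitrary: P)
  case Nil
  then show ?case by (intro exI[of _ "{}"]) simp
next
  case (Cons a as)
  obtain J where J: "J \<subseteq> {..<length as}" "card J = rnk cl (insert a P) as" "indl cl (insert a P) (nths as J)"
    "set as \<subseteq> cl (insert a P \<union> set (nths as J))" using Cons.IH[of "insert a P"] Cons.prems by auto
  have cJ: "card (Suc ` J) = card J" by (simp add: card_image)
  have nn: "nths (a # as) (Suc ` J) = nths as J" "nths (a # as) (insert 0 (Suc ` J)) = a # nths as J"
    by (auto simp: nths_Cons image_iff)
  show ?case
  proof (cases "a \<in> cl P")
    case True
    have "cl (insert a P \<union> set (nths as J)) = cl (P \<union> set (nths as J))"
      using eqv_absorb[OF True] unfolding eqv_def by blast
    moreover have "indl cl P (nths as J)"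
      using J(3) unfolding indl_rnk rnk_eqv[OF eqv_absorb[OF True]] .
    moreover have "a \<in> cl (P \<union> set (nths as J))" using True in_cl_mono by blast
    ultimately show ?thesis using J True cJ
      by (intro exI[of _ "Suc ` J"]) (auto simp: nn)
  next
    case False
    have "card (insert 0 (Suc ` J)) = Suc (card J)"
      using J(1) cJ finite_subset[OF J(1)] by (subst card_insert_disjoint) auto
    moreover have "a \<in> cl (P \<union> insert a (set (nths as J)))"
      by (rule subsetD[OF extensive]) (use Cons.prems in auto)
    ultimately show ?thesis using J False
      by (intro exI[of _ "insert 0 (Suc ` J)"]) (auto simp: nn)
  qed
qed

end

text \<open>Exchange is postulated over finite subsets of \<open>E\<close>, the form in which it
  will come out of permuting a finite tuple.\<close>

locale pregeometry = closure_operator +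
  assumes exchange: "finite P \<Longrightarrow> P \<subseteq> E \<Longrightarrow> x \<in> E \<Longrightarrow> y \<in> E \<Longrightarrow> x \<in> cl (insert y P) \<Longrightarrow> x \<notin> cl P \<Longrightarrow> y \<in> cl (insert x P)"
begin

text \<open>If neither \<open>a\<close> nor \<open>b\<close> lies in \<open>cl P\<close>, exchange
  says that dependence of one on the other is symmetric; the remaining cases are monotonicity and
  transitivity.\<close>

lemma rnk_swap:
  assumes "finite P" "P \<subseteq> E" "a \<in> E" "b \<in> E"
  shows "rnk cl P (a # b # as) = rnk cl P (b # a # as)"
proof -
  have "(if a \<in> cl P then 0 else 1::nat) + (if b \<in> cl (insert a P) then 0 else 1) =
      (if b \<in> cl P then 0 else 1) + (if a \<in> cl (insert b P) then 0 else 1)"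
  proof (cases "a \<in> cl P")
    case True
    then have "a \<in> cl (insert b P)" "b \<in> cl (insert a P) \<longleftrightarrow> b \<in> cl P"
      using in_cl_mono trans by blast+
    then show ?thesis using True by simp
  next
    case a: False
    show ?thesis
    proof (cases "b \<in> cl P")
      case True
      then have "b \<in> cl (insert a P)" "a \<in> cl (insert b P) \<longleftrightarrow> a \<in> cl P"
        using in_cl_mono trans by blast+
      then show ?thesis using True by simp
    next
      case False
      then have "b \<in> cl (insert a P) \<longleftrightarrow> a \<in> cl (insert b P)"
        using a exchange[OF assms(1,2)] assms(3,4) by blast
      then show ?thesis using a False by simp
    qed
  qed
  then show ?thesis by (simp add: insert_commute)
qed

lemma rnk_move:
  assumes "finite P" "P \<subseteq> E" "set as \<subseteq> E" "x \<in> E"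
  shows "rnk cl P (as @ x # bs) = rnk cl P (x # as @ bs)"
  using assms
proof (induction as arbitrary: P)
  case (Cons a as)
  have "rnk cl P ((a # as) @ x # bs) = (if a \<in> cl P then 0 else 1) + rnk cl (insert a P) (x # as @ bs)"
    using Cons.IH[of "insert a P"] Cons.prems by simp
  also have "\<dots> = rnk cl P (a # x # as @ bs)" by simp
  also have "\<dots> = rnk cl P (x # a # as @ bs)" using rnk_swap[of P a x "as @ bs"] Cons.prems by simp
  finally show ?case by simp
qed simp

lemma rnk_swap_append:
  assumes "finite P" "P \<subseteq> E" "set as \<subseteq> E" "set bs \<subseteq> E"
  shows "rnk cl P (as @ bs) = rnk cl P (bs @ as)"
  using assms
proof (induction bs arbitrary: P)
  case (Cons b bs)
  have "rnk cl P (as @ b # bs) = rnk cl P (b # as @ bs)" using rnk_move[of P as b bs] Cons.prems by simp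
  also have "\<dots> = rnk cl P (b # bs @ as)" using Cons.IH[of "insert b P"] Cons.prems by simp
  finally show ?case by simp
qed simp

text \<open>The rank of \<open>as @ bs\<close> is counted in both orders: behind \<open>as\<close>
  the tuple \<open>bs\<close> contributes nothing, in front it contributes its full rank.\<close>

lemma rnk_le:
  assumes "finite P" "P \<subseteq> E" "set as \<subseteq> E" "set bs \<subseteq> E" "set bs \<subseteq> cl (P \<union> set as)"
  shows "rnk cl P bs \<le> rnk cl P as"
proof -
  have "rnk cl P bs \<le> rnk cl P (bs @ as)" by (simp add: rnk_append)
  also have "\<dots> = rnk cl P (as @ bs)" using rnk_swap_append[of P as bs] assms by simp
  also have "\<dots> = rnk cl P as" using rnk_absorb assms by blast
  finally show ?thesis .
qed

lemma rnk_nths_le: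
  assumes "finite P" "P \<subseteq> E" "set as \<subseteq> E"
  shows "rnk cl P (nths as I) \<le> rnk cl P as"
proof (rule rnk_le[OF assms])
  show "set (nths as I) \<subseteq> E" using assms(3) set_nths_subset[of as I] by blast
  then show "set (nths as I) \<subseteq> cl (P \<union> set as)"
    by (rule subset_cl) (use set_nths_subset[of as I] in blast)
qed

end

section \<open>Polynomials over the residue field\<close>

context vfield
begin

declare O_carrier [simp] M_O [simp]

text \<open>Non-triviality of the valuation: the inverse of an element outside \<open>\<O>\<close>
  is small.\<close>

lemma M_nonzero: "\<exists>m\<in>\<M>. m \<noteq> \<zero>"
proof -
  have "\<O> \<subseteq> carrier K" using O_carrier by blast
  then obtain x where x: "x \<in> carrier K" "x \<notin> \<O>" using O_ne by blast
  then have "x \<noteq> \<zero>" by auto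
  then show ?thesis using inv_in_M[OF x] x by (intro bexI[of _ "inv x"]) simp_all
qed

text \<open>Horner evaluation; coefficients are listed from the constant term upwards.\<close>

primrec ev :: "'a list \<Rightarrow> 'a \<Rightarrow> 'a" where
  "ev [] x = \<zero>"
| "ev (c # cs) x = c \<oplus> x \<otimes> ev cs x"

text \<open>Synthetic division by \<open>X - a\<close>.\<close>

primrec sd :: "'a \<Rightarrow> 'a list \<Rightarrow> 'a list" where
  "sd a [] = []"
| "sd a (c # cs) = (if cs = [] then [] else ev cs a # sd a cs)"

lemma ev_closed [simp]: "set cs \<subseteq> carrier K \<Longrightarrow> x \<in> carrier K \<Longrightarrow> ev cs x \<in> carrier K"
  by (induction cs) simp_all

lemma ev_O: "set cs \<subseteq> \<O> \<Longrightarrow> x \<in> \<O> \<Longrightarrow> ev cs x \<in> \<O>"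
  by (induction cs) simp_all

lemma sd_closed: "set cs \<subseteq> carrier K \<Longrightarrow> a \<in> carrier K \<Longrightarrow> set (sd a cs) \<subseteq> carrier K"
  by (induction cs) simp_all

lemma sd_O: "set cs \<subseteq> \<O> \<Longrightarrow> a \<in> \<O> \<Longrightarrow> set (sd a cs) \<subseteq> \<O>"
  by (induction cs) (simp_all add: ev_O)

lemma length_sd: "length (sd a cs) = length cs - 1"
proof (induction cs)
  case (Cons c cs) then show ?case by (cases cs) simp_all
qed simp

lemma last_sd: "2 \<le> length cs \<Longrightarrow> set cs \<subseteq> carrier K \<Longrightarrow> a \<in> carrier K \<Longrightarrow> last (sd a cs) = last cs"
proof (induction cs)
  case (Cons c cs)
  show ?case
  proof (cases "2 \<le> length cs")
    case True
    then have "cs \<noteq> []" "sd a cs \<noteq> []" using length_sd[of a cs] by auto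
    then show ?thesis using Cons True by simp
  next
    case False
    then obtain d where "cs = [d]" using Cons.prems(1) by (cases cs) (simp_all, cases "tl cs", simp_all)
    then show ?thesis using Cons.prems by simp
  qed
qed simp

text \<open>For \<open>f = c + X g\<close> the difference \<open>f(x) - f(a)\<close> equals
  \<open>(x - a) g(a) + x (g(x) - g(a))\<close>, which is the recursion of
  \<open>sd\<close>.\<close>

lemma ev_sd:
  assumes "set cs \<subseteq> carrier K" "x \<in> carrier K" "a \<in> carrier K"
  shows "ev cs x \<ominus> ev cs a = (x \<ominus> a) \<otimes> ev (sd a cs) x"
  using assms(1)
proof (induction cs)
  case Nil
  then show ?case using assms by simp
next
  case (Cons c cs)
  show ?case
  proof (cases "cs = []")
    case True
    then show ?thesis using Cons.prems assms by simp
  next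
    case False
    have cl: "c \<in> carrier K" "ev cs x \<in> carrier K" "ev cs a \<in> carrier K" "ev (sd a cs) x \<in> carrier K"
      using Cons.prems assms sd_closed[of cs a] by simp_all
    have "(x \<ominus> a) \<otimes> ev (sd a (c # cs)) x = (x \<ominus> a) \<otimes> (ev cs a \<oplus> x \<otimes> ev (sd a cs) x)"
      using False by simp
    also have "\<dots> = (x \<ominus> a) \<otimes> ev cs a \<oplus> x \<otimes> ((x \<ominus> a) \<otimes> ev (sd a cs) x)"
      using cl assms by (simp add: r_distr m_lcomm)
    also have "(x \<ominus> a) \<otimes> ev (sd a cs) x = ev cs x \<ominus> ev cs a" using Cons by simp
    also have "(x \<ominus> a) \<otimes> ev cs a \<oplus> x \<otimes> (ev cs x \<ominus> ev cs a) = (c \<oplus> x \<otimes> ev cs x) \<ominus> (c \<oplus> a \<otimes> ev cs a)"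
      using cl assms by (simp add: ring_arith)
    finally show ?thesis by simp
  qed
qed

text \<open>A polynomial is \<open>X - a\<close> times its quotient plus its value at
  \<open>a\<close>; if both vanish modulo \<open>\<M>\<close>, so do all coefficients.\<close>

lemma sd_M: "set cs \<subseteq> \<O> \<Longrightarrow> a \<in> \<O> \<Longrightarrow> set (sd a cs) \<subseteq> \<M> \<Longrightarrow> ev cs a \<in> \<M> \<Longrightarrow> set cs \<subseteq> \<M>"
proof (induction cs)
  case (Cons c cs)
  show ?case
  proof (cases "cs = []")
    case True
    then show ?thesis using Cons.prems by simp
  next
    case False
    then have e: "ev cs a \<in> \<M>" "set (sd a cs) \<subseteq> \<M>" using Cons.prems by simp_all
    then have cs: "set cs \<subseteq> \<M>" using Cons by simp
    have "(c \<oplus> a \<otimes> ev cs a) \<ominus> a \<otimes> ev cs a \<in> \<M>" using Cons.prems e by simp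
    moreover have "(c \<oplus> a \<otimes> ev cs a) \<ominus> a \<otimes> ev cs a = c" using Cons.prems e add_sub_cancel(3) by simp
    ultimately show ?thesis using cs by simp
  qed
qed simp

primrec sep :: "'a list \<Rightarrow> bool" where
  "sep [] \<longleftrightarrow> True"
| "sep (t # ts) \<longleftrightarrow> (\<forall>s\<in>set ts. s \<ominus> t \<notin> \<M>) \<and> sep ts"

text \<open>Over the residue field, a polynomial with as many distinct roots as coefficients is
  zero. Division by \<open>X - t\<close> keeps the other roots because \<open>s \<ominus> t\<close>
  is a unit; everything is phrased with lifts in \<open>\<O>\<close>.\<close>

lemma too_many_roots:
  assumes "length cs = length ts" "set cs \<subseteq> \<O>" "set ts \<subseteq> \<O>" "sep ts" "\<And>t. t \<in> set ts \<Longrightarrow> ev cs t \<in> \<M>"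
  shows "set cs \<subseteq> \<M>"
  using assms
proof (induction ts arbitrary: cs)
  case (Cons t ts)
  have tO: "t \<in> \<O>" using Cons.prems by simp
  have csO: "set cs \<subseteq> carrier K" using Cons.prems(2) O_carrier by blast
  have "set (sd t cs) \<subseteq> \<M>"
  proof (rule Cons.IH)
    show "length (sd t cs) = length ts" using Cons.prems by (simp add: length_sd)
    show "set (sd t cs) \<subseteq> \<O>" using Cons.prems sd_O by simp
    fix s assume s: "s \<in> set ts"
    have sO: "s \<in> \<O>" using s Cons.prems by auto
    have "(s \<ominus> t) \<otimes> ev (sd t cs) s = ev cs s \<ominus> ev cs t" using ev_sd[of cs s t] csO sO tO by simp
    also have "\<dots> \<in> \<M>" using Cons.prems(5)[of s] Cons.prems(5)[of t] s by simp
    finally have p: "(s \<ominus> t) \<otimes> ev (sd t cs) s \<in> \<M>" .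
    have n: "s \<ominus> t \<notin> \<M>" using Cons.prems(4) s by simp
    have o: "s \<ominus> t \<in> \<O>" using sO tO by simp
    have e: "ev (sd t cs) s \<in> carrier K"
      by (rule ev_closed[OF sd_closed[OF csO]]) (use sO tO in simp_all)
    show "ev (sd t cs) s \<in> \<M>" by (rule M_times_cancel[OF o n e p])
  qed (use Cons.prems in simp_all)
  then show ?case using sd_M[of cs t] Cons.prems by simp
qed simp

text \<open>The coefficients of \<open>p + (X - a) f\<close>.\<close>

primrec mx :: "'a \<Rightarrow> 'a \<Rightarrow> 'a list \<Rightarrow> 'a list" where
  "mx a p [] = [p]"
| "mx a p (c # cs) = (p \<ominus> a \<otimes> c) # mx a c cs"

lemma ev_mx: "set cs \<subseteq> carrier K \<Longrightarrow> t \<in> carrier K \<Longrightarrow> a \<in> carrier K \<Longrightarrow> p \<in> carrier K \<Longrightarrow>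
    ev (mx a p cs) t = p \<oplus> (t \<ominus> a) \<otimes> ev cs t"
proof (induction cs arbitrary: p)
  case (Cons c cs)
  then show ?case by (simp add: ring_arith)
qed simp

lemma mx_props: "set cs \<subseteq> \<O> \<Longrightarrow> a \<in> \<O> \<Longrightarrow> p \<in> \<O> \<Longrightarrow>
    length (mx a p cs) = Suc (length cs) \<and> last (mx a p cs) = last (p # cs) \<and> set (mx a p cs) \<subseteq> \<O>"
proof (induction cs arbitrary: p)
  case (Cons c cs)
  have "mx a c cs \<noteq> []" by (cases cs) simp_all
  then show ?case using Cons by simp
qed simp

lemma monic_with_roots: "set ts \<subseteq> \<O> \<Longrightarrow>
    \<exists>b. length b = Suc (length ts) \<and> last b = \<one> \<and> set b \<subseteq> \<O> \<and> (\<forall>t\<in>set ts. ev b t = \<zero>)"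
proof (induction ts)
  case Nil
  show ?case by (intro exI[of _ "[\<one>]"]) simp
next
  case (Cons s ts)
  then obtain b where b: "length b = Suc (length ts)" "last b = \<one>" "set b \<subseteq> \<O>" "\<And>t. t \<in> set ts \<Longrightarrow> ev b t = \<zero>"
    by auto
  have bc: "set b \<subseteq> carrier K" using b(3) O_carrier by blast
  have "ev (mx s \<zero> b) t = \<zero>" if "t \<in> set (s # ts)" for t
  proof -
    have "t \<in> carrier K" "s \<in> carrier K" using that Cons.prems O_carrier by auto
    then show ?thesis using ev_mx[OF bc, of t s \<zero>] b(4)[of t] bc that by auto
  qed
  moreover have "b \<noteq> []" using b(1) by auto
  ultimately show ?case using mx_props[of b s \<zero>] b Cons.prems by (intro exI[of _ "mx s \<zero> b"]) simp
qed

lemma ev_diff_M: assumes "set b \<subseteq> \<O>" "x \<in> \<O>" "y \<in> \<O>" "x \<ominus> y \<in> \<M>" shows "ev b x \<ominus> ev b y \<in> \<M>"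
proof -
  have "set b \<subseteq> carrier K" using assms(1) O_carrier by blast
  then show ?thesis using ev_sd[of b x y] ev_O[OF sd_O[OF assms(1,3)] assms(2)] assms by simp
qed

lemma ev_map2_diff: "length b = length b' \<Longrightarrow> set b \<subseteq> carrier K \<Longrightarrow> set b' \<subseteq> carrier K \<Longrightarrow> t \<in> carrier K \<Longrightarrow>
    ev (map2 (\<lambda>x y. x \<ominus> y) b b') t = ev b t \<ominus> ev b' t"
proof (induction b b' rule: list_induct2)
  case (Cons x xs y ys)
  then show ?case by (simp add: ring_arith)
qed simp

lemma ev_M: "set cs \<subseteq> \<M> \<Longrightarrow> t \<in> \<O> \<Longrightarrow> ev cs t \<in> \<M>"
  by (induction cs) simp_all

lemma ev_snoc_zero: "set cs \<subseteq> carrier K \<Longrightarrow> t \<in> carrier K \<Longrightarrow> ev (cs @ [\<zero>]) t = ev cs t"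
  by (induction cs) simp_all

lemma pow_nonzero: "u \<in> carrier K \<Longrightarrow> u \<noteq> \<zero> \<Longrightarrow> u [^] (n::nat) \<noteq> \<zero>"
  by (induction n) simp_all

text \<open>For \<open>n = length cs\<close> these are the coefficients of
  \<open>u^(n-1) f(X/u)\<close>: the roots are multiplied by \<open>u\<close> and the leading
  coefficient is kept.\<close>

primrec sc :: "'a \<Rightarrow> 'a list \<Rightarrow> 'a list" where
  "sc u [] = []"
| "sc u (c # cs) = (c \<otimes> u [^] length cs) # sc u cs"

lemma length_sc [simp]: "length (sc u cs) = length cs"
  by (induction cs) simp_all

lemma sc_nth: "j < length cs \<Longrightarrow> sc u cs ! j = cs ! j \<otimes> u [^] (length cs - 1 - j)"
proof (induction cs arbitrary: j)
  case (Cons c cs)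
  then show ?case by (cases j) simp_all
qed simp

lemma sc_closed: "set cs \<subseteq> carrier K \<Longrightarrow> u \<in> carrier K \<Longrightarrow> set (sc u cs) \<subseteq> carrier K"
  by (induction cs) simp_all

text \<open>The additional factor \<open>u\<close> on the left avoids the exponent
  \<open>n - 1\<close>, which is meaningless for the empty list.\<close>

lemma ev_sc: "set cs \<subseteq> carrier K \<Longrightarrow> u \<in> carrier K \<Longrightarrow> t \<in> carrier K \<Longrightarrow>
    ev (sc u cs) (u \<otimes> t) \<otimes> u = u [^] length cs \<otimes> ev cs t"
proof (induction cs)
  case (Cons c cs)
  let ?E = "ev (sc u cs) (u \<otimes> t)" and ?n = "length cs"
  have cl: "c \<in> carrier K" "?E \<in> carrier K" "ev cs t \<in> carrier K" "u [^] ?n \<in> carrier K"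
    using Cons.prems sc_closed[of cs u] by simp_all
  have "ev (sc u (c # cs)) (u \<otimes> t) \<otimes> u = (c \<otimes> u [^] ?n \<oplus> (u \<otimes> t) \<otimes> ?E) \<otimes> u" by simp
  also have "\<dots> = (u [^] ?n \<otimes> u) \<otimes> c \<oplus> (u \<otimes> t) \<otimes> (?E \<otimes> u)"
    using cl Cons.prems by (simp add: l_distr r_distr m_ac)
  also have "?E \<otimes> u = u [^] ?n \<otimes> ev cs t" using Cons by simp
  also have "(u [^] ?n \<otimes> u) \<otimes> c \<oplus> (u \<otimes> t) \<otimes> (u [^] ?n \<otimes> ev cs t) = (u [^] ?n \<otimes> u) \<otimes> (c \<oplus> t \<otimes> ev cs t)"
    using cl Cons.prems by (simp add: r_distr m_ac)
  finally show ?case by simp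
qed simp

lemma pow_O: "u \<in> \<O> \<Longrightarrow> u [^] (n::nat) \<in> \<O>"
  by (induction n) simp_all

lemma Tm_pow: "Tm t \<Longrightarrow> Tm (\<lambda>e. t e [^] (n::nat))"
  by (induction n) (simp_all add: tm_intros)

lemma Tm_ev: "TmL n s \<Longrightarrow> Tm t \<Longrightarrow> Tm (\<lambda>e. ev (s e) (t e))"
proof (induction n arbitrary: s)
  case 0
  then have "s e = []" for e by (simp add: cotermL_def)
  then show ?case by (simp add: tm_intros)
next
  case (Suc n)
  have "s e = s e ! 0 # tl (s e)" for e
    using Suc.prems(1) by (cases "s e") (auto simp: cotermL_def dest: spec[of _ e])
  then have "ev (s e) (t e) = s e ! 0 \<oplus> t e \<otimes> ev (tl (s e)) (t e)" for e
    by (metis ev.simps(2))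
  moreover have "Tm (\<lambda>e. s e ! 0 \<oplus> t e \<otimes> ev (tl (s e)) (t e))"
    by (intro tm_intros Tm_nth[OF Suc.prems(1)] Suc.IH TmL_tl[OF Suc.prems(1)] Suc.prems(2)) simp_all
  ultimately show ?case by simp
qed

lemma val_max:
  assumes "finite S" "S \<noteq> {}" "S \<subseteq> carrier K - {\<zero>}"
  shows "\<exists>y\<in>S. \<forall>z\<in>S. z \<otimes> inv y \<in> \<O>"
  using assms
proof (induction S rule: finite_ne_induct)
  case (singleton x)
  then show ?case by simp
next
  case (insert x S)
  then obtain y where y: "y \<in> S" "\<And>z. z \<in> S \<Longrightarrow> z \<otimes> inv y \<in> \<O>" by auto
  have c: "x \<in> carrier K" "x \<noteq> \<zero>" "y \<in> carrier K" "y \<noteq> \<zero>" using insert.prems y by auto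
  show ?case
  proof (cases "x \<otimes> inv y \<in> \<O>")
    case True
    then show ?thesis using y by auto
  next
    case False
    then have "inv (x \<otimes> inv y) \<in> \<O>" using O_val[of "x \<otimes> inv y"] c by auto
    moreover have "inv (x \<otimes> inv y) = y \<otimes> inv x" using c by (simp add: inv_prod m_comm)
    ultimately have yx: "y \<otimes> inv x \<in> \<O>" by simp
    have "z \<otimes> inv x \<in> \<O>" if "z \<in> insert x S" for z
    proof (cases "z = x")
      case True then show ?thesis using c by simp
    next
      case False
      then have zy: "z \<otimes> inv y \<in> \<O>" "z \<in> carrier K" using y that insert.prems by auto
      have "(z \<otimes> inv y) \<otimes> (y \<otimes> inv x) = z \<otimes> (inv y \<otimes> y) \<otimes> inv x"
        using c zy(2) by (simp add: m_ac del: inv_simps(3,4))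
      also have "\<dots> = z \<otimes> inv x" using c zy(2) by simp
      finally show ?thesis using O_simps(4)[OF zy(1) yx] by simp
    qed
    then show ?thesis by blast
  qed
qed

end

context hmodel
begin

section \<open>Finite definable sets of leading terms with a single absolute value\<close>

lemma algover_trans_set:
  assumes "finite S" "S \<subseteq> carrier K" "A \<subseteq> carrier K" "\<And>c. c \<in> S \<Longrightarrow> algover (pt ` A) pt c"
    "x \<in> carrier K" "algover (pt ` (A \<union> S)) pt x"
  shows "algover (pt ` A) pt x"
  using assms
proof (induction S rule: finite_induct)
  case (insert c S)
  have "A \<union> S \<subseteq> carrier K" using insert.prems(1,2) by blast
  from order_trans[OF image_mono[OF this] RVx_PRV(3)] have P: "pt ` (A \<union> S) \<subseteq> PRV" .
  have "algover (pt ` (A \<union> S)) pt c" using algover_mono[OF insert.prems(3)[of c], of "pt ` (A \<union> S)"] by blast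
  moreover have "algover (insert (pt c) (pt ` (A \<union> S))) pt x" using insert.prems(5) by simp
  ultimately have "algover (pt ` (A \<union> S)) pt x"
    using algover_trans[of pt pt "pt ` (A \<union> S)" c x] P insert.prems by simp
  then show ?case using insert by simp
qed simp

lemma algover_zero: "algover P pt \<zero>"
proof -
  define \<Phi> where "\<Phi> = (\<lambda>l::'a list. l ! 0 = \<zero>)"
  have L: "LDef (Suc (length ([] :: 'a imag list))) \<Phi>" unfolding LDef_def \<Phi>_def
    by (intro def_intros tml_intros) ((rule refl | simp)+)?
  have "alg pt [] (pt \<zero>)"
    by (rule alg_intro[OF kap_simps(1) _ L, of "{pt \<zero>}" "[]"]) (simp_all add: \<Phi>_def)
  then show ?thesis unfolding algover_def by (intro exI[of _ "[]"]) simp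
qed

text \<open>The parameters are elements of the field, which are their own only representatives;
  hence they enter the formula directly.\<close>

definition adef :: "'a set \<Rightarrow> 'a imag set \<Rightarrow> bool" where
  "adef A D \<longleftrightarrow> D \<subseteq> RVx K \<and> (\<exists>as \<Phi>. set as \<subseteq> A \<and> LDef (Suc (length as)) \<Phi> \<and>
     (\<forall>y\<in>carrier K. rv K y \<in> D \<longleftrightarrow> \<Phi> (y # as)))"

text \<open>Selecting the elements of largest absolute value is first-order over the same
  parameters, and so is discarding them; a definable set of least size admits only a trivial cut of
  this kind.\<close>

lemma adef_dominant:
  assumes "adef A D" and R: "\<And>x y z w. x \<in> carrier K \<Longrightarrow> y \<in> carrier K \<Longrightarrow> rv K x = rv K y \<Longrightarrow> True"
  shows "adef A {\<xi> \<in> D. \<forall>y z. rv K y = \<xi> \<longrightarrow> y \<in> carrier K \<longrightarrow> z \<in> carrier K \<longrightarrow> rv K z \<in> D \<longrightarrow> (\<exists>a\<in>carrier K. a \<in> \<O> \<and> z = a \<otimes> y)}"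
    and "adef A (D - {\<xi> \<in> D. \<forall>y z. rv K y = \<xi> \<longrightarrow> y \<in> carrier K \<longrightarrow> z \<in> carrier K \<longrightarrow> rv K z \<in> D \<longrightarrow> (\<exists>a\<in>carrier K. a \<in> \<O> \<and> z = a \<otimes> y)})"
proof -
  obtain as \<Phi> where D: "D \<subseteq> RVx K" and as: "set as \<subseteq> A" and L: "LDef (Suc (length as)) \<Phi>"
    and \<Phi>: "\<And>y. y \<in> carrier K \<Longrightarrow> rv K y \<in> D \<longleftrightarrow> \<Phi> (y # as)" using assms(1) unfolding adef_def by blast
  let ?D = "{\<xi> \<in> D. \<forall>y z. rv K y = \<xi> \<longrightarrow> y \<in> carrier K \<longrightarrow> z \<in> carrier K \<longrightarrow> rv K z \<in> D \<longrightarrow> (\<exists>a\<in>carrier K. a \<in> \<O> \<and> z = a \<otimes> y)}"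
  define \<Psi> where "\<Psi> = (\<lambda>l. \<forall>y\<in>carrier K. \<forall>z\<in>carrier K. rv K y = rv K (l ! 0) \<longrightarrow> \<Phi> (z # tl l) \<longrightarrow> (\<exists>a\<in>carrier K. a \<in> \<O> \<and> z = a \<otimes> y))"
  have LP: "LDef (Suc (length as)) \<Psi>" unfolding LDef_def \<Psi>_def
    by (intro def_intros LDef_app[OF L] tml_intros) ((rule refl | simp)+)?
  have L1: "LDef (Suc (length as)) (\<lambda>l. \<Phi> l \<and> \<Psi> l)" and L2: "LDef (Suc (length as)) (\<lambda>l. \<Phi> l \<and> \<not> \<Psi> l)"
    using L LP unfolding LDef_def by (intro Def_basic; simp)+
  have e: "rv K x \<in> ?D \<longleftrightarrow> \<Phi> (x # as) \<and> \<Psi> (x # as)" if x: "x \<in> carrier K" for x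
    unfolding mem_Collect_eq \<Psi>_def list.sel nth_Cons_0 using \<Phi> x by blast
  have e2: "rv K x \<in> D - ?D \<longleftrightarrow> \<Phi> (x # as) \<and> \<not> \<Psi> (x # as)" if x: "x \<in> carrier K" for x
    unfolding Diff_iff e[OF x] using \<Phi>[OF x] by blast
  have s1: "?D \<subseteq> RVx K" and s2: "D - ?D \<subseteq> RVx K" using D by blast+
  show "adef A ?D" unfolding adef_def
    by (intro conjI s1 exI[of _ as] exI[of _ "\<lambda>l. \<Phi> l \<and> \<Psi> l"] as L1 ballI e)
  show "adef A (D - ?D)" unfolding adef_def
    by (intro conjI s2 exI[of _ as] exI[of _ "\<lambda>l. \<Phi> l \<and> \<not> \<Psi> l"] as L2 ballI e2)
qed

text \<open>Among the finite \<open>A\<close>-definable sets containing \<open>rv K x0\<close> one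
  of least cardinality is taken. If \<open>rv K x0\<close> lay outside its dominant part, removing
  that part, which is non-empty by \<open>val_max\<close>, would give a smaller set; so the dominant
  part is everything.\<close>

lemma adef_min:
  assumes A: "A \<subseteq> carrier K" and x0: "x0 \<in> carrier K" "x0 \<noteq> \<zero>" and a: "algover (pt ` A) (rv K) x0"
  shows "\<exists>D. adef A D \<and> finite D \<and> rv K x0 \<in> D \<and>
    (\<forall>y\<in>carrier K. \<forall>z\<in>carrier K. rv K y \<in> D \<longrightarrow> rv K z \<in> D \<longrightarrow> z \<otimes> inv y \<in> \<O>)"
proof -
  obtain ps where ps: "set ps \<subseteq> pt ` A" "alg (rv K) ps (rv K x0)" using a unfolding algover_def by blast
  obtain as where as: "set as \<subseteq> A" "map pt as = ps" using map_ex[OF ps(1)] by blast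
  have len: "length ps = length as" using as(2) by auto
  obtain \<Phi> N where L: "LDef (Suc (length ps)) \<Phi>" and f: "\<And>ws. ws \<in> tuples K (length ps) \<Longrightarrow> few (rv K) N \<Phi> ws"
    and \<Phi>: "\<And>ws y. rep ws ps \<Longrightarrow> [y] \<in> rv K x0 \<Longrightarrow> \<Phi> (y # ws)"
    by (rule algE[OF ps(2)], rule that)
  have asc: "set as \<subseteq> carrier K" using as A by blast
  have rp: "rep as ps" using rep_pt[OF asc, of as] as(2) by simp
  define \<Psi> where "\<Psi> = (\<lambda>l. l ! 0 \<noteq> \<zero> \<and> (\<forall>y\<in>carrier K. rv K y = rv K (l ! 0) \<longrightarrow> \<Phi> (y # tl l)))"
  have LP: "LDef (Suc (length as)) \<Psi>" unfolding LDef_def \<Psi>_def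
    by (intro def_intros LDef_app[OF L] tml_intros) ((rule refl | simp add: len)+)?
  define D0 where "D0 = rv K ` {y \<in> carrier K. \<Psi> (y # as)}"
  have e: "rv K y \<in> D0 \<longleftrightarrow> \<Psi> (y # as)" if y: "y \<in> carrier K" for y
  proof
    assume "rv K y \<in> D0"
    then obtain z where z: "z \<in> carrier K" "\<Psi> (z # as)" "rv K y = rv K z" unfolding D0_def by blast
    have "y \<noteq> \<zero>" using z rv_zero_iff[of z] unfolding \<Psi>_def by auto
    then show "\<Psi> (y # as)" using z unfolding \<Psi>_def by simp
  next
    assume "\<Psi> (y # as)"
    then show "rv K y \<in> D0" using y unfolding D0_def by blast
  qed
  have D0: "D0 \<subseteq> RVx K" unfolding D0_def RVx_def \<Psi>_def by auto
  have "D0 \<subseteq> rv K ` {y \<in> carrier K. \<Phi> (y # as)}" unfolding D0_def \<Psi>_def by auto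
  moreover have "as \<in> tuples K (length ps)" using asc len by (simp add: tuples_iff)
  from f[OF this] have "finite (rv K ` {y \<in> carrier K. \<Phi> (y # as)})" unfolding few_def by (rule conjunct1)
  ultimately have fin0: "finite D0" by (rule finite_subset)
  have x00: "rv K x0 \<in> D0" unfolding e[OF x0(1)] \<Psi>_def
    using x0 \<Phi>[OF rp] rv_mem_iff[OF x0(1)] by simp
  have ad0: "adef A D0" unfolding adef_def
    by (intro conjI D0 exI[of _ as] exI[of _ \<Psi>] as LP ballI e)
  define Q where "Q = (\<lambda>D. adef A D \<and> finite D \<and> rv K x0 \<in> D)"
  have "Q D0" unfolding Q_def using ad0 fin0 x00 by blast
  then obtain D where QD: "Q D" and min: "\<And>D'. Q D' \<Longrightarrow> card D \<le> card D'"
    using ex_has_least_nat[of Q D0 card] by blast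
  let ?M = "{\<xi> \<in> D. \<forall>y z. rv K y = \<xi> \<longrightarrow> y \<in> carrier K \<longrightarrow> z \<in> carrier K \<longrightarrow> rv K z \<in> D \<longrightarrow> (\<exists>a\<in>carrier K. a \<in> \<O> \<and> z = a \<otimes> y)}"
  have D: "adef A D" "finite D" "rv K x0 \<in> D" using QD unfolding Q_def by blast+
  have DR: "D \<subseteq> RVx K" using D(1) unfolding adef_def by blast
  have MD: "?M = D"
  proof (cases "rv K x0 \<in> ?M")
    case True
    then have "Q ?M" unfolding Q_def using adef_dominant(1)[OF D(1)] D(2) by simp
    from min[OF this] show ?thesis using D(2) by (intro card_seteq) auto
  next
    case False
    then have "Q (D - ?M)" unfolding Q_def using adef_dominant(2)[OF D(1)] D by simp
    from min[OF this] have "D - ?M = D" using D(2) by (intro card_seteq) auto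
    then have M0: "?M = {}" by blast
    have "D \<subseteq> rv K ` (carrier K - {\<zero>})" using DR unfolding RVx_def .
    then obtain S where S: "finite S" "S \<subseteq> carrier K - {\<zero>}" "D = rv K ` S"
      using D(2) finite_subset_image[of D "rv K"] by metis
    have "S \<noteq> {}" using S(3) D(3) by blast
    then obtain y where y: "y \<in> S" "\<And>z. z \<in> S \<Longrightarrow> z \<otimes> inv y \<in> \<O>" using val_max[OF S(1) _ S(2)] by blast
    have yc: "y \<in> carrier K" "y \<noteq> \<zero>" using y S by auto
    have "rv K y \<in> ?M"
    proof (intro CollectI conjI allI impI)
      show "rv K y \<in> D" using y S by blast
      fix y' z assume h: "rv K y' = rv K y" "y' \<in> carrier K" "z \<in> carrier K" "rv K z \<in> D"
      obtain s where s: "s \<in> S" "rv K z = rv K s" using h(4) S(3) by blast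
      have sc: "s \<in> carrier K" "s \<noteq> \<zero>" using s S by auto
      obtain m where m: "m \<in> \<M>" "z = s \<otimes> (\<one> \<oplus> m)" using rv_mem_iff[OF sc(1), of z] rv_mem[of z s] h(3) s(2) by auto
      obtain l where l: "l \<in> \<M>" "y = y' \<otimes> (\<one> \<oplus> l)" using rv_mem_iff[OF h(2), of y] rv_mem[of y y'] yc(1) h(1) by auto
      let ?a = "(s \<otimes> inv y) \<otimes> (\<one> \<oplus> m) \<otimes> (\<one> \<oplus> l)"
      have aO: "?a \<in> \<O>" using y(2)[OF s(1)] one_plus_M m l by simp
      have "(s \<otimes> inv y) \<otimes> (\<one> \<oplus> m) \<otimes> y = s \<otimes> (\<one> \<oplus> m) \<otimes> (inv y \<otimes> y)"
        using m(1) yc sc by (simp add: m_ac del: inv_simps(3,4))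
      then have "z = (s \<otimes> inv y) \<otimes> (\<one> \<oplus> m) \<otimes> y"
        using m yc sc by simp
      also have "\<dots> = (s \<otimes> inv y) \<otimes> (\<one> \<oplus> m) \<otimes> (y' \<otimes> (\<one> \<oplus> l))" using l(2) by simp
      also have "\<dots> = ?a \<otimes> y'"
        using m(1) l(1) yc sc h(2) one_plus_M by (simp add: m_ac)
      finally show "\<exists>a\<in>carrier K. a \<in> \<O> \<and> z = a \<otimes> y'" using aO O_carrier[OF aO] by blast
    qed
    then show ?thesis using M0 by blast
  qed
  have "z \<otimes> inv y \<in> \<O>" if "y \<in> carrier K" "z \<in> carrier K" "rv K y \<in> D" "rv K z \<in> D" for y z
  proof -
    have "rv K y \<in> ?M" using that(3) MD by blast
    from this[unfolded mem_Collect_eq, THEN conjunct2, rule_format, OF refl that(1,2,4)]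
    obtain a where a: "a \<in> \<O>" "z = a \<otimes> y" by blast
    have "y \<noteq> \<zero>" using that(1,3) DR RVx_iff by blast
    then have "z \<otimes> inv y = a" using a that(1) by (simp add: m_assoc)
    then show ?thesis using a by simp
  qed
  then show ?thesis using D by blast
qed

section \<open>Lifting algebraic leading terms\<close>

text \<open>The polynomial is formed after division by \<open>x0\<close>, where the elements of
  \<open>D\<close> become residues. In the original variable its coefficient of degree
  \<open>j\<close> acquires the factor \<open>x0 [^] (r - j)\<close>, and its leading term then
  depends on \<open>D\<close> alone, so that effectivity applies to it.\<close>

lemma acl_lift:
  assumes A: "A \<subseteq> carrier K" and x0: "x0 \<in> carrier K" "x0 \<noteq> \<zero>" and a: "algover (pt ` A) (rv K) x0"
  shows "\<exists>c\<in>carrier K. rv K c = rv K x0 \<and> algover (pt ` A) pt c"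
proof -
  obtain D where D: "adef A D" "finite D" "rv K x0 \<in> D"
    and val: "\<And>y z. y \<in> carrier K \<Longrightarrow> z \<in> carrier K \<Longrightarrow> rv K y \<in> D \<Longrightarrow> rv K z \<in> D \<Longrightarrow> z \<otimes> inv y \<in> \<O>"
    using adef_min[OF A x0 a] by blast
  obtain as \<Phi> where DR: "D \<subseteq> RVx K" and as: "set as \<subseteq> A" and L: "LDef (Suc (length as)) \<Phi>"
    and \<Phi>: "\<And>y. y \<in> carrier K \<Longrightarrow> rv K y \<in> D \<longleftrightarrow> \<Phi> (y # as)" using D(1) unfolding adef_def by blast
  have asc: "set as \<subseteq> carrier K" using as A by blast
  have nz: "y \<noteq> \<zero>" if "y \<in> carrier K" "rv K y \<in> D" for y using that DR RVx_iff by blast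
  obtain ds where ds: "set ds = D" "distinct ds" using finite_distinct_list[OF D(2)] by blast
  have "set ds \<subseteq> rv K ` (carrier K - {\<zero>})" using ds(1) DR unfolding RVx_def by simp
  from map_ex[OF this] obtain ys where ys: "set ys \<subseteq> carrier K - {\<zero>}" "map (rv K) ys = ds" by blast
  have ysD: "rv K ` set ys = D" using ys(2) ds(1) by (metis set_map)
  \<comment> \<open>By \<open>val\<close> these quotients are units of \<open>\<O>\<close>; they are
    pairwise incongruent modulo \<open>\<M>\<close>, and one of them is congruent to
    \<open>\<one>\<close>.\<close>
  define ts where "ts = map (\<lambda>y. y \<otimes> inv x0) ys"
  have tsO: "set ts \<subseteq> \<O>" unfolding ts_def using val[OF x0(1)] D(3) ysD ys(1) by auto
  have dist: "distinct (map (rv K) ys)" using ys(2) ds(2) by simp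
  have sm_x0: "sm u y" if h: "sm u x0" "y \<in> carrier K" "rv K y \<in> D" for u y
  proof -
    obtain m where m: "m \<in> \<M>" "u = m \<otimes> x0" using h(1) unfolding sm_def by blast
    have o: "x0 \<otimes> inv y \<in> \<O>" by (rule val[OF h(2) x0(1) h(3) D(3)])
    have "u = (m \<otimes> (x0 \<otimes> inv y)) \<otimes> y"
      using m h(2) x0 nz[OF h(2,3)] by (simp add: m_assoc)
    then show ?thesis using sm_M[OF M_times(1)[OF m(1) o], of y] by simp
  qed
  have sep_ys: "sep (map (\<lambda>y. y \<otimes> inv x0) zs)" if "set zs \<subseteq> set ys" "distinct (map (rv K) zs)" for zs
    using that
  proof (induction zs)
    case (Cons z zs)
    have "s \<otimes> inv x0 \<ominus> z \<otimes> inv x0 \<notin> \<M>" if s: "s \<in> set zs" for s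
    proof
      assume M: "s \<otimes> inv x0 \<ominus> z \<otimes> inv x0 \<in> \<M>"
      have c: "s \<in> carrier K" "z \<in> carrier K" using s Cons.prems ys(1) by auto
      have "(s \<otimes> inv x0 \<ominus> z \<otimes> inv x0) \<otimes> x0 = s \<ominus> z"
        using c x0 by (simp add: l_diff_distr m_assoc)
      then have "sm (s \<ominus> z) x0" using sm_M[OF M, of x0] by simp
      moreover have "rv K z \<in> D" using Cons.prems(1) ysD by auto
      ultimately have "sm (s \<ominus> z) z" using sm_x0 c by blast
      then have "rv K z = rv K s" using c by (simp add: rv_eq_iff)
      then show False using Cons.prems(2) s by auto
    qed
    then show ?case using Cons by simp
  qed simp
  have sep_ts: "sep ts" unfolding ts_def by (rule sep_ys[OF order_refl dist])
  define r where "r = length ts"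
  have r: "0 < r"
  proof -
    have "ys \<noteq> []" using ysD D(3) by auto
    then show ?thesis unfolding r_def ts_def by simp
  qed
  have root_ex: "\<exists>t\<in>set ts. s \<ominus> t \<in> \<M>" if s: "s \<in> carrier K" "rv K (x0 \<otimes> s) \<in> D" for s
  proof -
    obtain y where y: "y \<in> set ys" "rv K (x0 \<otimes> s) = rv K y" using s(2) ysD by blast
    have yc: "y \<in> carrier K" "y \<noteq> \<zero>" using y ys(1) by auto
    have "[x0 \<otimes> s] \<in> rv K y" using rv_mem_iff[OF yc(1), of "x0 \<otimes> s"] y(2) s(1) x0 by simp
    then obtain m where m: "m \<in> \<M>" "x0 \<otimes> s = y \<otimes> (\<one> \<oplus> m)" unfolding rv_mem by blast
    let ?t = "y \<otimes> inv x0"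
    have tO: "?t \<in> \<O>" using tsO y(1) unfolding ts_def by auto
    have "s = inv x0 \<otimes> (x0 \<otimes> s)" using x0 s(1) by (simp add: m_assoc[symmetric])
    also have "\<dots> = ?t \<oplus> ?t \<otimes> m" unfolding m(2) using x0 yc m(1) by (simp add: r_distr m_ac)
    finally have "s \<ominus> ?t = ?t \<otimes> m" using tO m(1) add_sub_cancel(1)[of ?t "?t \<otimes> m"] by simp
    then have "s \<ominus> ?t \<in> \<M>" using M_times(2)[OF m(1) tO] by simp
    moreover have "?t \<in> set ts" using y(1) unfolding ts_def by simp
    ultimately show ?thesis by blast
  qed
  have tO: "s \<in> \<O>" if s: "s \<in> carrier K" "rv K (x0 \<otimes> s) \<in> D" for s
  proof -
    have "(x0 \<otimes> s) \<otimes> inv x0 \<in> \<O>" by (rule val[OF x0(1) _ D(3) s(2)]) (use s x0 in simp)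
    moreover have "(x0 \<otimes> s) \<otimes> inv x0 = s \<otimes> (x0 \<otimes> inv x0)" using x0 s(1) by (simp add: m_ac del: inv_simps(3-5))
    ultimately show ?thesis using x0 s(1) by simp
  qed
  have ts_D: "rv K (x0 \<otimes> t) \<in> D" if "t \<in> set ts" for t
  proof -
    obtain y where y: "y \<in> set ys" "t = y \<otimes> inv x0" using \<open>t \<in> set ts\<close> unfolding ts_def by auto
    have yc: "y \<in> carrier K" using y ys(1) by auto
    have "x0 \<otimes> t = y \<otimes> (x0 \<otimes> inv x0)" unfolding y(2) using yc x0 by (simp add: m_ac del: inv_simps(3-5))
    then have "x0 \<otimes> t = y" using yc x0 by simp
    then show ?thesis using ysD y(1) by auto
  qed
  \<comment> \<open>Lifts of the monic polynomial of degree \<open>r\<close> whose roots modulo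
    \<open>\<M>\<close> are the elements of \<open>D\<close> divided by \<open>y\<close>. The
    condition refers only to membership in \<open>D\<close>, so it is first-order.\<close>
  define BB where "BB = (\<lambda>y. {b \<in> tuples K (Suc r). b ! r = \<one> \<and> (\<forall>i<Suc r. b ! i \<in> \<O>) \<and>
      (\<forall>t\<in>carrier K. rv K (y \<otimes> t) \<in> D \<longrightarrow> ev b t \<in> \<M>)})"
  have BO: "set b \<subseteq> \<O>" "set b \<subseteq> carrier K" "length b = Suc r" if "b \<in> BB y" for b y
    using that unfolding BB_def tuples_iff by (auto simp: in_set_conv_nth)
  have BB_ex: "\<exists>b. b \<in> BB x0"
  proof -
    obtain b where b: "length b = Suc r" "last b = \<one>" "set b \<subseteq> \<O>" "\<And>t. t \<in> set ts \<Longrightarrow> ev b t = \<zero>"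
      using monic_with_roots[OF tsO] unfolding r_def by blast
    have "ev b s \<in> \<M>" if s: "s \<in> carrier K" "rv K (x0 \<otimes> s) \<in> D" for s
    proof -
      obtain t where t: "t \<in> set ts" "s \<ominus> t \<in> \<M>" using root_ex[OF s] by blast
      have "ev b s \<ominus> ev b t \<in> \<M>" by (rule ev_diff_M[OF b(3) tO[OF s] _ t(2)]) (use t tsO in blast)
      moreover have "ev b s \<in> carrier K" using ev_O[OF b(3) tO[OF s]] by simp
      ultimately show ?thesis using b(4)[OF t(1)] by simp
    qed
    moreover have "b \<in> tuples K (Suc r)" using b(1,3) O_carrier by (auto simp: tuples_iff)
    moreover have "b ! r = \<one>" using b(1,2) last_conv_nth[of b] by force
    moreover have "\<forall>i<Suc r. b ! i \<in> \<O>"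
    proof (intro allI impI)
      fix i assume "i < Suc r"
      then have "b ! i \<in> set b" using b(1) by simp
      then show "b ! i \<in> \<O>" using b(3) by blast
    qed
    ultimately show ?thesis unfolding BB_def by blast
  qed
  have BB_close: "b' \<in> BB x0" if b: "b \<in> BB x0" and b': "b' \<in> tuples K (Suc r)" "b' ! r = \<one>" "\<And>i. i < Suc r \<Longrightarrow> b' ! i \<in> \<O>"
      and cl: "\<And>i. i < r \<Longrightarrow> b' ! i \<ominus> b ! i \<in> \<M>" for b b'
  proof -
    have c': "set b' \<subseteq> carrier K" "length b' = Suc r" using b' by (auto simp: tuples_iff)
    have br: "b ! r = \<one>" using b unfolding BB_def by blast
    have "ev b' s \<in> \<M>" if s: "s \<in> carrier K" "rv K (x0 \<otimes> s) \<in> D" for s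
    proof -
      have "set (map2 (\<lambda>x y. x \<ominus> y) b' b) \<subseteq> \<M>"
      proof
        fix z assume "z \<in> set (map2 (\<lambda>x y. x \<ominus> y) b' b)"
        then obtain i where i: "i < Suc r" "z = b' ! i \<ominus> b ! i"
          using c'(2) BO(3)[OF b] by (auto simp: in_set_conv_nth)
        then show "z \<in> \<M>" using cl[of i] b'(2) br by (cases "i = r") simp_all
      qed
      from ev_M[OF this tO[OF s]] have "ev b' s \<ominus> ev b s \<in> \<M>"
        using ev_map2_diff[of b' b s] c' BO[OF b] s(1) by simp
      moreover have "ev b s \<in> \<M>" using b s unfolding BB_def by blast
      ultimately have "(ev b' s \<ominus> ev b s) \<oplus> ev b s \<in> \<M>" by simp
      moreover have "(ev b' s \<ominus> ev b s) \<oplus> ev b s = ev b' s"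
        using c' BO[OF b] s(1) by (simp add: ring_arith)
      ultimately show ?thesis by simp
    qed
    then show ?thesis unfolding BB_def using b' by blast
  qed
  have BB_uniq: "b ! i \<ominus> b' ! i \<in> \<M>" if b: "b \<in> BB x0" and b': "b' \<in> BB x0" and i: "i < r" for b b' i
  proof -
    \<comment> \<open>Both polynomials are monic, so the top coefficient cancels and the
      \<open>r\<close> remaining ones face \<open>r\<close> distinct roots.\<close>
    let ?d = "map2 (\<lambda>x y. x \<ominus> y) b b'"
    have ld: "length ?d = Suc r" using BO(3)[OF b] BO(3)[OF b'] by simp
    have dn: "?d ! j = b ! j \<ominus> b' ! j" if "j < Suc r" for j using that BO(3)[OF b] BO(3)[OF b'] by simp
    have dr: "?d ! r = \<zero>" using dn[of r] b b' unfolding BB_def by simp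
    have dO: "set ?d \<subseteq> \<O>"
    proof
      fix z assume "z \<in> set ?d"
      then obtain j where "j < Suc r" "z = ?d ! j" using ld by (auto simp: in_set_conv_nth)
      then show "z \<in> \<O>" using dn b b' unfolding BB_def by simp
    qed
    have split: "?d = take r ?d @ [\<zero>]"
      using ld dr by (metis lessI take_Suc_conv_app_nth take_all_iff order_refl)
    have tkO: "set (take r ?d) \<subseteq> \<O>" using dO set_take_subset[of r ?d] by blast
    have "set (take r ?d) \<subseteq> \<M>"
    proof (rule too_many_roots[OF _ tkO tsO sep_ts])
      show "length (take r ?d) = length ts" using ld unfolding r_def by simp
      fix t assume t: "t \<in> set ts"
      have tc: "t \<in> carrier K" using t tsO O_carrier by blast
      have "ev (take r ?d) t = ev ?d t"
        using ev_snoc_zero[of "take r ?d" t] tkO tc split O_carrier by (metis subset_iff)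
      also have "\<dots> = ev b t \<ominus> ev b' t"
        by (rule ev_map2_diff) (use BO[OF b] BO[OF b'] tc in simp_all)
      also have "\<dots> \<in> \<M>" using b b' tc ts_D[OF t] unfolding BB_def by (intro M_minus) blast+
      finally show "ev (take r ?d) t \<in> \<M>" .
    qed
    moreover have "take r ?d ! i \<in> set (take r ?d)" using i ld by (intro nth_mem) simp
    moreover have "take r ?d ! i = b ! i \<ominus> b' ! i" using i dn[of i] by simp
    ultimately show ?thesis by auto
  qed
  \<comment> \<open>Changing the base point from \<open>y\<close> to \<open>x0\<close> multiplies
    the roots by the unit \<open>y \<otimes> inv x0\<close>; the products of coefficient and power
    do not feel it.\<close>
  have BB_base: "\<exists>b'\<in>BB x0. \<forall>j<Suc r. b ! j \<otimes> y [^] (r - j) = b' ! j \<otimes> x0 [^] (r - j)"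
    if y: "y \<in> carrier K" "rv K y \<in> D" and b: "b \<in> BB y" for y b
  proof -
    let ?u = "y \<otimes> inv x0" and ?v = "x0 \<otimes> inv y"
    have uO: "?u \<in> \<O>" by (rule val[OF x0(1) y(1) D(3) y(2)])
    have vO: "?v \<in> \<O>" by (rule val[OF y(1) x0(1) y(2) D(3)])
    note ynz = nz[OF y]
    have "?u \<otimes> ?v = y \<otimes> inv y \<otimes> (x0 \<otimes> inv x0)" using y(1) ynz x0 by (simp add: m_ac del: inv_simps(3-5))
    then have uv: "?u \<otimes> ?v = \<one>" using y(1) ynz x0 by simp
    have uM: "?u \<notin> \<M>"
    proof
      assume "?u \<in> \<M>"
      from M_times(1)[OF this vO] show False using uv by simp
    qed
    have uc: "?u \<in> carrier K" using uO by simp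
    have ux: "?u \<otimes> x0 = y" using y(1) x0 by (simp add: m_assoc)
    let ?b = "sc ?u b"
    have lb: "length b = Suc r" and bc: "set b \<subseteq> carrier K" using BO[OF b] by blast+
    have nth: "?b ! j = b ! j \<otimes> ?u [^] (r - j)" if "j < Suc r" for j
      using sc_nth[of j b ?u] that lb by simp
    have bO: "b ! j \<in> \<O>" if "j < Suc r" for j using b that unfolding BB_def by blast
    have "ev ?b s \<in> \<M>" if s: "s \<in> carrier K" "rv K (x0 \<otimes> s) \<in> D" for s
    proof -
      let ?t = "?v \<otimes> s"
      have tc: "?t \<in> carrier K" using vO s by simp
      have ut: "?u \<otimes> ?t = s" using uv uc vO s(1) by (simp add: m_assoc[symmetric])
      have "y \<otimes> ?t = (y \<otimes> inv y) \<otimes> (x0 \<otimes> s)" using y(1) x0(1) s(1) ynz by (simp add: m_ac del: inv_simps(3-5))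
      then have "y \<otimes> ?t = x0 \<otimes> s" using y(1) x0(1) s(1) ynz by simp
      then have "ev b ?t \<in> \<M>" using b tc s(2) unfolding BB_def by simp
      then have "?u [^] Suc r \<otimes> ev b ?t \<in> \<M>" using pow_O[OF uO, of "Suc r"] by (intro M_times(2))
      moreover have "ev ?b s \<otimes> ?u = ?u [^] Suc r \<otimes> ev b ?t"
        using ev_sc[OF bc uc tc] unfolding ut lb .
      moreover have evc: "ev ?b s \<in> carrier K" by (rule ev_closed[OF sc_closed[OF bc uc] s(1)])
      ultimately have "?u \<otimes> ev ?b s \<in> \<M>" using m_comm[OF uc evc] by simp
      then show ?thesis by (rule M_times_cancel[OF uO uM evc])
    qed
    moreover have "?b \<in> tuples K (Suc r)" using sc_closed[OF bc uc] lb by (simp add: tuples_iff)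
    moreover have "?b ! r = \<one>" using nth[of r] b unfolding BB_def by simp
    moreover have "\<forall>j<Suc r. ?b ! j \<in> \<O>" using nth bO pow_O[OF uO] by simp
    ultimately have "?b \<in> BB x0" unfolding BB_def by blast
    moreover have "b ! j \<otimes> y [^] (r - j) = ?b ! j \<otimes> x0 [^] (r - j)" if j: "j < Suc r" for j
    proof -
      have "y [^] (r - j) = ?u [^] (r - j) \<otimes> x0 [^] (r - j)"
        using nat_pow_distrib[of ?u x0 "r - j"] uc x0 ux by simp
      then show ?thesis using nth[OF j] bO[OF j] uc x0 by (simp add: m_assoc)
    qed
    ultimately show ?thesis by blast
  qed
  have coef: "\<exists>c\<in>carrier K. algover (pt ` A) pt c \<and> (\<exists>b\<in>BB x0. c = b ! j \<otimes> x0 [^] (r - j))" if j: "j < r" for j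
  proof -
    \<comment> \<open>All possible values of the coefficient of degree \<open>j\<close> in the
      original variable.\<close>
    define Ej where "Ej = (\<lambda>z. \<exists>b\<in>BB x0. z = b ! j \<otimes> x0 [^] (r - j))"
    have xp: "x0 [^] (r - j) \<in> carrier K" "x0 [^] (r - j) \<noteq> \<zero>" using x0 pow_nonzero by simp_all
    show ?thesis
    proof (cases "Ej \<zero>")
      \<comment> \<open>A coefficient that vanishes modulo \<open>\<M>\<close> takes many leading
        terms, but zero is one of its values and is algebraic over anything.\<close>
      case True
      then show ?thesis using algover_zero[of "pt ` A"] unfolding Ej_def by blast
    next
      case False
      obtain b0 where b0: "b0 \<in> BB x0" using BB_ex by blast
      define e where "e = b0 ! j \<otimes> x0 [^] (r - j)"
      have b0j: "b0 ! j \<in> \<O>" using b0 j unfolding BB_def by simp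
      have ec: "e \<in> carrier K" unfolding e_def using b0j xp by simp
      have upd: "b0[j := w] \<in> BB x0" if w: "w \<in> \<O>" "w \<ominus> b0 ! j \<in> \<M>" for w
      proof (rule BB_close[OF b0])
        show "b0[j := w] \<in> tuples K (Suc r)" using BO[OF b0] w(1) set_update_subset_insert[of b0 j w]
          by (auto simp: tuples_iff)
        show "b0[j := w] ! r = \<one>" using b0 j unfolding BB_def by simp
        show "b0[j := w] ! i \<in> \<O>" if "i < Suc r" for i
          using that w(1) b0 BO(3)[OF b0] unfolding BB_def by (cases "i = j") simp_all
        show "b0[j := w] ! i \<ominus> b0 ! i \<in> \<M>" if "i < r" for i
          using that w(2) b0 BO(3)[OF b0] unfolding BB_def by (cases "i = j") simp_all
      qed
      have lj: "j < length b0" using BO(3)[OF b0] j by simp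
      \<comment> \<open>A coefficient in \<open>\<M>\<close> could be replaced by zero inside
        \<open>BB x0\<close>. Being a unit, it is determined up to a factor in
        \<open>1 + \<M>\<close>, so that \<open>Ej\<close> becomes exactly one class of
        \<open>rv\<close>.\<close>
      have b0M: "b0 ! j \<notin> \<M>"
      proof
        assume M: "b0 ! j \<in> \<M>"
        then have "b0[j := \<zero>] \<in> BB x0" using upd[of \<zero>] by simp
        then have "Ej \<zero>" unfolding Ej_def using lj xp by (intro bexI[of _ "b0[j := \<zero>]"]) simp_all
        then show False using False by simp
      qed
      have Ej_iff: "Ej z \<longleftrightarrow> rv K z = rv K e" if z: "z \<in> carrier K" for z
      proof
        assume "Ej z"
        then obtain b where b: "b \<in> BB x0" "z = b ! j \<otimes> x0 [^] (r - j)" unfolding Ej_def by blast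
        have bj: "b ! j \<in> \<O>" using b j unfolding BB_def by simp
        let ?m = "b ! j \<ominus> b0 ! j"
        have m: "?m \<in> \<M>" by (rule BB_uniq[OF b(1) b0 j])
        note iv = unitD[OF b0j b0M]
        have "(?m \<otimes> inv (b0 ! j)) \<otimes> e = ?m \<otimes> (inv (b0 ! j) \<otimes> b0 ! j) \<otimes> x0 [^] (r - j)"
          unfolding e_def using b0j bj iv xp by (simp add: m_assoc del: inv_simps(3-5))
        also have "\<dots> = z \<ominus> e" unfolding e_def b(2) using b0j bj iv xp by (simp add: l_diff_distr)
        finally have "sm (z \<ominus> e) e" using sm_M[of "?m \<otimes> inv (b0 ! j)" e] m iv(2) by simp
        then show "rv K z = rv K e" using rv_eq_iff[OF ec z] by simp
      next
        assume "rv K z = rv K e"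
        then have "[z] \<in> rv K e" using rv_mem_iff[OF ec] z by simp
        then obtain m where m: "m \<in> \<M>" "z = e \<otimes> (\<one> \<oplus> m)" unfolding rv_mem by blast
        let ?w = "b0 ! j \<otimes> (\<one> \<oplus> m)"
        have wO: "?w \<in> \<O>" using b0j m(1) by simp
        have "?w \<ominus> b0 ! j = b0 ! j \<otimes> m" using b0j m(1) by (simp add: r_distr add_sub_cancel)
        then have "b0[j := ?w] \<in> BB x0" using upd[OF wO] b0j m(1) by simp
        moreover have "z = ?w \<otimes> x0 [^] (r - j)" unfolding m(2) e_def using b0j m(1) xp by (simp add: m_ac)
        ultimately show "Ej z" unfolding Ej_def using lj by (intro bexI[of _ "b0[j := ?w]"]) simp_all
      qed
      \<comment> \<open>The base point \<open>x0\<close> is no parameter from \<open>A\<close>; it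
        is replaced by a quantified \<open>y\<close> with leading term in \<open>D\<close>, and
        \<open>BB_base\<close> shows that the same set results.\<close>
      define \<Psi> where "\<Psi> = (\<lambda>l. \<exists>y\<in>carrier K. \<Phi> (y # tl l) \<and> (\<exists>b\<in>tuples K (Suc r). b ! r = \<one> \<and> (\<forall>i<Suc r. b ! i \<in> \<O>) \<and>
         (\<forall>t\<in>carrier K. \<Phi> ((y \<otimes> t) # tl l) \<longrightarrow> ev b t \<in> \<M>) \<and> l ! 0 = b ! j \<otimes> y [^] (r - j)))"
      have LP: "LDef (Suc (length as)) \<Psi>" unfolding LDef_def \<Psi>_def
        by (intro def_intros LDef_app[OF L] Tm_pow Tm_ev tml_intros) ((rule refl | simp add: j less_SucI)+)?
      have \<Psi>: "\<Psi> (z # as) \<longleftrightarrow> Ej z" if z: "z \<in> carrier K" for z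
      proof -
        have "\<Psi> (z # as) \<longleftrightarrow> (\<exists>y\<in>carrier K. rv K y \<in> D \<and> (\<exists>b\<in>BB y. z = b ! j \<otimes> y [^] (r - j)))"
          unfolding \<Psi>_def BB_def list.sel nth_Cons_0 using \<Phi> by (auto cong: bex_cong)
        also have "\<dots> \<longleftrightarrow> Ej z"
        proof
          assume "\<exists>y\<in>carrier K. rv K y \<in> D \<and> (\<exists>b\<in>BB y. z = b ! j \<otimes> y [^] (r - j))"
          then obtain y b where yb: "y \<in> carrier K" "rv K y \<in> D" "b \<in> BB y" "z = b ! j \<otimes> y [^] (r - j)" by blast
          from BB_base[OF yb(1-3)] obtain b' where "b' \<in> BB x0" "\<forall>j<Suc r. b ! j \<otimes> y [^] (r - j) = b' ! j \<otimes> x0 [^] (r - j)"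
            by blast
          then show "Ej z" unfolding Ej_def yb(4) using j by (meson less_SucI)
        next
          assume "Ej z"
          then show "\<exists>y\<in>carrier K. rv K y \<in> D \<and> (\<exists>b\<in>BB y. z = b ! j \<otimes> y [^] (r - j))"
            unfolding Ej_def using x0(1) D(3) by blast
        qed
        finally show ?thesis .
      qed
      have "\<exists>x\<in>carrier K. rv K x = rv K e \<and> algover (pt ` A) pt x"
      proof (rule effective_lift[OF A, of "map pt as" \<Psi> e])
        show "set (map pt as) \<subseteq> pt ` A" using as by auto
        show "LDef (Suc (length (map pt as))) \<Psi>" using LP by simp
        show "\<Psi> (y # ws) \<longleftrightarrow> rv K y = rv K e" if "y \<in> carrier K" "rep ws (map pt as)" for y ws
          using that(2) \<Psi>[OF that(1)] Ej_iff[OF that(1)] unfolding rep_pt[OF asc] by simp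
      qed (rule ec)
      then show ?thesis using Ej_iff unfolding Ej_def by blast
    qed
  qed
  then have "\<forall>j\<in>{..<r}. \<exists>c. c \<in> carrier K \<and> algover (pt ` A) pt c \<and> (\<exists>b\<in>BB x0. c = b ! j \<otimes> x0 [^] (r - j))" by blast
  then obtain g where g: "\<And>j. j < r \<Longrightarrow> g j \<in> carrier K \<and> algover (pt ` A) pt (g j) \<and> (\<exists>b\<in>BB x0. g j = b ! j \<otimes> x0 [^] (r - j))"
    unfolding bchoice_iff by auto
  then have "\<forall>j\<in>{..<r}. \<exists>b. b \<in> BB x0 \<and> g j = b ! j \<otimes> x0 [^] (r - j)" by blast
  then obtain B where B: "\<And>j. j < r \<Longrightarrow> B j \<in> BB x0 \<and> g j = B j ! j \<otimes> x0 [^] (r - j)"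
    unfolding bchoice_iff by auto
  \<comment> \<open>\<open>cs\<close> are the algebraic coefficients below the leading one,
    \<open>bs\<close> the same polynomial in the variable divided by \<open>x0\<close>. Each
    coefficient was lifted with its own member of \<open>BB x0\<close>; by \<open>BB_uniq\<close>
    and \<open>BB_close\<close> the mixture is again a member.\<close>
  define cs where "cs = map g [0..<r]"
  define bs where "bs = map (\<lambda>j. B j ! j) [0..<r] @ [\<one>]"
  have csc: "set cs \<subseteq> carrier K" unfolding cs_def using g by auto
  have csalg: "algover (pt ` A) pt c" if "c \<in> set cs" for c using that g unfolding cs_def by auto
  obtain b0 where b0: "b0 \<in> BB x0" using BB_ex by blast
  have BjO: "B j ! j \<in> \<O>" if "j < r" for j using B[OF that] that unfolding BB_def by simp
  have bs_nth: "bs ! j = B j ! j" if "j < r" for j using that unfolding bs_def by (simp add: nth_append)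
  have bs_r: "bs ! r = \<one>" and lbs: "length bs = Suc r" unfolding bs_def by (simp_all add: nth_append)
  have bsO: "bs ! j \<in> \<O>" if "j < Suc r" for j
    using that bs_nth[of j] BjO[of j] bs_r by (cases "j = r") simp_all
  have bs: "bs \<in> BB x0"
  proof (rule BB_close[OF b0 _ bs_r bsO])
    show "bs \<in> tuples K (Suc r)" using lbs bsO O_carrier by (auto simp: tuples_iff in_set_conv_nth)
    show "bs ! i \<ominus> b0 ! i \<in> \<M>" if "i < r" for i
      unfolding bs_nth[OF that] using BB_uniq[OF _ b0 that, of "B i"] B[OF that] by blast
  qed
  have bsc: "set bs \<subseteq> carrier K" and bsO': "set bs \<subseteq> \<O>" using BO[OF bs] by blast+
  have cs_sc: "cs @ [\<one>] = sc x0 bs"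
  proof (rule nth_equalityI)
    show "length (cs @ [\<one>]) = length (sc x0 bs)" unfolding cs_def using lbs by simp
    fix j assume "j < length (cs @ [\<one>])"
    then have j: "j < Suc r" unfolding cs_def by simp
    show "(cs @ [\<one>]) ! j = sc x0 bs ! j"
    proof (cases "j = r")
      case True
      then show ?thesis using sc_nth[of j bs x0] lbs bs_r unfolding cs_def by (simp add: nth_append)
    next
      case False
      then have "j < r" using j by simp
      then show ?thesis using sc_nth[of j bs x0] lbs bs_nth B unfolding cs_def by (simp add: nth_append)
    qed
  qed
  define P where "P = ev (cs @ [\<one>])"
  have Pc: "P x \<in> carrier K" if "x \<in> carrier K" for x unfolding P_def using that csc by simp
  have P_ev: "P (x0 \<otimes> t) \<otimes> x0 = x0 [^] Suc r \<otimes> ev bs t" if "t \<in> carrier K" for t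
    unfolding P_def cs_sc using ev_sc[OF bsc x0(1) that] lbs by simp
  \<comment> \<open>In the rescaled variable \<open>x0\<close> becomes \<open>\<one>\<close>;
    \<open>?q\<close> is the derivative of the polynomial there.\<close>
  let ?Q = "sd \<one> bs" let ?q = "ev ?Q \<one>" let ?p = "ev bs \<one>"
  have QO: "set ?Q \<subseteq> \<O>" by (rule sd_O[OF bsO']) simp
  have Qc: "set ?Q \<subseteq> carrier K" using QO O_carrier by blast
  have lQ: "length ?Q = length ts" using length_sd[of \<one> bs] lbs unfolding r_def by simp
  have qO: "?q \<in> \<O>" using ev_O[OF QO] by simp
  have pM: "?p \<in> \<M>" using bs D(3) x0(1) unfolding BB_def by simp
  \<comment> \<open>The root \<open>\<one>\<close> is simple modulo \<open>\<M>\<close>: otherwise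
    the monic quotient, with only \<open>r\<close> coefficients, would vanish modulo
    \<open>\<M>\<close> at all \<open>r\<close> residues.\<close>
  have qM: "?q \<notin> \<M>"
  proof
    assume qM: "?q \<in> \<M>"
    have "set ?Q \<subseteq> \<M>"
    proof (rule too_many_roots[OF lQ QO tsO sep_ts])
      fix s assume s: "s \<in> set ts"
      have sO: "s \<in> \<O>" using s tsO by blast
      then have sc: "s \<in> carrier K" by simp
      have evs: "ev ?Q s \<in> carrier K" using Qc sc by simp
      show "ev ?Q s \<in> \<M>"
      proof (cases "s \<ominus> \<one> \<in> \<M>")
        case True
        have "ev ?Q s \<ominus> ?q \<in> \<M>" by (rule ev_diff_M[OF QO sO _ True]) simp
        then have "(ev ?Q s \<ominus> ?q) \<oplus> ?q \<in> \<M>" using qM by simp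
        moreover have "(ev ?Q s \<ominus> ?q) \<oplus> ?q = ev ?Q s" using evs qO by (simp add: ring_arith)
        ultimately show ?thesis by simp
      next
        case False
        have "ev bs s \<in> \<M>" using bs ts_D[OF s] sc unfolding BB_def by blast
        then have "(s \<ominus> \<one>) \<otimes> ev ?Q s \<in> \<M>" using ev_sd[OF bsc sc one_closed] pM by (metis M_minus)
        then show ?thesis using M_times_cancel[OF _ False evs] sO by simp
      qed
    qed
    moreover have "last ?Q = \<one>" using last_sd[of bs \<one>] lbs r bsc bs_r last_conv_nth[of bs] by force
    moreover have "?Q \<noteq> []" using lQ r unfolding r_def by auto
    ultimately have "\<one> \<in> \<M>" using last_in_set[of ?Q] by auto
    then show False by simp
  qed
  note qu = unitD[OF qO qM]
  have shift: "\<exists>m'\<in>\<M>. ev bs (\<one> \<oplus> m) = ?p \<oplus> m \<otimes> (?q \<oplus> m')" if m: "m \<in> \<M>" for m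
  proof -
    let ?t = "\<one> \<oplus> m"
    have t: "?t \<in> \<O>" "?t \<in> carrier K" "?t \<ominus> \<one> = m" using m by (simp_all add: add_sub_cancel)
    let ?m' = "ev ?Q ?t \<ominus> ?q"
    have m': "?m' \<in> \<M>" by (rule ev_diff_M[OF QO t(1)]) (use t(3) m in simp_all)
    have c: "ev bs ?t \<in> carrier K" "?p \<in> carrier K" "ev ?Q ?t \<in> carrier K" "?q \<in> carrier K" "m \<in> carrier K"
      using bsc Qc t(2) m by simp_all
    have "ev bs ?t = ?p \<oplus> (ev bs ?t \<ominus> ?p)" using c by (simp add: add_sub_cancel)
    also have "ev bs ?t \<ominus> ?p = m \<otimes> ev ?Q ?t" using ev_sd[OF bsc t(2) one_closed] t(3) by simp
    also have "ev ?Q ?t = ?q \<oplus> ?m'" using c by (simp add: add_sub_cancel)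
    finally show ?thesis using m' by blast
  qed
  have "\<exists>x'\<in>carrier K. rv K x' = rv K x0 \<and> rv K (P x') \<noteq> rv K (P x0)"
  proof -
    have Px0: "P x0 \<otimes> x0 = x0 [^] Suc r \<otimes> ?p" using P_ev[of \<one>] x0(1) by simp
    have main: "rv K (P (x0 \<otimes> (\<one> \<oplus> m))) \<noteq> rv K (P x0)" if m: "m \<in> \<M>" and "rv K (ev bs (\<one> \<oplus> m)) \<noteq> rv K ?p" for m
    proof
      assume eq: "rv K (P (x0 \<otimes> (\<one> \<oplus> m))) = rv K (P x0)"
      have c: "\<one> \<oplus> m \<in> carrier K" "x0 \<otimes> (\<one> \<oplus> m) \<in> carrier K" using m x0 by simp_all
      let ?X = "x0 [^] Suc r"
      have X: "?X \<in> carrier K" "?X \<noteq> \<zero>" using x0 pow_nonzero[of x0 "Suc r"] by (simp_all del: nat_pow_Suc)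
      have e: "ev bs (\<one> \<oplus> m) \<in> carrier K" "?p \<in> carrier K" using bsc c by simp_all
      have "rv K (P (x0 \<otimes> (\<one> \<oplus> m)) \<otimes> x0) = rv K (P x0 \<otimes> x0)"
        by (rule rv_times_cong) (use eq Pc c x0 in simp_all)
      then have "rv K (?X \<otimes> ev bs (\<one> \<oplus> m)) = rv K (?X \<otimes> ?p)" using P_ev[OF c(1)] Px0 by (simp del: nat_pow_Suc)
      note eq2 = this
      have "rv K (inv ?X \<otimes> (?X \<otimes> ev bs (\<one> \<oplus> m))) = rv K (inv ?X \<otimes> (?X \<otimes> ?p))"
        by (rule rv_times_cong) (use X e eq2 in \<open>simp_all del: nat_pow_Suc\<close>)
      moreover have "inv ?X \<otimes> (?X \<otimes> w) = w" if "w \<in> carrier K" for w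
        using X that by (simp add: m_assoc[symmetric] del: nat_pow_Suc)
      ultimately show False using that(2) e by (simp del: nat_pow_Suc)
    qed
    \<comment> \<open>If the value at \<open>\<one>\<close> is zero, any non-zero displacement makes
      it non-zero, the root being simple. Otherwise a Newton step makes the value strictly smaller.
      Either way the leading term changes.\<close>
    have "\<exists>m\<in>\<M>. rv K (ev bs (\<one> \<oplus> m)) \<noteq> rv K ?p"
    proof (cases "?p = \<zero>")
      case True
      obtain m where m: "m \<in> \<M>" "m \<noteq> \<zero>" using M_nonzero by blast
      obtain m' where m': "m' \<in> \<M>" "ev bs (\<one> \<oplus> m) = ?p \<oplus> m \<otimes> (?q \<oplus> m')" using shift[OF m(1)] by blast
      have "?q \<oplus> m' \<noteq> \<zero>" using unit_plus_M[OF qO qM m'(1)] by auto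
      then have "ev bs (\<one> \<oplus> m) \<noteq> \<zero>" unfolding m'(2) True using m m'(1) qO by simp
      moreover have "ev bs (\<one> \<oplus> m) \<in> carrier K" using bsc m by simp
      ultimately have "rv K (ev bs (\<one> \<oplus> m)) \<noteq> rv K \<zero>" using rv_zero_iff[of "ev bs (\<one> \<oplus> m)"] by simp
      then show ?thesis unfolding True using m(1) by blast
    next
      case False
      let ?m = "\<ominus> (?p \<otimes> inv ?q)"
      have mM: "?m \<in> \<M>" using pM qu by simp
      obtain m' where m': "m' \<in> \<M>" "ev bs (\<one> \<oplus> ?m) = ?p \<oplus> ?m \<otimes> (?q \<oplus> m')" using shift[OF mM] by blast
      have c: "?p \<in> carrier K" "?q \<in> carrier K" "inv ?q \<in> carrier K" "m' \<in> carrier K" "?q \<noteq> \<zero>" using pM qO qu m'(1) by simp_all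
      have mq: "?m \<otimes> ?q = \<ominus> ?p" using c by (simp add: l_minus m_assoc)
      have "ev bs (\<one> \<oplus> ?m) = ?p \<oplus> (?m \<otimes> ?q \<oplus> ?m \<otimes> m')" unfolding m'(2) using c by (simp add: r_distr)
      also have "\<dots> = (?p \<oplus> \<ominus> ?p) \<oplus> ?m \<otimes> m'" unfolding mq using c by (simp add: a_assoc)
      also have "\<dots> = (\<ominus> (inv ?q \<otimes> m')) \<otimes> ?p" using c by (simp add: r_neg l_minus r_minus m_ac)
      finally have "sm (ev bs (\<one> \<oplus> ?m)) ?p" using sm_M[of "\<ominus> (inv ?q \<otimes> m')" ?p] m'(1) qu(2) by simp
      moreover have "rv K (ev bs (\<one> \<oplus> ?m)) \<noteq> rv K ?p" if s: "sm (ev bs (\<one> \<oplus> ?m)) ?p"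
      proof
        assume eq: "rv K (ev bs (\<one> \<oplus> ?m)) = rv K ?p"
        have ec: "ev bs (\<one> \<oplus> ?m) \<in> carrier K" using bsc mM by simp
        have "sm (ev bs (\<one> \<oplus> ?m) \<ominus> ?p) ?p" using rv_eq_iff[OF c(1) ec] eq by simp
        from sm_diff[OF s this c(1)] have "sm (ev bs (\<one> \<oplus> ?m) \<ominus> (ev bs (\<one> \<oplus> ?m) \<ominus> ?p)) ?p" .
        moreover have "ev bs (\<one> \<oplus> ?m) \<ominus> (ev bs (\<one> \<oplus> ?m) \<ominus> ?p) = ?p"
          using ec c(1) by (simp only: diff_diff_eq2 add_sub_cancel)
        ultimately show False using sm_self[OF _ c(1)] False by simp
      qed
      ultimately show ?thesis using mM by blast
    qed
    then obtain m where m: "m \<in> \<M>" "rv K (ev bs (\<one> \<oplus> m)) \<noteq> rv K ?p" by blast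
    have "rv K (x0 \<otimes> (\<one> \<oplus> m)) = rv K x0" by (rule rv_mult_unit[OF x0(1) m(1)])
    then show ?thesis using main[OF m] m(1) x0(1) by (intro bexI[of _ "x0 \<otimes> (\<one> \<oplus> m)"]) simp_all
  qed
  then obtain x' where x': "x' \<in> carrier K" "rv K x' = rv K x0" "rv K (P x') \<noteq> rv K (P x0)" by blast
  \<comment> \<open>The set where \<open>P\<close> has the leading term it has at \<open>x0\<close>:
    the coefficients are parameters from the field, and \<open>rv K (P x0)\<close> is a parameter
    from \<open>RV\<close>.\<close>
  define \<Theta> where "\<Theta> = (\<lambda>l. rv K (ev (map (\<lambda>i. l ! Suc i) [0..<r] @ [\<one>]) (l ! 0)) = rv K (l ! Suc r))"
  let ?ps = "map pt cs @ [rv K (P x0)]"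
  have lp: "length ?ps = Suc r" unfolding cs_def by simp
  have LT: "LDef (Suc (length ?ps)) \<Theta>" unfolding LDef_def \<Theta>_def lp
  proof (rule Def_rv)
    show "Tm (\<lambda>e. map e [0..<Suc (Suc r)] ! Suc r)" by (rule Tm_nth_map) (simp_all add: tm_intros)
    have "TmL r (\<lambda>e. map (\<lambda>i. map e [0..<Suc (Suc r)] ! Suc i) [0..<r])"
      unfolding cotermL_def
    proof (intro conjI allI impI)
      fix i assume i: "i < r"
      have "Tm (\<lambda>e. e (Suc i))" by (rule tm_intros)
      moreover have "(\<lambda>e. map (\<lambda>i. map e [0..<Suc (Suc r)] ! Suc i) [0..<r] ! i) = (\<lambda>e::nat \<Rightarrow> 'a. e (Suc i))"
        using i by (simp add: fun_eq_iff del: upt_Suc)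
      ultimately show "Tm (\<lambda>e. map (\<lambda>i. map e [0..<Suc (Suc r)] ! Suc i) [0..<r] ! i)" by simp
    qed simp_all
    from tml_intros0(3)[OF this tml_intros0(2)[OF tm_intros(3) tml_intros0(1)[OF refl] refl] refl]
    have T1: "TmL (r + Suc 0) (\<lambda>e. map (\<lambda>i. map e [0..<Suc (Suc r)] ! Suc i) [0..<r] @ [\<one>])" .
    have T2: "Tm (\<lambda>e. map e [0..<Suc (Suc r)] ! 0)" by (rule Tm_nth_map) (simp_all add: tm_intros)
    show "Tm (\<lambda>e. ev (map (\<lambda>i. map e [0..<Suc (Suc r)] ! Suc i) [0..<r] @ [\<one>]) (map e [0..<Suc (Suc r)] ! 0))"
      by (rule Tm_ev[OF T1 T2])
  qed
  define X where "X = {x \<in> carrier K. rv K (P x) = rv K (P x0)}"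
  have "\<exists>c\<in>carrier K. rv K c = rv K x0 \<and> algover (pt ` (A \<union> set cs)) pt c"
  proof (rule split_center[OF _ _ LT, of "A \<union> set cs" X x0 x'])
    show "A \<union> set cs \<subseteq> carrier K" using A csc by blast
    show "set ?ps \<subseteq> pt ` (A \<union> set cs) \<union> RV K" using Pc[OF x0(1)] unfolding RV_def by auto
    show "X \<subseteq> carrier K" unfolding X_def by blast
    show "x0 \<in> X" "x' \<in> carrier K" "x' \<notin> X" "rv K x0 = rv K x'" using x0 x' unfolding X_def by simp_all
    fix x ws assume x: "x \<in> carrier K" and ws: "rep ws ?ps"
    obtain us vs where uv: "ws = us @ vs" "rep us (map pt cs)" "rep vs [rv K (P x0)]" using rep_append_ex[OF ws] by blast
    have us: "us = cs" using uv(2) rep_pt[OF csc] by simp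
    obtain w where w: "vs = [w]" "[w] \<in> rv K (P x0)" using uv(3) by (auto simp: rep_def list_all2_Cons2)
    have rw: "rv K w = rv K (P x0)" using w(2) rv_mem_iff[OF Pc[OF x0(1)]] by simp
    have lcs: "length cs = r" unfolding cs_def by simp
    have ws_eq: "ws = cs @ [w]" using uv us w by simp
    have m: "map (\<lambda>i. (x # ws) ! Suc i) [0..<r] = cs"
      by (rule nth_equalityI) (simp_all add: lcs ws_eq nth_append)
    have l: "(x # ws) ! Suc r = w" using lcs ws_eq by (simp add: nth_append)
    show "x \<in> X \<longleftrightarrow> \<Theta> (x # ws)" unfolding \<Theta>_def m l X_def nth_Cons_0 rw P_def[symmetric] using x by simp
  qed
  then obtain c where c: "c \<in> carrier K" "rv K c = rv K x0" "algover (pt ` (A \<union> set cs)) pt c" by blast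
  have "algover (pt ` A) pt c"
    by (rule algover_trans_set[OF finite_set csc A csalg c(1,3)])
  then show ?thesis using c by blast
qed

end

section \<open>Full-dimensional points and exchange\<close>

lemma indl_nth: "indl c P xs \<longleftrightarrow> (\<forall>i<length xs. xs ! i \<notin> c (P \<union> set (take i xs)))"
proof (induction xs arbitrary: P)
  case (Cons x xs)
  have "(\<forall>i<length (x # xs). (x # xs) ! i \<notin> c (P \<union> set (take i (x # xs)))) \<longleftrightarrow>
      x \<notin> c P \<and> (\<forall>i<length xs. xs ! i \<notin> c (insert x P \<union> set (take i xs)))"
    by (simp add: All_less_Suc2)
  then show ?case using Cons.IH by simp
qed simp

context vfield
begin

declare O_carrier [simp] M_O [simp]

lemma nat_diff_notin_M: assumes "(n::nat) < k" shows "[k] \<cdot> \<one> \<ominus> [n] \<cdot> \<one> \<notin> \<M>"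
proof -
  have "[n] \<cdot> \<one> \<oplus> [(k - n)] \<cdot> \<one> = [(n + (k - n))] \<cdot> \<one>" by (rule add.nat_pow_mult) simp
  also have "n + (k - n) = k" using assms by simp
  finally have e: "[k] \<cdot> \<one> = [n] \<cdot> \<one> \<oplus> [(k - n)] \<cdot> \<one>" by simp
  have "[k] \<cdot> \<one> \<ominus> [n] \<cdot> \<one> = [(k - n)] \<cdot> \<one>" unfolding e by (rule add_sub_cancel(1)) simp_all
  then show ?thesis using nat_notin_M[of "k - n"] assms by simp
qed

lemma nat_O: "[(n::nat)] \<cdot> \<one> \<in> \<O>"
proof (induction n)
  case 0
  have "[(0::nat)] \<cdot> \<one> = \<zero>" by (rule add.nat_pow_0)
  then show ?case by simp
next
  case (Suc n)
  have "[Suc n] \<cdot> \<one> = [n] \<cdot> \<one> \<oplus> \<one>" by (rule add.nat_pow_Suc)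
  then show ?case using Suc by simp
qed

lemma nat_inj: assumes "n \<noteq> k" shows "[(n::nat)] \<cdot> \<one> \<ominus> [(k::nat)] \<cdot> \<one> \<notin> \<M>"
proof (cases "n < k")
  case True
  have c: "[n] \<cdot> \<one> \<in> carrier K" "[k] \<cdot> \<one> \<in> carrier K" by simp_all
  show ?thesis
  proof
    assume "[n] \<cdot> \<one> \<ominus> [k] \<cdot> \<one> \<in> \<M>"
    from M_uminus[OF this] show False using nat_diff_notin_M[OF True] uminus_diff[OF c] by simp
  qed
next
  case False
  then have "k < n" using assms by simp
  then show ?thesis by (rule nat_diff_notin_M)
qed

text \<open>For a non-zero \<open>m\<close> in \<open>\<M>\<close> the points
  \<open>x (1 + n m)\<close> are pairwise distinct, because different natural numbers differ by a
  unit.\<close>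

lemma rv_class_infinite:
  assumes x: "x \<in> carrier K" "x \<noteq> \<zero>" shows "infinite {y \<in> carrier K. rv K y = rv K x}"
proof -
  obtain m where m: "m \<in> \<M>" "m \<noteq> \<zero>" using M_nonzero by blast
  define g where "g = (\<lambda>n::nat. x \<otimes> (\<one> \<oplus> [n] \<cdot> \<one> \<otimes> m))"
  have "inj g"
  proof (rule injI, rule ccontr)
    fix n k assume gk: "g n = g k" and nk: "n \<noteq> k"
    have c: "[n] \<cdot> \<one> \<in> carrier K" "[k] \<cdot> \<one> \<in> carrier K" "m \<in> carrier K" using m by simp_all
    have "\<one> \<oplus> [n] \<cdot> \<one> \<otimes> m = \<one> \<oplus> [k] \<cdot> \<one> \<otimes> m"
      using gk x c m_lcancel[of x] unfolding g_def by simp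
    then have "[n] \<cdot> \<one> \<otimes> m = [k] \<cdot> \<one> \<otimes> m" using c by simp
    then have "[n] \<cdot> \<one> = [k] \<cdot> \<one>" using m_rcancel[of m] c m(2) by simp
    then have "[n] \<cdot> \<one> \<ominus> [k] \<cdot> \<one> = \<zero>" using c by simp
    then show False using nat_inj[OF nk] by simp
  qed
  moreover have "g n \<in> {y \<in> carrier K. rv K y = rv K x}" for n
  proof -
    have "[n] \<cdot> \<one> \<otimes> m \<in> \<M>" using M_times(2)[OF m(1) nat_O] .
    then show ?thesis using rv_mult_unit[OF x(1)] x(1) unfolding g_def by simp
  qed
  ultimately show ?thesis using infinite_iff_countable_subset by blast
qed

declare O_carrier [simp del] M_O [simp del]

section \<open>Tuples whose product of balls no formula splits\<close>

lemma RVx_pow_iff: "\<xi> \<in> RVx_pow K n \<longleftrightarrow> length \<xi> = n \<and> set \<xi> \<subseteq> RVx K"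
  unfolding RVx_pow_def listset_replicate by simp

lemma RVx_pow_rep: assumes "\<xi> \<in> RVx_pow K n" shows "\<exists>xs\<in>tuples K n. \<zero> \<notin> set xs \<and> \<xi> = map (rv K) xs"
proof -
  have l: "length \<xi> = n" and "set \<xi> \<subseteq> rv K ` (carrier K - {\<zero>})" using assms unfolding RVx_pow_iff RVx_def by blast+
  from map_ex[OF this(2)] obtain xs where xs: "set xs \<subseteq> carrier K - {\<zero>}" "map (rv K) xs = \<xi>" by blast
  then have "length xs = n" using l by auto
  then show ?thesis using xs by (intro bexI[of _ xs]) (auto simp: tuples_iff)
qed

text \<open>A leading term is algebraic over itself, and a point is finer information than its
  leading term.\<close>

lemma algover_rv: assumes "P \<subseteq> PRV" "c \<in> carrier K" "algover P pt c" shows "algover P (rv K) c"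
proof -
  have "alg (rv K) [rv K c] (rv K c)" by (rule alg_refl) (use assms kap_PRV in simp_all)
  then have "alg (rv K) [pt c] (rv K c)"
    by (rule alg_finer) (use rv_self[OF assms(2)] in \<open>simp add: pt_def\<close>)
  then have "algover (insert (pt c) P) (rv K) c" unfolding algover_def by (intro exI[of _ "[pt c]"]) simp
  then show ?thesis by (rule algover_trans[OF kap_simps(2,1) assms(1,2)]) (rule assms(3))
qed

text \<open>\<open>full_dimensional\<close> for formulas whose truth does not depend on the chosen
  representatives of the parameters. Since the coordinates occur only as variables, invariance under
  permutation is a matter of renaming.\<close>

definition unsplit :: "'a imag list \<Rightarrow> bool" where
  "unsplit \<xi> \<longleftrightarrow> (\<forall>ps \<Phi>. set ps \<subseteq> RV K \<longrightarrow> LDef (length \<xi> + length ps) \<Phi> \<longrightarrow>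
     (\<forall>ys\<in>tuples K (length \<xi>). \<forall>ws ws'. rep ws ps \<longrightarrow> rep ws' ps \<longrightarrow> \<Phi> (ys @ ws) = \<Phi> (ys @ ws')) \<longrightarrow>
     (\<forall>ys\<in>tuples K (length \<xi>). \<forall>ys'\<in>tuples K (length \<xi>). map (rv K) ys = \<xi> \<longrightarrow> map (rv K) ys' = \<xi> \<longrightarrow>
        (\<forall>ws. rep ws ps \<longrightarrow> \<Phi> (ys @ ws) \<longrightarrow> \<Phi> (ys' @ ws))))"

lemma map_pt_inj: "map pt xs = map pt ys \<longleftrightarrow> xs = ys"
  by (rule inj_map_eq_map) (auto simp: inj_on_def pt_def)

lemma unsplit_iff: assumes \<xi>: "\<xi> \<in> RVx_pow K n" shows "full_dimensional K n \<xi> \<longleftrightarrow> unsplit \<xi>"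
proof -
  have len: "length \<xi> = n" using \<xi> RVx_pow_iff by blast
  have sub: "map pt ` X \<subseteq> listset (replicate n (pt ` carrier K))" if "X \<subseteq> tuples K n" for X
  proof (rule image_subsetI)
    fix x assume "x \<in> X"
    then have "x \<in> tuples K n" using that by blast
    then show "map pt x \<in> listset (replicate n (pt ` carrier K))" by (auto simp: listset_replicate tuples_iff)
  qed
  have im: "map pt ys \<in> map pt ` X \<longleftrightarrow> ys \<in> X" for ys X
    unfolding image_iff map_pt_inj by blast
  show ?thesis
  proof
    assume f: "full_dimensional K n \<xi>"
    show "unsplit \<xi>" unfolding unsplit_def len
    proof (intro allI impI ballI)
      fix ps \<Phi> ys ys' ws
      assume ps: "set ps \<subseteq> RV K" and L: "LDef (n + length ps) \<Phi>"
        and inv: "\<forall>ys\<in>tuples K n. \<forall>ws ws'. rep ws ps \<longrightarrow> rep ws' ps \<longrightarrow> \<Phi> (ys @ ws) = \<Phi> (ys @ ws')"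
        and y: "ys \<in> tuples K n" "ys' \<in> tuples K n" "map (rv K) ys = \<xi>" "map (rv K) ys' = \<xi>" "rep ws ps" "\<Phi> (ys @ ws)"
      define X where "X = {zs \<in> tuples K n. \<Phi> (zs @ ws)}"
      have XT: "X \<subseteq> tuples K n" unfolding X_def by blast
      have "definable K (replicate n (pt ` carrier K)) (RV K) (map pt ` X)"
      proof (rule definableI[OF kap_simps(1) RVx_PRV(2) sub[OF XT] ps L])
        fix zs vs assume "zs \<in> tuples K n" "rep vs ps"
        then show "map pt zs \<in> map pt ` X \<longleftrightarrow> \<Phi> (zs @ vs)" unfolding im X_def using inv y(5) by blast
      qed
      then have "definableK K n (RV K) X" unfolding definableK_def .
      then have "X \<inter> {x \<in> tuples K n. map (rv K) x = \<xi>} = {} \<or> {x \<in> tuples K n. map (rv K) x = \<xi>} \<subseteq> X"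
        using f XT unfolding full_dimensional_def by blast
      moreover have "ys \<in> X \<inter> {x \<in> tuples K n. map (rv K) x = \<xi>}" using y unfolding X_def by blast
      ultimately have "ys' \<in> X" using y by blast
      then show "\<Phi> (ys' @ ws)" unfolding X_def by blast
    qed
  next
    assume u: "unsplit \<xi>"
    show "full_dimensional K n \<xi>" unfolding full_dimensional_def
    proof (intro conjI \<xi> allI impI)
      fix X assume XT: "X \<subseteq> tuples K n" and dX: "definableK K n (RV K) X"
      obtain ps \<Phi> where ps: "set ps \<subseteq> RV K" and L: "LDef (n + length ps) \<Phi>"
        and X: "\<And>ys ws. ys \<in> tuples K n \<Longrightarrow> rep ws ps \<Longrightarrow> map pt ys \<in> map pt ` X \<longleftrightarrow> \<Phi> (ys @ ws)"
        using definableE[OF kap_simps(1) RVx_PRV(2) sub[OF XT] dX[unfolded definableK_def]] by blast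
      have X': "ys \<in> X \<longleftrightarrow> \<Phi> (ys @ ws)" if "ys \<in> tuples K n" "rep ws ps" for ys ws
        using X[OF that] unfolding im .
      obtain ws where ws: "rep ws ps" using rep_ex[of ps] ps RVx_PRV(2) by blast
      have inv: "\<forall>ys\<in>tuples K n. \<forall>ws ws'. rep ws ps \<longrightarrow> rep ws' ps \<longrightarrow> \<Phi> (ys @ ws) = \<Phi> (ys @ ws')"
        using X' by blast
      have "ys' \<in> X" if "ys \<in> tuples K n" "ys' \<in> tuples K n" "map (rv K) ys = \<xi>" "map (rv K) ys' = \<xi>" "ys \<in> X" for ys ys'
        using u[unfolded unsplit_def len, rule_format, OF ps L inv[rule_format], of ys ys' ws] X' that ws by blast
      then show "X \<inter> {x \<in> tuples K n. map (rv K) x = \<xi>} = {} \<or> {x \<in> tuples K n. map (rv K) x = \<xi>} \<subseteq> X"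
        by blast
    qed
  qed
qed

text \<open>Composition with the transposition of the last two variables maps the formulas tested
  for one order to those tested for the other.\<close>

lemma unsplit_swap: assumes u: "unsplit (\<beta> @ [\<xi>, \<eta>])" shows "unsplit (\<beta> @ [\<eta>, \<xi>])"
  unfolding unsplit_def
proof (intro allI impI ballI)
  fix ps \<Phi> ys ys' ws
  let ?b = "length \<beta>"
  let ?n = "length (\<beta> @ [\<eta>, \<xi>])"
  have n2: "length (\<beta> @ [\<xi>, \<eta>]) = ?n" by simp
  assume ps: "set ps \<subseteq> RV K" and L: "LDef (?n + length ps) \<Phi>"
    and inv: "\<forall>ys\<in>tuples K ?n. \<forall>ws ws'. rep ws ps \<longrightarrow> rep ws' ps \<longrightarrow> \<Phi> (ys @ ws) = \<Phi> (ys @ ws')"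
    and y: "ys \<in> tuples K ?n" "ys' \<in> tuples K ?n" "map (rv K) ys = \<beta> @ [\<eta>, \<xi>]" "map (rv K) ys' = \<beta> @ [\<eta>, \<xi>]" "rep ws ps" "\<Phi> (ys @ ws)"
  define g where "g = (\<lambda>i. if i = ?b then Suc ?b else if i = Suc ?b then ?b else i)"
  define h where "h = (\<lambda>l::'a list. map (\<lambda>i. l ! g i) [0..<?n + length ps])"
  have g: "g i < ?n + length ps" if "i < ?n + length ps" for i using that unfolding g_def by auto
  have "TmL (?n + length ps) (\<lambda>e. h (map e [0..<?n + length ps]))" unfolding h_def cotermL_def
  proof (intro conjI allI impI)
    fix i assume i: "i < ?n + length ps"
    have "Tm (\<lambda>e. e (g i))" by (rule tm_intros)
    moreover have "(\<lambda>e. map (\<lambda>i. map e [0..<?n + length ps] ! g i) [0..<?n + length ps] ! i) = (\<lambda>e::nat \<Rightarrow> 'a. e (g i))"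
      using g[OF i] i by (simp add: fun_eq_iff del: upt_Suc)
    ultimately show "Tm (\<lambda>e. map (\<lambda>i. map e [0..<?n + length ps] ! g i) [0..<?n + length ps] ! i)" by simp
  qed simp_all
  from LDef_app[OF L this] have L': "LDef (length (\<beta> @ [\<xi>, \<eta>]) + length ps) (\<lambda>l. \<Phi> (h l))" unfolding LDef_def n2 .
  have h: "h ((us @ [b, a]) @ vs) = (us @ [a, b]) @ vs" if "length us = ?b" "length vs = length ps" for us a b vs
  proof (rule nth_equalityI)
    show "length (h ((us @ [b, a]) @ vs)) = length ((us @ [a, b]) @ vs)" using that by (simp add: h_def)
    fix i assume "i < length (h ((us @ [b, a]) @ vs))"
    then have i: "i < ?n + length ps" by (simp add: h_def)
    then have "h ((us @ [b, a]) @ vs) ! i = ((us @ [b, a]) @ vs) ! g i" unfolding h_def by (simp del: upt_Suc)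
    also have "\<dots> = ((us @ [a, b]) @ vs) ! i"
      using that i unfolding g_def by (auto simp: nth_append nth_Cons' Suc_diff_le)
    finally show "h ((us @ [b, a]) @ vs) ! i = ((us @ [a, b]) @ vs) ! i" .
  qed
  have split: "\<exists>us a b. zs = us @ [a, b] \<and> length us = ?b \<and> set us \<subseteq> carrier K \<and> a \<in> carrier K \<and> b \<in> carrier K"
    if "zs \<in> tuples K ?n" for zs
  proof -
    have l: "length zs = Suc (Suc ?b)" "set zs \<subseteq> carrier K" using that by (auto simp: tuples_iff)
    then obtain us1 b where 1: "zs = us1 @ [b]" by (cases zs rule: rev_cases) auto
    then obtain us a where 2: "us1 = us @ [a]" using l(1) by (cases us1 rule: rev_cases) auto
    show ?thesis using l 1 2 by (intro exI[of _ us] exI[of _ a] exI[of _ b]) auto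
  qed
  have lr: "length vs = length ps" if "rep vs ps" for vs using that by (simp add: rep_def list_all2_lengthD)
  obtain us a b where s: "ys = us @ [a, b]" "length us = ?b" "set us \<subseteq> carrier K" "a \<in> carrier K" "b \<in> carrier K"
    using split[OF y(1)] by blast
  obtain us' a' b' where s': "ys' = us' @ [a', b']" "length us' = ?b" "set us' \<subseteq> carrier K" "a' \<in> carrier K" "b' \<in> carrier K"
    using split[OF y(2)] by blast
  have "\<forall>ys\<in>tuples K (length (\<beta> @ [\<xi>, \<eta>])). \<forall>ws ws'. rep ws ps \<longrightarrow> rep ws' ps \<longrightarrow> \<Phi> (h (ys @ ws)) = \<Phi> (h (ys @ ws'))"
    unfolding n2
  proof (intro ballI allI impI)
    fix zs ws ws' assume z: "zs \<in> tuples K ?n" and w: "rep ws ps" "rep ws' ps"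
    obtain us a b where s: "zs = us @ [b, a]" "length us = ?b" "set us \<subseteq> carrier K" "a \<in> carrier K" "b \<in> carrier K"
      using split[OF z] by blast
    have "us @ [a, b] \<in> tuples K ?n" using s by (simp add: tuples_iff)
    then show "\<Phi> (h (zs @ ws)) = \<Phi> (h (zs @ ws'))"
      unfolding s(1) h[OF s(2) lr[OF w(1)]] h[OF s(2) lr[OF w(2)]] using inv w by blast
  qed
  note inv' = this
  have t: "us @ [b, a] \<in> tuples K (length (\<beta> @ [\<xi>, \<eta>]))" "us' @ [b', a'] \<in> tuples K (length (\<beta> @ [\<xi>, \<eta>]))"
    using s s' by (simp_all add: tuples_iff)
  have m: "map (rv K) (us @ [b, a]) = \<beta> @ [\<xi>, \<eta>]" "map (rv K) (us' @ [b', a']) = \<beta> @ [\<xi>, \<eta>]"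
    using y(3,4) s(1,2) s'(1,2) by simp_all
  have "\<Phi> (h ((us @ [b, a]) @ ws))" unfolding h[OF s(2) lr[OF y(5)]] using y(6) s(1) by simp
  from u[unfolded unsplit_def, rule_format, OF ps L' inv'[rule_format] t m y(5) this]
  have "\<Phi> (h ((us' @ [b', a']) @ ws))" by blast
  then show "\<Phi> (ys' @ ws)" unfolding h[OF s'(2) lr[OF y(5)]] s'(1) .
qed

end

context hmodel
begin

text \<open>A formula separating two points of the ball would, by \<open>split_center\<close>, yield
  a point of the ball algebraic over \<open>A\<close>, and then its leading term would be algebraic
  as well.\<close>

lemma unsplit_one:
  assumes A: "A \<subseteq> carrier K" and ps: "set ps \<subseteq> pt ` A \<union> RV K" and L: "LDef (Suc (length ps)) \<Phi>"
    and inv: "\<And>x ws ws'. x \<in> carrier K \<Longrightarrow> rep ws ps \<Longrightarrow> rep ws' ps \<Longrightarrow> \<Phi> (x # ws) = \<Phi> (x # ws')"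
    and x: "x \<in> carrier K" "x \<noteq> \<zero>" "rv K x \<notin> cl (pt ` A)" and x': "x' \<in> carrier K" "rv K x = rv K x'"
    and ws: "rep ws ps" "\<Phi> (x # ws)"
  shows "\<Phi> (x' # ws)"
proof (rule ccontr)
  assume n: "\<not> \<Phi> (x' # ws)"
  have P: "pt ` A \<subseteq> PRV" using A RVx_PRV(3) by blast
  define X where "X = {y \<in> carrier K. \<Phi> (y # ws)}"
  have "\<exists>c\<in>carrier K. rv K c = rv K x \<and> algover (pt ` A) pt c"
  proof (rule split_center[OF A ps L, of X x x'])
    show "y \<in> X \<longleftrightarrow> \<Phi> (y # vs)" if "y \<in> carrier K" "rep vs ps" for y vs
      unfolding X_def using inv[OF that(1,2) ws(1)] that(1) by blast
  qed (use x x' ws n in \<open>simp_all add: X_def\<close>)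
  then obtain c where c: "c \<in> carrier K" "rv K c = rv K x" "algover (pt ` A) pt c" by blast
  have "algover (pt ` A) (rv K) c" by (rule algover_rv[OF P c(1,3)])
  moreover have "c \<noteq> \<zero>" using c(1,2) x rv_zero_iff[of x] by auto
  ultimately have "rv K c \<in> cl (pt ` A)" using cl_algover[OF c(1) P] by blast
  then show False using x c by simp
qed

text \<open>
  As the points of the ball over a generic \<open>\<xi>\<close> all look alike, a point of the ball computes nothing
  in \<open>RV\<close> that \<open>\<xi>\<close> does not compute.
\<close>

lemma cl_coarsen:
  assumes A: "A \<subseteq> carrier K" and x: "x \<in> carrier K" "x \<noteq> \<zero>" "rv K x \<notin> cl (pt ` A)" and Q: "Q \<subseteq> RV K"
    and \<xi>: "\<xi> \<in> cl (insert (pt x) (pt ` A \<union> Q))"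
  shows "\<xi> \<in> cl (insert (rv K x) (pt ` A \<union> Q))"
proof -
  let ?P = "pt ` A \<union> Q"
  have PP: "?P \<subseteq> PRV" using A Q RVx_PRV(2,3) by blast
  obtain ps where ps: "set ps \<subseteq> insert (pt x) ?P" "alg (rv K) ps \<xi>" and \<xi>R: "\<xi> \<in> RVx K" using \<xi> unfolding cl_def by blast
  obtain y0 where y0: "y0 \<in> carrier K" "\<xi> = rv K y0" using \<xi>R unfolding RVx_def by blast
  define qs where "qs = filter (\<lambda>p. p \<in> ?P) ps"
  have qs: "set qs \<subseteq> ?P" unfolding qs_def by auto
  then have qsP: "set qs \<subseteq> PRV" using PP by blast
  have ptx: "pt x \<in> PRV" using x(1) by (simp add: kap_PRV)
  have al: "alg (rv K) (pt x # qs) \<xi>"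
    by (rule alg_weaken[OF ps(2)]) (use ps(1) qsP ptx in \<open>auto simp: qs_def\<close>)
  obtain \<Phi> N where L: "LDef (Suc (Suc (length qs))) \<Phi>"
    and f: "\<And>ws. ws \<in> tuples K (Suc (length qs)) \<Longrightarrow> few (rv K) N \<Phi> ws"
    and \<Phi>: "\<And>ws y. rep ws (pt x # qs) \<Longrightarrow> [y] \<in> \<xi> \<Longrightarrow> \<Phi> (y # ws)"
    by (rule algE[OF al, unfolded length_Cons], rule that)
  \<comment> \<open>As a condition on \<open>l ! 0\<close>: with this value in place of
    \<open>x\<close>, the formula \<open>\<Phi>\<close> holds for all representatives of
    \<open>\<xi>\<close> and of \<open>qs\<close>.\<close>
  define \<Theta> where "\<Theta> = (\<lambda>l. \<forall>y\<in>carrier K. rv K y = rv K (l ! 1) \<longrightarrow>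
     (\<forall>vs\<in>tuples K (length qs). sims qs (drop 2 l) vs \<longrightarrow> \<Phi> (y # l ! 0 # vs)))"
  have LT: "LDef (Suc (length (rv K y0 # qs))) \<Theta>" unfolding LDef_def \<Theta>_def length_Cons
    by (intro def_intros Def_sims LDef_app[OF L] tml_intros) ((rule refl | simp)+)?
  have \<Theta>: "\<Theta> (z # w # ws) \<longleftrightarrow> (\<forall>y vs. [y] \<in> rv K y0 \<longrightarrow> rep vs qs \<longrightarrow> \<Phi> (y # z # vs))"
    if "[w] \<in> rv K y0" "rep ws qs" for z w ws
  proof -
    have w: "w \<in> carrier K" "rv K w = rv K y0" using rv_mem_iff[OF y0(1)] that(1) by auto
    have "\<Theta> (z # w # ws) \<longleftrightarrow> (\<forall>y\<in>carrier K. rv K y = rv K y0 \<longrightarrow> (\<forall>vs\<in>tuples K (length qs). sims qs ws vs \<longrightarrow> \<Phi> (y # z # vs)))"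
      unfolding \<Theta>_def using w(2) by simp
    also have "\<dots> \<longleftrightarrow> (\<forall>y vs. [y] \<in> rv K y0 \<longrightarrow> rep vs qs \<longrightarrow> \<Phi> (y # z # vs))"
      unfolding rep_sims[OF qsP that(2)] rv_mem_iff[OF y0(1)] by (metis (no_types))
    finally show ?thesis .
  qed
  have \<Theta>rep: "\<Theta> (z # ws) \<longleftrightarrow> (\<forall>y vs. [y] \<in> rv K y0 \<longrightarrow> rep vs qs \<longrightarrow> \<Phi> (y # z # vs))"
    if r: "rep ws (rv K y0 # qs)" for z ws
  proof -
    obtain w us where "ws = w # us" "[w] \<in> rv K y0" "rep us qs" using r by (cases ws) (auto simp: rep_def)
    then show ?thesis using \<Theta> by simp
  qed
  have all: "\<Phi> (y # z # vs)" if z: "z \<in> carrier K" "rv K x = rv K z" and y: "[y] \<in> rv K y0" and vs: "rep vs qs" for z y vs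
  proof -
    have r: "rep (y0 # vs) (rv K y0 # qs)" using rv_self[OF y0(1)] vs by simp
    \<comment> \<open>The leading term \<open>\<xi>\<close>, although it is what is being computed,
      serves as a parameter: \<open>unsplit_one\<close> tolerates arbitrary parameters from
      \<open>RV\<close>.\<close>
    have "\<Theta> (z # y0 # vs)"
    proof (rule unsplit_one[OF A _ LT _ x z r])
      show "set (rv K y0 # qs) \<subseteq> pt ` A \<union> RV K" using qs Q y0(1) unfolding RV_def by auto
      show "\<Theta> (u # ws) = \<Theta> (u # ws')" if "rep ws (rv K y0 # qs)" "rep ws' (rv K y0 # qs)" for u ws ws'
        using \<Theta>rep that by simp
      have "rep (x # vs) (pt x # qs)" if "rep vs qs" for vs using that by (simp add: pt_def)
      then show "\<Theta> (x # y0 # vs)" unfolding \<Theta>rep[OF r] using \<Phi> y0(2) by blast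
    qed
    then show ?thesis unfolding \<Theta>rep[OF r] using y vs by blast
  qed
  have "alg (rv K) (rv K x # qs) \<xi>" unfolding alg_def length_Cons
  proof (intro exI[of _ \<Phi>] exI[of _ N] conjI L ballI f allI impI)
    fix ws y assume ws: "rep ws (rv K x # qs)" and y: "[y] \<in> \<xi>"
    obtain z vs where "ws = z # vs" "[z] \<in> rv K x" "rep vs qs" using ws by (cases ws) (auto simp: rep_def)
    then show "\<Phi> (y # ws)" using all[of z y vs] rv_mem_iff[OF x(1)] y y0(2) by auto
  qed
  moreover have "rv K x \<in> PRV" using x(1) by (simp add: kap_PRV)
  ultimately show ?thesis unfolding cl_def using \<xi>R qs qsP by (intro CollectI conjI exI[of _ "rv K x # qs"]) auto
qed

lemma indl_coarsen:
  assumes A: "A \<subseteq> carrier K" and x: "x \<in> carrier K" "x \<noteq> \<zero>" "rv K x \<notin> cl (pt ` A)"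
  shows "Q \<subseteq> RV K \<Longrightarrow> set \<xi>s \<subseteq> RV K \<Longrightarrow> indl cl (insert (rv K x) (pt ` A \<union> Q)) \<xi>s \<Longrightarrow> indl cl (insert (pt x) (pt ` A \<union> Q)) \<xi>s"
proof (induction \<xi>s arbitrary: Q)
  case (Cons \<xi> \<xi>s)
  have "\<xi> \<notin> cl (insert (pt x) (pt ` A \<union> Q))" using cl_coarsen[OF A x Cons.prems(1)] Cons.prems(3) by auto
  moreover have "indl cl (insert (rv K x) (pt ` A \<union> insert \<xi> Q)) \<xi>s" using Cons.prems(3) by (simp add: insert_commute)
  then have "indl cl (insert (pt x) (pt ` A \<union> insert \<xi> Q)) \<xi>s"
    by (intro Cons.IH) (use Cons.prems in simp_all)
  ultimately show ?case by (simp add: insert_commute)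
qed simp

text \<open>Induction on the tuple, with the set \<open>A\<close> growing by points of the field.
  The later leading terms are independent over the first one, hence by \<open>indl_coarsen\<close>
  over any point of its ball, and the induction hypothesis moves the later coordinates while the
  first stays fixed.\<close>

lemma indl_unsplit:
  assumes "A \<subseteq> carrier K" "xs \<in> tuples K n" "\<zero> \<notin> set xs" "indl cl (pt ` A) (map (rv K) xs)"
    "set ps \<subseteq> pt ` A \<union> RV K" "LDef (n + length ps) \<Phi>"
    "\<And>ys ws ws'. ys \<in> tuples K n \<Longrightarrow> rep ws ps \<Longrightarrow> rep ws' ps \<Longrightarrow> \<Phi> (ys @ ws) = \<Phi> (ys @ ws')"
    "ys \<in> tuples K n" "ys' \<in> tuples K n" "map (rv K) ys = map (rv K) xs" "map (rv K) ys' = map (rv K) xs"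
    "rep ws ps" "\<Phi> (ys @ ws)"
  shows "\<Phi> (ys' @ ws)"
  using assms
proof (induction xs arbitrary: A n ps \<Phi> ys ys' ws)
  case Nil
  have "n = 0" using Nil.prems(2) by (simp add: tuples_iff)
  then have "ys = []" "ys' = []" using Nil.prems(8,9) by (simp_all add: tuples_iff)
  then show ?case using Nil.prems(13) by simp
next
  case (Cons x xs)
  have x: "x \<in> carrier K" "x \<noteq> \<zero>" "rv K x \<notin> cl (pt ` A)" "indl cl (insert (rv K x) (pt ` A)) (map (rv K) xs)"
    using Cons.prems(2-4) by (auto simp: tuples_iff)
  have xs: "set xs \<subseteq> carrier K" "\<zero> \<notin> set xs" using Cons.prems(2,3) by (auto simp: tuples_iff)
  let ?m = "length xs"
  have n: "n = Suc ?m" using Cons.prems(2) by (auto simp: tuples_iff)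
  have xt: "xs \<in> tuples K ?m" using xs by (simp add: tuples_iff)
  note L = Cons.prems(6) note inv = Cons.prems(7)
  have psP: "set ps \<subseteq> PRV" using Cons.prems(1,5) RVx_PRV(2,3) by blast
  \<comment> \<open>The point \<open>z\<close> joins \<open>A\<close> as a parameter, so the first
    variable of \<open>\<Phi>\<close> becomes a parameter place behind the others.\<close>
  have sec: "\<Phi> ((z # vs') @ us)" if z: "z \<in> carrier K" "rv K z = rv K x" and vs: "vs \<in> tuples K ?m" "vs' \<in> tuples K ?m"
      "map (rv K) vs = map (rv K) xs" "map (rv K) vs' = map (rv K) xs" and us: "rep us ps" and h: "\<Phi> ((z # vs) @ us)" for z vs vs' us
  proof -
    define \<Psi> where "\<Psi> = (\<lambda>l. \<Phi> (l ! ?m # take ?m l @ drop (Suc ?m) l))"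
    have z0: "z \<noteq> \<zero>" using z x(1,2) rv_zero_iff[of x] by auto
    have "indl cl (insert (rv K z) (pt ` A \<union> {})) (map (rv K) xs)" using x(4) z(2) by simp
    then have "indl cl (insert (pt z) (pt ` A \<union> {})) (map (rv K) xs)"
      by (intro indl_coarsen[OF Cons.prems(1) z(1) z0]) (use x(3) z(2) xs in \<open>auto simp: RV_def\<close>)
    then have ind: "indl cl (pt ` insert z A) (map (rv K) xs)" by simp
    have T: "TmL ?m (\<lambda>e. take ?m (map e [0..<?m + Suc (length ps)]))"
    proof -
      have "take ?m (map e [0..<?m + Suc (length ps)]) = map e [0..<?m]" for e :: "nat \<Rightarrow> 'a"
        by (simp add: take_map del: upt_Suc)
      then show ?thesis by (simp add: TmL_map0 tm_intros)
    qed
    have D: "TmL (length ps) (\<lambda>e. drop (Suc ?m) (map e [0..<?m + Suc (length ps)]))"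
      by (rule TmL_drop[OF TmL_map0[OF tm_intros(1) refl]]) simp
    have N: "Tm (\<lambda>e. map e [0..<?m + Suc (length ps)] ! ?m)" by (rule Tm_nth_map[OF tm_intros(1)]) simp
    have LP: "LDef (?m + length (pt z # ps)) \<Psi>" unfolding LDef_def \<Psi>_def length_Cons
      by (rule LDef_app[OF L]) (rule tml_intros0(2)[OF N tml_intros0(3)[OF T D refl]], simp add: n)
    have P: "\<Psi> (ys @ w # us) = \<Phi> ((w # ys) @ us)" if "ys \<in> tuples K ?m" for ys w us
      using that unfolding \<Psi>_def by (simp add: tuples_iff nth_append)
    have rp: "\<exists>us'. ws = z # us' \<and> rep us' ps" if "rep ws (pt z # ps)" for ws
      using that by (cases ws) (auto simp: rep_def pt_def)
    have "\<Psi> (vs' @ z # us)"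
    proof (rule Cons.IH[OF _ xt xs(2) ind _ LP _ vs])
      show "insert z A \<subseteq> carrier K" using z Cons.prems(1) by simp
      show "set (pt z # ps) \<subseteq> pt ` insert z A \<union> RV K" using Cons.prems(5) by auto
      show "rep (z # us) (pt z # ps)" using us by (simp add: pt_def)
      show "\<Psi> (vs @ z # us)" using P[OF vs(1)] h by simp
      fix ys ws ws' assume "ys \<in> tuples K ?m" "rep ws (pt z # ps)" "rep ws' (pt z # ps)"
      moreover have "z # ys \<in> tuples K n" if "ys \<in> tuples K ?m" for ys using that z(1) n by (simp add: tuples_iff)
      ultimately show "\<Psi> (ys @ ws) = \<Psi> (ys @ ws')" using rp[of ws] rp[of ws'] P inv by metis
    qed
    then show ?thesis using P[OF vs(2)] by simp
  qed
  let ?qs = "map (rv K) xs @ ps"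
  \<comment> \<open>The first coordinate is moved last: the condition that \<open>\<Phi>\<close>
    holds for all choices of the later coordinates needs only their leading terms as parameters, so
    \<open>unsplit_one\<close> applies.\<close>
  define \<Theta> where "\<Theta> = (\<lambda>l. \<forall>vs\<in>tuples K ?m. (\<forall>i<?m. rv K (vs ! i) = rv K (l ! Suc i)) \<longrightarrow> \<Phi> (l ! 0 # vs @ drop (Suc ?m) l))"
  have lq: "length ?qs = ?m + length ps" by simp
  have LT: "LDef (Suc (length ?qs)) \<Theta>" unfolding LDef_def \<Theta>_def lq
    by (intro def_intros LDef_app[OF L] tml_intros) ((rule refl | simp add: n)+)?
  have \<Theta>: "\<Theta> (z # us) \<longleftrightarrow> (\<forall>vs\<in>tuples K ?m. map (rv K) vs = map (rv K) xs \<longrightarrow> (\<forall>ts. rep ts ps \<longrightarrow> \<Phi> ((z # vs) @ ts)))"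
    if z: "z \<in> carrier K" and us: "rep us ?qs" for z us
  proof -
    obtain us1 us2 where u: "us = us1 @ us2" "rep us1 (map (rv K) xs)" "rep us2 ps" using rep_append_ex[OF us] by blast
    have u1: "us1 \<in> tuples K ?m" "map (rv K) us1 = map (rv K) xs" using u(2) rep_map[OF kap_simps(2) xs(1)] by auto
    have l1: "length us1 = ?m" using u1 by (simp add: tuples_iff)
    have eq: "(\<forall>i<?m. rv K (vs ! i) = rv K ((z # us) ! Suc i)) \<longleftrightarrow> map (rv K) vs = map (rv K) xs" if "vs \<in> tuples K ?m" for vs
    proof -
      have "map (rv K) vs = map (rv K) us1 \<longleftrightarrow> (\<forall>i<?m. rv K (vs ! i) = rv K (us1 ! i))"
        using that l1 by (simp add: list_eq_iff_nth_eq tuples_iff)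
      then show ?thesis using u(1) u1(2) l1 by (simp add: nth_append)
    qed
    have dr: "drop (Suc ?m) (z # us) = us2" using u(1) l1 by simp
    have "\<Phi> ((z # vs) @ us2) \<longleftrightarrow> (\<forall>ts. rep ts ps \<longrightarrow> \<Phi> ((z # vs) @ ts))" if "vs \<in> tuples K ?m" for vs
    proof -
      have "z # vs \<in> tuples K n" using that z n by (simp add: tuples_iff)
      then show ?thesis using inv u(3) by blast
    qed
    then show ?thesis unfolding \<Theta>_def nth_Cons_0 dr using eq by simp
  qed
  obtain z vs where zv: "ys = z # vs" "z \<in> carrier K" "vs \<in> tuples K ?m" "rv K z = rv K x" "map (rv K) vs = map (rv K) xs"
    using Cons.prems(8,10) n by (cases ys) (auto simp: tuples_iff)
  obtain z' vs' where zv': "ys' = z' # vs'" "z' \<in> carrier K" "vs' \<in> tuples K ?m" "rv K z' = rv K x" "map (rv K) vs' = map (rv K) xs"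
    using Cons.prems(9,11) n by (cases ys') (auto simp: tuples_iff)
  have z0: "z \<noteq> \<zero>" using zv x(1,2) rv_zero_iff[of x] by auto
  have rx: "rep (xs @ ws) ?qs" using rep_map[OF kap_simps(2) xs(1), of xs] xt Cons.prems(12) rep_split by blast
  have "\<Theta> (z' # xs @ ws)"
  proof (rule unsplit_one[OF Cons.prems(1) _ LT _ zv(2) z0 _ zv'(2) _ rx])
    show "set ?qs \<subseteq> pt ` A \<union> RV K" using Cons.prems(5) xs(1) unfolding RV_def by auto
    show "\<Theta> (u # ws) = \<Theta> (u # ws')" if "u \<in> carrier K" "rep ws ?qs" "rep ws' ?qs" for u ws ws'
      using \<Theta>[OF that(1)] that(2,3) by simp
    show "rv K z \<notin> cl (pt ` A)" using zv(4) x(3) by simp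
    show "rv K z = rv K z'" using zv(4) zv'(4) by simp
    show "\<Theta> (z # xs @ ws)" unfolding \<Theta>[OF zv(2) rx]
    proof (intro ballI impI allI)
      fix us ts assume us: "us \<in> tuples K ?m" "map (rv K) us = map (rv K) xs" and ts: "rep ts ps"
      have "z # vs \<in> tuples K n" using zv n by (simp add: tuples_iff)
      then have "\<Phi> ((z # vs) @ ts)" using inv ts Cons.prems(12,13) zv(1) by blast
      then show "\<Phi> ((z # us) @ ts)" by (rule sec[OF zv(2,4,3) us(1) zv(5) us(2) ts])
    qed
  qed
  then show ?case unfolding \<Theta>[OF zv'(2) rx] zv'(1) using zv'(3,5) Cons.prems(12) by blast
qed

text \<open>Independence excludes splitting by \<open>indl_unsplit\<close>. Conversely, a dependent
  coordinate lifts to a point of its ball that is algebraic over representatives of the preceding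
  coordinates; the formula isolating this point has finitely many solutions and cannot hold on the
  infinite ball.\<close>

lemma full_dimensional_iff:
  assumes \<xi>: "\<xi> \<in> RVx_pow K n" shows "full_dimensional K n \<xi> \<longleftrightarrow> indl cl {} \<xi>"
proof
  obtain xs where xs: "xs \<in> tuples K n" "\<zero> \<notin> set xs" "\<xi> = map (rv K) xs" using RVx_pow_rep[OF \<xi>] by blast
  note lxs = conjunct1[OF xs(1)[unfolded tuples_iff]] conjunct2[OF xs(1)[unfolded tuples_iff]]
  assume i: "indl cl {} \<xi>"
  have i': "indl cl (pt ` {}) (map (rv K) xs)" using i xs(3) by simp
  have "unsplit \<xi>" unfolding unsplit_def xs(3) length_map lxs(1)
  proof (intro allI impI ballI)
    fix ps \<Phi> ys ys' ws
    assume h: "set ps \<subseteq> RV K" "LDef (n + length ps) \<Phi>"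
      "\<forall>ys\<in>tuples K n. \<forall>ws ws'. rep ws ps \<longrightarrow> rep ws' ps \<longrightarrow> \<Phi> (ys @ ws) = \<Phi> (ys @ ws')"
      "ys \<in> tuples K n" "ys' \<in> tuples K n" "map (rv K) ys = map (rv K) xs" "map (rv K) ys' = map (rv K) xs" "rep ws ps" "\<Phi> (ys @ ws)"
    show "\<Phi> (ys' @ ws)"
      by (rule indl_unsplit[OF _ xs(1,2) i' _ h(2) _ h(4-9)]) (simp, use h(1) in simp, use h(3) in blast)
  qed
  then show "full_dimensional K n \<xi>" using unsplit_iff[OF \<xi>] by blast
next
  obtain xs where xs: "xs \<in> tuples K n" "\<zero> \<notin> set xs" "\<xi> = map (rv K) xs" using RVx_pow_rep[OF \<xi>] by blast
  note lxs = conjunct1[OF xs(1)[unfolded tuples_iff]] conjunct2[OF xs(1)[unfolded tuples_iff]]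
  assume "full_dimensional K n \<xi>"
  then have u: "unsplit \<xi>" using unsplit_iff[OF \<xi>] by blast
  show "indl cl {} \<xi>" unfolding indl_nth
  proof (intro allI impI notI)
    fix i assume "i < length \<xi>" and c: "\<xi> ! i \<in> cl ({} \<union> set (take i \<xi>))"
    then have i: "i < n" using xs(3) lxs by simp
    let ?ts = "take i xs"
    have ts: "set ?ts \<subseteq> carrier K" "length ?ts = i" using lxs i set_take_subset[of i xs] by auto
    have xi: "xs ! i \<in> carrier K" "xs ! i \<noteq> \<zero>" using i lxs xs(2) by (auto dest: nth_mem)
    obtain ps where ps: "set ps \<subseteq> set (take i \<xi>)" "alg (rv K) ps (\<xi> ! i)" using c unfolding cl_def by auto
    have tk: "take i \<xi> = map (rv K) ?ts" unfolding xs(3) by (rule take_map)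
    have tP: "set (map (rv K) ?ts) \<subseteq> PRV" using ts by (auto simp: PRV_def RV_def)
    have "alg (rv K) (map (rv K) ?ts) (\<xi> ! i)" by (rule alg_weaken[OF ps(2) _ tP]) (use ps(1) tk in simp)
    then have "alg (rv K) (map pt ?ts) (\<xi> ! i)"
    proof (rule alg_finer)
      show "list_all2 (\<subseteq>) (map pt ?ts) (map (rv K) ?ts)"
        unfolding list_all2_map1 list_all2_map2 list_all2_same
      proof
        fix x assume "x \<in> set ?ts"
        then have "x \<in> carrier K" using ts(1) by blast
        then show "pt x \<subseteq> rv K x" using rv_self by (simp add: pt_def)
      qed
    qed
    moreover have "\<xi> ! i = rv K (xs ! i)" using i lxs xs(3) by simp
    ultimately have "algover (pt ` set ?ts) (rv K) (xs ! i)" unfolding algover_def by (intro exI[of _ "map pt ?ts"]) simp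
    then obtain c where c: "c \<in> carrier K" "rv K c = rv K (xs ! i)" "algover (pt ` set ?ts) pt c"
      using acl_lift[OF ts(1) xi] by blast
    obtain qs where qs: "set qs \<subseteq> pt ` set ?ts" "alg pt qs (pt c)" using c(3) unfolding algover_def by blast
    have tP': "set (map pt ?ts) \<subseteq> PRV" using ts by (auto simp: PRV_def)
    have "alg pt (map pt ?ts) (pt c)" by (rule alg_weaken[OF qs(2) _ tP']) (use qs(1) in simp)
    note al = this
    obtain \<Phi> N where L: "LDef (Suc (length (map pt ?ts))) \<Phi>"
      and f: "\<And>ws. ws \<in> tuples K (length (map pt ?ts)) \<Longrightarrow> few pt N \<Phi> ws"
      and \<Phi>: "\<And>ws y. rep ws (map pt ?ts) \<Longrightarrow> [y] \<in> pt c \<Longrightarrow> \<Phi> (y # ws)"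
      by (rule algE[OF al], rule that)
    have L1: "LDef (Suc i) \<Phi>" using L ts(2) by simp
    \<comment> \<open>The preceding coordinates are read as variables, so no parameters remain and
      \<open>unsplit\<close> is used with the empty list; only coordinate \<open>i\<close> is then
      varied.\<close>
    define \<Psi> where "\<Psi> = (\<lambda>l. \<Phi> (l ! i # take i l))"
    have T: "TmL i (\<lambda>e. take i (map e [0..<n]))"
    proof -
      have "take i (map e [0..<n]) = map e [0..<i]" for e :: "nat \<Rightarrow> 'a" using i by (simp add: take_map)
      then show ?thesis by (simp add: TmL_map0 tm_intros)
    qed
    have LP: "LDef (length \<xi> + length ([] :: 'a imag list)) \<Psi>" unfolding LDef_def \<Psi>_def
      using LDef_app[OF L1 tml_intros0(2)[OF Tm_nth_map[OF tm_intros(1) i] T refl]] xs(3) lxs(1) by simp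
    have e: "rep ws [] \<longleftrightarrow> ws = []" for ws by (cases ws) (auto simp: rep_def)
    have upd: "xs[i := y] \<in> tuples K (length \<xi>) \<and> map (rv K) (xs[i := y]) = \<xi>" if "y \<in> carrier K" "rv K y = rv K (xs ! i)" for y
    proof -
      have "map (rv K) (xs[i := y]) = (map (rv K) xs)[i := rv K (xs ! i)]" using that(2) by (simp add: map_update)
      also have "\<dots> = \<xi>" using i lxs xs(3) by (metis list_update_id nth_map)
      finally show ?thesis using that(1) lxs xs(3) set_update_subset_insert[of xs i y] by (auto simp: tuples_iff)
    qed
    have P: "\<Psi> (xs[i := y] @ []) = \<Phi> (y # ?ts)" for y unfolding \<Psi>_def using i lxs by simp
    have "\<Phi> (c # ?ts)" using \<Phi>[of ?ts c] rep_pt[OF ts(1)] by (simp add: pt_def)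
    then have Pc: "\<Psi> (xs[i := c] @ [])" using P by simp
    have "\<Phi> (y # ?ts)" if y: "y \<in> carrier K" "rv K y = rv K (xs ! i)" for y
    proof -
      have "\<Psi> (xs[i := y] @ [])"
        by (rule u[unfolded unsplit_def, rule_format, OF _ LP, of "xs[i := c]"])
           (use upd[OF c(1,2)] upd[OF y] Pc e in auto)
      then show ?thesis using P by simp
    qed
    then have "pt ` {y \<in> carrier K. rv K y = rv K (xs ! i)} \<subseteq> pt ` {y \<in> carrier K. \<Phi> (y # ?ts)}" by blast
    moreover have "finite (pt ` {y \<in> carrier K. \<Phi> (y # ?ts)})"
    proof -
      have "?ts \<in> tuples K (length (map pt ?ts))" using ts by (simp add: tuples_iff)
      from f[OF this] show ?thesis unfolding few_def by blast
    qed
    ultimately have "finite (pt ` {y \<in> carrier K. rv K y = rv K (xs ! i)})" by (rule finite_subset)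
    moreover have "inj_on pt {y \<in> carrier K. rv K y = rv K (xs ! i)}" by (auto simp: inj_on_def pt_def)
    ultimately have "finite {y \<in> carrier K. rv K y = rv K (xs ! i)}" by (rule finite_imageD)
    then show False using rv_class_infinite[OF xi] by blast
  qed
qed

end

sublocale vfield \<subseteq> cop: closure_operator "RVx K" cl
  by unfold_locales (rule cl_mono, assumption, rule cl_ext, rule cl_trans)

context hmodel
begin

text \<open>Replacing \<open>P\<close> by a basis \<open>b\<close> turns a failure of exchange into
  the independence of \<open>b\<close> followed by \<open>x\<close> and \<open>y\<close>. This is
  full-dimensionality, hence survives the transposition, and then contradicts that \<open>x\<close>
  depends on \<open>y\<close> over \<open>P\<close>.\<close>

lemma cl_exchange:
  assumes P: "finite P" "P \<subseteq> RVx K" and x: "x \<in> RVx K" and y: "y \<in> RVx K"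
    and xy: "x \<in> cl (insert y P)" "x \<notin> cl P"
  shows "y \<in> cl (insert x P)"
proof (rule ccontr)
  assume n: "y \<notin> cl (insert x P)"
  obtain as where as: "set as = P" using finite_list[OF P(1)] by blast
  have asR: "set as \<subseteq> RVx K" using as P(2) by simp
  obtain I where I: "indl cl {} (nths as I)" "set as \<subseteq> cl ({} \<union> set (nths as I))"
    using cop.basis_nths[OF asR, of "{}"] by blast
  define b where "b = nths as I"
  have b: "indl cl {} b" "P \<subseteq> cl (set b)" "set b \<subseteq> P" using I as set_nths_subset[of as I] unfolding b_def by auto
  have bR: "set b \<subseteq> RVx K" using b(3) P(2) by blast
  have "x \<notin> cl (set b)" using xy(2) cl_mono[OF b(3)] by blast
  moreover have "y \<notin> cl (insert x (set b))" using n cl_mono[of "insert x (set b)" "insert x P"] b(3) by blast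
  ultimately have "indl cl {} (b @ [x, y])" using b(1) by (simp add: indl_append)
  moreover have t: "b @ [x, y] \<in> RVx_pow K (length b + 2)" "b @ [y, x] \<in> RVx_pow K (length b + 2)"
    using bR x y by (simp_all add: RVx_pow_iff)
  ultimately have "unsplit (b @ [x, y])" using full_dimensional_iff[OF t(1)] unsplit_iff[OF t(1)] by simp
  then have "unsplit (b @ [y, x])" by (rule unsplit_swap)
  then have "indl cl {} (b @ [y, x])" using full_dimensional_iff[OF t(2)] unsplit_iff[OF t(2)] by simp
  then have nx: "x \<notin> cl (insert y (set b))" by (simp add: indl_append)
  have "P \<subseteq> cl (insert y (set b))" using b(2) cl_mono[of "set b" "insert y (set b)"] by blast
  moreover have "x \<in> cl (insert y (set b) \<union> P)" using xy(1) cl_mono[of "insert y P" "insert y (set b) \<union> P"] by blast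
  ultimately have "x \<in> cl (insert y (set b))" by (rule cop.cl_trans_finite[OF P(1)])
  then show False using nx by blast
qed

end

sublocale hmodel \<subseteq> pg: pregeometry "RVx K" cl
  by unfold_locales (rule cl_exchange)

section \<open>Saturation\<close>

context vfield
begin

text \<open>Leading terms of terms, the expressions that may be substituted into sets of leading
  terms.\<close>

definition RTm :: "((nat \<Rightarrow> 'a) \<Rightarrow> 'a imag) \<Rightarrow> bool" where
  "RTm r \<longleftrightarrow> (\<exists>t. Tm t \<and> (\<forall>e. r e = rv K (t e)))"

definition RTmL :: "nat \<Rightarrow> ((nat \<Rightarrow> 'a) \<Rightarrow> 'a imag list) \<Rightarrow> bool" where
  "RTmL n r \<longleftrightarrow> (\<exists>s. TmL n s \<and> (\<forall>e. r e = map (rv K) (s e)))"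

lemma RTm_rv: "Tm t \<Longrightarrow> RTm (\<lambda>e. rv K (t e))"
  unfolding RTm_def by blast
lemma RTmL_map: "TmL n s \<Longrightarrow> RTmL n (\<lambda>e. map (rv K) (s e))"
  unfolding RTmL_def by blast
lemma RTmL_Nil: "k = 0 \<Longrightarrow> RTmL k (\<lambda>e. [])"
  unfolding RTmL_def by (rule exI[of _ "\<lambda>e. []"]) (simp add: tml_intros0(1))
lemma RTmL_Cons: assumes "RTm r" "RTmL n l" "k = Suc n" shows "RTmL k (\<lambda>e. r e # l e)"
proof -
  obtain t s where "Tm t" "\<And>e. r e = rv K (t e)" "TmL n s" "\<And>e. l e = map (rv K) (s e)"
    using assms(1,2) unfolding RTm_def RTmL_def by blast
  then show ?thesis unfolding RTmL_def using tml_intros0(2)[of t n s k] assms(3)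
    by (intro exI[of _ "\<lambda>e. t e # s e"]) simp
qed
lemma RTmL_append: assumes "RTmL n l" "RTmL m l'" "k = n + m" shows "RTmL k (\<lambda>e. l e @ l' e)"
proof -
  obtain s s' where "TmL n s" "\<And>e. l e = map (rv K) (s e)" "TmL m s'" "\<And>e. l' e = map (rv K) (s' e)"
    using assms(1,2) unfolding RTmL_def by blast
  then show ?thesis unfolding RTmL_def using tml_intros0(3)[of n s m s' k] assms(3)
    by (intro exI[of _ "\<lambda>e. s e @ s' e"]) simp
qed
lemma RTm_nth: assumes "RTmL n l" "i < n" shows "RTm (\<lambda>e. l e ! i)"
proof -
  obtain s where s: "TmL n s" "\<And>e. l e = map (rv K) (s e)" using assms(1) unfolding RTmL_def by blast
  have "length (s e) = n" for e using s(1) by (simp add: cotermL_def)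
  then show ?thesis unfolding RTm_def using Tm_nth[OF s(1) assms(2)] s(2) assms(2)
    by (intro exI[of _ "\<lambda>e. s e ! i"]) simp
qed

lemma RTmL_list: assumes "\<And>i. i \<in> set is \<Longrightarrow> RTm (\<lambda>e. f e i)" "k = length is" shows "RTmL k (\<lambda>e. map (f e) is)"
  using assms
proof (induction "is" arbitrary: k)
  case (Cons i "is")
  have "RTmL (length is) (\<lambda>e. map (f e) is)" by (rule Cons.IH) (simp_all add: Cons.prems)
  then have "RTmL k (\<lambda>e. f e i # map (f e) is)" by (rule RTmL_Cons[rotated]) (simp_all add: Cons.prems)
  then show ?case by simp
qed (simp add: RTmL_Nil)

lemma nths_map_upt: "nths xs I = map (\<lambda>i. xs ! i) (filter (\<lambda>i. i \<in> I) [0..<length xs])"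
  unfolding nths_def
proof -
  have "zip xs [0..<length xs] = map (\<lambda>i. (xs ! i, i)) [0..<length xs]"
    by (rule nth_equalityI) simp_all
  then show "map fst (filter (\<lambda>p. snd p \<in> I) (zip xs [0..<length xs])) = map (\<lambda>i. xs ! i) (filter (\<lambda>i. i \<in> I) [0..<length xs])"
    by (simp add: filter_map o_def)
qed

lemma RTmL_nths: assumes "RTmL n l" "I \<subseteq> {..<n}" "k = card I" shows "RTmL k (\<lambda>e. nths (l e) I)"
proof -
  have "length (l e) = n" for e using assms(1) unfolding RTmL_def cotermL_def by force
  then have e: "(\<lambda>e. nths (l e) I) = (\<lambda>e. map (\<lambda>i. l e ! i) (filter (\<lambda>i. i \<in> I) [0..<n]))"
    using nths_map_upt by metis
  have "card I = length (filter (\<lambda>i. i \<in> I) [0..<n])"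
  proof -
    have "set (filter (\<lambda>i. i \<in> I) [0..<n]) = I" using assms(2) by auto
    then show ?thesis using distinct_card[of "filter (\<lambda>i. i \<in> I) [0..<n]"] by simp
  qed
  then show ?thesis unfolding e by (intro RTmL_list RTm_nth[OF assms(1)]) (simp_all add: assms(3))
qed

lemmas rtm_intros = RTm_rv RTmL_map RTmL_Nil RTmL_Cons RTmL_append

text \<open>Parameter-free definability in powers of \<open>RVx K\<close>, read on representatives.
  Families over leading terms are handled by keeping the parameters as initial coordinates.\<close>

definition RD :: "nat \<Rightarrow> 'a imag list set \<Rightarrow> bool" where
  "RD n X \<longleftrightarrow> X \<subseteq> RVx_pow K n \<and> LDef n (\<lambda>ys. map (rv K) ys \<in> X)"

lemma Def_RD: assumes "RD n X" "RTmL n r" shows "Def (\<lambda>e. r e \<in> X)"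
proof -
  obtain s where s: "TmL n s" "\<And>e. r e = map (rv K) (s e)" using assms(2) unfolding RTmL_def by blast
  have "LDef n (\<lambda>ys. map (rv K) ys \<in> X)" using assms(1) unfolding RD_def by blast
  from LDef_app[OF this s(1)] show ?thesis using s(2) by simp
qed

lemma map_rv_RVx_pow: "ys \<in> tuples K n \<Longrightarrow> map (rv K) ys \<in> RVx_pow K n \<longleftrightarrow> (\<forall>i<n. ys ! i \<noteq> \<zero>)"
proof -
  assume y: "ys \<in> tuples K n"
  then have l: "length ys = n" "\<And>i. i < n \<Longrightarrow> ys ! i \<in> carrier K" by (auto simp: tuples_iff)
  have "map (rv K) ys \<in> RVx_pow K n \<longleftrightarrow> (\<forall>i<n. rv K (ys ! i) \<in> RVx K)"
  proof -
    have "set (map (rv K) ys) \<subseteq> RVx K \<longleftrightarrow> (\<forall>x\<in>set ys. rv K x \<in> RVx K)" by (simp add: image_subset_iff)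
    then show ?thesis unfolding RVx_pow_iff all_set_conv_all_nth using l(1) by simp
  qed
  then show ?thesis using RVx_iff l(2) by simp
qed

lemma RDI:
  assumes "X \<subseteq> RVx_pow K n" "\<And>\<xi>. \<xi> \<in> RVx_pow K n \<Longrightarrow> \<xi> \<in> X \<longleftrightarrow> P \<xi>" "Def (\<lambda>e. P (map (rv K) (map e [0..<n])))"
  shows "RD n X"
  unfolding RD_def LDef_def
proof (intro conjI assms(1))
  have "Def (\<lambda>e. (\<forall>i<n. e i \<noteq> \<zero>) \<and> P (map (rv K) (map e [0..<n])))"
    by (intro Def_basic Def_finite_all tm_intros assms(3))
  then show "Def (\<lambda>e. map (rv K) (map e [0..<n]) \<in> X)"
  proof (rule Def_cong)
    fix e :: "nat \<Rightarrow> 'a" assume e: "range e \<subseteq> carrier K"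
    have t: "map e [0..<n] \<in> tuples K n" using map_tuples[OF e, of 0 n] by simp
    show "((\<forall>i<n. e i \<noteq> \<zero>) \<and> P (map (rv K) (map e [0..<n]))) = (map (rv K) (map e [0..<n]) \<in> X)"
      using map_rv_RVx_pow[OF t] assms(1) assms(2)[of "map (rv K) (map e [0..<n])"] by auto
  qed
qed

lemma definableRV_RD: assumes "X \<subseteq> RVx_pow K n" shows "definableRV K n {} X \<longleftrightarrow> RD n X"
proof -
  have sub: "X \<subseteq> listset (replicate n (rv K ` carrier K))"
  proof
    fix x assume "x \<in> X"
    then have "x \<in> RVx_pow K n" using assms by blast
    then have "length x = n" "set x \<subseteq> RVx K" by (simp_all add: RVx_pow_iff)
    then have "length x = n" "set x \<subseteq> rv K ` carrier K" using RVx_PRV(4) unfolding RV_def by blast+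
    then show "x \<in> listset (replicate n (rv K ` carrier K))" by (simp add: listset_replicate)
  qed
  have e: "rep ws [] \<longleftrightarrow> ws = []" for ws by (cases ws) (auto simp: rep_def)
  have "definableRV K n {} X \<longleftrightarrow> (\<exists>\<Phi>. LDef n \<Phi> \<and> (\<forall>ys\<in>tuples K n. map (rv K) ys \<in> X \<longleftrightarrow> \<Phi> ys))"
    unfolding RV_def definable_iff[OF kap_simps(2) empty_subsetI sub] by (simp add: e)
  also have "\<dots> \<longleftrightarrow> LDef n (\<lambda>ys. map (rv K) ys \<in> X)"
  proof
    assume "\<exists>\<Phi>. LDef n \<Phi> \<and> (\<forall>ys\<in>tuples K n. map (rv K) ys \<in> X \<longleftrightarrow> \<Phi> ys)"
    then show "LDef n (\<lambda>ys. map (rv K) ys \<in> X)" unfolding LDef_iff by blast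
  qed blast
  finally show ?thesis using assms unfolding RD_def by blast
qed

lemma rep_RVx: "\<zeta> \<in> RVx_pow K m \<Longrightarrow> rep ws \<zeta> \<longleftrightarrow> ws \<in> tuples K m \<and> map (rv K) ws = \<zeta>"
proof -
  assume z: "\<zeta> \<in> RVx_pow K m"
  obtain zs where zs: "zs \<in> tuples K m" "\<zeta> = map (rv K) zs" using RVx_pow_rep[OF z] by blast
  then show ?thesis using rep_map[of "rv K" zs ws] by (simp add: tuples_iff)
qed

lemma RVx_pow_PRV: "\<zeta> \<in> RVx_pow K m \<Longrightarrow> set \<zeta> \<subseteq> PRV"
  using RVx_PRV(1) by (auto simp: RVx_pow_iff)

lemma cl_fibreI:
  assumes X: "RD (Suc m) X" and z: "\<zeta> \<in> RVx_pow K m" and x: "\<zeta> @ [\<xi>] \<in> X" and fin: "finite {\<xi>. \<zeta> @ [\<xi>] \<in> X}"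
  shows "\<xi> \<in> cl (set \<zeta>)"
proof -
  have lz: "length \<zeta> = m" using z by (simp add: RVx_pow_iff)
  have "\<zeta> @ [\<xi>] \<in> RVx_pow K (Suc m)" using X x unfolding RD_def by blast
  then have xR: "\<xi> \<in> RVx K" by (simp add: RVx_pow_iff)
  then obtain y where y: "y \<in> carrier K" "\<xi> = rv K y" unfolding RVx_def by blast
  obtain ws where ws: "rep ws \<zeta>" using rep_ex[OF RVx_pow_PRV[OF z]] by blast
  define \<Phi> where "\<Phi> = (\<lambda>l. map (rv K) (tl l) @ [rv K (l ! 0)] \<in> X)"
  have L: "LDef (Suc (length \<zeta>)) \<Phi>" unfolding LDef_def \<Phi>_def lz
    by (intro Def_RD[OF X] rtm_intros tm_intros Tm_nth_map tml_intros) ((rule refl | simp)+)?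
  have \<Phi>: "\<Phi> (y # ws) \<longleftrightarrow> \<zeta> @ [rv K y] \<in> X" if "rep ws \<zeta>" for y ws
    using rep_RVx[OF z] that unfolding \<Phi>_def by simp
  have "alg (rv K) \<zeta> (rv K y)"
    by (rule alg_intro[OF kap_simps(2) RVx_pow_PRV[OF z] L fin _ ws y(1)]) (use \<Phi> x y ws in auto)
  then show ?thesis unfolding cl_def using xR y RVx_pow_PRV[OF z] by blast
qed

text \<open>The uniform bound built into \<open>alg\<close> makes every fibre of the defining family
  finite, not only the one over \<open>\<zeta>\<close>.\<close>

lemma cl_fibreE:
  assumes z: "\<zeta> \<in> RVx_pow K m" and x: "\<xi> \<in> cl (set \<zeta>)"
  shows "\<exists>X. RD (Suc m) X \<and> \<zeta> @ [\<xi>] \<in> X \<and> (\<forall>\<zeta>'\<in>RVx_pow K m. finite {\<xi>. \<zeta>' @ [\<xi>] \<in> X})"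
proof -
  have lz: "length \<zeta> = m" using z by (simp add: RVx_pow_iff)
  obtain ps where ps: "set ps \<subseteq> set \<zeta>" "alg (rv K) ps \<xi>" and xR: "\<xi> \<in> RVx K" using x unfolding cl_def by blast
  have al: "alg (rv K) \<zeta> \<xi>" by (rule alg_weaken[OF ps(2,1) RVx_pow_PRV[OF z]])
  obtain \<Phi> N where L: "LDef (Suc m) \<Phi>" and f: "\<And>ws. ws \<in> tuples K m \<Longrightarrow> few (rv K) N \<Phi> ws"
    and \<Phi>: "\<And>ws y. rep ws \<zeta> \<Longrightarrow> [y] \<in> \<xi> \<Longrightarrow> \<Phi> (y # ws)"
    by (rule algE[OF al, unfolded lz], rule that)
  define P where "P = (\<lambda>\<eta>::'a imag list. \<forall>y\<in>carrier K. \<forall>ws\<in>tuples K m. rv K y = \<eta> ! m \<longrightarrow> (\<forall>i<m. rv K (ws ! i) = \<eta> ! i) \<longrightarrow> \<Phi> (y # ws))"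
  define X where "X = {\<eta> \<in> RVx_pow K (Suc m). P \<eta>}"
  have nthm: "map (rv K) (map g [0..<Suc m]) ! i = rv K (g i)" if "i < Suc m" for g i
    using that by (simp del: upt_Suc)
  have "Def (\<lambda>e. \<forall>y\<in>carrier K. \<forall>ws\<in>tuples K m. rv K y = rv K (e m) \<longrightarrow> (\<forall>i<m. rv K (ws ! i) = rv K (e i)) \<longrightarrow> \<Phi> (y # ws))"
    by (intro def_intros LDef_app[OF L] tml_intros) ((rule refl | simp)+)?
  then have "Def (\<lambda>e. P (map (rv K) (map e [0..<Suc m])))"
    unfolding P_def using nthm by (simp add: less_SucI del: upt_Suc)
  then have RDX: "RD (Suc m) X" by (intro RDI[where P = P]) (auto simp: X_def)
  have P: "P (map (rv K) zs @ [\<eta>]) \<longleftrightarrow> (\<forall>y\<in>carrier K. \<forall>ws\<in>tuples K m. rv K y = \<eta> \<longrightarrow> map (rv K) ws = map (rv K) zs \<longrightarrow> \<Phi> (y # ws))"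
    if "zs \<in> tuples K m" for zs \<eta>
  proof -
    have "(\<forall>i<m. rv K (ws ! i) = (map (rv K) zs @ [\<eta>]) ! i) \<longleftrightarrow> map (rv K) ws = map (rv K) zs" if "ws \<in> tuples K m" for ws
      using that \<open>zs \<in> tuples K m\<close> by (auto simp: list_eq_iff_nth_eq tuples_iff nth_append)
    moreover have "(map (rv K) zs @ [\<eta>]) ! m = \<eta>" using that by (simp add: tuples_iff nth_append)
    ultimately show ?thesis unfolding P_def by simp
  qed
  obtain zs where zs: "zs \<in> tuples K m" "\<zeta> = map (rv K) zs" using RVx_pow_rep[OF z] by blast
  obtain y0 where y0: "y0 \<in> carrier K" "\<xi> = rv K y0" using xR unfolding RVx_def by blast
  have "P (\<zeta> @ [\<xi>])" unfolding zs(2) P[OF zs(1)]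
    using \<Phi> rep_RVx[OF z] zs(2) y0 rv_mem_iff[OF y0(1)] by auto
  moreover have "\<zeta> @ [\<xi>] \<in> RVx_pow K (Suc m)" using z xR by (simp add: RVx_pow_iff)
  ultimately have "\<zeta> @ [\<xi>] \<in> X" unfolding X_def by blast
  moreover have "finite {\<xi>. \<zeta>' @ [\<xi>] \<in> X}" if z': "\<zeta>' \<in> RVx_pow K m" for \<zeta>'
  proof -
    obtain zs' where zs': "zs' \<in> tuples K m" "\<zeta>' = map (rv K) zs'" using RVx_pow_rep[OF z'] by blast
    have "{\<xi>. \<zeta>' @ [\<xi>] \<in> X} \<subseteq> rv K ` {y \<in> carrier K. \<Phi> (y # zs')}"
    proof
      fix \<eta> assume "\<eta> \<in> {\<xi>. \<zeta>' @ [\<xi>] \<in> X}"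
      then have h: "P (\<zeta>' @ [\<eta>])" "\<eta> \<in> RVx K" unfolding X_def by (auto simp: RVx_pow_iff)
      then obtain y where y: "y \<in> carrier K" "\<eta> = rv K y" unfolding RVx_def by blast
      then have "\<Phi> (y # zs')" using h(1) zs'(1) unfolding zs'(2) P[OF zs'(1)] by blast
      then show "\<eta> \<in> rv K ` {y \<in> carrier K. \<Phi> (y # zs')}" using y by blast
    qed
    then show ?thesis using f[OF zs'(1)] unfolding few_def by (meson finite_subset)
  qed
  ultimately show ?thesis using RDX by blast
qed

section \<open>Realising types: generic elements and compactness\<close>

lemma cl_pt_rv: assumes "B \<subseteq> carrier K" "b \<in> B" "b \<noteq> \<zero>" shows "rv K b \<in> cl (pt ` B)"
proof -
  have P: "pt ` B \<subseteq> PRV" using assms(1) RVx_PRV(3) by blast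
  have bc: "b \<in> carrier K" using assms by blast
  have "algover (pt ` B) pt b" by (rule algover_refl) (use assms bc in simp_all)
  then have "algover (pt ` B) (rv K) b" by (rule algover_rv[OF P bc])
  then show ?thesis using cl_algover[OF bc P] assms(3) by blast
qed

text \<open>Saturation over \<open>A\<close> has to accommodate finitely many further parameters.
  Elements of \<open>A\<close> are coded by one-element lists and the others by distinct formulas;
  the two kinds of formula in \<open>h\<close> keep the cases apart.\<close>

lemma ordLeq_params:
  fixes A F :: "'a set"
  assumes "finite F"
  shows "ordLeq3 (card_of (A \<union> F)) (card_of ((UNIV :: ('f, 'r) fm set) \<times> lists A))"
proof -
  obtain g :: "'a \<Rightarrow> nat" and n where g: "inj_on g F" using finite_imp_inj_to_nat_seg[OF assms] by blast
  define h where "h = (\<lambda>x. if x \<in> A then (FEq TZero TZero :: ('f, 'r) fm, [x]) else (FEq (TVar (g x)) TZero, []))"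
  have "inj_on h (A \<union> F)"
  proof (rule inj_onI)
    fix x y assume xy: "x \<in> A \<union> F" "y \<in> A \<union> F" "h x = h y"
    show "x = y"
    proof (cases "x \<in> A")
      case True
      then show ?thesis using xy by (cases "y \<in> A") (simp_all add: h_def)
    next
      case False
      then have nA: "y \<notin> A" using xy by (cases "y \<in> A") (simp_all add: h_def)
      then have "g x = g y" using xy False by (simp add: h_def)
      moreover have "x \<in> F" "y \<in> F" using xy False nA by blast+
      ultimately show ?thesis using g by (meson inj_onD)
    qed
  qed
  moreover have "h ` (A \<union> F) \<subseteq> UNIV \<times> lists A" by (auto simp: h_def)
  ultimately show ?thesis unfolding card_of_ordLeq[symmetric] by blast
qed

lemma saturatedD:
  assumes sat: "saturated K A" and A: "A \<subseteq> carrier K" "finite F" "F \<subseteq> carrier K"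
    and Ps: "\<And>P bs. (P, bs) \<in> \<P> \<Longrightarrow> set bs \<subseteq> A \<union> F \<and> LDef (Suc (length bs)) P"
    and fs: "\<And>\<F>. finite \<F> \<Longrightarrow> \<F> \<subseteq> \<P> \<Longrightarrow> \<exists>x\<in>carrier K. \<forall>(P, bs)\<in>\<F>. P (x # bs)"
  shows "\<exists>x\<in>carrier K. \<forall>(P, bs)\<in>\<P>. P (x # bs)"
proof -
  have "\<forall>p\<in>\<P>. \<exists>\<phi>. \<forall>xs\<in>tuples K (Suc (length (snd p))). fst p xs \<longleftrightarrow> sat K \<phi> xs"
    using Ps unfolding LDef_iff by (metis prod.collapse)
  from bchoice[OF this] obtain fm where fm: "\<And>p xs. p \<in> \<P> \<Longrightarrow> xs \<in> tuples K (Suc (length (snd p))) \<Longrightarrow> fst p xs \<longleftrightarrow> sat K (fm p) xs" by blast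
  have fm': "P (x # bs) \<longleftrightarrow> sat K (fm (P, bs)) (x # bs)" if "(P, bs) \<in> \<P>" "x \<in> carrier K" for P bs x
  proof -
    have "x # bs \<in> tuples K (Suc (length (snd (P, bs))))" using Ps[OF that(1)] A that(2) by (auto simp: tuples_iff)
    from fm[OF that(1) this] show ?thesis by simp
  qed
  define \<Sigma> where "\<Sigma> = (\<lambda>p. (fm p, snd p)) ` \<P>"
  have "\<exists>x\<in>carrier K. \<forall>(\<phi>, bs)\<in>\<Sigma>. sat K \<phi> (x # bs)"
  proof (rule sat[unfolded saturated_def, rule_format, of "A \<union> F"])
    show "A \<union> F \<subseteq> carrier K" using A by blast
    show "ordLeq3 (card_of (A \<union> F)) (card_of ((UNIV :: ('f, 'r) fm set) \<times> lists A))" by (rule ordLeq_params[OF A(2)])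
    show "\<Sigma> \<subseteq> UNIV \<times> lists (A \<union> F)" unfolding \<Sigma>_def using Ps by (force simp: in_lists_conv_set)
    fix \<Sigma>0 assume S: "finite \<Sigma>0" "\<Sigma>0 \<subseteq> \<Sigma>"
    obtain \<F> where F: "\<F> \<subseteq> \<P>" "finite \<F>" "\<Sigma>0 = (\<lambda>p. (fm p, snd p)) ` \<F>"
      using finite_subset_image[OF S[unfolded \<Sigma>_def]] by blast
    obtain x where x: "x \<in> carrier K" "\<And>P bs. (P, bs) \<in> \<F> \<Longrightarrow> P (x # bs)" using fs[OF F(2,1)] by blast
    have "sat K \<phi> (x # bs)" if "(\<phi>, bs) \<in> \<Sigma>0" for \<phi> bs
    proof -
      obtain P where P: "(P, bs) \<in> \<F>" "\<phi> = fm (P, bs)" using \<open>(\<phi>, bs) \<in> \<Sigma>0\<close> unfolding F(3) by auto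
      then show ?thesis using x fm'[of P bs x] F(1) by blast
    qed
    then show "\<exists>x\<in>carrier K. \<forall>(\<phi>, bs)\<in>\<Sigma>0. sat K \<phi> (x # bs)" using x(1) by blast
  qed
  then obtain x where x: "x \<in> carrier K" "\<And>\<phi> bs. (\<phi>, bs) \<in> \<Sigma> \<Longrightarrow> sat K \<phi> (x # bs)" by blast
  have "P (x # bs)" if p: "(P, bs) \<in> \<P>" for P bs
  proof -
    have "(fm (P, bs), bs) \<in> \<Sigma>" unfolding \<Sigma>_def using image_eqI[OF _ p, of "(fm (P, bs), bs)" "\<lambda>p. (fm p, snd p)"] by simp
    then show ?thesis using x fm'[OF p x(1)] by blast
  qed
  then show ?thesis using x(1) by blast
qed

text \<open>The type to realise says \<open>\<Phi>\<close> and denies every formula over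
  \<open>A \<union> F\<close> with uniformly few solutions. Finitely many such formulas exclude
  finitely many leading terms, too few to exhaust an infinite set.\<close>

lemma generic_ex:
  assumes sat: "saturated K A" and A: "A \<subseteq> carrier K" "finite F" "F \<subseteq> carrier K"
    and bs: "set bs \<subseteq> A \<union> F" and L: "LDef (Suc (length bs)) \<Phi>"
    and inf: "infinite (rv K ` {y \<in> carrier K. y \<noteq> \<zero> \<and> \<Phi> (y # bs)})"
  shows "\<exists>y\<in>carrier K. y \<noteq> \<zero> \<and> \<Phi> (y # bs) \<and> rv K y \<notin> cl (pt ` (A \<union> F))"
proof -
  have AF: "A \<union> F \<subseteq> carrier K" using A by blast
  define P0 where "P0 = (\<lambda>l. l ! 0 \<noteq> \<zero> \<and> \<Phi> l)"
  have L0: "LDef (Suc (length bs)) P0" using L unfolding P0_def LDef_def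
    by (intro Def_basic Tm_nth_map tm_intros) simp_all
  define \<N> where "\<N> = {((\<lambda>l. \<not> \<Psi> l), as) | \<Psi> as. set as \<subseteq> A \<union> F \<and> LDef (Suc (length as)) \<Psi> \<and> (\<exists>N. \<forall>ws\<in>tuples K (length as). few (rv K) N \<Psi> ws)}"
  have "\<exists>x\<in>carrier K. \<forall>(P, cs)\<in>insert (P0, bs) \<N>. P (x # cs)"
  proof (rule saturatedD[OF sat A])
    fix P cs assume "(P, cs) \<in> insert (P0, bs) \<N>"
    then show "set cs \<subseteq> A \<union> F \<and> LDef (Suc (length cs)) P"
    proof
      assume "(P, cs) = (P0, bs)"
      then show ?thesis using bs L0 by simp
    next
      assume "(P, cs) \<in> \<N>"
      then obtain \<Psi> where "P = (\<lambda>l. \<not> \<Psi> l)" "set cs \<subseteq> A \<union> F" "LDef (Suc (length cs)) \<Psi>" unfolding \<N>_def by blast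
      then show ?thesis unfolding LDef_def using Def_basic(3) by blast
    qed
  next
    fix \<F> assume F: "finite \<F>" "\<F> \<subseteq> insert (P0, bs) \<N>"
    define bad where "bad = (\<lambda>p. rv K ` {y \<in> carrier K. \<not> fst p (y # snd p)})"
    have fin: "finite (bad p)" if "p \<in> \<N>" for p
    proof -
      obtain \<Psi> as N where p: "p = ((\<lambda>l. \<not> \<Psi> l), as)" "set as \<subseteq> A \<union> F" "\<And>ws. ws \<in> tuples K (length as) \<Longrightarrow> few (rv K) N \<Psi> ws"
        using \<open>p \<in> \<N>\<close> unfolding \<N>_def by blast
      have "as \<in> tuples K (length as)" using p(2) AF by (auto simp: tuples_iff)
      from p(3)[OF this] show ?thesis unfolding few_def bad_def p(1) by simp
    qed
    have "finite (\<Union>p\<in>\<F> \<inter> \<N>. bad p)" using F(1) fin by blast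
    then obtain \<xi> where x: "\<xi> \<in> rv K ` {y \<in> carrier K. y \<noteq> \<zero> \<and> \<Phi> (y # bs)}" "\<xi> \<notin> (\<Union>p\<in>\<F> \<inter> \<N>. bad p)"
      using inf by (meson finite_subset subsetI)
    then obtain y where y: "y \<in> carrier K" "y \<noteq> \<zero>" "\<Phi> (y # bs)" "\<xi> = rv K y" by blast
    have "P (y # cs)" if "(P, cs) \<in> \<F>" for P cs
    proof (cases "(P, cs) \<in> \<N>")
      case True
      then have "\<xi> \<notin> bad (P, cs)" using x(2) that by blast
      then show ?thesis using y unfolding bad_def by auto
    next
      case False
      then have "P = P0" "cs = bs" using that F(2) by blast+
      then show ?thesis using y unfolding P0_def by simp
    qed
    then show "\<exists>x\<in>carrier K. \<forall>(P, cs)\<in>\<F>. P (x # cs)" using y(1) by blast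
  qed
  then obtain y where y: "y \<in> carrier K" "P0 (y # bs)" "\<And>P cs. (P, cs) \<in> \<N> \<Longrightarrow> P (y # cs)" by blast
  have "rv K y \<notin> cl (pt ` (A \<union> F))"
  proof
    assume "rv K y \<in> cl (pt ` (A \<union> F))"
    then obtain ps where ps: "set ps \<subseteq> pt ` (A \<union> F)" "alg (rv K) ps (rv K y)" unfolding cl_def by blast
    obtain as where as: "set as \<subseteq> A \<union> F" "map pt as = ps" using map_ex[OF ps(1)] by blast
    have len: "length ps = length as" using as(2) by auto
    obtain \<Psi> N where Ps: "LDef (Suc (length as)) \<Psi>" "\<And>ws. ws \<in> tuples K (length as) \<Longrightarrow> few (rv K) N \<Psi> ws"
      "\<And>ws z. rep ws ps \<Longrightarrow> [z] \<in> rv K y \<Longrightarrow> \<Psi> (z # ws)"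
      by (rule algE[OF ps(2), unfolded len], rule that)
    have "((\<lambda>l. \<not> \<Psi> l), as) \<in> \<N>" unfolding \<N>_def using as(1) Ps(1,2) by blast
    from y(3)[OF this] have "\<not> \<Psi> (y # as)" .
    moreover have "rep as ps" using rep_pt[of as as] as AF by auto
    ultimately show False using Ps(3)[of as y] rv_self[OF y(1)] by blast
  qed
  then show ?thesis using y(1,2) unfolding P0_def by auto
qed

text \<open>Saturation concerns parameters from the field, so \<open>\<zeta>\<close> and
  \<open>B\<close> are replaced by representatives; genericity over these is the stronger property,
  as points compute their leading terms.\<close>

lemma generic_fibre:
  assumes sat: "saturated K A" and A: "A \<subseteq> carrier K" and X: "RD (Suc m) X" and z: "\<zeta> \<in> RVx_pow K m"
    and inf: "infinite {\<xi>. \<zeta> @ [\<xi>] \<in> X}" and B: "finite B" "B \<subseteq> RVx K"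
  shows "\<exists>\<xi>. \<zeta> @ [\<xi>] \<in> X \<and> \<xi> \<notin> cl (pt ` A \<union> set \<zeta> \<union> B)"
proof -
  obtain zs where zs: "zs \<in> tuples K m" "\<zero> \<notin> set zs" "\<zeta> = map (rv K) zs" using RVx_pow_rep[OF z] by blast
  have zsl: "length zs = m" "set zs \<subseteq> carrier K" using zs(1) unfolding tuples_iff by blast+
  obtain bl where bl: "set bl = B" using finite_list[OF B(1)] by blast
  have "bl \<in> RVx_pow K (length bl)" using bl B(2) by (simp add: RVx_pow_iff)
  then obtain ds where ds: "ds \<in> tuples K (length bl)" "\<zero> \<notin> set ds" "bl = map (rv K) ds" using RVx_pow_rep by blast
  have dsc: "set ds \<subseteq> carrier K" using ds(1) unfolding tuples_iff by blast
  let ?F = "set zs \<union> set ds"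
  define \<Phi> where "\<Phi> = (\<lambda>l. map (rv K) (tl l) @ [rv K (l ! 0)] \<in> X)"
  have L: "LDef (Suc (length zs)) \<Phi>" unfolding LDef_def \<Phi>_def zsl(1)
    by (intro Def_RD[OF X] rtm_intros tm_intros Tm_nth_map tml_intros) ((rule refl | simp)+)?
  have \<Phi>: "\<Phi> (y # zs) \<longleftrightarrow> \<zeta> @ [rv K y] \<in> X" for y unfolding \<Phi>_def zs(3) by simp
  have XR: "\<xi> \<in> RVx K" if "\<zeta> @ [\<xi>] \<in> X" for \<xi>
  proof -
    have "\<zeta> @ [\<xi>] \<in> RVx_pow K (Suc m)" using that X unfolding RD_def by blast
    then show ?thesis by (simp add: RVx_pow_iff)
  qed
  have "{\<xi>. \<zeta> @ [\<xi>] \<in> X} \<subseteq> rv K ` {y \<in> carrier K. y \<noteq> \<zero> \<and> \<Phi> (y # zs)}"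
  proof
    fix \<xi> assume "\<xi> \<in> {\<xi>. \<zeta> @ [\<xi>] \<in> X}"
    then have h: "\<zeta> @ [\<xi>] \<in> X" by simp
    obtain y where y: "y \<in> carrier K - {\<zero>}" "\<xi> = rv K y" using XR[OF h] unfolding RVx_def by blast
    then show "\<xi> \<in> rv K ` {y \<in> carrier K. y \<noteq> \<zero> \<and> \<Phi> (y # zs)}" using \<Phi> h by blast
  qed
  then have "infinite (rv K ` {y \<in> carrier K. y \<noteq> \<zero> \<and> \<Phi> (y # zs)})" using inf finite_subset by blast
  from generic_ex[OF sat A _ _ _ L this, of ?F] zsl(2) dsc
  obtain y where y: "y \<in> carrier K" "\<Phi> (y # zs)" "rv K y \<notin> cl (pt ` (A \<union> ?F))" by auto
  let ?P = "pt ` (A \<union> ?F)"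
  have AF: "A \<union> ?F \<subseteq> carrier K" using A zsl(2) dsc by blast
  have sub: "set \<zeta> \<union> B \<subseteq> cl ?P"
  proof
    fix \<eta> assume "\<eta> \<in> set \<zeta> \<union> B"
    then obtain b where b: "b \<in> ?F" "\<eta> = rv K b" using zs(3) ds(3) bl by auto
    then have "b \<noteq> \<zero>" using zs(2) ds(2) by auto
    then show "\<eta> \<in> cl ?P" unfolding b(2) by (intro cl_pt_rv[OF AF]) (use b(1) in auto)
  qed
  have "rv K y \<notin> cl (pt ` A \<union> set \<zeta> \<union> B)"
  proof
    assume "rv K y \<in> cl (pt ` A \<union> set \<zeta> \<union> B)"
    then have h: "rv K y \<in> cl (?P \<union> (set \<zeta> \<union> B))" using cl_mono[of "pt ` A \<union> set \<zeta> \<union> B" "?P \<union> (set \<zeta> \<union> B)"] by blast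
    have "rv K y \<in> cl ?P" by (rule cop.cl_trans_finite[OF _ sub h]) (use B(1) in simp)
    then show False using y(3) by blast
  qed
  then show ?thesis using y(2) \<Phi> by blast
qed

text \<open>One coordinate is realised at a time, the last one first: its type asserts, for each
  finite part of the family, that the remaining coordinates can be found.\<close>

lemma compact_tuples:
  assumes sat: "saturated K {}" and bs: "set bs \<subseteq> carrier K"
    and Ps: "\<And>P. P \<in> \<P> \<Longrightarrow> LDef (n + length bs) P"
    and fs: "\<And>\<F>. finite \<F> \<Longrightarrow> \<F> \<subseteq> \<P> \<Longrightarrow> \<exists>xs\<in>tuples K n. \<forall>P\<in>\<F>. P (xs @ bs)"
  shows "\<exists>xs\<in>tuples K n. \<forall>P\<in>\<P>. P (xs @ bs)"
  using bs Ps fs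
proof (induction n arbitrary: bs)
  case 0
  have h: "P ([] @ bs)" if "P \<in> \<P>" for P
    using "0.prems"(3)[of "{P}"] that by (auto simp: tuples_iff)
  show ?case by (rule bexI[of _ "[]"]) (use h in \<open>blast, simp add: tuples_iff\<close>)
next
  case (Suc n)
  define ex where "ex = (\<lambda>\<F> l. \<exists>xs\<in>tuples K n. \<forall>P\<in>\<F>. P (xs @ l))"
  have Lex: "LDef (Suc (length bs)) (ex \<F>)" if F: "finite \<F>" "\<F> \<subseteq> \<P>" for \<F>
  proof -
    obtain ps where ps: "set ps = \<F>" using finite_list[OF F(1)] by blast
    have L: "LDef (Suc n + length bs) (ps ! i)" if "i < length ps" for i using Suc.prems(2) F(2) ps that nth_mem by blast
    have e: "ex \<F> = (\<lambda>l. \<exists>xs\<in>tuples K n. \<forall>i<length ps. (ps ! i) (xs @ l))"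
      unfolding ex_def ps[symmetric] all_set_conv_all_nth ..
    show ?thesis unfolding e LDef_def
    proof (intro Def_quant Def_finite_all)
      fix i assume i: "i < length ps"
      show "Def (\<lambda>e. (ps ! i) (map e [0..<n] @ map (\<lambda>na. e (na + n)) [0..<Suc (length bs)]))"
        by (rule LDef_app[OF L[OF i]], intro tml_intros tm_intros) ((rule refl | simp)+)?
    qed
  qed
  have "\<exists>x\<in>carrier K. \<forall>(P, cs)\<in>{(ex \<F>, bs) | \<F>. finite \<F> \<and> \<F> \<subseteq> \<P>}. P (x # cs)"
  proof (rule saturatedD[OF sat empty_subsetI, of "set bs"])
    show "set cs \<subseteq> {} \<union> set bs \<and> LDef (Suc (length cs)) P" if "(P, cs) \<in> {(ex \<F>, bs) | \<F>. finite \<F> \<and> \<F> \<subseteq> \<P>}" for P cs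
      using that Lex by auto
    fix \<G> assume G: "finite \<G>" "\<G> \<subseteq> {(ex \<F>, bs) | \<F>. finite \<F> \<and> \<F> \<subseteq> \<P>}"
    then have "\<forall>p\<in>\<G>. \<exists>\<F>. finite \<F> \<and> \<F> \<subseteq> \<P> \<and> p = (ex \<F>, bs)" by blast
    from bchoice[OF this] obtain fam where fam: "\<And>p. p \<in> \<G> \<Longrightarrow> finite (fam p) \<and> fam p \<subseteq> \<P> \<and> p = (ex (fam p), bs)" by blast
    have "finite (\<Union>p\<in>\<G>. fam p)" "(\<Union>p\<in>\<G>. fam p) \<subseteq> \<P>" using G(1) fam by blast+
    from Suc.prems(3)[OF this] obtain ys where ys: "ys \<in> tuples K (Suc n)" "\<And>P. P \<in> (\<Union>p\<in>\<G>. fam p) \<Longrightarrow> P (ys @ bs)" by blast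
    obtain xs x where xx: "ys = xs @ [x]" using ys(1) by (cases ys rule: rev_cases) (auto simp: tuples_iff)
    have xc: "xs \<in> tuples K n" "x \<in> carrier K" using ys(1) xx by (auto simp: tuples_iff)
    have "P (x # cs)" if p: "(P, cs) \<in> \<G>" for P cs
    proof -
      have "ex (fam (P, cs)) (x # bs)" unfolding ex_def using ys(2) xc(1) xx p by (intro bexI[of _ xs]) auto
      moreover have "(P, cs) = (ex (fam (P, cs)), bs)" using fam[OF p] by blast
      ultimately show ?thesis by (metis prod.inject)
    qed
    then show "\<exists>x\<in>carrier K. \<forall>(P, cs)\<in>\<G>. P (x # cs)" using xc(2) by blast
  qed (use Suc.prems(1) in simp_all)
  then obtain x where x: "x \<in> carrier K" and ex: "\<And>\<F>. finite \<F> \<Longrightarrow> \<F> \<subseteq> \<P> \<Longrightarrow> ex \<F> (x # bs)" by blast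
  have "\<exists>xs\<in>tuples K n. \<forall>P\<in>\<P>. P (xs @ (x # bs))"
  proof (rule Suc.IH)
    show "LDef (n + length (x # bs)) P" if "P \<in> \<P>" for P using Suc.prems(2)[OF that] by simp
    show "\<exists>xs\<in>tuples K n. \<forall>P\<in>\<F>. P (xs @ (x # bs))" if "finite \<F>" "\<F> \<subseteq> \<P>" for \<F>
      using ex[OF that] unfolding ex_def .
  qed (use x Suc.prems(1) in simp)
  then obtain xs where xs: "xs \<in> tuples K n" "\<And>P. P \<in> \<P> \<Longrightarrow> P (xs @ (x # bs))" by blast
  then show ?case using x by (intro bexI[of _ "xs @ [x]"]) (auto simp: tuples_iff)
qed

lemma compact_cover:
  assumes sat: "saturated K {}" and Y: "RD n Y" and X: "\<And>X. X \<in> \<X> \<Longrightarrow> RD n X" and cov: "Y \<subseteq> \<Union>\<X>"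
  shows "\<exists>\<F>. finite \<F> \<and> \<F> \<subseteq> \<X> \<and> Y \<subseteq> \<Union>\<F>"
proof (rule ccontr)
  assume n: "\<not> (\<exists>\<F>. finite \<F> \<and> \<F> \<subseteq> \<X> \<and> Y \<subseteq> \<Union>\<F>)"
  define neg where "neg = (\<lambda>X xs. map (rv K) xs \<in> Y \<and> map (rv K) xs \<notin> X)"
  have L: "LDef n (neg X)" if "RD n X" for X
    using Y that unfolding RD_def LDef_def neg_def by (intro Def_basic) blast+
  \<comment> \<open>The empty set is added to the cover so that membership in \<open>Y\<close> is
    part of the type even if the family is empty.\<close>
  have "\<exists>xs\<in>tuples K n. \<forall>P\<in>neg ` insert {} \<X>. P (xs @ [])"
  proof (rule compact_tuples[OF sat])
    have "RD n {}" by (rule RDI[where P = "\<lambda>_. False"]) (simp_all add: Def_basic)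
    then show "LDef (n + length ([] :: 'a list)) P" if "P \<in> neg ` insert {} \<X>" for P using that L X by auto
    fix \<F> assume F: "finite \<F>" "\<F> \<subseteq> neg ` insert {} \<X>"
    obtain \<G> where G: "\<G> \<subseteq> insert {} \<X>" "finite \<G>" "\<F> = neg ` \<G>" using finite_subset_image[OF F] by blast
    have "finite (\<G> - {{}})" "\<G> - {{}} \<subseteq> \<X>" using G by blast+
    then have "\<not> Y \<subseteq> \<Union>(\<G> - {{}})" using n by blast
    then obtain \<eta> where e: "\<eta> \<in> Y" "\<eta> \<notin> \<Union>\<G>" by auto
    obtain xs where xs: "xs \<in> tuples K n" "\<eta> = map (rv K) xs" using RVx_pow_rep[of \<eta> n] Y e(1) unfolding RD_def by blast
    show "\<exists>xs\<in>tuples K n. \<forall>P\<in>\<F>. P (xs @ [])"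
      by (rule bexI[OF _ xs(1)]) (use e xs(2) in \<open>auto simp: G(3) neg_def\<close>)
  qed simp
  then obtain xs where "\<And>X. X \<in> insert {} \<X> \<Longrightarrow> neg X xs" by auto
  then have "map (rv K) xs \<in> Y" "\<And>X. X \<in> \<X> \<Longrightarrow> map (rv K) xs \<notin> X" unfolding neg_def by blast+
  then show False using cov by blast
qed

section \<open>Uniform finiteness\<close>

lemma veq_sym: "veq K x y \<Longrightarrow> veq K y x"
  unfolding veq_def by blast

lemma sm_vle: assumes "sm a x" "vle K x y" "y \<in> carrier K" shows "sm a y"
proof -
  obtain m where m: "m \<in> \<M>" "a = m \<otimes> x" using assms(1) unfolding sm_def by blast
  obtain b where b: "b \<in> \<O>" "x = b \<otimes> y" using assms(2) unfolding vle_def by blast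
  have "a = (m \<otimes> b) \<otimes> y" using m b O_carrier[OF b(1)] O_carrier[OF M_O[OF m(1)]] assms(3) by (simp add: m_assoc)
  then show ?thesis unfolding sm_def using M_times(1)[OF m(1) b(1)] by blast
qed

lemma vle_diff: assumes "vle K x z" "vle K y z" "z \<in> carrier K" shows "vle K (x \<ominus> y) z"
proof -
  obtain a b where ab: "a \<in> \<O>" "x = a \<otimes> z" "b \<in> \<O>" "y = b \<otimes> z" using assms unfolding vle_def by blast
  have "x \<ominus> y = (a \<ominus> b) \<otimes> z" unfolding ab(2,4)
    by (rule l_diff_distr[symmetric]) (fact O_carrier[OF ab(1)] O_carrier[OF ab(3)] assms(3))+
  then show ?thesis unfolding vle_def by (rule bexI[OF _ O_simps(6)[OF ab(1,3)]])
qed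

lemma vle_add: assumes "vle K x z" "vle K y z" "z \<in> carrier K" shows "vle K (x \<oplus> y) z"
proof -
  obtain a b where ab: "a \<in> \<O>" "x = a \<otimes> z" "b \<in> \<O>" "y = b \<otimes> z" using assms unfolding vle_def by blast
  have "x \<oplus> y = (a \<oplus> b) \<otimes> z" unfolding ab(2,4)
    by (rule l_distr[symmetric]) (fact O_carrier[OF ab(1)] O_carrier[OF ab(3)] assms(3))+
  then show ?thesis unfolding vle_def by (rule bexI[OF _ O_simps(5)[OF ab(1,3)]])
qed

lemma vle_mult: assumes "vle K x z" "u \<in> \<O>" "z \<in> carrier K" shows "vle K (u \<otimes> x) z"
proof -
  obtain a where ab: "a \<in> \<O>" "x = a \<otimes> z" using assms unfolding vle_def by blast
  have "u \<otimes> x = (u \<otimes> a) \<otimes> z" unfolding ab(2)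
    by (rule m_assoc[symmetric]) (fact O_carrier[OF ab(1)] O_carrier[OF assms(2)] assms(3))+
  then show ?thesis unfolding vle_def by (rule bexI[OF _ O_simps(4)[OF assms(2) ab(1)]])
qed

lemma vle_not_sm: assumes "vle K x z" "\<not> sm x z" "z \<in> carrier K" shows "veq K x z"
proof -
  obtain a where ab: "a \<in> \<O>" "x = a \<otimes> z" using assms unfolding vle_def by blast
  then have n: "a \<notin> \<M>" using assms(2) sm_M by blast
  note u = unitD(1,2)[OF ab(1) n]
  have "inv a \<otimes> x = z" using ab assms(3) u O_carrier[OF ab(1)] by (simp add: m_assoc[symmetric])
  then show ?thesis unfolding veq_def vle_def using ab u(2) by blast
qed

lemma rv_eq_sm:
  assumes "rv K x = rv K y" "x \<in> carrier K" "y \<in> carrier K" "vle K x z" "z \<in> carrier K" shows "sm (y \<ominus> x) z"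
  using assms rv_eq_iff[of x y] sm_vle by blast

lemma sm_rv_eq:
  assumes "sm (y \<ominus> x) z" "x \<in> carrier K" "y \<in> carrier K" "vle K z x" shows "rv K x = rv K y"
  using assms rv_eq_iff[of x y] sm_vle by blast

lemma rv_veq: assumes "rv K x = rv K y" "x \<in> carrier K" "y \<in> carrier K" shows "vle K x y"
proof -
  obtain m where m: "m \<in> \<M>" "x = y \<otimes> (\<one> \<oplus> m)"
    using rv_mem_iff[of y x] rv_mem[of x y] assms by auto
  then have "x = (\<one> \<oplus> m) \<otimes> y" using assms O_carrier[OF one_plus_M(1)[OF m(1)]] by (simp add: m_comm)
  then show ?thesis unfolding vle_def using one_plus_M(1)[OF m(1)] by blast
qed

lemma vle_trans: assumes "vle K x y" "vle K y z" "z \<in> carrier K" shows "vle K x z"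
proof -
  obtain a where "a \<in> \<O>" "x = a \<otimes> y" using assms(1) unfolding vle_def by blast
  then show ?thesis using vle_mult[OF assms(2) _ assms(3)] by blast
qed

lemma Def_veq: "Tm t \<Longrightarrow> Tm s \<Longrightarrow> Def (\<lambda>e. veq K (t e) (s e))"
proof (rule Def_app2)
  have "Def (\<lambda>e. (\<exists>a\<in>carrier K. a \<in> \<O> \<and> e 0 = a \<otimes> e 1) \<and> (\<exists>a\<in>carrier K. a \<in> \<O> \<and> e 1 = a \<otimes> e 0))"
    by (intro Def_basic Def_quant tm_intros)
  then show "Def (\<lambda>e. veq K (e 0) (e 1))"
    by (rule Def_cong) (use O_carrier in \<open>auto simp: veq_def vle_def\<close>)
qed

section \<open>Leading terms computed from other leading terms\<close>

lemma cl_uniqueI: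
  assumes z: "\<zeta> \<in> RVx_pow K m" and y0: "y0 \<in> carrier K" "y0 \<noteq> \<zero>" and L: "LDef (Suc m) \<Phi>" and F: "finite F"
    and un: "\<And>ws y. ws \<in> tuples K m \<Longrightarrow> map (rv K) ws = \<zeta> \<Longrightarrow> y \<in> carrier K \<Longrightarrow> \<Phi> (y # ws) \<Longrightarrow> rv K y \<in> F"
    and ex: "vs \<in> tuples K m" "map (rv K) vs = \<zeta>" "\<Phi> (y0 # vs)"
  shows "rv K y0 \<in> cl (set \<zeta>)"
proof -
  have lz: "length \<zeta> = m" using z by (simp add: RVx_pow_iff)
  have L': "LDef (Suc (length \<zeta>)) \<Phi>" using L lz by simp
  have r: "rep vs \<zeta>" using rep_RVx[OF z] ex by blast
  have "alg (rv K) \<zeta> (rv K y0)"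
    by (rule alg_intro[OF kap_simps(2) RVx_pow_PRV[OF z] L' F _ r y0(1) ex(3)]) (use un rep_RVx[OF z] in blast)
  then show ?thesis unfolding cl_def using RVx_iff[OF y0(1)] y0(2) RVx_pow_PRV[OF z] by blast
qed

text \<open>If the leading term of the value depends only on those of the arguments, it is the
  single solution of a formula over them.\<close>

lemma cl_term2:
  assumes x: "x \<in> carrier K" "x \<noteq> \<zero>" and y: "y \<in> carrier K" "y \<noteq> \<zero>" and F: "F x y \<in> carrier K" "F x y \<noteq> \<zero>"
    and T: "Tm (\<lambda>e. F (e 0) (e 1))"
    and c: "\<And>x' y'. x' \<in> carrier K \<Longrightarrow> y' \<in> carrier K \<Longrightarrow> rv K x' = rv K x \<Longrightarrow> rv K y' = rv K y \<Longrightarrow> rv K (F x' y') = rv K (F x y)"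
  shows "rv K (F x y) \<in> cl {rv K x, rv K y}"
proof -
  define \<Phi> where "\<Phi> = (\<lambda>l. rv K (l ! 0) = rv K (F (l ! 1) (l ! 2)))"
  have T': "Tm (\<lambda>e. F (e 1) (e 2))"
    using Tm_shift[OF T] by (simp add: numeral_2_eq_2)
  have L: "LDef (Suc 2) \<Phi>" unfolding LDef_def \<Phi>_def
    by (rule Def_rv) (use T' in \<open>simp_all add: tm_intros numeral_2_eq_2 upt_rec\<close>)
  have "[rv K x, rv K y] \<in> RVx_pow K 2" using x y RVx_iff by (simp add: RVx_pow_iff)
  moreover have "rv K z \<in> {rv K (F x y)}" if h: "ws \<in> tuples K 2" "map (rv K) ws = [rv K x, rv K y]" "\<Phi> (z # ws)" for ws z
  proof -
    obtain x' y' where w: "ws = [x', y']" using h(2) by auto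
    then have "rv K z = rv K (F x' y')" using h(3) unfolding \<Phi>_def by simp
    then show ?thesis using c[of x' y'] h(1,2) w by (simp add: tuples_iff)
  qed
  ultimately have "rv K (F x y) \<in> cl (set [rv K x, rv K y])"
    by (intro cl_uniqueI[OF _ F L, where F = "{rv K (F x y)}" and vs = "[x, y]"])
       (use x y in \<open>simp_all add: tuples_iff \<Phi>_def\<close>)
  then show ?thesis by simp
qed

lemma cl_rv_mult: assumes "x \<in> carrier K" "y \<in> carrier K" "x \<noteq> \<zero>" "y \<noteq> \<zero>" shows "rv K (x \<otimes> y) \<in> cl {rv K x, rv K y}"
proof (rule cl_term2[where F = "\<lambda>x y. x \<otimes> y"])
  show "rv K (x' \<otimes> y') = rv K (x \<otimes> y)"
    if "x' \<in> carrier K" "y' \<in> carrier K" "rv K x' = rv K x" "rv K y' = rv K y" for x' y'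
    by (rule rv_times_cong[OF that(1,2) assms(1,2) that(3,4)])
qed (use assms in \<open>simp_all add: tm_intros\<close>)

lemma cl_rv_minus_mult: assumes "x \<in> carrier K" "y \<in> carrier K" "x \<noteq> \<zero>" "y \<noteq> \<zero>"
  shows "rv K (\<zero> \<ominus> x \<otimes> y) \<in> cl {rv K x, rv K y}"
proof (rule cl_term2[where F = "\<lambda>x y. \<zero> \<ominus> x \<otimes> y"])
  have m: "\<zero> \<ominus> w = (\<ominus> \<one>) \<otimes> w" if "w \<in> carrier K" for w using that by (simp add: a_minus_def l_minus)
  show "\<zero> \<ominus> x \<otimes> y \<noteq> \<zero>"
  proof
    assume "\<zero> \<ominus> x \<otimes> y = \<zero>"
    then have "\<zero> = x \<otimes> y" using r_right_minus_eq[OF zero_closed m_closed[OF assms(1,2)]] by blast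
    then show False using prod_nonzero[OF assms(1,2)] assms(3,4) by metis
  qed
  show "rv K (\<zero> \<ominus> x' \<otimes> y') = rv K (\<zero> \<ominus> x \<otimes> y)"
    if "x' \<in> carrier K" "y' \<in> carrier K" "rv K x' = rv K x" "rv K y' = rv K y" for x' y'
    unfolding m[OF m_closed[OF that(1,2)]] m[OF m_closed[OF assms(1,2)]]
    by (rule rv_times_cong[OF _ _ _ _ refl rv_times_cong[OF that(1,2) assms(1,2) that(3,4)]])
       (use that(1,2) assms(1,2) in simp_all)
qed (use assms in \<open>simp_all add: tm_intros\<close>)

text \<open>Without cancellation of leading terms, \<open>rv_shift\<close> replaces first one
  argument and then, after a change of sign, the other.\<close>

lemma cl_rv_diff: assumes "x \<in> carrier K" "y \<in> carrier K" "x \<noteq> \<zero>" "y \<noteq> \<zero>" "rv K x \<noteq> rv K y"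
  shows "rv K (x \<ominus> y) \<in> cl {rv K x, rv K y}"
proof (rule cl_term2[where F = "\<lambda>x y. x \<ominus> y"])
  show "x \<ominus> y \<noteq> \<zero>" using assms by auto
  show "rv K (x' \<ominus> y') = rv K (x \<ominus> y)"
    if "x' \<in> carrier K" "y' \<in> carrier K" "rv K x' = rv K x" "rv K y' = rv K y" for x' y'
  proof -
    have m: "rv K (\<ominus> w) = rv K (\<ominus> w')" if "w \<in> carrier K" "w' \<in> carrier K" "rv K w = rv K w'" for w w'
      using rv_times_cong[of "\<ominus> \<one>" w "\<ominus> \<one>" w'] that by (simp add: l_minus)
    have "rv K (x' \<ominus> y') = rv K (x \<ominus> y')" using rv_shift[of x' x y'] that assms by simp
    also have "\<dots> = rv K (\<ominus> (y' \<ominus> x))" using that assms by (simp add: uminus_diff)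
    also have "\<dots> = rv K (\<ominus> (y \<ominus> x))" using rv_shift[of y' y x] that assms by (intro m) simp_all
    also have "\<dots> = rv K (x \<ominus> y)" using assms by (simp add: uminus_diff)
    finally show ?thesis .
  qed
qed (use assms in \<open>simp_all add: tm_intros\<close>)

section \<open>Fibres and their difference quotients\<close>

definition fib :: "'a imag list set \<Rightarrow> 'a imag list \<Rightarrow> 'a imag set" where
  "fib X \<zeta> = {\<xi>. \<zeta> @ [\<xi>] \<in> X}"

lemma RD_mem: "RD n X \<Longrightarrow> \<xi> \<in> X \<Longrightarrow> length \<xi> = n \<and> set \<xi> \<subseteq> RVx K"
  using RVx_pow_iff unfolding RD_def by blast

lemma fib_RVx: "RD (Suc m) X \<Longrightarrow> \<xi> \<in> fib X \<zeta> \<Longrightarrow> \<zeta> \<in> RVx_pow K m \<and> \<xi> \<in> RVx K"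
  using RD_mem[of "Suc m" X "\<zeta> @ [\<xi>]"] unfolding fib_def by (simp add: RVx_pow_iff)

lemma few_fib: assumes X: "RD (Suc m) X"
  shows "few (rv K) N (\<lambda>l. map (rv K) (tl l) @ [rv K (l ! 0)] \<in> X) zs \<longleftrightarrow>
    finite (fib X (map (rv K) zs)) \<and> card (fib X (map (rv K) zs)) \<le> N"
proof -
  have "rv K ` {y \<in> carrier K. map (rv K) (tl (y # zs)) @ [rv K ((y # zs) ! 0)] \<in> X} = fib X (map (rv K) zs)"
  proof (intro equalityI subsetI)
    fix \<xi> assume x: "\<xi> \<in> fib X (map (rv K) zs)"
    then obtain y where "y \<in> carrier K" "\<xi> = rv K y" using fib_RVx[OF X x] unfolding RVx_def by blast
    then show "\<xi> \<in> rv K ` {y \<in> carrier K. map (rv K) (tl (y # zs)) @ [rv K ((y # zs) ! 0)] \<in> X}"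
      using x unfolding fib_def by simp
  qed (auto simp: fib_def)
  then show ?thesis unfolding few_def by simp
qed

text \<open>
  An infinite set of leading terms in one coset of the residue field's units produces every
  residue as a quotient of differences. Unlike infinity, this is visibly first-order, which
  is how the quantifier ``there are infinitely many'' is eliminated.
\<close>

definition spread :: "'a imag list set \<Rightarrow> 'a imag list \<Rightarrow> bool" where
  "spread X \<zeta> \<longleftrightarrow> (\<exists>\<theta>\<in>carrier K. \<theta> \<noteq> \<zero> \<and> (\<forall>u\<in>carrier K. u \<in> \<O> \<longrightarrow>
     (\<exists>x\<in>tuples K 4. (\<forall>i<4. rv K (x ! i) \<in> fib X \<zeta> \<and> veq K (x ! i) \<theta>) \<and>
        rv K (x ! 0) \<noteq> rv K (x ! 1) \<and> sm ((x ! 2 \<ominus> x ! 3) \<ominus> u \<otimes> (x ! 0 \<ominus> x ! 1)) \<theta>)))"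

lemma LDef_spread: assumes X: "RD (Suc m) X" shows "LDef m (\<lambda>zs. spread X (map (rv K) zs))"
  unfolding LDef_def spread_def fib_def mem_Collect_eq
  by (intro Def_basic Def_quant Def_finite_all tm_intros Def_rv Def_sm Def_veq Tm_nth_map Def_RD[OF X] rtm_intros tml_intros)
     ((rule refl | simp)+)?

text \<open>The leading terms of four points of size \<open>\<theta>\<close> determine the residue
  of \<open>u\<close>. The natural numbers supply infinitely many residues, while a finite fibre has
  finitely many quadruples.\<close>

lemma spread_infinite: assumes X: "RD (Suc m) X" and s: "spread X \<zeta>" shows "infinite (fib X \<zeta>)"
proof
  assume fin: "finite (fib X \<zeta>)"
  obtain \<theta> where \<theta>: "\<theta> \<in> carrier K" "\<theta> \<noteq> \<zero>" and ex: "\<And>u. u \<in> \<O> \<Longrightarrow> \<exists>x\<in>tuples K 4.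
     (\<forall>i<4. rv K (x ! i) \<in> fib X \<zeta> \<and> veq K (x ! i) \<theta>) \<and>
        rv K (x ! 0) \<noteq> rv K (x ! 1) \<and> sm ((x ! 2 \<ominus> x ! 3) \<ominus> u \<otimes> (x ! 0 \<ominus> x ! 1)) \<theta>"
    using s O_carrier unfolding spread_def by blast
  have "\<forall>n::nat. \<exists>x. x \<in> tuples K 4 \<and> (\<forall>i<4. rv K (x ! i) \<in> fib X \<zeta> \<and> veq K (x ! i) \<theta>) \<and>
        rv K (x ! 0) \<noteq> rv K (x ! 1) \<and> sm ((x ! 2 \<ominus> x ! 3) \<ominus> [n] \<cdot> \<one> \<otimes> (x ! 0 \<ominus> x ! 1)) \<theta>"
    using ex[OF nat_O] by blast
  from choice[OF this] obtain x where xt: "\<And>n::nat. x n \<in> tuples K 4"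
    and xf: "\<And>n i. i < 4 \<Longrightarrow> rv K (x n ! i) \<in> fib X \<zeta>" and xv: "\<And>n i. i < 4 \<Longrightarrow> veq K (x n ! i) \<theta>"
    and xn: "\<And>n. rv K (x n ! 0) \<noteq> rv K (x n ! 1)"
    and xs: "\<And>n. sm ((x n ! 2 \<ominus> x n ! 3) \<ominus> [n] \<cdot> \<one> \<otimes> (x n ! 0 \<ominus> x n ! 1)) \<theta>" by blast
  have xc: "x n ! i \<in> carrier K" if "i < 4" for n i
    using xt[of n] that unfolding tuples_iff by (metis nth_mem subsetD)
  have "inj (\<lambda>n. map (rv K) (x n))"
  proof (rule injI, rule ccontr)
    fix n k assume e: "map (rv K) (x n) = map (rv K) (x k)" and nk: "n \<noteq> k"
    have r: "rv K (x n ! i) = rv K (x k ! i)" if "i < 4" for i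
      using e xt[of n] xt[of k] that unfolding tuples_iff by (metis nth_map)
    have d: "sm (x k ! i \<ominus> x n ! i) \<theta>" if "i < 4" for i
      by (rule rv_eq_sm[OF r[OF that] xc[OF that] xc[OF that] _ \<theta>(1)]) (use xv[OF that] in \<open>simp add: veq_def\<close>)
    let ?u = "[n] \<cdot> \<one>" and ?v = "[k] \<cdot> \<one>"
    have uv: "?u \<in> carrier K" "?v \<in> carrier K" "?v \<in> \<O>" using nat_O by simp_all
    \<comment> \<open>Difference of the two approximate equations for \<open>u\<close> and
      \<open>v\<close>: every term on the right is small relative to
      \<open>\<theta>\<close>.\<close>
    have lin: "(u \<ominus> v) \<otimes> p = ((q' \<ominus> v \<otimes> p') \<ominus> (q \<ominus> u \<otimes> p)) \<ominus> (q' \<ominus> q) \<oplus> v \<otimes> (p' \<ominus> p)"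
      if "u \<in> carrier K" "v \<in> carrier K" "p \<in> carrier K" "q \<in> carrier K" "p' \<in> carrier K" "q' \<in> carrier K" for u v p q p' q'
      using that by (simp add: ring_arith)
    have com: "(a' \<ominus> b') \<ominus> (a \<ominus> b) = (a' \<ominus> a) \<ominus> (b' \<ominus> b)"
      if "a \<in> carrier K" "b \<in> carrier K" "a' \<in> carrier K" "b' \<in> carrier K" for a b a' b'
      using that by (simp add: ring_arith)
    have c4: "x j ! 0 \<in> carrier K" "x j ! 1 \<in> carrier K" "x j ! 2 \<in> carrier K" "x j ! 3 \<in> carrier K" for j
      by (rule xc, simp)+
    have s1: "sm ((x k ! 2 \<ominus> x k ! 3) \<ominus> (x n ! 2 \<ominus> x n ! 3)) \<theta>"
      unfolding com[OF c4(3,4) c4(3,4)] by (intro sm_diff d \<theta>) simp_all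
    have s2: "sm ((x k ! 0 \<ominus> x k ! 1) \<ominus> (x n ! 0 \<ominus> x n ! 1)) \<theta>"
      unfolding com[OF c4(1,2) c4(1,2)] by (intro sm_diff d \<theta>) simp_all
    have "sm ((?u \<ominus> ?v) \<otimes> (x n ! 0 \<ominus> x n ! 1)) \<theta>"
      by (subst lin[where q = "x n ! 2 \<ominus> x n ! 3" and q' = "x k ! 2 \<ominus> x k ! 3" and p' = "x k ! 0 \<ominus> x k ! 1"])
         (use c4 uv in simp, use c4 uv in simp, use c4 uv in simp, use c4 uv in simp, use c4 uv in simp, use c4 uv in simp,
          intro sm_add sm_diff sm_O xs s1 s2 \<theta> uv)
    then obtain \<mu> where m: "\<mu> \<in> \<M>" "(?u \<ominus> ?v) \<otimes> (x n ! 0 \<ominus> x n ! 1) = \<mu> \<otimes> \<theta>" unfolding sm_def by blast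
    let ?w = "?u \<ominus> ?v"
    have w: "?w \<in> \<O>" "?w \<notin> \<M>" using nat_inj[OF nk] O_simps(6)[OF nat_O nat_O] by blast+
    note wi = unitD(1,2)[OF w]
    have wc: "?w \<in> carrier K" "inv ?w \<in> carrier K" using w wi O_carrier by blast+
    have mc: "\<mu> \<in> carrier K" using m O_carrier M_O by blast
    have "x n ! 0 \<ominus> x n ! 1 = inv ?w \<otimes> (?w \<otimes> (x n ! 0 \<ominus> x n ! 1))"
      using wc wi c4 by (simp add: m_assoc[symmetric])
    also have "\<dots> = (inv ?w \<otimes> \<mu>) \<otimes> \<theta>" using m(2) wc mc \<theta> by (simp add: m_assoc)
    finally have "sm (x n ! 0 \<ominus> x n ! 1) \<theta>" unfolding sm_def using M_times(2)[OF m(1) wi(2)] by blast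
    then have "rv K (x n ! 1) = rv K (x n ! 0)"
      by (rule sm_rv_eq) (use c4 xv[of 1 n] in \<open>simp_all add: veq_def\<close>)
    then show False using xn[of n] by simp
  qed
  moreover have "range (\<lambda>n. map (rv K) (x n)) \<subseteq> {l. set l \<subseteq> fib X \<zeta> \<and> length l = 4}"
  proof
    fix l assume "l \<in> range (\<lambda>n. map (rv K) (x n))"
    then obtain n where n: "l = map (rv K) (x n)" by blast
    have "length (x n) = 4" using xt[of n] by (simp add: tuples_iff)
    then show "l \<in> {l. set l \<subseteq> fib X \<zeta> \<and> length l = 4}" unfolding n using xf by (auto simp: set_conv_nth)
  qed
  moreover have "finite {l. set l \<subseteq> fib X \<zeta> \<and> length l = 4}" using finite_lists_length_eq[OF fin] by simp
  ultimately show False by (meson finite_subset range_inj_infinite)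
qed

text \<open>Having the same absolute value, as a set of pairs: the value group is not a sort of
  \<open>RD\<close>, so a coset of \<open>kx K\<close> is named by one of its elements.\<close>

definition vpairs :: "'a imag list set" where
  "vpairs = {\<xi>. \<exists>x\<in>carrier K. \<exists>y\<in>carrier K. x \<noteq> \<zero> \<and> y \<noteq> \<zero> \<and> veq K x y \<and> \<xi> = [rv K x, rv K y]}"

lemma vpairs_iff: "[\<xi>, \<eta>] \<in> vpairs \<longleftrightarrow>
    (\<exists>x\<in>carrier K. \<exists>y\<in>carrier K. x \<noteq> \<zero> \<and> y \<noteq> \<zero> \<and> veq K x y \<and> \<xi> = rv K x \<and> \<eta> = rv K y)"
  unfolding vpairs_def by simp

lemma RD_vpairs: "RD 2 vpairs"
proof (rule RDI)
  define P where "P = (\<lambda>\<xi>. \<exists>x\<in>carrier K. \<exists>y\<in>carrier K. x \<noteq> \<zero> \<and> y \<noteq> \<zero> \<and> veq K x y \<and> \<xi> ! 0 = rv K x \<and> \<xi> ! 1 = rv K y)"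
  have R: "rv K x \<in> RVx K" if "x \<in> carrier K" "x \<noteq> \<zero>" for x using RVx_iff that by blast
  show "vpairs \<subseteq> RVx_pow K 2" using R by (auto simp: RVx_pow_iff vpairs_def)
  show "\<xi> \<in> vpairs \<longleftrightarrow> P \<xi>" if "\<xi> \<in> RVx_pow K 2" for \<xi>
  proof -
    have "length \<xi> = 2" using that by (simp add: RVx_pow_iff)
    then obtain \<xi>0 \<xi>1 where "\<xi> = [\<xi>0, \<xi>1]" by (auto simp: numeral_2_eq_2 length_Suc_conv)
    then show ?thesis unfolding P_def by (simp add: vpairs_iff)
  qed
  have "Def (\<lambda>e. \<exists>x\<in>carrier K. \<exists>y\<in>carrier K. x \<noteq> \<zero> \<and> y \<noteq> \<zero> \<and> veq K x y \<and> rv K (e 0) = rv K x \<and> rv K (e 1) = rv K y)"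
    by (intro Def_basic Def_quant tm_intros Def_rv Def_veq)
  then show "Def (\<lambda>e. P (map (rv K) (map e [0..<2])))" unfolding P_def by (simp add: upt_rec)
qed

lemma vpairs_veq: assumes h0: "[rv K x, rv K y] \<in> vpairs" "x \<in> carrier K" "y \<in> carrier K" shows "veq K x y"
proof -
  obtain x' y' where h: "x' \<in> carrier K" "y' \<in> carrier K" "veq K x' y'" "rv K x = rv K x'" "rv K y = rv K y'"
    using h0(1)[unfolded vpairs_iff] by (elim bexE conjE)
  have "vle K x' y" by (rule vle_trans[of _ y']) (use h h0 rv_veq[of y' y] in \<open>simp_all add: veq_def\<close>)
  then have xy: "vle K x y" by (rule vle_trans[OF rv_veq[OF h(4) h0(2) h(1)] _ h0(3)])
  have "vle K y' x" by (rule vle_trans[of _ x']) (use h h0 rv_veq[of x' x] in \<open>simp_all add: veq_def\<close>)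
  then have "vle K y x" by (rule vle_trans[OF rv_veq[OF h(5) h0(3) h(2)] _ h0(2)])
  then show ?thesis using xy unfolding veq_def by blast
qed

lemma veq_fibre_infinite: assumes t: "t \<in> carrier K" "t \<noteq> \<zero>"
  shows "infinite (fib vpairs [rv K t])"
proof -
  \<comment> \<open>\<open>Suc n\<close> keeps the multipliers units of \<open>\<O>\<close>.\<close>
  let ?n = "\<lambda>n. [Suc n] \<cdot> \<one>"
  have u: "?n n \<in> \<O>" "?n n \<notin> \<M>" for n using nat_O nat_notin_M[of "Suc n"] by blast+
  note ui = unitD(1,2)[OF u]
  have c: "?n n \<in> carrier K" "inv (?n n) \<in> carrier K" for n using u ui O_carrier by blast+
  have "inj (\<lambda>n. rv K (?n n \<otimes> t))"
  proof (rule injI, rule ccontr)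
    fix n k assume e: "rv K (?n n \<otimes> t) = rv K (?n k \<otimes> t)" and nk: "n \<noteq> k"
    have "sm (?n k \<otimes> t \<ominus> ?n n \<otimes> t) (?n n \<otimes> t)" using e rv_eq_iff c t by simp
    then have "sm (t \<otimes> (?n k \<ominus> ?n n)) (t \<otimes> ?n n)" using c t by (simp add: r_diff_distr m_comm)
    then have "sm (?n k \<ominus> ?n n) (?n n)" using sm_cancel c t by blast
    then have "?n k \<ominus> ?n n \<in> \<M>" unfolding sm_def using M_times(1) u by auto
    then show False using nat_inj[of "Suc k" "Suc n"] nk by simp
  qed
  moreover have "rv K (?n n \<otimes> t) \<in> fib vpairs [rv K t]" for n
  proof -
    have "t = inv (?n n) \<otimes> (?n n \<otimes> t)" using c ui t by (simp add: m_assoc[symmetric])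
    then have "veq K t (?n n \<otimes> t)" unfolding veq_def vle_def using u ui by blast
    moreover have "?n n \<otimes> t \<in> carrier K" "?n n \<otimes> t \<noteq> \<zero>" using c ui t by simp_all
    ultimately have "[rv K t, rv K (?n n \<otimes> t)] \<in> vpairs" unfolding vpairs_iff
      by (intro bexI[of _ t] bexI[of _ "?n n \<otimes> t"] conjI t refl)
    then show ?thesis unfolding fib_def by simp
  qed
  ultimately show ?thesis using infinite_iff_countable_subset by blast
qed

end

locale smodel = hmodel + assumes sat: "saturated K {}"
begin

lemma generic_fib:
  assumes "RD (Suc m) X" "\<zeta> \<in> RVx_pow K m" "infinite (fib X \<zeta>)" "finite B" "B \<subseteq> RVx K"
  obtains \<xi> where "\<xi> \<in> fib X \<zeta>" "\<xi> \<notin> cl (set \<zeta> \<union> B)"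
  using generic_fibre[OF sat _ assms(1,2) _ assms(4,5)] assms(3) unfolding fib_def by auto

text \<open>If \<open>u\<close> were no quotient of differences, the assignment of
  \<open>y1 + u y2\<close> to a pair would be injective on pairs from the coset, up to leading
  terms. One leading term would then determine two independent ones.\<close>

lemma infinite_spread:
  assumes X: "RD (Suc m) X" and inf: "infinite (fib X \<zeta>)" shows "spread X \<zeta>"
proof -
  define V where "V = vpairs"
  have V2: "RD (Suc 1) V" using RD_vpairs unfolding V_def by (simp add: numeral_2_eq_2)
  obtain \<eta>0 where "\<eta>0 \<in> fib X \<zeta>" using inf by (metis finite.emptyI ex_in_conv)
  then have z: "\<zeta> \<in> RVx_pow K m" using fib_RVx[OF X] by blast
  have lz: "length \<zeta> = m" "set \<zeta> \<subseteq> RVx K" using z by (simp_all add: RVx_pow_iff)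
  obtain \<theta>0 where \<theta>0: "\<theta>0 \<in> fib X \<zeta>" "\<theta>0 \<notin> cl (set \<zeta>)" using generic_fib[OF X z inf, of "{}"] by auto
  have \<theta>0R: "\<theta>0 \<in> RVx K" using fib_RVx[OF X \<theta>0(1)] by blast
  obtain t0 where t0: "t0 \<in> carrier K" "t0 \<noteq> \<zero>" "\<theta>0 = rv K t0" using \<theta>0R unfolding RVx_def by blast
  have "infinite (fib V [\<theta>0])" using veq_fibre_infinite[OF t0(1,2)] unfolding V_def t0(3) .
  \<comment> \<open>An element of the coset of \<open>\<theta>0\<close>, generic over it, whose role
    is to name the coset; by symmetry of rank \<open>\<theta>0\<close> remains generic over
    \<open>\<zeta>\<close> and \<open>\<xi>\<close>.\<close>
  then obtain \<xi> where \<xi>: "\<xi> \<in> fib V [\<theta>0]" "\<xi> \<notin> cl (set [\<theta>0] \<union> set \<zeta>)"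
    using generic_fib[OF V2, of "[\<theta>0]" "set \<zeta>"] \<theta>0R lz(2) by (auto simp: RVx_pow_iff)
  have \<xi>R: "\<xi> \<in> RVx K" using fib_RVx[OF V2 \<xi>(1)] by blast
  have n\<theta>: "\<theta>0 \<notin> cl (insert \<xi> (set \<zeta>))"
    using pg.rnk_swap[of "set \<zeta>" \<theta>0 \<xi> "[]"] \<theta>0 \<xi> lz(2) \<theta>0R \<xi>R by (auto split: if_splits)
  have zx: "\<zeta> @ [\<xi>] \<in> RVx_pow K (Suc m)" using z \<xi>R by (simp add: RVx_pow_iff)
  \<comment> \<open>The fibre cut down to the coset named by \<open>\<xi>'\<close>. It stays
    infinite because it contains \<open>\<theta>0\<close>, which is not in the closure of the
    parameters.\<close>
  define D where "D = {\<zeta>' @ [\<xi>', \<eta>] | \<zeta>' \<xi>' \<eta>. length \<zeta>' = m \<and> \<zeta>' @ [\<eta>] \<in> X \<and> [\<eta>, \<xi>'] \<in> V}"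
  have De: "\<zeta>' @ [\<xi>', \<eta>] \<in> D \<longleftrightarrow> \<zeta>' @ [\<eta>] \<in> X \<and> [\<eta>, \<xi>'] \<in> V" if "length \<zeta>' = m" for \<zeta>' \<xi>' \<eta>
    unfolding D_def using that by auto
  have DD: "RD (Suc (Suc m)) D"
  proof (rule RDI)
    define P where "P = (\<lambda>\<xi>s::'a imag list. map (\<lambda>i. \<xi>s ! i) [0..<m] @ [\<xi>s ! Suc m] \<in> X \<and> [\<xi>s ! Suc m, \<xi>s ! m] \<in> V)"
    show "D \<subseteq> RVx_pow K (Suc (Suc m))"
    proof
      fix \<xi>s assume "\<xi>s \<in> D"
      then obtain \<zeta>' \<xi>' \<eta> where h: "\<xi>s = \<zeta>' @ [\<xi>', \<eta>]" "length \<zeta>' = m" "\<zeta>' @ [\<eta>] \<in> X" "[\<eta>, \<xi>'] \<in> V" unfolding D_def by blast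
      then show "\<xi>s \<in> RVx_pow K (Suc (Suc m))" using RD_mem[OF X h(3)] RD_mem[OF V2 h(4)] by (simp add: RVx_pow_iff)
    qed
    show "\<xi>s \<in> D \<longleftrightarrow> P \<xi>s" if "\<xi>s \<in> RVx_pow K (Suc (Suc m))" for \<xi>s
    proof -
      have len: "length \<xi>s = Suc (Suc m)" using that by (simp add: RVx_pow_iff)
      have e: "\<xi>s = map (\<lambda>i. \<xi>s ! i) [0..<m] @ [\<xi>s ! m, \<xi>s ! Suc m]"
        using map_nth[of \<xi>s] unfolding len by simp
      have "map (\<lambda>i. \<xi>s ! i) [0..<m] @ [\<xi>s ! m, \<xi>s ! Suc m] \<in> D \<longleftrightarrow> P \<xi>s"
        unfolding P_def by (rule De) simp
      then show ?thesis using e by metis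
    qed
    have g: "map (rv K) (map e [0..<Suc (Suc m)]) ! i = rv K (e i)" if "i < Suc (Suc m)" for e i
      using that by (simp del: upt_Suc)
    have "Def (\<lambda>e. map (\<lambda>i. rv K (e i)) [0..<m] @ [rv K (e (Suc m))] \<in> X \<and> [rv K (e (Suc m)), rv K (e m)] \<in> V)"
      by (intro Def_basic Def_RD[OF X] Def_RD[OF V2] RTmL_list rtm_intros tm_intros) ((rule refl | simp)+)?
    moreover have "map (\<lambda>i. map (rv K) (map e [0..<Suc (Suc m)]) ! i) [0..<m] = map (\<lambda>i. rv K (e i)) [0..<m]" for e
      by (rule map_cong[OF refl], rule g) simp
    ultimately show "Def (\<lambda>e. P (map (rv K) (map e [0..<Suc (Suc m)])))"
      unfolding P_def by (simp only: g lessI less_SucI)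
  qed
  have fD: "fib D (\<zeta> @ [\<xi>]) = {\<eta> \<in> fib X \<zeta>. [\<eta>, \<xi>] \<in> V}" unfolding fib_def using De[OF lz(1)] by simp
  have iD: "infinite (fib D (\<zeta> @ [\<xi>]))"
  proof
    assume f: "finite (fib D (\<zeta> @ [\<xi>]))"
    have "\<theta>0 \<in> fib D (\<zeta> @ [\<xi>])" unfolding fD using \<theta>0 \<xi>(1) unfolding fib_def by simp
    then have "\<theta>0 \<in> cl (set (\<zeta> @ [\<xi>]))" using cl_fibreI[OF DD zx, of \<theta>0] f unfolding fib_def by simp
    then show False using n\<theta> by simp
  qed
  obtain \<theta> where \<theta>: "\<theta> \<in> carrier K" "\<theta> \<noteq> \<zero>" "\<xi> = rv K \<theta>" using \<xi>R unfolding RVx_def by blast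
  have mem: "\<exists>y\<in>carrier K. y \<noteq> \<zero> \<and> \<eta> = rv K y \<and> rv K y \<in> fib X \<zeta> \<and> veq K y \<theta>" if "\<eta> \<in> fib D (\<zeta> @ [\<xi>])" for \<eta>
  proof -
    have h: "\<eta> \<in> fib X \<zeta>" "[\<eta>, \<xi>] \<in> V" using that unfolding fD by blast+
    obtain y where y: "y \<in> carrier K" "y \<noteq> \<zero>" "\<eta> = rv K y" using fib_RVx[OF X h(1)] unfolding RVx_def by blast
    then show ?thesis using h vpairs_veq[of y \<theta>] \<theta> unfolding V_def by auto
  qed
  show "spread X \<zeta>" unfolding spread_def
  proof (intro bexI[of _ \<theta>] conjI ballI impI \<theta>)
    fix u assume u: "u \<in> carrier K" "u \<in> \<O>"
    have fin4: "\<exists>x\<in>tuples K 4. (\<forall>i<4. rv K (x ! i) \<in> fib X \<zeta> \<and> veq K (x ! i) \<theta>) \<and>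
        rv K (x ! 0) \<noteq> rv K (x ! 1) \<and> sm ((x ! 2 \<ominus> x ! 3) \<ominus> u \<otimes> (x ! 0 \<ominus> x ! 1)) \<theta>"
      if h: "a \<in> carrier K" "b \<in> carrier K" "c \<in> carrier K" "d \<in> carrier K"
        "rv K a \<in> fib X \<zeta>" "rv K b \<in> fib X \<zeta>" "rv K c \<in> fib X \<zeta>" "rv K d \<in> fib X \<zeta>"
        "veq K a \<theta>" "veq K b \<theta>" "veq K c \<theta>" "veq K d \<theta>" "rv K a \<noteq> rv K b" "sm ((c \<ominus> d) \<ominus> u \<otimes> (a \<ominus> b)) \<theta>" for a b c d
    proof (rule bexI[of _ "[a, b, c, d]"], intro conjI allI impI)
      fix i :: nat assume "i < 4"
      then have "i = 0 \<or> i = 1 \<or> i = 2 \<or> i = 3" by auto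
      then show "rv K ([a, b, c, d] ! i) \<in> fib X \<zeta>" "veq K ([a, b, c, d] ! i) \<theta>" using h by auto
    qed (use h in \<open>simp_all add: tuples_iff\<close>)
    show "\<exists>x\<in>tuples K 4. (\<forall>i<4. rv K (x ! i) \<in> fib X \<zeta> \<and> veq K (x ! i) \<theta>) \<and>
        rv K (x ! 0) \<noteq> rv K (x ! 1) \<and> sm ((x ! 2 \<ominus> x ! 3) \<ominus> u \<otimes> (x ! 0 \<ominus> x ! 1)) \<theta>" (is ?GG)
    proof (cases "u \<in> \<M>")
      \<comment> \<open>The residue of \<open>u\<close> is zero: two different leading terms in the
        denominator and equal points in the numerator suffice.\<close>
      case True
      obtain \<eta>1 where e1: "\<eta>1 \<in> fib D (\<zeta> @ [\<xi>])" using iD by (metis finite.emptyI ex_in_conv)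
      obtain \<eta>2 where e2: "\<eta>2 \<in> fib D (\<zeta> @ [\<xi>])" "\<eta>1 \<noteq> \<eta>2"
        using iD by (metis finite.emptyI finite_insert finite_subset insertCI subsetI)
      obtain y1 where y1: "y1 \<in> carrier K" "y1 \<noteq> \<zero>" "\<eta>1 = rv K y1" "rv K y1 \<in> fib X \<zeta>" "veq K y1 \<theta>" using mem[OF e1] by blast
      obtain y2 where y2: "y2 \<in> carrier K" "y2 \<noteq> \<zero>" "\<eta>2 = rv K y2" "rv K y2 \<in> fib X \<zeta>" "veq K y2 \<theta>" using mem[OF e2(1)] by blast
      have "vle K (y1 \<ominus> y2) \<theta>" using vle_diff y1(5) y2(5) \<theta>(1) unfolding veq_def by blast
      then have "sm (u \<otimes> (y1 \<ominus> y2)) \<theta>" using sm_vle[OF sm_M[OF True]] \<theta>(1) by blast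
      then have "sm ((y1 \<ominus> y1) \<ominus> u \<otimes> (y1 \<ominus> y2)) \<theta>"
        by (rule sm_diff[rotated]) (use y1(1) \<theta>(1) in simp_all)
      then show ?thesis by (intro fin4[of y1 y2 y1 y1]) (use y1 y2 e2(2) in auto)
    next
      case False
      note ui = unitD(1,2)[OF u(2) False]
      let ?c = "rv K u"
      have cR: "?c \<in> RVx K" using RVx_iff u ui by blast
      \<comment> \<open>Two elements independent over \<open>\<zeta>\<close>, \<open>\<xi>\<close>
        and the leading term of \<open>u\<close>; \<open>d1\<close> and \<open>d2\<close> carry rank
        two.\<close>
      obtain d2 where d2: "d2 \<in> fib D (\<zeta> @ [\<xi>])" "d2 \<notin> cl (set (\<zeta> @ [\<xi>]) \<union> {?c})"
        using generic_fib[OF DD zx iD, of "{?c}"] cR by auto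
      have d2R: "d2 \<in> RVx K" using fib_RVx[OF DD d2(1)] by blast
      obtain d1 where d1: "d1 \<in> fib D (\<zeta> @ [\<xi>])" "d1 \<notin> cl (set (\<zeta> @ [\<xi>]) \<union> {?c, d2})"
        using generic_fib[OF DD zx iD, of "{?c, d2}"] cR d2R by auto
      have d1R: "d1 \<in> RVx K" using fib_RVx[OF DD d1(1)] by blast
      obtain y1 where y1: "y1 \<in> carrier K" "y1 \<noteq> \<zero>" "d1 = rv K y1" "rv K y1 \<in> fib X \<zeta>" "veq K y1 \<theta>" using mem[OF d1(1)] by blast
      obtain y2 where y2: "y2 \<in> carrier K" "y2 \<noteq> \<zero>" "d2 = rv K y2" "rv K y2 \<in> fib X \<zeta>" "veq K y2 \<theta>" using mem[OF d2(1)] by blast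
      let ?Q = "set (\<zeta> @ [\<xi>, ?c])"
      have QR: "?Q \<subseteq> RVx K" using lz(2) \<xi>R cR by simp
      define e where "e = y1 \<oplus> u \<otimes> y2"
      have ec: "e \<in> carrier K" using y1 y2 u unfolding e_def by simp
      have ve: "vle K e \<theta>" unfolding e_def using vle_add[OF _ vle_mult] y1(5) y2(5) \<theta>(1) u unfolding veq_def by blast
      have n1: "d1 \<notin> cl {?c, d2}" using d1(2) cl_mono[of "{?c, d2}" "set (\<zeta> @ [\<xi>]) \<union> {?c, d2}"] by blast
      \<comment> \<open>Cancellation in \<open>e\<close> would express \<open>d1\<close> through
        \<open>d2\<close> and \<open>u\<close>, against the choice of \<open>d1\<close>; so
        \<open>e\<close> has the size of \<open>\<theta>\<close>, the scale of all later
        comparisons.\<close>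
      have nsm: "\<not> sm e \<theta>"
      proof
        assume s: "sm e \<theta>"
        have "rv K y1 = rv K (\<zero> \<ominus> u \<otimes> y2)"
        proof (rule sm_rv_eq[of _ _ \<theta>])
          have "(\<zero> \<ominus> u \<otimes> y2) \<ominus> y1 = \<ominus> e" unfolding e_def using y1 y2 u by (simp add: a_minus_def minus_add a_ac)
          then show "sm ((\<zero> \<ominus> u \<otimes> y2) \<ominus> y1) \<theta>" using sm_uminus[OF s \<theta>(1)] by simp
        qed (use y1 y2 u in \<open>simp_all add: veq_def\<close>)
        then have "d1 \<in> cl {?c, d2}" using cl_rv_minus_mult[of u y2] y1(3) y2 u ui by simp
        then show False using n1 by blast
      qed
      have e\<theta>: "veq K e \<theta>" by (rule vle_not_sm[OF ve nsm \<theta>(1)])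
      have e0: "e \<noteq> \<zero>" using nsm \<theta>(1) by auto
      let ?\<epsilon> = "rv K e"
      have eR: "?\<epsilon> \<in> RVx K" using RVx_iff ec e0 by blast
      \<comment> \<open>\<open>y1\<close> is recovered as \<open>e\<close> minus
        \<open>u y2\<close>; this difference involves no cancellation since \<open>y1\<close> itself
        is not small.\<close>
      have d1cl: "d1 \<in> cl {?\<epsilon>, ?c, d2}"
      proof -
        have uy: "u \<otimes> y2 \<in> carrier K" "u \<otimes> y2 \<noteq> \<zero>" using u ui y2 by simp_all
        have y1e: "e \<ominus> u \<otimes> y2 = y1" unfolding e_def using y1 uy add_sub_cancel(3) by simp
        have "rv K e \<noteq> rv K (u \<otimes> y2)"
        proof
          assume "rv K e = rv K (u \<otimes> y2)"
          then have "sm (e \<ominus> u \<otimes> y2) (u \<otimes> y2)" using rv_eq_iff[OF uy(1) ec] by simp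
          then have "sm y1 (u \<otimes> y2)" unfolding y1e .
          moreover have "vle K (u \<otimes> y2) y1"
            using vle_mult[OF _ u(2) y1(1)] vle_trans[of y2 \<theta> y1] y1 y2(5) unfolding veq_def by blast
          ultimately show False using sm_vle[of y1 "u \<otimes> y2" y1] sm_self[of y1] y1 by blast
        qed
        then have a: "d1 \<in> cl {?\<epsilon>, rv K (u \<otimes> y2)}" using cl_rv_diff[OF ec uy(1) e0 uy(2)] y1(3) y1e by simp
        have b: "rv K (u \<otimes> y2) \<in> cl {?c, d2}" using cl_rv_mult[of u y2] u ui y2 by simp
        have "d1 \<in> cl (insert (rv K (u \<otimes> y2)) {?\<epsilon>, ?c, d2})"
          using a cl_mono[of "{?\<epsilon>, rv K (u \<otimes> y2)}" "insert (rv K (u \<otimes> y2)) {?\<epsilon>, ?c, d2}"] by blast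
        moreover have "rv K (u \<otimes> y2) \<in> cl {?\<epsilon>, ?c, d2}" using b cl_mono[of "{?c, d2}" "{?\<epsilon>, ?c, d2}"] by blast
        ultimately show ?thesis by (rule cl_trans)
      qed
      show ?thesis
      proof (rule ccontr)
        assume no: "\<not> ?GG"
        \<comment> \<open>A second decomposition of \<open>e\<close> with another leading term of
          \<open>y\<close> would exhibit \<open>u\<close> as the quotient of
          \<open>y' \<ominus> y1\<close> by \<open>y2 \<ominus> y\<close>, the excluded
          quadruple.\<close>
        have uniq: "rv K y = d2" if h: "y \<in> carrier K" "rv K y \<in> fib X \<zeta>" "veq K y \<theta>"
          "y' \<in> carrier K" "rv K y' \<in> fib X \<zeta>" "veq K y' \<theta>" "w \<in> carrier K" "rv K w = ?c" "rv K (y' \<oplus> w \<otimes> y) = ?\<epsilon>" for y y' w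
        proof (rule ccontr)
          assume ne: "rv K y \<noteq> d2"
          have "sm ((y' \<oplus> w \<otimes> y) \<ominus> e) \<theta>"
            by (rule rv_eq_sm[OF h(9)[symmetric] ec _ _ \<theta>(1)]) (use h ve in simp_all)
          moreover have "sm ((w \<ominus> u) \<otimes> y) \<theta>"
          proof -
            obtain m where m: "m \<in> \<M>" "w \<ominus> u = m \<otimes> u" using rv_eq_iff[of u w] h(7,8) u unfolding sm_def by auto
            then have "w \<ominus> u \<in> \<M>" using M_times(1) u by simp
            then show ?thesis using sm_vle[OF sm_M] h(3) \<theta>(1) unfolding veq_def by blast
          qed
          ultimately have "sm (((y' \<oplus> w \<otimes> y) \<ominus> e) \<ominus> (w \<ominus> u) \<otimes> y) \<theta>" by (rule sm_diff[OF _ _ \<theta>(1)])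
          moreover have "((y' \<oplus> w \<otimes> y) \<ominus> e) \<ominus> (w \<ominus> u) \<otimes> y = (y' \<ominus> y1) \<ominus> u \<otimes> (y2 \<ominus> y)"
            unfolding e_def using h(1,4,7) y1(1) y2(1) u(1) by (simp add: ring_arith)
          ultimately have "sm ((y' \<ominus> y1) \<ominus> u \<otimes> (y2 \<ominus> y)) \<theta>" by simp
          then have ?GG by (intro fin4[of y2 y y' y1]) (use h y1 y2 ne in auto)
          then show False using no by blast
        qed
        \<comment> \<open>The places of \<open>l\<close> are \<open>y\<close>, the \<open>m\<close>
          representatives of \<open>\<zeta>\<close>, then \<open>\<theta>\<close>, \<open>u\<close>
          and \<open>e\<close>; only their leading terms matter, by \<open>uniq\<close>.\<close>
        define \<Phi> where "\<Phi> = (\<lambda>l. \<exists>y'\<in>carrier K. map (\<lambda>i. rv K (l ! Suc i)) [0..<m] @ [rv K y'] \<in> X \<and>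
           map (\<lambda>i. rv K (l ! Suc i)) [0..<m] @ [rv K (l ! 0)] \<in> X \<and> veq K y' (l ! Suc m) \<and> veq K (l ! 0) (l ! Suc m) \<and>
           rv K (y' \<oplus> l ! (m + 2) \<otimes> l ! 0) = rv K (l ! (m + 3)))"
        have L: "LDef (Suc (m + 3)) \<Phi>"
        proof -
          have "Def (\<lambda>e. \<exists>y'\<in>carrier K. map (\<lambda>i. rv K (e (Suc i))) [0..<m] @ [rv K y'] \<in> X \<and>
             map (\<lambda>i. rv K (e (Suc i))) [0..<m] @ [rv K (e 0)] \<in> X \<and> veq K y' (e (Suc m)) \<and> veq K (e 0) (e (Suc m)) \<and>
             rv K (y' \<oplus> e (m + 2) \<otimes> e 0) = rv K (e (m + 3)))"
            by (intro Def_basic Def_quant Def_RD[OF X] RTmL_list rtm_intros tm_intros Def_veq Def_rv) ((rule refl | simp)+)?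
          moreover have g: "map e [0..<Suc (m + 3)] ! i = e i" if "i < Suc (m + 3)" for e :: "nat \<Rightarrow> 'a" and i
            using that by (simp del: upt_Suc)
          moreover have "map (\<lambda>i. rv K (map e [0..<Suc (m + 3)] ! Suc i)) [0..<m] = map (\<lambda>i. rv K (e (Suc i))) [0..<m]" for e :: "nat \<Rightarrow> 'a"
            by (rule map_cong[OF refl], subst g) simp_all
          moreover have "Suc m < Suc (m + 3)" "0 < Suc (m + 3)" "m + 2 < Suc (m + 3)" "m + 3 < Suc (m + 3)" by simp_all
          ultimately show ?thesis unfolding LDef_def \<Phi>_def by (simp only:)
        qed
        let ?Z = "\<zeta> @ [\<xi>, ?c, ?\<epsilon>]"
        have Z: "?Z \<in> RVx_pow K (m + 3)" using lz \<xi>R cR eR by (simp add: RVx_pow_iff)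
        obtain zs where zs: "zs \<in> tuples K m" "\<zeta> = map (rv K) zs" using RVx_pow_rep[OF z] by blast
        have lzs: "length zs = m" "set zs \<subseteq> carrier K" using zs(1) by (simp_all add: tuples_iff)
        have \<Phi>e: "\<Phi> (y # vs @ [t, w, e']) \<longleftrightarrow> (\<exists>y'\<in>carrier K. rv K y' \<in> fib X \<zeta> \<and> rv K y \<in> fib X \<zeta> \<and> veq K y' t \<and> veq K y t \<and> rv K (y' \<oplus> w \<otimes> y) = rv K e')"
          if "length vs = m" "map (rv K) vs = \<zeta>" for y vs t w e'
        proof -
          have "map (\<lambda>i. rv K ((y # vs @ [t, w, e']) ! Suc i)) [0..<m] = \<zeta>"
            unfolding that(2)[symmetric] by (rule nth_equalityI) (simp_all add: that(1) nth_append)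
          moreover have "(y # vs @ [t, w, e']) ! Suc m = t" "(y # vs @ [t, w, e']) ! (m + 2) = w" "(y # vs @ [t, w, e']) ! (m + 3) = e'"
            using that(1) by (simp_all add: nth_append numeral_2_eq_2 numeral_3_eq_3)
          ultimately show ?thesis unfolding \<Phi>_def fib_def by simp
        qed
        have "rv K y2 \<in> cl (set ?Z)"
        proof (rule cl_uniqueI[OF Z y2(1,2) L, where F = "{d2}" and vs = "zs @ [\<theta>, u, e]"])
          show "zs @ [\<theta>, u, e] \<in> tuples K (m + 3)" using lzs \<theta> u ec by (simp add: tuples_iff)
          show "map (rv K) (zs @ [\<theta>, u, e]) = ?Z" using zs(2) \<theta>(3) by simp
          show "\<Phi> (y2 # zs @ [\<theta>, u, e])" unfolding \<Phi>e[OF lzs(1) zs(2)[symmetric]]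
            by (rule bexI[OF _ y1(1)]) (use y1 y2 in \<open>simp add: e_def\<close>)
          fix ws y assume ws: "ws \<in> tuples K (m + 3)" "map (rv K) ws = ?Z" and y: "y \<in> carrier K" "\<Phi> (y # ws)"
          obtain vs t w e' where v: "ws = vs @ [t, w, e']" "map (rv K) vs = \<zeta>" "rv K t = \<xi>" "rv K w = ?c" "rv K e' = ?\<epsilon>"
          proof -
            have "ws = take m ws @ drop m ws" by simp
            moreover have "map (rv K) (take m ws) = \<zeta>" "map (rv K) (drop m ws) = [\<xi>, ?c, ?\<epsilon>]"
              using ws(2) lz(1) by (simp_all add: take_map[symmetric] drop_map[symmetric])
            moreover obtain t w e' where "drop m ws = [t, w, e']" "rv K t = \<xi>" "rv K w = ?c" "rv K e' = ?\<epsilon>"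
              using calculation(3) by (auto simp: map_eq_Cons_conv)
            ultimately show thesis using that by metis
          qed
          have wsc: "t \<in> carrier K" "w \<in> carrier K" "length vs = m" using ws(1) v(1) by (auto simp: tuples_iff)
          obtain y' where y': "y' \<in> carrier K" "rv K y' \<in> fib X \<zeta>" "rv K y \<in> fib X \<zeta>" "veq K y' t" "veq K y t" "rv K (y' \<oplus> w \<otimes> y) = ?\<epsilon>"
            using y(2) unfolding v(1) \<Phi>e[OF wsc(3) v(2)] v(5) by blast
          have t\<theta>: "vle K t \<theta>" "vle K \<theta> t" using rv_veq[of t \<theta>] rv_veq[of \<theta> t] v(3) \<theta> wsc by simp_all
          have "veq K z \<theta>" if "veq K z t" "z \<in> carrier K" for z
            using that t\<theta> vle_trans[of z t \<theta>] vle_trans[of \<theta> t z] \<theta>(1) unfolding veq_def by blast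
          then have "rv K y = d2" using uniq[OF y(1) y'(3) _ y'(1,2) _ wsc(2) v(4) y'(6)] y y' by blast
          then show "rv K y \<in> {d2}" by simp
        qed simp
        then have d2cl: "d2 \<in> cl (?Q \<union> {?\<epsilon>})" using y2(3) by (simp add: insert_commute)
        have "d1 \<in> cl (insert d2 (?Q \<union> {?\<epsilon>}))" using d1cl cl_mono[of "{?\<epsilon>, ?c, d2}" "insert d2 (?Q \<union> {?\<epsilon>})"] by auto
        then have d1cl': "d1 \<in> cl (?Q \<union> {?\<epsilon>})" using d2cl by (rule cl_trans)
        \<comment> \<open>The contradiction: both elements lie in the closure of \<open>?Q\<close>
          and the single element \<open>?\<epsilon>\<close>.\<close>
        have "rnk cl ?Q [d2, d1] \<le> rnk cl ?Q [?\<epsilon>]"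
          by (rule pg.rnk_le) (use QR d1R d2R eR d1cl' d2cl in simp_all)
        also have "\<dots> \<le> 1" using rnk_le_length[of cl ?Q "[?\<epsilon>]"] by simp
        finally have "rnk cl ?Q [d2, d1] \<le> 1" .
        moreover have "d2 \<notin> cl ?Q" "d1 \<notin> cl (insert d2 ?Q)" using d1(2) d2(2) by (simp_all add: insert_commute)
        ultimately show False by simp
      qed
    qed
  qed
qed

text \<open>Unbounded finite fibres would, by saturation, produce a fibre that is infinite and not
  spread: each finite fibre fails to be spread by \<open>spread_infinite\<close>, and both
  requirements are first-order. Such a fibre contradicts \<open>infinite_spread\<close>.\<close>

lemma uniform_finiteness:
  assumes X: "RD (Suc m) X"
  shows "\<exists>N. \<forall>\<zeta>. finite (fib X \<zeta>) \<longrightarrow> card (fib X \<zeta>) \<le> N"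
proof (rule ccontr)
  assume no: "\<not> ?thesis"
  define \<Phi> where "\<Phi> = (\<lambda>l. map (rv K) (tl l) @ [rv K (l ! 0)] \<in> X)"
  have L: "LDef (Suc m) \<Phi>" unfolding LDef_def \<Phi>_def
    by (intro Def_RD[OF X] rtm_intros tm_intros Tm_nth_map tml_intros) ((rule refl | simp)+)?
  have fw: "few (rv K) N \<Phi> zs \<longleftrightarrow> finite (fib X (map (rv K) zs)) \<and> card (fib X (map (rv K) zs)) \<le> N" for N zs
    unfolding \<Phi>_def by (rule few_fib[OF X])
  define neg where "neg = (\<lambda>N zs. \<not> few (rv K) N \<Phi> zs \<and> \<not> spread X (map (rv K) zs))"
  have "\<exists>xs\<in>tuples K m. \<forall>P\<in>range neg. P (xs @ [])"
  proof (rule compact_tuples[OF sat])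
    fix P assume "P \<in> range neg"
    then obtain N where P: "P = neg N" by blast
    have "LDef m (neg N)" using LDef_spread[OF X] unfolding LDef_def neg_def
      by (intro Def_basic Def_few[OF kap_simps(2) L] tml_intros tm_intros) simp_all
    then show "LDef (m + length ([] :: 'a list)) P" using P by simp
  next
    fix \<F> assume F: "finite \<F>" "\<F> \<subseteq> range neg"
    then obtain S where S: "finite S" "\<F> = neg ` S" by (meson finite_subset_image)
    obtain \<zeta> where z: "finite (fib X \<zeta>)" "\<not> card (fib X \<zeta>) \<le> Max (insert 0 S)" using no by blast
    then obtain \<xi> where "\<xi> \<in> fib X \<zeta>" by (metis card.empty ex_in_conv zero_le)
    then have "\<zeta> \<in> RVx_pow K m" using fib_RVx[OF X] by blast
    then obtain zs where zs: "zs \<in> tuples K m" "\<zeta> = map (rv K) zs" using RVx_pow_rep by blast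
    have "neg N zs" if "N \<in> S" for N
    proof -
      have "N \<le> Max (insert 0 S)" using that S(1) by simp
      then show ?thesis unfolding neg_def fw zs(2)[symmetric] using z spread_infinite[OF X] by auto
    qed
    then show "\<exists>xs\<in>tuples K m. \<forall>P\<in>\<F>. P (xs @ [])" using zs(1) unfolding S(2) by auto
  qed simp
  then obtain zs where zs: "zs \<in> tuples K m" "\<And>N. neg N zs" by auto
  then have "infinite (fib X (map (rv K) zs))" unfolding neg_def fw by blast
  then have "spread X (map (rv K) zs)" by (rule infinite_spread[OF X])
  then show False using zs(2) unfolding neg_def by blast
qed

end

section \<open>Generic tuples\<close>

context vfield
begin

text \<open>Spelled out in the primitives of the language, so that one and the same formula can be
  read in two structures.\<close>

lemma rv_char: assumes "x \<in> carrier K" "y \<in> carrier K"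
  shows "rv K x = rv K y \<longleftrightarrow>
    (\<exists>m\<in>carrier K. (m \<in> \<O> \<and> \<not> (\<exists>u\<in>carrier K. u \<in> \<O> \<and> m \<otimes> u = \<one>)) \<and> y \<ominus> x = m \<otimes> x)"
proof -
  have "(\<exists>m\<in>\<M>. y \<ominus> x = m \<otimes> x) \<longleftrightarrow> (\<exists>m\<in>carrier K. m \<in> \<M> \<and> y \<ominus> x = m \<otimes> x)"
    using O_carrier M_O by blast
  then show ?thesis unfolding rv_eq_iff[OF assms] sm_def using M_char by blast
qed

definition inff :: "'a imag list set \<Rightarrow> 'a imag list set" where
  "inff X = {\<zeta>. infinite (fib X \<zeta>)}"

lemma inff_RVx: "RD (Suc m) X \<Longrightarrow> inff X \<subseteq> RVx_pow K m"
proof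
  fix \<zeta> assume X: "RD (Suc m) X" and "\<zeta> \<in> inff X"
  then have "fib X \<zeta> \<noteq> {}" unfolding inff_def by auto
  then show "\<zeta> \<in> RVx_pow K m" using fib_RVx[OF X] by blast
qed

text \<open>
  The left-hand side is first-order and mentions neither \<open>A\<close> nor \<open>B\<close>; this is what makes the
  dimension definable in families and independent of parameters.
\<close>

lemma generic_tuple:
  assumes sat: "saturated K A" and A: "A \<subseteq> carrier K" and b: "b \<in> RVx_pow K m" and B: "finite B" "B \<subseteq> RVx K"
    and "\<And>j. j \<le> q \<Longrightarrow> RD (m + (q - j)) ((inff ^^ j) Y)"
  shows "b \<in> (inff ^^ q) Y \<longleftrightarrow> (\<exists>a. length a = q \<and> b @ a \<in> Y \<and> indl cl (pt ` A \<union> set b \<union> B) a)"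
  using assms(6)
proof (induction q arbitrary: Y)
  case 0
  then show ?case by simp
next
  case (Suc q)
  let ?P = "pt ` A \<union> set b \<union> B"
  have Y: "RD (Suc (m + q)) Y" using Suc.prems[of 0] by simp
  have R: "RD (m + (q - j)) ((inff ^^ j) (inff Y))" if "j \<le> q" for j
    using Suc.prems[of "Suc j"] that by (simp add: funpow_swap1)
  \<comment> \<open>An infinite fibre contains a point generic over all parameters, and a finite
    fibre lies in the closure of its base; this exchanges infinity for genericity one coordinate at
    a time.\<close>
  have step: "b @ a \<in> inff Y \<longleftrightarrow> (\<exists>\<xi>. b @ a @ [\<xi>] \<in> Y \<and> \<xi> \<notin> cl (?P \<union> set a))" if a: "length a = q" for a
  proof
    assume i: "b @ a \<in> inff Y"
    then have z: "b @ a \<in> RVx_pow K (m + q)" using inff_RVx[OF Y] by blast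
    have "infinite {\<xi>. (b @ a) @ [\<xi>] \<in> Y}" using i unfolding inff_def fib_def by simp
    from generic_fibre[OF sat A Y z this B] obtain \<xi> where "(b @ a) @ [\<xi>] \<in> Y" "\<xi> \<notin> cl (pt ` A \<union> set (b @ a) \<union> B)" by blast
    moreover have "pt ` A \<union> set (b @ a) \<union> B = ?P \<union> set a" by auto
    ultimately show "\<exists>\<xi>. b @ a @ [\<xi>] \<in> Y \<and> \<xi> \<notin> cl (?P \<union> set a)" by auto
  next
    assume "\<exists>\<xi>. b @ a @ [\<xi>] \<in> Y \<and> \<xi> \<notin> cl (?P \<union> set a)"
    then obtain \<xi> where x: "(b @ a) @ [\<xi>] \<in> Y" "\<xi> \<notin> cl (?P \<union> set a)" by auto
    then have z: "b @ a \<in> RVx_pow K (m + q)" using fib_RVx[OF Y, of \<xi> "b @ a"] unfolding fib_def by simp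
    have "\<not> finite {\<xi>. (b @ a) @ [\<xi>] \<in> Y}"
    proof
      assume "finite {\<xi>. (b @ a) @ [\<xi>] \<in> Y}"
      from cl_fibreI[OF Y z x(1) this] have "\<xi> \<in> cl (set (b @ a))" .
      moreover have "cl (set (b @ a)) \<subseteq> cl (?P \<union> set a)" by (rule cl_mono) auto
      ultimately show False using x(2) by blast
    qed
    then show "b @ a \<in> inff Y" unfolding inff_def fib_def by simp
  qed
  have "b \<in> (inff ^^ Suc q) Y \<longleftrightarrow> b \<in> (inff ^^ q) (inff Y)" by (simp add: funpow_swap1)
  also have "\<dots> \<longleftrightarrow> (\<exists>a. length a = q \<and> b @ a \<in> inff Y \<and> indl cl ?P a)" by (rule Suc.IH[OF R])
  also have "\<dots> \<longleftrightarrow> (\<exists>a \<xi>. length a = q \<and> b @ a @ [\<xi>] \<in> Y \<and> indl cl ?P (a @ [\<xi>]))"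
    using step by (auto simp: indl_append)
  also have "\<dots> \<longleftrightarrow> (\<exists>a. length a = Suc q \<and> b @ a \<in> Y \<and> indl cl ?P a)"
  proof
    assume "\<exists>a \<xi>. length a = q \<and> b @ a @ [\<xi>] \<in> Y \<and> indl cl ?P (a @ [\<xi>])"
    then obtain a \<xi> where "length a = q" "b @ a @ [\<xi>] \<in> Y" "indl cl ?P (a @ [\<xi>])" by blast
    then show "\<exists>a. length a = Suc q \<and> b @ a \<in> Y \<and> indl cl ?P a" by (intro exI[of _ "a @ [\<xi>]"]) simp
  next
    assume "\<exists>a. length a = Suc q \<and> b @ a \<in> Y \<and> indl cl ?P a"
    then obtain a where a: "length a = Suc q" "b @ a \<in> Y" "indl cl ?P a" by blast
    obtain a' \<xi> where e: "a = a' @ [\<xi>]" using a(1) by (cases a rule: rev_cases) auto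
    show "\<exists>a \<xi>. length a = q \<and> b @ a @ [\<xi>] \<in> Y \<and> indl cl ?P (a @ [\<xi>])"
      using a unfolding e by (intro exI[of _ a'] exI[of _ \<xi>]) simp
  qed
  finally show ?case .
qed

lemma length_nths_card: "I \<subseteq> {..<length xs} \<Longrightarrow> length (nths xs I) = card I"
proof -
  assume "I \<subseteq> {..<length xs}"
  then have "{i. i < length xs \<and> i \<in> I} = I" by auto
  then show ?thesis by (simp add: length_nths)
qed

lemma filter_card: assumes "I \<subseteq> {..<n}" shows "length (filter (\<lambda>i. i \<in> I) [0..<n]) = card I"
proof -
  have "set (filter (\<lambda>i. i \<in> I) [0..<n]) = I" using assms by auto
  then show ?thesis using distinct_card[of "filter (\<lambda>i. i \<in> I) [0..<n]"] by simp
qed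

lemma nths_nth:
  assumes "I \<subseteq> {..<n}" "length xs = n" "i < card I"
  shows "nths xs I ! i = xs ! (filter (\<lambda>i. i \<in> I) [0..<n] ! i)"
  unfolding nths_map_upt assms(2) using filter_card[OF assms(1)] assms(3) by simp

lemma nths_RVx_pow: "x \<in> RVx_pow K n \<Longrightarrow> I \<subseteq> {..<n} \<Longrightarrow> nths x I \<in> RVx_pow K (card I)"
  using set_nths_subset[of x I] length_nths_card[of I x] by (auto simp: RVx_pow_iff)

lemma prj_iff:
  assumes G: "RD n G" and I: "I \<subseteq> {..<n}" and zs: "length zs = card I"
  shows "map (rv K) zs \<in> (\<lambda>x. nths x I) ` G \<longleftrightarrow>
    (\<exists>xs\<in>tuples K n. map (rv K) xs \<in> G \<and> (\<forall>i<card I. rv K (nths xs I ! i) = rv K (zs ! i)))"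
proof -
  have e: "map (rv K) zs = nths (map (rv K) xs) I \<longleftrightarrow> (\<forall>i<card I. rv K (nths xs I ! i) = rv K (zs ! i))" if "xs \<in> tuples K n" for xs
  proof -
    have "length (nths xs I) = card I" using length_nths_card[of I xs] I that by (simp add: tuples_iff)
    then show ?thesis using zs by (auto simp: nths_map list_eq_iff_nth_eq)
  qed
  show ?thesis
  proof
    assume "map (rv K) zs \<in> (\<lambda>x. nths x I) ` G"
    then obtain x where x: "x \<in> G" "map (rv K) zs = nths x I" by blast
    obtain xs where xs: "xs \<in> tuples K n" "x = map (rv K) xs" using RVx_pow_rep[of x n] G x(1) unfolding RD_def by blast
    show "\<exists>xs\<in>tuples K n. map (rv K) xs \<in> G \<and> (\<forall>i<card I. rv K (nths xs I ! i) = rv K (zs ! i))"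
      using e[OF xs(1)] x xs by blast
  next
    assume "\<exists>xs\<in>tuples K n. map (rv K) xs \<in> G \<and> (\<forall>i<card I. rv K (nths xs I ! i) = rv K (zs ! i))"
    then show "map (rv K) zs \<in> (\<lambda>x. nths x I) ` G" using e by blast
  qed
qed

lemma prj_RVx: "RD n G \<Longrightarrow> I \<subseteq> {..<n} \<Longrightarrow> (\<lambda>x. nths x I) ` G \<subseteq> RVx_pow K (card I)"
  using nths_RVx_pow unfolding RD_def by blast

lemma dim_indl:
  assumes P: "P \<subseteq> PRV" and X: "X \<subseteq> RVx_pow K n"
  shows "dimRV K P X = Sup {ereal (real (card I)) | I. I \<subseteq> {..<n} \<and> (\<exists>a\<in>X. indl cl P (nths a I))}"
proof -
  have "(I \<subseteq> {..<length a} \<and> (\<forall>i\<in>I. a ! i \<notin> acl K (P \<union> {a ! j | j. j \<in> I \<and> j < i}))) \<longleftrightarrow>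
      (I \<subseteq> {..<n} \<and> indl cl P (nths a I))" if a: "a \<in> X" for a I
  proof (cases "I \<subseteq> {..<n}")
    case True
    have "a \<in> RVx_pow K n" using X a by blast
    then have aR: "length a = n" "set a \<subseteq> RVx K" by (simp_all add: RVx_pow_iff)
    then have I: "I \<subseteq> {..<length a}" using True by simp
    have m: "a ! i \<in> RVx K" if "i \<in> I" for i using aR I that by (meson lessThan_iff nth_mem subsetD)
    have "a ! i \<in> acl K (P \<union> {a ! j | j. j \<in> I \<and> j < i}) \<longleftrightarrow> a ! i \<in> cl (P \<union> {a ! j | j. j \<in> I \<and> j < i})" if "i \<in> I" for i
      by (rule acl_cl[OF _ m[OF that]]) (use P m RVx_PRV(1) in blast)
    then show ?thesis using I True indl_nths[OF I, of cl P] by blast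
  next
    case False
    have "length a = n" using X a by (auto simp: RVx_pow_iff)
    then show ?thesis using False by simp
  qed
  then have "(\<exists>a\<in>X. I \<subseteq> {..<length a} \<and> (\<forall>i\<in>I. a ! i \<notin> acl K (P \<union> {a ! j | j. j \<in> I \<and> j < i}))) \<longleftrightarrow>
      I \<subseteq> {..<n} \<and> (\<exists>a\<in>X. indl cl P (nths a I))" for I by blast
  then show ?thesis unfolding dimRV_def by simp
qed

end

section \<open>Transfer between elementarily equivalent structures\<close>

lemma codef_left: "codef K K' P P' \<Longrightarrow> codef K K P P"
  and codef_right: "codef K K' P P' \<Longrightarrow> codef K' K' P' P'"
  unfolding codef_def by blast+

locale vpair = vfield K + V': vfield K'
  for K :: "('a, 'f, 'r) vstr" (structure) and K' :: "('b, 'f, 'r) vstr"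

sublocale vpair \<subseteq> two: vfield_pair K K'
  by unfold_locales (rule vf V'.vf)+

context vpair
begin

lemma CD_cong:
  assumes "codef K K' P P'" "\<And>e. range e \<subseteq> carrier K \<Longrightarrow> P e = Q e" "\<And>e. range e \<subseteq> carrier K' \<Longrightarrow> P' e = Q' e"
  shows "codef K K' Q Q'"
  using assms unfolding codef_def by (elim exE) (rule exI, auto)

lemma CD_app2:
  "codef K K' (\<lambda>e. P (e 0) (e 1)) (\<lambda>e. P' (e 0) (e 1)) \<Longrightarrow> coterm K K' t t' \<Longrightarrow> coterm K K' s s' \<Longrightarrow>
   codef K K' (\<lambda>e. P (t e) (s e)) (\<lambda>e. P' (t' e) (s' e))"
  using two.CD_list[of "\<lambda>l. P (l ! 0) (l ! 1)" 2 "\<lambda>l. P' (l ! 0) (l ! 1)" "\<lambda>e. [t e, s e]" "\<lambda>e. [t' e, s' e]"]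
    two.CTL_Cons[OF _ two.CTL_Cons[OF _ two.CTL_Nil], of t t' s s'] by (simp add: numeral_2_eq_2)

lemma CD_rv: "coterm K K' t t' \<Longrightarrow> coterm K K' s s' \<Longrightarrow> codef K K' (\<lambda>e. rv K (t e) = rv K (s e)) (\<lambda>e. rv K' (t' e) = rv K' (s' e))"
proof (rule CD_app2)
  show "codef K K' (\<lambda>e. rv K (e 0) = rv K (e 1)) (\<lambda>e. rv K' (e 0) = rv K' (e 1))"
  proof (rule CD_cong)
    show "codef K K'
       (\<lambda>e. \<exists>m\<in>carrier K. (m \<in> vring K \<and> \<not> (\<exists>u\<in>carrier K. u \<in> vring K \<and> m \<otimes> u = \<one>)) \<and> e 1 \<ominus> e 0 = m \<otimes> e 0)
       (\<lambda>e. \<exists>m\<in>carrier K'. (m \<in> vring K' \<and> \<not> (\<exists>u\<in>carrier K'. u \<in> vring K' \<and> m \<otimes>\<^bsub>K'\<^esub> u = \<one>\<^bsub>K'\<^esub>)) \<and> e 1 \<ominus>\<^bsub>K'\<^esub> e 0 = m \<otimes>\<^bsub>K'\<^esub> e 0)"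
      by (intro two.CD_ex two.CD_and two.CD_not two.CD_eq two.CD_vring two.CT_var two.CT_times two.CT_minus two.CT_one)
  next
    fix e :: "nat \<Rightarrow> 'a" assume e: "range e \<subseteq> carrier K"
    then have "e 0 \<in> carrier K" "e 1 \<in> carrier K" by blast+
    from rv_char[OF this]
    show "(\<exists>m\<in>carrier K. (m \<in> vring K \<and> \<not> (\<exists>u\<in>carrier K. u \<in> vring K \<and> m \<otimes> u = \<one>)) \<and> e 1 \<ominus> e 0 = m \<otimes> e 0) = (rv K (e 0) = rv K (e 1))"
      by (rule sym)
  next
    fix e :: "nat \<Rightarrow> 'b" assume e: "range e \<subseteq> carrier K'"
    then have "e 0 \<in> carrier K'" "e 1 \<in> carrier K'" by blast+
    from V'.rv_char[OF this]
    show "(\<exists>m\<in>carrier K'. (m \<in> vring K' \<and> \<not> (\<exists>u\<in>carrier K'. u \<in> vring K' \<and> m \<otimes>\<^bsub>K'\<^esub> u = \<one>\<^bsub>K'\<^esub>)) \<and> e 1 \<ominus>\<^bsub>K'\<^esub> e 0 = m \<otimes>\<^bsub>K'\<^esub> e 0) = (rv K' (e 0) = rv K' (e 1))"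
      by (rule sym)
  qed
qed

lemma CD_few:
  assumes "codef K K' (\<lambda>e. \<Phi> (map e [0..<Suc m])) (\<lambda>e. \<Phi>' (map e [0..<Suc m]))"
  shows "codef K K' (\<lambda>e. few (rv K) N \<Phi> (map e [0..<m])) (\<lambda>e. V'.few (rv K') N \<Phi>' (map e [0..<m]))"
  unfolding few_iff V'.few_iff
proof (intro two.CD_not two.CD_tuples_ex two.CD_and two.CD_finite_all two.CD_imp two.CD_const)
  have n: "coterm K K' (\<lambda>e. map e [0..<Suc N] ! i) (\<lambda>e. map e [0..<Suc N] ! i)" if "i < Suc N" for i
    by (rule two.CT_nth[OF two.CTL_map[where a = 0, simplified] that]) (rule two.CT_var)
  show "codef K K' (\<lambda>e. rv K (map e [0..<Suc N] ! i) = rv K (map e [0..<Suc N] ! j)) (\<lambda>e. rv K' (map e [0..<Suc N] ! i) = rv K' (map e [0..<Suc N] ! j))"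
    if "i < Suc N" "j < Suc N" for i j by (intro CD_rv n that)
  fix i assume i: "i < Suc N"
  have "cotermL K K' m (\<lambda>e. map (\<lambda>n. e (n + Suc N)) [0..<m]) (\<lambda>e. map (\<lambda>n. e (n + Suc N)) [0..<m])"
    using two.CTL_map[of "\<lambda>e n. e (n + Suc N)" "\<lambda>e n. e (n + Suc N)" m 0] two.CT_var by simp
  then have "cotermL K K' (Suc m) (\<lambda>e. map e [0..<Suc N] ! i # map (\<lambda>n. e (n + Suc N)) [0..<m]) (\<lambda>e. map e [0..<Suc N] ! i # map (\<lambda>n. e (n + Suc N)) [0..<m])"
    by (rule two.CTL_Cons[OF n[OF i]])
  from two.CD_list[OF assms this]
  show "codef K K' (\<lambda>e. \<Phi> (map e [0..<Suc N] ! i # map (\<lambda>n. e (n + Suc N)) [0..<m])) (\<lambda>e. \<Phi>' (map e [0..<Suc N] ! i # map (\<lambda>n. e (n + Suc N)) [0..<m]))" .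
qed

text \<open>Two sets cut out by the same formula, each in its own structure.\<close>

definition RD2 :: "nat \<Rightarrow> 'a imag list set \<Rightarrow> 'b imag list set \<Rightarrow> bool" where
  "RD2 n Y Y' \<longleftrightarrow> Y \<subseteq> RVx_pow K n \<and> Y' \<subseteq> RVx_pow K' n \<and>
     codef K K' (\<lambda>e. map (rv K) (map e [0..<n]) \<in> Y) (\<lambda>e. map (rv K') (map e [0..<n]) \<in> Y')"

lemma RD2_RD: assumes "RD2 n Y Y'" shows "RD n Y" "V'.RD n Y'"
  using assms codef_left codef_right unfolding RD2_def RD_def V'.RD_def LDef_def V'.LDef_def by blast+

lemma RD2_prj: assumes G: "RD2 n G G'" and I: "I \<subseteq> {..<n}"
  shows "RD2 (card I) ((\<lambda>x. nths x I) ` G) ((\<lambda>x. nths x I) ` G')"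
  unfolding RD2_def
proof (intro conjI prj_RVx[OF RD2_RD(1)[OF G] I] V'.prj_RVx[OF RD2_RD(2)[OF G] I])
  have g: "codef K K' (\<lambda>e. map (rv K) (map e [0..<n]) \<in> G) (\<lambda>e. map (rv K') (map e [0..<n]) \<in> G')"
    using G unfolding RD2_def by blast
  have s: "nths (map e [0..<n]) I ! i = e (filter (\<lambda>i. i \<in> I) [0..<n] ! i)" if "i < card I" for e :: "nat \<Rightarrow> 'c" and i
  proof -
    have "i < length (filter (\<lambda>i. i \<in> I) [0..<n])" using filter_card[OF I] that by simp
    from nth_mem[OF this] have "filter (\<lambda>i. i \<in> I) [0..<n] ! i < n" by simp
    then show ?thesis using nths_nth[OF I _ that, of "map e [0..<n]"] by simp
  qed
  show "codef K K' (\<lambda>e. map (rv K) (map e [0..<card I]) \<in> (\<lambda>x. nths x I) ` G) (\<lambda>e. map (rv K') (map e [0..<card I]) \<in> (\<lambda>x. nths x I) ` G')"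
  proof (rule CD_cong)
    show "codef K K'
       (\<lambda>e. \<exists>xs\<in>tuples K n. map (rv K) xs \<in> G \<and> (\<forall>i<card I. rv K (nths xs I ! i) = rv K (e i)))
       (\<lambda>e. \<exists>xs\<in>tuples K' n. map (rv K') xs \<in> G' \<and> (\<forall>i<card I. rv K' (nths xs I ! i) = rv K' (e i)))"
    proof (intro two.CD_tuples_ex two.CD_and g two.CD_finite_all CD_rv two.CT_var)
      show "coterm K K' (\<lambda>e. nths (map e [0..<n]) I ! i) (\<lambda>e. nths (map e [0..<n]) I ! i)" if "i < card I" for i
        unfolding s[OF that] by (rule two.CT_var)
    qed
  next
    fix e :: "nat \<Rightarrow> 'a"
    show "(\<exists>xs\<in>tuples K n. map (rv K) xs \<in> G \<and> (\<forall>i<card I. rv K (nths xs I ! i) = rv K (e i))) \<longleftrightarrow>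
      (map (rv K) (map e [0..<card I]) \<in> (\<lambda>x. nths x I) ` G)"
      using prj_iff[OF RD2_RD(1)[OF G] I, of "map e [0..<card I]"] by simp
  next
    fix e :: "nat \<Rightarrow> 'b"
    show "(\<exists>xs\<in>tuples K' n. map (rv K') xs \<in> G' \<and> (\<forall>i<card I. rv K' (nths xs I ! i) = rv K' (e i))) \<longleftrightarrow>
      (map (rv K') (map e [0..<card I]) \<in> (\<lambda>x. nths x I) ` G')"
      using V'.prj_iff[OF RD2_RD(2)[OF G] I, of "map e [0..<card I]"] by simp
  qed
qed

end

locale spair = smodel K T + vpair K K'
  for K :: "('a, 'f, 'r) vstr" (structure) and T and K' :: "('b, 'f, 'r) vstr" +
  assumes ee: "sat K \<phi> [] \<longleftrightarrow> sat K' \<phi> []"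
begin

text \<open>A formula with constant truth value may be evaluated at the empty tuple, where the two
  structures agree.\<close>

lemma CD_sentence: assumes "codef K K' (\<lambda>e. b) (\<lambda>e. b')" shows "b = b'"
proof -
  obtain \<phi> where p: "\<And>e. range e \<subseteq> carrier K \<Longrightarrow> b = holds K e \<phi>" "\<And>e. range e \<subseteq> carrier K' \<Longrightarrow> b' = holds K' e \<phi>"
    using assms unfolding codef_def by blast
  have "b = sat K \<phi> []" unfolding sat_env by (rule p(1)) (simp add: env_def image_subset_iff)
  moreover have "b' = sat K' \<phi> []" unfolding sat_env by (rule p(2)) (simp add: env_def image_subset_iff)
  ultimately show ?thesis using ee by simp
qed

text \<open>Uniform finiteness is available in \<open>K\<close> and yields the bound
  \<open>N\<close> that makes infinity of a fibre first-order. The same bound has to be established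
  in \<open>K'\<close> before the two sets can be compared.\<close>

lemma RD2_inff: assumes Y: "RD2 (Suc m) Y Y'" shows "RD2 m (inff Y) (V'.inff Y')"
proof -
  note R = RD2_RD[OF Y]
  obtain N where N: "\<And>\<zeta>. finite (fib Y \<zeta>) \<Longrightarrow> card (fib Y \<zeta>) \<le> N" using uniform_finiteness[OF R(1)] by blast
  define \<Phi> where "\<Phi> = (\<lambda>l. map (rv K) (tl l) @ [rv K (l ! 0)] \<in> Y)"
  define \<Phi>' where "\<Phi>' = (\<lambda>l. map (rv K') (tl l) @ [rv K' (l ! 0)] \<in> Y')"
  have g: "codef K K' (\<lambda>e. (\<lambda>l. map (rv K) l \<in> Y) (map e [0..<Suc m])) (\<lambda>e. (\<lambda>l. map (rv K') l \<in> Y') (map e [0..<Suc m]))"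
    using Y unfolding RD2_def by blast
  have t: "tl (map e [0..<Suc m]) = map (\<lambda>i. e (Suc i)) [0..<m]" "map e [0..<Suc m] ! 0 = e 0" for e :: "nat \<Rightarrow> 'c"
  proof -
    have "map e [0..<Suc m] = e 0 # map (\<lambda>i. e (Suc i)) [0..<m]" by (simp add: map_upt_Suc del: upt_Suc)
    then show "tl (map e [0..<Suc m]) = map (\<lambda>i. e (Suc i)) [0..<m]" "map e [0..<Suc m] ! 0 = e 0" by simp_all
  qed
  have "cotermL K K' (m + Suc 0) (\<lambda>e. map (\<lambda>i. e (Suc i)) [0..<m] @ [e 0]) (\<lambda>e. map (\<lambda>i. e (Suc i)) [0..<m] @ [e 0])"
    using two.CTL_append[OF two.CTL_map[of "\<lambda>e i. e (Suc i)" "\<lambda>e i. e (Suc i)" m 0] two.CTL_Cons[OF _ two.CTL_Nil]] two.CT_var by simp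
  then have "cotermL K K' (Suc m) (\<lambda>e. map (\<lambda>i. e (Suc i)) [0..<m] @ [e 0]) (\<lambda>e. map (\<lambda>i. e (Suc i)) [0..<m] @ [e 0])" by simp
  from two.CD_list[OF g this]
  have C: "codef K K' (\<lambda>e. \<Phi> (map e [0..<Suc m])) (\<lambda>e. \<Phi>' (map e [0..<Suc m]))"
    unfolding \<Phi>_def \<Phi>'_def t by simp
  have F: "few (rv K) M \<Phi> zs \<longleftrightarrow> finite (fib Y (map (rv K) zs)) \<and> card (fib Y (map (rv K) zs)) \<le> M" for M zs
    unfolding \<Phi>_def by (rule few_fib[OF R(1)])
  have F': "V'.few (rv K') M \<Phi>' zs \<longleftrightarrow> finite (V'.fib Y' (map (rv K') zs)) \<and> card (V'.fib Y' (map (rv K') zs)) \<le> M" for M zs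
    unfolding \<Phi>'_def by (rule V'.few_fib[OF R(2)])
  \<comment> \<open>For a finite fibre of size \<open>?M\<close> in \<open>K'\<close>, the assertion
    that at most \<open>?M\<close> elements implies at most \<open>N\<close> is a single sentence,
    true in \<open>K\<close>; no quantification over sizes is transferred.\<close>
  have N': "finite (V'.fib Y' (map (rv K') zs)) \<Longrightarrow> card (V'.fib Y' (map (rv K') zs)) \<le> N" if zs: "zs \<in> tuples K' m" for zs
  proof -
    assume f: "finite (V'.fib Y' (map (rv K') zs))"
    let ?M = "card (V'.fib Y' (map (rv K') zs))"
    have "codef K K' (\<lambda>e. \<forall>ws\<in>tuples K m. (\<lambda>ws e. few (rv K) ?M \<Phi> ws \<longrightarrow> few (rv K) N \<Phi> ws) ws e)
       (\<lambda>e. \<forall>ws\<in>tuples K' m. (\<lambda>ws e. V'.few (rv K') ?M \<Phi>' ws \<longrightarrow> V'.few (rv K') N \<Phi>' ws) ws e)"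
      by (rule two.CD_tuples_all) (intro two.CD_imp CD_few C)
    then have "(\<forall>ws\<in>tuples K m. few (rv K) ?M \<Phi> ws \<longrightarrow> few (rv K) N \<Phi> ws) =
       (\<forall>ws\<in>tuples K' m. V'.few (rv K') ?M \<Phi>' ws \<longrightarrow> V'.few (rv K') N \<Phi>' ws)"
      by (rule CD_sentence)
    then have "V'.few (rv K') ?M \<Phi>' zs \<longrightarrow> V'.few (rv K') N \<Phi>' zs" using zs N unfolding F by blast
    then show ?thesis using f unfolding F' by simp
  qed
  show ?thesis unfolding RD2_def
  proof (intro conjI inff_RVx[OF R(1)] V'.inff_RVx[OF R(2)])
    show "codef K K' (\<lambda>e. map (rv K) (map e [0..<m]) \<in> inff Y) (\<lambda>e. map (rv K') (map e [0..<m]) \<in> V'.inff Y')"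
    proof (rule CD_cong)
      show "codef K K' (\<lambda>e. \<not> few (rv K) N \<Phi> (map e [0..<m])) (\<lambda>e. \<not> V'.few (rv K') N \<Phi>' (map e [0..<m]))"
        by (rule two.CD_not[OF CD_few[OF C]])
      show "(\<not> few (rv K) N \<Phi> (map e [0..<m])) = (map (rv K) (map e [0..<m]) \<in> inff Y)" for e
        unfolding F inff_def using N[of "map (rv K) (map e [0..<m])"] by auto
      show "(\<not> V'.few (rv K') N \<Phi>' (map e [0..<m])) = (map (rv K') (map e [0..<m]) \<in> V'.inff Y')" if "range e \<subseteq> carrier K'" for e
      proof -
        have "map e [0..<m] \<in> tuples K' m" using V'.map_tuples[OF that, of 0 m] by simp
        from N'[OF this] show ?thesis unfolding F' V'.inff_def by auto
      qed
    qed
  qed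
qed

lemma RD2_inff_pow: assumes "RD2 (m + q) Y Y'" shows "j \<le> q \<Longrightarrow> RD2 (m + (q - j)) ((inff ^^ j) Y) ((V'.inff ^^ j) Y')"
proof (induction j)
  case 0
  then show ?case using assms by simp
next
  case (Suc j)
  then have "RD2 (Suc (m + (q - Suc j))) ((inff ^^ j) Y) ((V'.inff ^^ j) Y')" by (simp add: Suc_diff_Suc)
  from RD2_inff[OF this] show ?case by simp
qed

text \<open>Whether coordinates \<open>I\<close> can be made independent is, by
  \<open>generic_tuple\<close>, membership of the empty tuple in an iterated \<open>inff\<close> of
  a projection. In \<open>K\<close> this is read over no parameters, in \<open>K'\<close> over
  \<open>A\<close>; as a sentence it has the same truth value.\<close>

lemma dim_transfer:
  assumes R: "RD2 n R R'" and A: "A \<subseteq> carrier K'" and sat': "saturated K' A"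
  shows "dimRV K' (pt ` A) R' = dimRV K {} R"
proof -
  note r = RD2_RD[OF R]
  have "(\<exists>a\<in>R'. indl V'.cl (pt ` A) (nths a I)) \<longleftrightarrow> (\<exists>a\<in>R. indl cl {} (nths a I))" if I: "I \<subseteq> {..<n}" for I
  proof -
    let ?Y = "(\<lambda>x. nths x I) ` R" and ?Y' = "(\<lambda>x. nths x I) ` R'"
    have Y: "RD2 (0 + card I) ?Y ?Y'" using RD2_prj[OF R I] by simp
    note P = RD2_inff_pow[OF Y]
    have q: "RD (0 + (card I - j)) ((inff ^^ j) ?Y)" "V'.RD (0 + (card I - j)) ((V'.inff ^^ j) ?Y')" if "j \<le> card I" for j
      using RD2_RD[OF P[OF that]] .
    have e: "[] \<in> RVx_pow K 0" "[] \<in> RVx_pow K' 0" by (simp_all add: RVx_pow_iff V'.RVx_pow_iff)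
    have len: "length y = card I" if "y \<in> ?Y" for y using prj_RVx[OF r(1) I] that by (auto simp: RVx_pow_iff)
    have len': "length y = card I" if "y \<in> ?Y'" for y using V'.prj_RVx[OF r(2) I] that by (auto simp: V'.RVx_pow_iff)
    have 1: "[] \<in> (inff ^^ card I) ?Y \<longleftrightarrow> (\<exists>a. length a = card I \<and> [] @ a \<in> ?Y \<and> indl cl (pt ` {} \<union> set [] \<union> {}) a)"
      by (rule generic_tuple[OF sat empty_subsetI e(1) finite.emptyI empty_subsetI q(1)])
    have 2: "[] \<in> (V'.inff ^^ card I) ?Y' \<longleftrightarrow> (\<exists>a. length a = card I \<and> [] @ a \<in> ?Y' \<and> indl V'.cl (pt ` A \<union> set [] \<union> {}) a)"
      by (rule V'.generic_tuple[OF sat' A e(2) finite.emptyI empty_subsetI q(2)])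
    have "RD2 0 ((inff ^^ card I) ?Y) ((V'.inff ^^ card I) ?Y')" using P[of "card I"] by simp
    then have "codef K K' (\<lambda>e. [] \<in> (inff ^^ card I) ?Y) (\<lambda>e. [] \<in> (V'.inff ^^ card I) ?Y')" unfolding RD2_def by simp
    from CD_sentence[OF this] have "(\<exists>y\<in>?Y'. indl V'.cl (pt ` A) y) \<longleftrightarrow> (\<exists>y\<in>?Y. indl cl {} y)"
      unfolding 1 2 using len len' by auto
    then show ?thesis by simp
  qed
  then have e: "(I \<subseteq> {..<n} \<and> (\<exists>a\<in>R'. indl V'.cl (pt ` A) (nths a I))) \<longleftrightarrow> (I \<subseteq> {..<n} \<and> (\<exists>a\<in>R. indl cl {} (nths a I)))" for I by blast
  have "pt ` A \<subseteq> V'.PRV" using A V'.RVx_PRV(3) by blast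
  moreover have "R' \<subseteq> RVx_pow K' n" "R \<subseteq> RVx_pow K n" using R unfolding RD2_def by blast+
  ultimately show ?thesis using V'.dim_indl[of "pt ` A" R' n] dim_indl[of "{}" R n] e by simp
qed

end

context smodel
begin

text \<open>The diagonal case of the comparison.\<close>

lemma RD_inff: assumes "RD (Suc m) X" shows "RD m (inff X)"
proof -
  interpret d: spair K T K by unfold_locales simp
  have "d.RD2 (Suc m) X X" using assms unfolding d.RD2_def RD_def LDef_def by simp
  then show ?thesis using d.RD2_RD(1)[OF d.RD2_inff] by blast
qed

end

context vfield
begin

lemma RD_prj: assumes "RD n G" "I \<subseteq> {..<n}" shows "RD (card I) ((\<lambda>x. nths x I) ` G)"
proof -
  interpret d: vpair K K by unfold_locales
  have "d.RD2 n G G" using assms unfolding d.RD2_def RD_def LDef_def by simp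
  then show ?thesis using d.RD2_RD(1)[OF d.RD2_prj] assms(2) by blast
qed

section \<open>Dimension\<close>

lemma RD_empty: "RD n {}"
  unfolding RD_def LDef_def using Def_basic(8)[of False] by simp
lemma RD_Un: "RD n X \<Longrightarrow> RD n Y \<Longrightarrow> RD n (X \<union> Y)"
  unfolding RD_def LDef_def Un_iff using Def_basic(5) by blast
lemma RD_Int: "RD n X \<Longrightarrow> RD n Y \<Longrightarrow> RD n (X \<inter> Y)"
  unfolding RD_def LDef_def Int_iff using Def_basic(4) by blast
lemma RD_Diff: "RD n X \<Longrightarrow> RD n Y \<Longrightarrow> RD n (X - Y)"
  unfolding RD_def LDef_def Diff_iff using Def_basic(3,4) by blast
lemma RD_UN: "finite S \<Longrightarrow> (\<And>i. i \<in> S \<Longrightarrow> RD n (X i)) \<Longrightarrow> RD n (\<Union>i\<in>S. X i)"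
  by (induction S rule: finite_induct) (simp_all add: RD_empty RD_Un)

lemma RTmL_rv: "RTmL n (\<lambda>e. map (rv K) (map e [0..<n]))"
  by (intro RTmL_map TmL_map0 tm_intros refl)

lemma RTmL_reindex: assumes "\<And>i. i \<in> set is \<Longrightarrow> i < n" "k = length is"
  shows "RTmL k (\<lambda>e. map (\<lambda>i. map (rv K) (map e [0..<n]) ! i) is)"
  by (rule RTmL_list[OF _ assms(2)]) (rule RTm_nth[OF RTmL_rv assms(1)])

lemma RD_swap: assumes G: "RD (n + k) G"
  shows "RD (k + n) {y @ x | x y. x @ y \<in> G \<and> length x = n}" (is "RD _ ?S")
proof (rule RDI)
  define P where "P = (\<lambda>z::'a imag list. map (\<lambda>i. z ! i) ([k..<k + n] @ [0..<k]) \<in> G)"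
  show "?S \<subseteq> RVx_pow K (k + n)"
  proof
    fix z assume "z \<in> ?S"
    then obtain x y where h: "z = y @ x" "x @ y \<in> G" "length x = n" by blast
    then show "z \<in> RVx_pow K (k + n)" using RD_mem[OF G h(2)] by (auto simp: RVx_pow_iff)
  qed
  show "z \<in> ?S \<longleftrightarrow> P z" if z: "z \<in> RVx_pow K (k + n)" for z
  proof -
    have len: "length z = k + n" using z by (simp add: RVx_pow_iff)
    have "map (\<lambda>i. z ! i) [k..<k + n] = drop k z" "map (\<lambda>i. z ! i) [0..<k] = take k z"
      by (rule nth_equalityI; simp add: len)+
    then have P: "P z \<longleftrightarrow> drop k z @ take k z \<in> G" unfolding P_def by simp
    show ?thesis
    proof
      assume "z \<in> ?S"
      then obtain x y where h: "z = y @ x" "x @ y \<in> G" "length x = n" by blast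
      then have "length y = k" using len by simp
      then show "P z" unfolding P using h by simp
    next
      assume "P z"
      then have "drop k z @ take k z \<in> G" "length (drop k z) = n" "z = take k z @ drop k z" using P len by simp_all
      then show "z \<in> ?S" by blast
    qed
  qed
  show "Def (\<lambda>e. P (map (rv K) (map e [0..<k + n])))" unfolding P_def
    by (intro Def_RD[OF G] RTmL_reindex) auto
qed

text \<open>The index set keeping \<open>m\<close> base coordinates and selecting \<open>I\<close>
  among the fibre coordinates.\<close>

definition coords :: "nat \<Rightarrow> nat set \<Rightarrow> nat set" where
  "coords m I = {..<m} \<union> (+) m ` I"

lemma nths_coords: "length \<xi> = m \<Longrightarrow> nths (\<xi> @ \<eta>) (coords m I) = \<xi> @ nths \<eta> I"
proof -
  assume m: "length \<xi> = m"
  have 1: "nths \<xi> (coords m I) = \<xi>" by (rule nths_all) (simp add: m coords_def)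
  have "{j. j + m \<in> coords m I} = I" by (auto simp: coords_def)
  then show ?thesis unfolding nths_append m 1 by simp
qed

lemma card_coords: "finite I \<Longrightarrow> card (coords m I) = m + card I"
proof -
  assume I: "finite I"
  have "card ({..<m} \<union> (+) m ` I) = card {..<m} + card ((+) m ` I)" by (rule card_Un_disjoint) (use I in auto)
  then show ?thesis unfolding coords_def by (simp add: card_image)
qed

lemma RD_coords: assumes "RD (m + n) G" "I \<subseteq> {..<n}" shows "RD (m + card I) ((\<lambda>x. nths x (coords m I)) ` G)"
proof -
  have "coords m I \<subseteq> {..<m + n}" using assms(2) by (auto simp: coords_def)
  from RD_prj[OF assms(1) this] show ?thesis using card_coords[of I m] finite_subset[OF assms(2)] by simp
qed

lemma coords_mem: assumes "RD (m + n) G" "length \<xi> = m"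
  shows "\<xi> @ a \<in> (\<lambda>x. nths x (coords m I)) ` G \<longleftrightarrow> (\<exists>\<eta>. \<xi> @ \<eta> \<in> G \<and> a = nths \<eta> I)"
proof
  assume "\<xi> @ a \<in> (\<lambda>x. nths x (coords m I)) ` G"
  then obtain x where x: "x \<in> G" "\<xi> @ a = nths x (coords m I)" by blast
  have l: "length (take m x) = m" using RD_mem[OF assms(1) x(1)] by simp
  have "nths x (coords m I) = take m x @ nths (drop m x) I" using nths_coords[OF l, of "drop m x" I] by simp
  then have "\<xi> = take m x" "a = nths (drop m x) I" using x(2) l assms(2) by simp_all
  then show "\<exists>\<eta>. \<xi> @ \<eta> \<in> G \<and> a = nths \<eta> I" using x(1) by (intro exI[of _ "drop m x"]) simp
next
  assume "\<exists>\<eta>. \<xi> @ \<eta> \<in> G \<and> a = nths \<eta> I"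
  then obtain \<eta> where "\<xi> @ \<eta> \<in> G" "a = nths \<eta> I" by blast
  then show "\<xi> @ a \<in> (\<lambda>x. nths x (coords m I)) ` G" using nths_coords[OF assms(2), of \<eta> I] by force
qed

lemma nths_singleton: "i < length xs \<Longrightarrow> nths xs {i} = [xs ! i]"
proof (induction xs arbitrary: i)
  case (Cons x xs)
  show ?case
  proof (cases i)
    case 0
    have "nths xs {j. Suc j \<in> {0}} = []" by simp
    then show ?thesis using 0 by (simp add: nths_Cons)
  next
    case (Suc k)
    have "{j. Suc j \<in> {Suc k}} = {k}" by auto
    then show ?thesis using Suc Cons by (simp add: nths_Cons)
  qed
qed simp

lemma RD_coord:
  assumes "RD (m + n) G" "i < n"
  shows "RD (Suc m) ((\<lambda>x. nths x (coords m {i})) ` G)"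
    "length \<xi> = m \<Longrightarrow> fib ((\<lambda>x. nths x (coords m {i})) ` G) \<xi> = (\<lambda>\<eta>. \<eta> ! i) ` {\<eta>. \<xi> @ \<eta> \<in> G}"
proof -
  show "RD (Suc m) ((\<lambda>x. nths x (coords m {i})) ` G)" using RD_coords[OF assms(1), of "{i}"] assms(2) by simp
  assume l: "length \<xi> = m"
  have "nths \<eta> {i} = [\<eta> ! i]" if "\<xi> @ \<eta> \<in> G" for \<eta>
    using RD_mem[OF assms(1) that] l assms(2) by (intro nths_singleton) simp
  then show "fib ((\<lambda>x. nths x (coords m {i})) ` G) \<xi> = (\<lambda>\<eta>. \<eta> ! i) ` {\<eta>. \<xi> @ \<eta> \<in> G}"
    unfolding fib_def coords_mem[OF assms(1) l] by auto
qed

text \<open>Each coordinate of a finite fibre takes finitely many values, so it lies in a finite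
  one-dimensional fibre over the same base.\<close>

lemma finite_fibre_cl:
  assumes G: "RD (m + n) G" and l: "length \<xi> = m" and \<eta>: "\<xi> @ \<eta> \<in> G" and fin: "finite {\<eta>. \<xi> @ \<eta> \<in> G}"
  shows "set \<eta> \<subseteq> cl (set \<xi>)"
proof
  fix y assume "y \<in> set \<eta>"
  then obtain i where i: "i < length \<eta>" "y = \<eta> ! i" by (auto simp: in_set_conv_nth)
  have len: "length \<eta> = n" "set \<xi> \<subseteq> RVx K" using RD_mem[OF G \<eta>] l by simp_all
  have "y \<in> fib ((\<lambda>x. nths x (coords m {i})) ` G) \<xi>" using RD_coord(2)[OF G _ l, of i] i len \<eta> by auto
  moreover have "finite (fib ((\<lambda>x. nths x (coords m {i})) ` G) \<xi>)" using RD_coord(2)[OF G _ l, of i] i len fin by simp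
  moreover have "\<xi> \<in> RVx_pow K m" using l len by (simp add: RVx_pow_iff)
  moreover have "RD (Suc m) ((\<lambda>x. nths x (coords m {i})) ` G)" using RD_coord(1)[OF G] i len by simp
  ultimately show "y \<in> cl (set \<xi>)" unfolding fib_def using cl_fibreI by blast
qed

lemma sat_eq_mem:
  assumes zs: "zs \<in> tuples K n"
  shows "map (rv K) zs \<in> {\<xi> \<in> RVx_pow K n. sat_eq K \<phi> \<xi>} \<longleftrightarrow>
    (\<forall>i<n. zs ! i \<noteq> \<zero>) \<and> (\<exists>ws\<in>tuples K n. (\<forall>i<n. rv K (ws ! i) = rv K (zs ! i)) \<and> sat K \<phi> ws)"
proof (cases "\<forall>i<n. zs ! i \<noteq> \<zero>")
  case True
  then have R: "map (rv K) zs \<in> RVx_pow K n" using map_rv_RVx_pow[OF zs] by blast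
  have e: "rep ws (map (rv K) zs) \<longleftrightarrow> ws \<in> tuples K n \<and> (\<forall>i<n. rv K (ws ! i) = rv K (zs ! i))" for ws
    unfolding rep_RVx[OF R] using zs by (auto simp: tuples_iff list_eq_iff_nth_eq)
  show ?thesis using R True unfolding mem_Collect_eq sat_eq_rep[OF RVx_pow_PRV[OF R]] e by blast
next
  case False
  then show ?thesis using map_rv_RVx_pow[OF zs] by blast
qed

lemma sat_holds: "sat K \<phi> (map e [0..<n]) \<longleftrightarrow> holds K e (fsubst \<phi> (\<lambda>i. if i < n then TVar i else TZero))"
proof -
  have "env K (map e [0..<n]) = (\<lambda>i. tval K e (if i < n then TVar i else TZero))" by (auto simp: env_def fun_eq_iff)
  then show ?thesis by (simp only: holds_fsubst sat_env)
qed

lemma vpairs_sym: "[\<xi>, \<eta>] \<in> vpairs \<Longrightarrow> [\<eta>, \<xi>] \<in> vpairs"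
  unfolding vpairs_iff using veq_sym by blast

lemma vpairs_trans: assumes "[\<xi>, \<eta>] \<in> vpairs" "[\<eta>, \<zeta>] \<in> vpairs" shows "[\<xi>, \<zeta>] \<in> vpairs"
proof -
  obtain x y where x: "x \<in> carrier K" "y \<in> carrier K" "x \<noteq> \<zero>" "y \<noteq> \<zero>" "veq K x y" "\<xi> = rv K x" "\<eta> = rv K y"
    using assms(1) unfolding vpairs_iff by blast
  obtain y' z where z: "y' \<in> carrier K" "z \<in> carrier K" "z \<noteq> \<zero>" "\<eta> = rv K y'" "veq K y' z" "\<zeta> = rv K z"
    using assms(2) unfolding vpairs_iff by blast
  have "[rv K y, rv K z] \<in> vpairs" using assms(2) x(7) z(6) by simp
  then have "veq K y z" by (rule vpairs_veq) (use x z in simp_all)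
  then have "veq K x z" using x z vle_trans[of x y z] vle_trans[of z y x] unfolding veq_def by blast
  then show ?thesis unfolding vpairs_iff using x z by blast
qed

lemma vpairs_kx: assumes "[\<xi>, \<eta>] \<in> vpairs" shows "\<exists>u\<in>kx K. rv_mult K \<xi> u = \<eta>"
proof -
  obtain x y where x: "x \<in> carrier K" "y \<in> carrier K" "x \<noteq> \<zero>" "y \<noteq> \<zero>" "veq K x y" "\<xi> = rv K x" "\<eta> = rv K y"
    using assms unfolding vpairs_iff by blast
  obtain a where a: "a \<in> \<O>" "y = a \<otimes> x" using x(5) unfolding veq_def vle_def by blast
  obtain b where b: "b \<in> \<O>" "x = b \<otimes> y" using x(5) unfolding veq_def vle_def by blast
  have c: "a \<in> carrier K" "b \<in> carrier K" using a b O_carrier by blast+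
  have "(b \<otimes> a) \<otimes> x = b \<otimes> y" unfolding a(2) by (rule m_assoc[OF c(2,1) x(1)])
  then have "(b \<otimes> a) \<otimes> x = \<one> \<otimes> x" using b(2) x(1) by simp
  then have "b \<otimes> a = \<one>" using m_rcancel[of x "b \<otimes> a" \<one>] c x(1,3) by simp
  then have "veq K a \<one>" unfolding veq_def vle_def using a(1) b(1) c(1) r_one[OF c(1)] by (metis)
  moreover have "a \<noteq> \<zero>" using a(2) x(1,4) by auto
  ultimately have "rv K a \<in> kx K" unfolding kx_def using c(1) by blast
  moreover have "rv_mult K \<xi> (rv K a) = \<eta>" unfolding x(6,7) rv_mult_rv[OF x(1) c(1)] a(2) using m_comm[OF x(1) c(1)] by simp
  ultimately show ?thesis by blast
qed

lemma kx_cosetI: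
  assumes "length \<xi> = n" "length \<eta> = n" "\<And>i. i < n \<Longrightarrow> [\<xi> ! i, \<eta> ! i] \<in> vpairs" shows "\<eta> \<in> kx_coset K \<xi>"
proof -
  have "\<forall>i\<in>{..<n}. \<exists>u. u \<in> kx K \<and> rv_mult K (\<xi> ! i) u = \<eta> ! i" using vpairs_kx assms(3) by blast
  from bchoice[OF this] obtain u where u: "\<And>i. i < n \<Longrightarrow> u i \<in> kx K \<and> rv_mult K (\<xi> ! i) (u i) = \<eta> ! i" by auto
  let ?us = "map u [0..<n]"
  have "map2 (rv_mult K) \<xi> ?us = \<eta>" by (rule nth_equalityI) (use assms(1,2) u in simp_all)
  moreover have "?us \<in> listset (replicate (length \<xi>) (kx K))" using u assms(1) by (auto simp: listset_replicate)
  ultimately show ?thesis unfolding kx_coset_def by blast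
qed

end

context vpair
begin

lemma RD2_sat_eq: "RD2 n {\<xi> \<in> RVx_pow K n. sat_eq K \<phi> \<xi>} {\<xi> \<in> RVx_pow K' n. sat_eq K' \<phi> \<xi>}"
  unfolding RD2_def
proof (intro conjI)
  have S: "codef K K' (\<lambda>e. sat K \<phi> (map e [0..<n])) (\<lambda>e. sat K' \<phi> (map e [0..<n]))"
    unfolding codef_def using sat_holds V'.sat_holds by blast
  have n: "coterm K K' (\<lambda>e. map e [0..<n] ! i) (\<lambda>e. map e [0..<n] ! i)" if "i < n" for i
    by (rule two.CT_nth[OF two.CTL_map[where a = 0, simplified] that]) (rule two.CT_var)
  show "codef K K' (\<lambda>e. map (rv K) (map e [0..<n]) \<in> {\<xi> \<in> RVx_pow K n. sat_eq K \<phi> \<xi>})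
      (\<lambda>e. map (rv K') (map e [0..<n]) \<in> {\<xi> \<in> RVx_pow K' n. sat_eq K' \<phi> \<xi>})"
  proof (rule CD_cong)
    show "codef K K'
      (\<lambda>e. (\<forall>i<n. e i \<noteq> \<zero>) \<and> (\<exists>ws\<in>tuples K n. (\<forall>i<n. rv K (ws ! i) = rv K (e i)) \<and> sat K \<phi> ws))
      (\<lambda>e. (\<forall>i<n. e i \<noteq> \<zero>\<^bsub>K'\<^esub>) \<and> (\<exists>ws\<in>tuples K' n. (\<forall>i<n. rv K' (ws ! i) = rv K' (e i)) \<and> sat K' \<phi> ws))"
      by (intro two.CD_and two.CD_finite_all two.CD_not two.CD_eq two.CT_var two.CT_zero two.CD_tuples_ex CD_rv n S)
  next
    fix e :: "nat \<Rightarrow> 'a" assume e: "range e \<subseteq> carrier K"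
    have "map e [0..<n] \<in> tuples K n" using map_tuples[OF e, of 0 n] by simp
    from sat_eq_mem[OF this, of \<phi>]
    show "((\<forall>i<n. e i \<noteq> \<zero>) \<and> (\<exists>ws\<in>tuples K n. (\<forall>i<n. rv K (ws ! i) = rv K (e i)) \<and> sat K \<phi> ws)) \<longleftrightarrow>
      (map (rv K) (map e [0..<n]) \<in> {\<xi> \<in> RVx_pow K n. sat_eq K \<phi> \<xi>})" by simp
  next
    fix e :: "nat \<Rightarrow> 'b" assume e: "range e \<subseteq> carrier K'"
    have "map e [0..<n] \<in> tuples K' n" using V'.map_tuples[OF e, of 0 n] by simp
    from V'.sat_eq_mem[OF this, of \<phi>]
    show "((\<forall>i<n. e i \<noteq> \<zero>\<^bsub>K'\<^esub>) \<and> (\<exists>ws\<in>tuples K' n. (\<forall>i<n. rv K' (ws ! i) = rv K' (e i)) \<and> sat K' \<phi> ws)) \<longleftrightarrow>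
      (map (rv K') (map e [0..<n]) \<in> {\<xi> \<in> RVx_pow K' n. sat_eq K' \<phi> \<xi>})" by simp
  qed
qed auto

end

section \<open>Dimension as a supremum of ranks\<close>

lemma dimRV_empty: "dimRV K P {} = -\<infinity>"
  unfolding dimRV_def by (simp add: bot_ereal_def)

lemma dimRV_Un: "dimRV K P (X \<union> Y) = max (dimRV K P X) (dimRV K P Y)"
proof -
  let ?Q = "\<lambda>a I. I \<subseteq> {..<length a} \<and> (\<forall>i\<in>I. a ! i \<notin> acl K (P \<union> {a ! j | j. j \<in> I \<and> j < i}))"
  have "{ereal (real (card I)) | I. \<exists>a\<in>X \<union> Y. ?Q a I} = {ereal (real (card I)) | I. \<exists>a\<in>X. ?Q a I} \<union> {ereal (real (card I)) | I. \<exists>a\<in>Y. ?Q a I}"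
    by blast
  then show ?thesis unfolding dimRV_def by (simp only: Sup_union_distrib sup_max)
qed

context hmodel
begin

text \<open>Subsequences of independent tuples are independent because closures grow with the set;
  that an independent subsequence cannot exceed the rank rests on exchange.\<close>

lemma rnk_ge_iff:
  assumes P: "finite P" "P \<subseteq> RVx K" and as: "set as \<subseteq> RVx K"
  shows "q \<le> rnk cl P as \<longleftrightarrow> (\<exists>I. I \<subseteq> {..<length as} \<and> card I = q \<and> indl cl P (nths as I))"
proof
  assume q: "q \<le> rnk cl P as"
  obtain J where J: "J \<subseteq> {..<length as}" "card J = rnk cl P as" "indl cl P (nths as J)"
    using cop.basis_nths[OF as] by blast
  obtain I where I: "I \<subseteq> J" "card I = q" using q J(2) obtain_subset_with_card_n[of q J] by metis
  have IL: "I \<subseteq> {..<length as}" using I J by blast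
  have "as ! i \<notin> cl (P \<union> {as ! j | j. j \<in> I \<and> j < i})" if "i \<in> I" for i
  proof -
    have "as ! i \<notin> cl (P \<union> {as ! j | j. j \<in> J \<and> j < i})" using J(3) indl_nths[OF J(1)] that I(1) by blast
    moreover have "cl (P \<union> {as ! j | j. j \<in> I \<and> j < i}) \<subseteq> cl (P \<union> {as ! j | j. j \<in> J \<and> j < i})"
      by (rule cl_mono) (use I(1) in blast)
    ultimately show ?thesis by blast
  qed
  then show "\<exists>I. I \<subseteq> {..<length as} \<and> card I = q \<and> indl cl P (nths as I)"
    using indl_nths[OF IL] IL I(2) by blast
next
  assume "\<exists>I. I \<subseteq> {..<length as} \<and> card I = q \<and> indl cl P (nths as I)"
  then obtain I where I: "I \<subseteq> {..<length as}" "card I = q" "indl cl P (nths as I)" by blast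
  have "q = rnk cl P (nths as I)" using I length_nths_card[OF I(1)] unfolding indl_rnk by simp
  then show "q \<le> rnk cl P as" using pg.rnk_nths_le[OF P as] by simp
qed

lemma rnk_zero_iff: assumes "finite P" "P \<subseteq> RVx K" "set as \<subseteq> RVx K"
  shows "rnk cl P as = 0 \<longleftrightarrow> set as \<subseteq> cl P"
proof
  assume r: "rnk cl P as = 0"
  obtain J where J: "J \<subseteq> {..<length as}" "card J = rnk cl P as" "set as \<subseteq> cl (P \<union> set (nths as J))"
    using cop.basis_nths[OF assms(3)] by blast
  have "J = {}" using J(1,2) r finite_subset[OF J(1)] by simp
  then show "set as \<subseteq> cl P" using J(3) by simp
qed (rule cop.rnk_zero)

text \<open>Ranks do not depend on the order of the coordinates, so from here on neither does
  dimension.\<close>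

lemma dim_rnk:
  assumes P: "finite P" "P \<subseteq> RVx K" and X: "X \<subseteq> RVx_pow K n"
  shows "dimRV K P X = (SUP a\<in>X. ereal (real (rnk cl P a)))"
proof -
  have PV: "P \<subseteq> PRV" using P(2) RVx_PRV(1) by blast
  have aR: "length a = n" "set a \<subseteq> RVx K" if "a \<in> X" for a
    using subsetD[OF X that] by (simp_all add: RVx_pow_iff)
  show ?thesis unfolding dim_indl[OF PV X]
  proof (rule antisym)
    show "Sup {ereal (real (card I)) | I. I \<subseteq> {..<n} \<and> (\<exists>a\<in>X. indl cl P (nths a I))} \<le> (SUP a\<in>X. ereal (real (rnk cl P a)))"
    proof (rule Sup_least)
      fix s assume "s \<in> {ereal (real (card I)) | I. I \<subseteq> {..<n} \<and> (\<exists>a\<in>X. indl cl P (nths a I))}"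
      then obtain I a where h: "s = ereal (real (card I))" "I \<subseteq> {..<n}" "a \<in> X" "indl cl P (nths a I)" by blast
      then have "card I \<le> rnk cl P a" using rnk_ge_iff[OF P aR(2)[OF h(3)], of "card I"] aR(1)[OF h(3)] by blast
      then show "s \<le> (SUP a\<in>X. ereal (real (rnk cl P a)))" using h by (intro SUP_upper2[OF h(3)]) simp
    qed
    show "(SUP a\<in>X. ereal (real (rnk cl P a))) \<le> Sup {ereal (real (card I)) | I. I \<subseteq> {..<n} \<and> (\<exists>a\<in>X. indl cl P (nths a I))}"
    proof (rule SUP_least)
      fix a assume a: "a \<in> X"
      obtain I where I: "I \<subseteq> {..<n}" "card I = rnk cl P a" "indl cl P (nths a I)"
        using rnk_ge_iff[OF P aR(2)[OF a], of "rnk cl P a"] aR(1)[OF a] by auto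
      show "ereal (real (rnk cl P a)) \<le> Sup {ereal (real (card I)) | I. I \<subseteq> {..<n} \<and> (\<exists>a\<in>X. indl cl P (nths a I))}"
        by (rule Sup_upper) (use I a in \<open>auto intro!: exI[of _ I]\<close>)
    qed
  qed
qed

lemma dim_eqI:
  assumes P: "finite P" "P \<subseteq> RVx K" and X: "X \<subseteq> RVx_pow K n"
    and q: "\<And>a. a \<in> X \<Longrightarrow> rnk cl P a \<le> q" "b \<in> X" "rnk cl P b = q"
  shows "dimRV K P X = ereal (real q)"
  unfolding dim_rnk[OF P X]
proof (rule antisym)
  show "(SUP a\<in>X. ereal (real (rnk cl P a))) \<le> ereal (real q)" by (rule SUP_least) (use q(1) in simp)
  show "ereal (real q) \<le> (SUP a\<in>X. ereal (real (rnk cl P a)))" by (rule SUP_upper2[OF q(2)]) (use q(3) in simp)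
qed

lemma dim_ex:
  assumes P: "finite P" "P \<subseteq> RVx K" and X: "X \<subseteq> RVx_pow K n" "X \<noteq> {}"
  obtains q a0 where "q \<le> n" "dimRV K P X = ereal (real q)" "\<And>a. a \<in> X \<Longrightarrow> rnk cl P a \<le> q" "a0 \<in> X" "rnk cl P a0 = q"
proof -
  have b: "rnk cl P a \<le> n" if "a \<in> X" for a
    using subsetD[OF X(1) that] rnk_le_length[of cl P a] by (simp add: RVx_pow_iff)
  then have fin: "finite (rnk cl P ` X)" by (meson finite_atMost finite_subset image_subsetI atMost_iff)
  have "Max (rnk cl P ` X) \<in> rnk cl P ` X" by (rule Max_in[OF fin]) (use X(2) in simp)
  then obtain a0 where a0: "a0 \<in> X" "rnk cl P a0 = Max (rnk cl P ` X)" by auto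
  have m: "rnk cl P a \<le> rnk cl P a0" if "a \<in> X" for a unfolding a0(2) using fin that by simp
  show thesis by (rule that[OF b[OF a0(1)] dim_eqI[OF P X(1) m a0(1) refl] m a0(1) refl])
qed

lemma dim_iff:
  assumes P: "finite P" "P \<subseteq> RVx K" and X: "X \<subseteq> RVx_pow K n"
  shows "dimRV K P X = ereal (real q) \<longleftrightarrow> (\<forall>a\<in>X. rnk cl P a \<le> q) \<and> (\<exists>a\<in>X. rnk cl P a = q)"
proof
  assume d: "dimRV K P X = ereal (real q)"
  then have "X \<noteq> {}" using dimRV_empty[of K P] by auto
  then obtain q' a0 where h: "dimRV K P X = ereal (real q')" "\<And>a. a \<in> X \<Longrightarrow> rnk cl P a \<le> q'" "a0 \<in> X" "rnk cl P a0 = q'"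
    using dim_ex[OF P X] by metis
  then have "q = q'" using d by simp
  then show "(\<forall>a\<in>X. rnk cl P a \<le> q) \<and> (\<exists>a\<in>X. rnk cl P a = q)" using h by blast
qed (use dim_eqI[OF P X] in blast)

text \<open>Additivity \<open>rnk_append\<close>, applied to maximal ranks; every fibre attains
  \<open>q\<close>, in particular the one over a base point of maximal rank. Over an empty base both
  sides are \<open>-\<infinity>\<close>.\<close>

lemma dim_fibred:
  assumes Q: "Q \<subseteq> RVx_pow K n" and F: "\<And>\<xi>. \<xi> \<in> Q \<Longrightarrow> F \<xi> \<subseteq> RVx_pow K n'"
    and d: "\<And>\<xi>. \<xi> \<in> Q \<Longrightarrow> dimRV K (set \<xi>) (F \<xi>) = ereal (real q)"
  shows "dimRV K {} {\<xi> @ \<eta> | \<xi> \<eta>. \<xi> \<in> Q \<and> \<eta> \<in> F \<xi>} = dimRV K {} Q + ereal (real q)"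
proof (cases "Q = {}")
  case True
  then show ?thesis by (simp add: dimRV_empty)
next
  case False
  have sR: "set \<xi> \<subseteq> RVx K" if "\<xi> \<in> Q" for \<xi> using subsetD[OF Q that] by (simp add: RVx_pow_iff)
  have d': "\<And>\<eta>. \<eta> \<in> F \<xi> \<Longrightarrow> rnk cl (set \<xi>) \<eta> \<le> q" "\<exists>\<eta>\<in>F \<xi>. rnk cl (set \<xi>) \<eta> = q" if "\<xi> \<in> Q" for \<xi>
    using d[OF that] dim_iff[OF finite_set sR[OF that] F[OF that], of q] by blast+
  obtain p \<xi>0 where p: "dimRV K {} Q = ereal (real p)" "\<And>\<xi>. \<xi> \<in> Q \<Longrightarrow> rnk cl {} \<xi> \<le> p" "\<xi>0 \<in> Q" "rnk cl {} \<xi>0 = p"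
    using dim_ex[OF finite.emptyI empty_subsetI Q False] by metis
  obtain \<eta>0 where e0: "\<eta>0 \<in> F \<xi>0" "rnk cl (set \<xi>0) \<eta>0 = q" using d'(2)[OF p(3)] by blast
  have "dimRV K {} {\<xi> @ \<eta> | \<xi> \<eta>. \<xi> \<in> Q \<and> \<eta> \<in> F \<xi>} = ereal (real (p + q))"
  proof (rule dim_eqI[OF finite.emptyI empty_subsetI])
    show "{\<xi> @ \<eta> | \<xi> \<eta>. \<xi> \<in> Q \<and> \<eta> \<in> F \<xi>} \<subseteq> RVx_pow K (n + n')"
    proof
      fix a assume "a \<in> {\<xi> @ \<eta> | \<xi> \<eta>. \<xi> \<in> Q \<and> \<eta> \<in> F \<xi>}"
      then obtain \<xi> \<eta> where h: "a = \<xi> @ \<eta>" "\<xi> \<in> Q" "\<eta> \<in> F \<xi>" by blast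
      then have "\<xi> \<in> RVx_pow K n" "\<eta> \<in> RVx_pow K n'" using Q F by blast+
      then show "a \<in> RVx_pow K (n + n')" using h(1) by (simp add: RVx_pow_iff)
    qed
    show "rnk cl {} a \<le> p + q" if h0: "a \<in> {\<xi> @ \<eta> | \<xi> \<eta>. \<xi> \<in> Q \<and> \<eta> \<in> F \<xi>}" for a
    proof -
      obtain \<xi> \<eta> where h: "a = \<xi> @ \<eta>" "\<xi> \<in> Q" "\<eta> \<in> F \<xi>" using h0 by blast
      then show ?thesis using p(2)[OF h(2)] d'(1)[OF h(2,3)] by (simp add: rnk_append)
    qed
    show "\<xi>0 @ \<eta>0 \<in> {\<xi> @ \<eta> | \<xi> \<eta>. \<xi> \<in> Q \<and> \<eta> \<in> F \<xi>}" using p(3) e0(1) by blast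
    show "rnk cl {} (\<xi>0 @ \<eta>0) = p + q" using p(4) e0(2) by (simp add: rnk_append)
  qed
  then show ?thesis using p(1) by simp
qed

lemma dim_image:
  assumes "X \<subseteq> RVx_pow K n" "g ` X \<subseteq> RVx_pow K m" "\<And>x. x \<in> X \<Longrightarrow> rnk cl {} (g x) = rnk cl {} x"
  shows "dimRV K {} (g ` X) = dimRV K {} X"
  unfolding dim_rnk[OF finite.emptyI empty_subsetI assms(1)] dim_rnk[OF finite.emptyI empty_subsetI assms(2)]
  using assms(3) by (simp add: image_image)

lemma dim_image_le:
  assumes "X \<subseteq> RVx_pow K n" "g ` X \<subseteq> RVx_pow K m" "\<And>x. x \<in> X \<Longrightarrow> rnk cl {} (g x) \<le> rnk cl {} x"
  shows "dimRV K {} (g ` X) \<le> dimRV K {} X"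
  unfolding dim_rnk[OF finite.emptyI empty_subsetI assms(1)] dim_rnk[OF finite.emptyI empty_subsetI assms(2)] image_image
  by (rule SUP_mono) (use assms(3) in force)

end

context smodel
begin

section \<open>Rank in the fibres of a definable set\<close>

lemma RD_inff_pow: assumes "RD (m + q) Y" shows "j \<le> q \<Longrightarrow> RD (m + (q - j)) ((inff ^^ j) Y)"
proof (induction j)
  case 0
  then show ?case using assms by simp
next
  case (Suc j)
  then have "RD (Suc (m + (q - Suc j))) ((inff ^^ j) Y)" by (simp add: Suc_diff_Suc)
  from RD_inff[OF this] show ?case by simp
qed

text \<open>One iterated \<open>inff\<close> for each choice of \<open>q\<close> fibre coordinates;
  this is the first-order form of having a tuple of rank at least \<open>q\<close> in the
  fibre.\<close>

definition rank_ge :: "nat \<Rightarrow> nat \<Rightarrow> 'a imag list set \<Rightarrow> nat \<Rightarrow> 'a imag list set" where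
  "rank_ge m n G q = (\<Union>I\<in>{I. I \<subseteq> {..<n} \<and> card I = q}. (inff ^^ q) ((\<lambda>x. nths x (coords m I)) ` G))"

lemma RD_rank_ge: assumes "RD (m + n) G" shows "RD m (rank_ge m n G q)"
  unfolding rank_ge_def
proof (rule RD_UN)
  have "{I. I \<subseteq> {..<n} \<and> card I = q} \<subseteq> Pow {..<n}" by blast
  then show "finite {I. I \<subseteq> {..<n} \<and> card I = q}" by (rule finite_subset) simp
  fix I assume "I \<in> {I. I \<subseteq> {..<n} \<and> card I = q}"
  then have I: "I \<subseteq> {..<n}" "card I = q" by blast+
  have "RD (m + q) ((\<lambda>x. nths x (coords m I)) ` G)" using RD_coords[OF assms I(1)] I(2) by simp
  from RD_inff_pow[OF this, of q] show "RD m ((inff ^^ q) ((\<lambda>x. nths x (coords m I)) ` G))" by simp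
qed

text \<open>The set on the left does not mention \<open>B\<close>: by \<open>generic_tuple\<close>
  the rank condition has the same meaning over every finite set of additional parameters.\<close>

lemma rank_ge_iff:
  assumes G: "RD (m + n) G" and x: "\<xi> \<in> RVx_pow K m" and B: "finite B" "B \<subseteq> RVx K"
  shows "\<xi> \<in> rank_ge m n G q \<longleftrightarrow> (\<exists>\<eta>. \<xi> @ \<eta> \<in> G \<and> q \<le> rnk cl (set \<xi> \<union> B) \<eta>)"
proof -
  have l: "length \<xi> = m" "set \<xi> \<subseteq> RVx K" using x by (simp_all add: RVx_pow_iff)
  have P: "finite (set \<xi> \<union> B)" "set \<xi> \<union> B \<subseteq> RVx K" using l B by simp_all
  have "\<xi> \<in> (inff ^^ q) ((\<lambda>x. nths x (coords m I)) ` G) \<longleftrightarrow> (\<exists>\<eta>. \<xi> @ \<eta> \<in> G \<and> indl cl (set \<xi> \<union> B) (nths \<eta> I))"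
    if I: "I \<subseteq> {..<n}" "card I = q" for I
  proof -
    have Y: "RD (m + q) ((\<lambda>x. nths x (coords m I)) ` G)" using RD_coords[OF G I(1)] I(2) by simp
    have len: "length (nths \<eta> I) = q" if "\<xi> @ \<eta> \<in> G" for \<eta>
      using RD_mem[OF G that] l(1) length_nths_card[of I \<eta>] I by simp
    have "\<xi> \<in> (inff ^^ q) ((\<lambda>x. nths x (coords m I)) ` G) \<longleftrightarrow>
        (\<exists>a. length a = q \<and> \<xi> @ a \<in> (\<lambda>x. nths x (coords m I)) ` G \<and> indl cl (pt ` {} \<union> set \<xi> \<union> B) a)"
      by (rule generic_tuple[OF sat empty_subsetI x B RD_inff_pow[OF Y]])
    then show ?thesis unfolding coords_mem[OF G l(1)] using len by auto
  qed
  then have "\<xi> \<in> rank_ge m n G q \<longleftrightarrow> (\<exists>I. I \<subseteq> {..<n} \<and> card I = q \<and> (\<exists>\<eta>. \<xi> @ \<eta> \<in> G \<and> indl cl (set \<xi> \<union> B) (nths \<eta> I)))"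
    unfolding rank_ge_def by blast
  also have "\<dots> \<longleftrightarrow> (\<exists>\<eta>. \<xi> @ \<eta> \<in> G \<and> (\<exists>I. I \<subseteq> {..<n} \<and> card I = q \<and> indl cl (set \<xi> \<union> B) (nths \<eta> I)))" by blast
  also have "\<dots> \<longleftrightarrow> (\<exists>\<eta>. \<xi> @ \<eta> \<in> G \<and> q \<le> rnk cl (set \<xi> \<union> B) \<eta>)"
  proof -
    have "q \<le> rnk cl (set \<xi> \<union> B) \<eta> \<longleftrightarrow> (\<exists>I. I \<subseteq> {..<n} \<and> card I = q \<and> indl cl (set \<xi> \<union> B) (nths \<eta> I))" if "\<xi> @ \<eta> \<in> G" for \<eta>
    proof -
      have "length \<eta> = n" "set \<eta> \<subseteq> RVx K" using RD_mem[OF G that] l(1) by simp_all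
      then show ?thesis using rnk_ge_iff[OF P, of \<eta> q] by simp
    qed
    then show ?thesis by blast
  qed
  finally show ?thesis .
qed

text \<open>Comparison of \<open>rank_ge_iff\<close> over no and over additional parameters: the
  tuple may change, but the rank does not drop.\<close>

lemma rank_generic:
  assumes G: "RD (m + n) G" and x: "\<xi> \<in> RVx_pow K m" and \<eta>: "\<xi> @ \<eta> \<in> G" and B: "finite B" "B \<subseteq> RVx K"
  shows "\<exists>\<eta>'. \<xi> @ \<eta>' \<in> G \<and> rnk cl (set \<xi>) \<eta> \<le> rnk cl (set \<xi> \<union> B) \<eta>'"
proof -
  have "\<xi> \<in> rank_ge m n G (rnk cl (set \<xi>) \<eta>)"
    unfolding rank_ge_iff[OF G x finite.emptyI empty_subsetI] using \<eta> by auto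
  then show ?thesis unfolding rank_ge_iff[OF G x B] .
qed

lemma dim_pos_iff: assumes R: "RD n R" shows "dimRV K {} R > 0 \<longleftrightarrow> infinite R"
proof (cases "R = {}")
  case True
  then show ?thesis by (simp add: dimRV_empty)
next
  case False
  have RS: "R \<subseteq> RVx_pow K n" using R unfolding RD_def by blast
  obtain q a0 where q: "dimRV K {} R = ereal (real q)" "\<And>a. a \<in> R \<Longrightarrow> rnk cl {} a \<le> q" "a0 \<in> R" "rnk cl {} a0 = q"
    using dim_ex[OF finite.emptyI empty_subsetI RS False] by metis
  have R0: "RD (0 + n) R" using R by simp
  have e: "[] \<in> RVx_pow K 0" by (simp add: RVx_pow_iff)
  have "q > 0 \<longleftrightarrow> infinite R"
  proof
    assume q0: "q > 0"
    show "infinite R"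
    proof
      assume "finite R"
      then have "set a0 \<subseteq> cl (set [])" using finite_fibre_cl[OF R0, of "[]" a0] q(3) by simp
      then have "rnk cl {} a0 = 0" using cop.rnk_zero by simp
      then show False using q0 q(4) by simp
    qed
  next
    assume inf: "infinite R"
    \<comment> \<open>Infinitely many tuples of fixed length need a coordinate with infinitely many
      values; a generic value there gives positive rank.\<close>
    obtain i where i: "i < n" "infinite ((\<lambda>x. x ! i) ` R)"
    proof (rule ccontr)
      assume "\<not> thesis"
      then have f: "finite (\<Union>i<n. (\<lambda>x. x ! i) ` R)" using that by blast
      have "R \<subseteq> {l. set l \<subseteq> (\<Union>i<n. (\<lambda>x. x ! i) ` R) \<and> length l = n}"
      proof
        fix x assume x: "x \<in> R"
        then have len: "length x = n" using RD_mem[OF R] by blast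
        have "set x \<subseteq> (\<Union>i<n. (\<lambda>x. x ! i) ` R)"
        proof
          fix z assume "z \<in> set x"
          then obtain j where j: "j < n" "z = x ! j" using len by (auto simp: in_set_conv_nth)
          have "x ! j \<in> (\<lambda>x. x ! j) ` R" using x by (rule imageI)
          then show "z \<in> (\<Union>i<n. (\<lambda>x. x ! i) ` R)" unfolding j(2) using j(1) by (intro UN_I[of j]) simp_all
        qed
        then show "x \<in> {l. set l \<subseteq> (\<Union>i<n. (\<lambda>x. x ! i) ` R) \<and> length l = n}" using len by blast
      qed
      then show False using inf finite_lists_length_eq[OF f, of n] finite_subset by blast
    qed
    have "fib ((\<lambda>x. nths x (coords 0 {i})) ` R) [] = (\<lambda>x. x ! i) ` R" using RD_coord(2)[OF R0 i(1), of "[]"] by simp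
    then have f: "infinite (fib ((\<lambda>x. nths x (coords 0 {i})) ` R) [])" "fib ((\<lambda>x. nths x (coords 0 {i})) ` R) [] = (\<lambda>x. x ! i) ` R"
      using i(2) by simp_all
    obtain \<xi> where "\<xi> \<in> fib ((\<lambda>x. nths x (coords 0 {i})) ` R) []" "\<xi> \<notin> cl (set [] \<union> {})"
      by (rule generic_fib[OF RD_coord(1)[OF R0 i(1)] e f(1) finite.emptyI empty_subsetI])
    then have x: "\<xi> \<in> (\<lambda>x. x ! i) ` R" "\<xi> \<notin> cl {}" unfolding f(2) by simp_all
    then obtain a where a: "a \<in> R" "\<xi> = a ! i" by blast
    have aR: "length a = n" "set a \<subseteq> RVx K" using RD_mem[OF R a(1)] by blast+
    have "rnk cl {} a \<noteq> 0"
    proof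
      assume "rnk cl {} a = 0"
      then have "set a \<subseteq> cl {}" using rnk_zero_iff[of "{}" a] aR by simp
      moreover have "a ! i \<in> set a" using aR(1) i(1) by simp
      ultimately show False using x(2) a(2) by blast
    qed
    then show "q > 0" using q(2)[OF a(1)] by simp
  qed
  then show ?thesis using q(1) by (simp add: zero_ereal_def)
qed

text \<open>The neighbourhood of \<open>a\<close> is cut out by the formulas that make its
  coordinates algebraic over a basis. Their fibres are finite over every base, so the projection is
  finite-to-one on the whole piece.\<close>

lemma finite_to_one_piece:
  assumes a: "a \<in> RVx_pow K n" and d: "rnk cl {} a \<le> d" "d \<le> n"
  shows "\<exists>X. RD n X \<and> a \<in> X \<and> (\<exists>I. I \<subseteq> {..<n} \<and> card I = d \<and> (\<forall>\<eta>. finite {x \<in> X. nths x I = \<eta>}))"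
proof -
  have aR: "length a = n" "set a \<subseteq> RVx K" using a by (simp_all add: RVx_pow_iff)
  obtain J where J: "J \<subseteq> {..<n}" "card J = rnk cl {} a" "set a \<subseteq> cl ({} \<union> set (nths a J))"
    using cop.basis_nths[OF aR(2), of "{}"] aR(1) by metis
  \<comment> \<open>The projection must have exactly \<open>d\<close> coordinates also at points of
    smaller rank, so the basis is filled up arbitrarily.\<close>
  obtain I where I: "J \<subseteq> I" "I \<subseteq> {..<n}" "card I = d"
    using exists_subset_between[of J d "{..<n}"] J(1,2) d by auto
  have sub: "set (nths a J) \<subseteq> set (nths a I)" using I(1) by (auto simp: set_nths)
  have "set a \<subseteq> cl (set (nths a I))" using J(3) cl_mono[OF sub] by auto
  then have ai: "a ! i \<in> cl (set (nths a I))" if "i < n" for i using that aR(1) nth_mem[of i a] by blast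
  have nI: "nths a I \<in> RVx_pow K d" using nths_RVx_pow[OF a I(2)] I(3) by simp
  have "\<forall>i\<in>{..<n}. \<exists>Z. RD (Suc d) Z \<and> nths a I @ [a ! i] \<in> Z \<and> (\<forall>\<zeta>'\<in>RVx_pow K d. finite {\<xi>. \<zeta>' @ [\<xi>] \<in> Z})"
    using cl_fibreE[OF nI ai] by blast
  from bchoice[OF this] obtain Z where Z: "\<And>i. i < n \<Longrightarrow> RD (Suc d) (Z i)" "\<And>i. i < n \<Longrightarrow> nths a I @ [a ! i] \<in> Z i"
    "\<And>i \<zeta>'. i < n \<Longrightarrow> \<zeta>' \<in> RVx_pow K d \<Longrightarrow> finite {\<xi>. \<zeta>' @ [\<xi>] \<in> Z i}" by auto
  define P where "P = (\<lambda>x. \<forall>i<n. nths x I @ [x ! i] \<in> Z i)"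
  define X where "X = {x \<in> RVx_pow K n. P x}"
  have "RD n X"
  proof (rule RDI[where P = P])
    have "RTmL (Suc d) (\<lambda>e. nths (map (rv K) (map e [0..<n])) I @ [map (rv K) (map e [0..<n]) ! i])" if "i < n" for i
      by (rule RTmL_append[OF RTmL_nths[OF RTmL_rv I(2) refl] RTmL_Cons[OF RTm_nth[OF RTmL_rv that] RTmL_Nil[OF refl] refl]])
         (simp add: I(3))
    then show "Def (\<lambda>e. P (map (rv K) (map e [0..<n])))" unfolding P_def
      by (intro Def_finite_all Def_RD[OF Z(1)])
  qed (auto simp: X_def)
  moreover have "a \<in> X" unfolding X_def P_def using a Z(2) by blast
  moreover have "finite {x \<in> X. nths x I = \<eta>}" for \<eta>
  proof (cases "\<eta> \<in> RVx_pow K d")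
    case True
    let ?U = "\<Union>i<n. {\<xi>. \<eta> @ [\<xi>] \<in> Z i}"
    have "finite ?U" using Z(3)[OF _ True] by blast
    moreover have "{x \<in> X. nths x I = \<eta>} \<subseteq> {l. set l \<subseteq> ?U \<and> length l = n}"
    proof
      fix x assume "x \<in> {x \<in> X. nths x I = \<eta>}"
      then have x: "length x = n" "P x" "nths x I = \<eta>" unfolding X_def by (auto simp: RVx_pow_iff)
      have "set x \<subseteq> ?U"
      proof
        fix z assume "z \<in> set x"
        then obtain j where j: "j < n" "z = x ! j" using x(1) by (auto simp: in_set_conv_nth)
        then have "z \<in> {\<xi>. \<eta> @ [\<xi>] \<in> Z j}" using x(2,3) unfolding P_def by simp
        then show "z \<in> ?U" by (intro UN_I[of j]) (simp_all add: j(1))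
      qed
      then show "x \<in> {l. set l \<subseteq> ?U \<and> length l = n}" using x(1) by blast
    qed
    ultimately show ?thesis using finite_lists_length_eq[of ?U n] finite_subset by blast
  next
    case False
    have "nths x I \<in> RVx_pow K d" if "x \<in> X" for x
      using nths_RVx_pow[OF _ I(2), of x] that I(3) unfolding X_def by simp
    then have e: "{x \<in> X. nths x I = \<eta>} = {}" using False by blast
    show ?thesis unfolding e by (rule finite.emptyI)
  qed
  ultimately show ?thesis using I by blast
qed

lemma RD_refine_partition:
  assumes "finite \<F>" "\<And>X. X \<in> \<F> \<Longrightarrow> RD n X"
  shows "\<exists>\<P>. finite \<P> \<and> partition_on (\<Union>\<F>) \<P> \<and> (\<forall>Q\<in>\<P>. RD n Q \<and> (\<exists>X\<in>\<F>. Q \<subseteq> X))"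
  using assms
proof (induction \<F> rule: finite_induct)
  case empty
  then show ?case by (intro exI[of _ "{}"]) (simp add: partition_on_def)
next
  case (insert X \<F>)
  have hX: "RD n X" by (rule insert.prems) simp
  have hF: "RD n Y" if "Y \<in> \<F>" for Y by (rule insert.prems) (simp add: that)
  have ih: "\<exists>\<P>. finite \<P> \<and> partition_on (\<Union>\<F>) \<P> \<and> (\<forall>Q\<in>\<P>. RD n Q \<and> (\<exists>X\<in>\<F>. Q \<subseteq> X))"
    by (rule insert.IH[OF hF])
  obtain \<P> where P: "finite \<P>" "partition_on (\<Union>\<F>) \<P>" "\<And>Q. Q \<in> \<P> \<Longrightarrow> RD n Q \<and> (\<exists>X\<in>\<F>. Q \<subseteq> X)"
    using ih by blast
  define D where "D = X - \<Union>\<F>"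
  have UD: "RD n (\<Union>\<F>)" using RD_UN[of \<F> n "\<lambda>x. x", OF insert.hyps(1) hF] by simp
  have D: "RD n D" unfolding D_def by (rule RD_Diff[OF hX UD])
  have PU: "\<Union>\<P> = \<Union>\<F>" by (rule partition_onD1[OF P(2), symmetric])
  have old: "RD n Q \<and> (\<exists>Y\<in>insert X \<F>. Q \<subseteq> Y)" if Q: "Q \<in> \<P>" for Q
  proof -
    obtain Y where "Y \<in> \<F>" "Q \<subseteq> Y" using P(3)[OF Q] by blast
    then show ?thesis using P(3)[OF Q] by (intro conjI bexI[of _ Y]) simp_all
  qed
  show ?case
  proof (cases "D = {}")
    case True
    then have e: "\<Union>(insert X \<F>) = \<Union>\<F>" unfolding D_def by blast
    show ?thesis unfolding e by (rule exI[of _ \<P>]) (intro conjI ballI, fact P(1), fact P(2), use old in simp_all)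
  next
    case False
    have "disjnt D (\<Union>\<P>)" unfolding PU D_def disjnt_def by blast
    moreover have "\<Union>(insert X \<F>) - D = \<Union>\<F>" "D \<subseteq> \<Union>(insert X \<F>)" unfolding D_def by blast+
    ultimately have "partition_on (\<Union>(insert X \<F>)) (insert D \<P>)" using P(2) False by (simp add: partition_on_insert)
    moreover have "RD n D \<and> (\<exists>Y\<in>insert X \<F>. D \<subseteq> Y)"
      by (intro conjI D bexI[of _ X]) (simp_all add: D_def)
    ultimately show ?thesis using P(1) old by (intro exI[of _ "insert D \<P>"] conjI) simp_all
  qed
qed

text \<open>The pieces around the points of \<open>R\<close> cover it; saturation leaves finitely
  many, and making them disjoint keeps projections finite-to-one.\<close>

lemma finite_to_one_partition:
  assumes R: "RD n R"
  shows "\<exists>\<P>. finite \<P> \<and> partition_on R \<P> \<and>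
    (\<forall>Q\<in>\<P>. RD n Q \<and> (\<exists>I. I \<subseteq> {..<n} \<and> ereal (real (card I)) = dimRV K {} R \<and> (\<forall>\<eta>. finite {\<xi> \<in> Q. nths \<xi> I = \<eta>})))"
proof (cases "R = {}")
  case True
  then show ?thesis by (intro exI[of _ "{}"]) (simp add: partition_on_def)
next
  case False
  have RS: "R \<subseteq> RVx_pow K n" using R unfolding RD_def by blast
  obtain d a0 where d: "d \<le> n" "dimRV K {} R = ereal (real d)" "\<And>a. a \<in> R \<Longrightarrow> rnk cl {} a \<le> d"
    using dim_ex[OF finite.emptyI empty_subsetI RS False] by metis
  define \<X> where "\<X> = {X. RD n X \<and> (\<exists>I. I \<subseteq> {..<n} \<and> card I = d \<and> (\<forall>\<eta>. finite {x \<in> X. nths x I = \<eta>}))}"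
  have cov: "R \<subseteq> \<Union>\<X>"
  proof
    fix a assume a: "a \<in> R"
    then have "a \<in> RVx_pow K n" using RS by blast
    from finite_to_one_piece[OF this d(3)[OF a] d(1)]
    obtain X I where X: "RD n X" "a \<in> X" "I \<subseteq> {..<n}" "card I = d" "\<forall>\<eta>. finite {x \<in> X. nths x I = \<eta>}" by (elim exE conjE)
    show "a \<in> \<Union>\<X>" unfolding \<X>_def by (intro UnionI[of X] CollectI conjI exI[of _ I] X)
  qed
  have XD: "RD n X" if "X \<in> \<X>" for X using that unfolding \<X>_def by (elim CollectE conjE)
  have "\<exists>\<F>. finite \<F> \<and> \<F> \<subseteq> \<X> \<and> R \<subseteq> \<Union>\<F>" by (rule compact_cover[OF sat R XD cov])
  then obtain \<F> where F: "finite \<F>" "\<F> \<subseteq> \<X>" "R \<subseteq> \<Union>\<F>" by (elim exE conjE)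
  let ?F = "(\<lambda>X. R \<inter> X) ` \<F>"
  have FD: "RD n Y" if Y: "Y \<in> ?F" for Y
  proof -
    obtain X where "X \<in> \<F>" "Y = R \<inter> X" using Y by blast
    then show ?thesis using RD_Int[OF R XD[OF subsetD[OF F(2)]]] by simp
  qed
  have "\<exists>\<P>. finite \<P> \<and> partition_on (\<Union>?F) \<P> \<and> (\<forall>Q\<in>\<P>. RD n Q \<and> (\<exists>X\<in>?F. Q \<subseteq> X))"
    by (rule RD_refine_partition[OF finite_imageI[OF F(1)] FD])
  then obtain \<P> where P': "finite \<P>" "partition_on (\<Union>?F) \<P>" "\<forall>Q\<in>\<P>. RD n Q \<and> (\<exists>X\<in>?F. Q \<subseteq> X)" by (elim exE conjE)
  have U: "\<Union>?F = R" using F(3) by blast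
  note P = P'(1) P'(2)[unfolded U] bspec[OF P'(3)]
  have "\<exists>I. I \<subseteq> {..<n} \<and> ereal (real (card I)) = dimRV K {} R \<and> (\<forall>\<eta>. finite {\<xi> \<in> Q. nths \<xi> I = \<eta>})" if Q: "Q \<in> \<P>" for Q
  proof -
    obtain X where X: "X \<in> \<F>" "Q \<subseteq> X" using P(3)[OF Q] by blast
    have "X \<in> \<X>" using F(2) X(1) by (rule subsetD)
    then obtain I where I: "I \<subseteq> {..<n}" "card I = d" "\<forall>\<eta>. finite {x \<in> X. nths x I = \<eta>}" unfolding \<X>_def by (elim CollectE exE conjE)
    have "finite {\<xi> \<in> Q. nths \<xi> I = \<eta>}" for \<eta> by (rule finite_subset[OF _ spec[OF I(3), of \<eta>]]) (use X(2) in blast)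
    then show ?thesis using I(1,2) d(2) by (intro exI[of _ I]) simp
  qed
  then show ?thesis using P(3) by (intro exI[of _ \<P>] conjI ballI P(1,2)) simp_all
qed

text \<open>Provides names for the cosets of the entries of \<open>\<theta>\<close> that are
  independent over given parameters; each name is a generic element of its coset.\<close>

lemma generic_shift:
  assumes "set \<theta> \<subseteq> RVx K" "finite B" "B \<subseteq> RVx K"
  shows "\<exists>x. list_all2 (\<lambda>t x. [t, x] \<in> vpairs) \<theta> x \<and> indl cl B x \<and> set x \<subseteq> RVx K"
  using assms
proof (induction \<theta> arbitrary: B)
  case Nil
  then show ?case by (intro exI[of _ "[]"]) simp
next
  case (Cons t \<theta>)
  obtain u where u: "u \<in> carrier K" "u \<noteq> \<zero>" "t = rv K u" using Cons.prems(1) unfolding RVx_def by auto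
  have V: "RD (Suc 1) vpairs" using RD_vpairs by (simp add: numeral_2_eq_2)
  have tR: "[t] \<in> RVx_pow K 1" using Cons.prems(1) by (simp add: RVx_pow_iff)
  have inf: "infinite (fib vpairs [t])" using veq_fibre_infinite[OF u(1,2)] u(3) by simp
  obtain y where y: "y \<in> fib vpairs [t]" "y \<notin> cl (set [t] \<union> B)" by (rule generic_fib[OF V tR inf Cons.prems(2,3)])
  have yR: "y \<in> RVx K" using fib_RVx[OF V y(1)] by blast
  obtain x where x: "list_all2 (\<lambda>t x. [t, x] \<in> vpairs) \<theta> x" "indl cl (insert y B) x" "set x \<subseteq> RVx K"
    using Cons.IH[of "insert y B"] Cons.prems yR by auto
  have "y \<notin> cl B" using y(2) cl_mono[of B "set [t] \<union> B"] by blast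
  then show ?case using x y(1) yR by (intro exI[of _ "y # x"]) (simp add: fib_def)
qed

text \<open>The dimension inside the coset of \<open>a\<close> is taken over \<open>a\<close>, over
  which \<open>a\<close> itself has rank zero, so another point of maximal rank must be found there.
  The independent tuple \<open>x\<close> names the coset without lowering the rank of
  \<open>a\<close>.\<close>

lemma dim_coset:
  assumes R: "RD n R" and ne: "R \<noteq> {}"
  shows "\<exists>\<xi>\<in>R. dimRV K (set \<xi>) (R \<inter> kx_coset K \<xi>) = dimRV K {} R"
proof -
  have RS: "R \<subseteq> RVx_pow K n" using R unfolding RD_def by blast
  obtain d a where d: "dimRV K {} R = ereal (real d)" "\<And>b. b \<in> R \<Longrightarrow> rnk cl {} b \<le> d" "a \<in> R" "rnk cl {} a = d"
    using dim_ex[OF finite.emptyI empty_subsetI RS ne] by metis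
  have aR: "length a = n" "set a \<subseteq> RVx K" using RD_mem[OF R d(3)] by blast+
  obtain x where x: "list_all2 (\<lambda>t x. [t, x] \<in> vpairs) a x" "indl cl (set a) x" "set x \<subseteq> RVx K"
    using generic_shift[OF aR(2) finite_set aR(2)] by blast
  have lx: "length x = n" using x(1) aR(1) by (simp add: list_all2_lengthD)
  have xR: "x \<in> RVx_pow K n" using lx x(3) by (simp add: RVx_pow_iff)
  have xa: "[a ! i, x ! i] \<in> vpairs" if "i < n" for i using x(1) that aR(1) by (simp add: list_all2_conv_all_nth)
  \<comment> \<open>Symmetry of rank: \<open>x\<close> adds \<open>n\<close> behind \<open>a\<close>
    and at most \<open>n\<close> in front, so \<open>a\<close> keeps its full rank over
    \<open>x\<close>.\<close>
  have "d + n = rnk cl {} (a @ x)" using d(4) x(2) lx by (simp add: rnk_append indl_rnk)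
  also have "\<dots> = rnk cl {} (x @ a)" using pg.rnk_swap_append[of "{}" a x] aR x(3) by simp
  also have "\<dots> = rnk cl {} x + rnk cl (set x) a" by (simp add: rnk_append)
  also have "\<dots> \<le> n + rnk cl (set x) a" using rnk_le_length[of cl "{}" x] lx by simp
  finally have dx: "d \<le> rnk cl (set x) a" by simp
  have V: "RD 2 vpairs" by (rule RD_vpairs)
  \<comment> \<open>Pairs of a tuple and a point of \<open>R\<close> in the same coset, coordinate
    by coordinate; the fibre over \<open>x\<close> is the part of \<open>R\<close> in the coset of
    \<open>a\<close>.\<close>
  define P where "P = (\<lambda>z::'a imag list. map (\<lambda>i. z ! i) [n..<n + n] \<in> R \<and> (\<forall>i<n. map (\<lambda>j. z ! j) [i, n + i] \<in> vpairs))"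
  define G where "G = {z \<in> RVx_pow K (n + n). P z}"
  have GD: "RD (n + n) G"
  proof (rule RDI[where P = P])
    show "Def (\<lambda>e. P (map (rv K) (map e [0..<n + n])))" unfolding P_def
      by (intro Def_basic Def_finite_all Def_RD[OF R] Def_RD[OF V] RTmL_reindex) auto
  qed (auto simp: G_def)
  have Gi: "x @ y \<in> G \<longleftrightarrow> y \<in> R \<and> (\<forall>i<n. [x ! i, y ! i] \<in> vpairs)" if y: "length y = n" for y
  proof -
    have "map (\<lambda>i. (x @ y) ! i) [n..<n + n] = y" by (rule nth_equalityI) (simp_all add: y lx nth_append)
    moreover have "map (\<lambda>j. (x @ y) ! j) [i, n + i] = [x ! i, y ! i]" if "i < n" for i using that lx by (simp add: nth_append)
    moreover have "x @ y \<in> RVx_pow K (n + n)" if "y \<in> R" using RD_mem[OF R that] lx x(3) by (simp add: RVx_pow_iff)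
    ultimately show ?thesis unfolding G_def P_def by auto
  qed
  have "x @ a \<in> G" unfolding Gi[OF aR(1)] using d(3) xa vpairs_sym by blast
  \<comment> \<open>With \<open>a\<close> as additional parameters, the rank that \<open>a\<close>
    has over \<open>x\<close> is attained by a point \<open>b\<close> of the same fibre.\<close>
  from rank_generic[OF GD xR this finite_set aR(2)]
  obtain b where b: "x @ b \<in> G" "rnk cl (set x) a \<le> rnk cl (set x \<union> set a) b" by blast
  have lb: "length b = n" using RD_mem[OF GD b(1)] lx by simp
  have bR: "b \<in> R" "\<And>i. i < n \<Longrightarrow> [x ! i, b ! i] \<in> vpairs" using b(1) Gi[OF lb] by blast+
  have "b \<in> kx_coset K a" by (rule kx_cosetI[OF aR(1) lb]) (rule vpairs_trans[OF xa bR(2)])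
  moreover have up: "rnk cl (set a) c \<le> d" if "c \<in> R" for c
    using cop.rnk_anti[of "{}" "set a" c] d(2)[OF that] by simp
  moreover have "rnk cl (set a) b = d"
    using up[OF bR(1)] dx b(2) cop.rnk_anti[of "set a" "set x \<union> set a" b] by simp
  ultimately have "dimRV K (set a) (R \<inter> kx_coset K a) = ereal (real d)"
    by (intro dim_eqI[OF finite_set aR(2), where n = n and b = b]) (use RS bR(1) in auto)
  then show ?thesis using d(1,3) by metis
qed

text \<open>More parameters can only lower ranks, and \<open>rank_generic\<close> finds a point that
  retains the maximal one.\<close>

lemma dim_params:
  assumes R: "RD n R" and B: "finite B" "B \<subseteq> RVx K" shows "dimRV K B R = dimRV K {} R"
proof (cases "R = {}")
  case True
  then show ?thesis by (simp add: dimRV_empty)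
next
  case False
  have RS: "R \<subseteq> RVx_pow K n" using R unfolding RD_def by blast
  obtain d a where d: "dimRV K {} R = ereal (real d)" "\<And>b. b \<in> R \<Longrightarrow> rnk cl {} b \<le> d" "a \<in> R" "rnk cl {} a = d"
    using dim_ex[OF finite.emptyI empty_subsetI RS False] by metis
  have R0: "RD (0 + n) R" using R by simp
  have e: "[] \<in> RVx_pow K 0" by (simp add: RVx_pow_iff)
  obtain b where b: "b \<in> R" "d \<le> rnk cl B b" using rank_generic[OF R0 e _ B, of a] d(3,4) by auto
  have up: "rnk cl B c \<le> d" if "c \<in> R" for c using cop.rnk_anti[of "{}" B c] d(2)[OF that] by simp
  have "dimRV K B R = ereal (real d)" by (rule dim_eqI[OF B RS up b(1)]) (use up[OF b(1)] b(2) in simp_all)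
  then show ?thesis using d(1) by simp
qed

lemma dim_product:
  assumes R: "R \<subseteq> RVx_pow K n" and S: "RD m S"
  shows "dimRV K {} {\<xi> @ \<eta> | \<xi> \<eta>. \<xi> \<in> R \<and> \<eta> \<in> S} = dimRV K {} R + dimRV K {} S"
proof (cases "S = {}")
  case True
  \<comment> \<open>In \<open>ereal\<close> the sum of \<open>\<infinity>\<close> and
    \<open>-\<infinity>\<close> is \<open>\<infinity>\<close>, so this value has to be excluded for
    the first summand.\<close>
  have "dimRV K {} R \<noteq> \<infinity>"
  proof (cases "R = {}")
    case False
    then obtain q where "dimRV K {} R = ereal (real q)" using dim_ex[OF finite.emptyI empty_subsetI R] by metis
    then show ?thesis by simp
  qed (simp add: dimRV_empty)
  then show ?thesis using True by (cases "dimRV K {} R") (simp_all add: dimRV_empty)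
next
  case False
  have SS: "S \<subseteq> RVx_pow K m" using S unfolding RD_def by blast
  obtain q where q: "dimRV K {} S = ereal (real q)" using dim_ex[OF finite.emptyI empty_subsetI SS False] by metis
  have "dimRV K (set \<xi>) S = ereal (real q)" if "\<xi> \<in> R" for \<xi>
  proof -
    have "set \<xi> \<subseteq> RVx K" using subsetD[OF R that] by (simp add: RVx_pow_iff)
    then show ?thesis using dim_params[OF S finite_set] q by simp
  qed
  then show ?thesis using dim_fibred[OF R, of "\<lambda>_. S" m q] SS q by simp
qed

text \<open>Dimension \<open>q\<close> means that a tuple of rank at least \<open>q\<close> occurs
  in the fibre and none of rank at least \<open>Suc q\<close>; both conditions are instances of
  \<open>rank_ge\<close>.\<close>

lemma dim_family:
  assumes R: "RD n R" and F: "\<And>\<xi>. \<xi> \<in> R \<Longrightarrow> F \<xi> \<subseteq> RVx_pow K n'"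
    and G: "RD (n + n') {\<xi> @ \<eta> | \<xi> \<eta>. \<xi> \<in> R \<and> \<eta> \<in> F \<xi>}"
  shows "RD n {\<xi> \<in> R. dimRV K (set \<xi>) (F \<xi>) = ereal (real q)}"
proof -
  let ?G = "{\<xi> @ \<eta> | \<xi> \<eta>. \<xi> \<in> R \<and> \<eta> \<in> F \<xi>}"
  have "dimRV K (set \<xi>) (F \<xi>) = ereal (real q) \<longleftrightarrow> \<xi> \<in> rank_ge n n' ?G q - rank_ge n n' ?G (Suc q)" if x: "\<xi> \<in> R" for \<xi>
  proof -
    have xR: "length \<xi> = n" "set \<xi> \<subseteq> RVx K" using RD_mem[OF R x] by blast+
    have xp: "\<xi> \<in> RVx_pow K n" using xR by (simp add: RVx_pow_iff)
    have g: "\<xi> @ \<eta> \<in> ?G \<longleftrightarrow> \<eta> \<in> F \<xi>" for \<eta>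
    proof
      assume "\<xi> @ \<eta> \<in> ?G"
      then obtain \<xi>' \<eta>' where h: "\<xi> @ \<eta> = \<xi>' @ \<eta>'" "\<xi>' \<in> R" "\<eta>' \<in> F \<xi>'" by blast
      have "length \<xi>' = n" using RD_mem[OF R h(2)] by blast
      then show "\<eta> \<in> F \<xi>" using h xR(1) by simp
    qed (use x in blast)
    have r: "\<xi> \<in> rank_ge n n' ?G p \<longleftrightarrow> (\<exists>\<eta>\<in>F \<xi>. p \<le> rnk cl (set \<xi>) \<eta>)" for p
      unfolding rank_ge_iff[OF G xp finite.emptyI empty_subsetI] g by auto
    show ?thesis unfolding dim_iff[OF finite_set xR(2) F[OF x]] Diff_iff r by (metis le_antisym not_less_eq_eq order_refl)
  qed
  then have "{\<xi> \<in> R. dimRV K (set \<xi>) (F \<xi>) = ereal (real q)} = R \<inter> (rank_ge n n' ?G q - rank_ge n n' ?G (Suc q))" by blast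
  then show ?thesis using RD_Int[OF R RD_Diff[OF RD_rank_ge[OF G] RD_rank_ge[OF G]]] by simp
qed

end

section \<open>Properties of dimension, read off from ranks of points and of graphs\<close>

theorem theorem4p9:
  fixes T :: "('f, 'r) fm set"
    and K :: "('a, 'f, 'r) vstr"
    and R S :: "'a imag list set"
    and f :: "'a imag list \<Rightarrow> 'a imag list"
    and n m k :: nat
  assumes hmin: "h_minimal TYPE('a) 1 T"
    and eff: "effective TYPE('a) T"
    and K: "model T K"
    and K_sat: "saturated K {}"
    and R: "R \<subseteq> RVx_pow K n" "definableRV K n {} R"
    and S: "S \<subseteq> RVx_pow K m" "definableRV K m {} S"
    and f: "f ` R \<subseteq> RVx_pow K k" "definableRV K (n + k) {} {\<xi> @ f \<xi> | \<xi>. \<xi> \<in> R}"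
  shows
    \<comment> \<open>(1)\<close>
    "(dimRV K {} R > 0 \<longleftrightarrow> infinite R) \<and>
    \<comment> \<open>(2)\<close>
     (n = m \<longrightarrow> dimRV K {} (R \<union> S) = max (dimRV K {} R) (dimRV K {} S)) \<and>
    \<comment> \<open>(3)\<close>
     (\<exists>\<P>. finite \<P> \<and> partition_on R \<P> \<and>
        (\<forall>Q\<in>\<P>. definableRV K n {} Q \<and>
           (\<exists>I. I \<subseteq> {..<n} \<and> ereal (real (card I)) = dimRV K {} R \<and>
              (\<forall>\<eta>. finite {\<xi> \<in> Q. nths \<xi> I = \<eta>})))) \<and>
    \<comment> \<open>(4)\<close>
     (dimRV K {} R = ereal (real n) \<longleftrightarrow> (\<exists>\<xi>\<in>R. full_dimensional K n \<xi>)) \<and>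
    \<comment> \<open>(5)\<close>
     (\<forall>A (K' :: ('b, 'f, 'r) vstr) h \<phi>.
        A \<subseteq> carrier K \<longrightarrow>
        valued_field K' \<longrightarrow> elementary K (carrier K) h K' \<longrightarrow> saturated K' (h ` A) \<longrightarrow>
        R = {\<xi> \<in> RVx_pow K n. sat_eq K \<phi> \<xi>} \<longrightarrow>
        dimRV K' (pt ` h ` A) {\<xi> \<in> RVx_pow K' n. sat_eq K' \<phi> \<xi>} = dimRV K {} R) \<and>
    \<comment> \<open>(6)\<close>
     (dimRV K {} R \<ge> dimRV K {} (f ` R)) \<and>
    \<comment> \<open>(7)\<close>
     (\<forall>n' (F :: 'a imag list \<Rightarrow> 'a imag list set) (q :: nat).
        (\<forall>\<xi>\<in>R. F \<xi> \<subseteq> RVx_pow K n') \<longrightarrow>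
        definableRV K (n + n') {} {\<xi> @ \<eta> | \<xi> \<eta>. \<xi> \<in> R \<and> \<eta> \<in> F \<xi>} \<longrightarrow>
        q > 0 \<longrightarrow>
        (let Rq = {\<xi> \<in> R. dimRV K (set \<xi>) (F \<xi>) = ereal (real q)}
         in definableRV K n {} Rq \<and>
            dimRV K {} {\<xi> @ \<eta> | \<xi> \<eta>. \<xi> \<in> Rq \<and> \<eta> \<in> F \<xi>} = ereal (real q) + dimRV K {} Rq)) \<and>
    \<comment> \<open>(8)\<close>
     (\<forall>q :: nat.
        (\<forall>\<xi>\<in>f ` R. dimRV K (set \<xi>) {\<zeta> \<in> R. f \<zeta> = \<xi>} = ereal (real q)) \<longrightarrow>
        dimRV K {} R = dimRV K {} (f ` R) + ereal (real q)) \<and>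
    \<comment> \<open>(9)\<close>
     ((\<forall>\<xi>. finite {\<zeta> \<in> R. f \<zeta> = \<xi>}) \<longrightarrow> dimRV K {} R = dimRV K {} (f ` R)) \<and>
    \<comment> \<open>(10)\<close>
     (dimRV K {} {\<xi> @ \<eta> | \<xi> \<eta>. \<xi> \<in> R \<and> \<eta> \<in> S} = dimRV K {} R + dimRV K {} S) \<and>
    \<comment> \<open>(11)\<close>
     (R \<noteq> {} \<longrightarrow> (\<exists>\<xi>\<in>R. dimRV K (set \<xi>) (R \<inter> kx_coset K \<xi>) = dimRV K {} R))"
proof -
  have vfK: "valued_field K" using K unfolding model_def by blast
  interpret smodel K T by unfold_locales (rule vfK hmin eff K K_sat)+
  have RD: "RD n R" and SD: "RD m S" using R S definableRV_RD by blast+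
  let ?Gf = "{\<xi> @ f \<xi> | \<xi>. \<xi> \<in> R}"
  have lR: "length \<xi> = n" "set \<xi> \<subseteq> RVx K" if "\<xi> \<in> R" for \<xi> using RD_mem[OF RD that] by blast+
  have lf: "length (f \<xi>) = k" "set (f \<xi>) \<subseteq> RVx K" if "\<xi> \<in> R" for \<xi>
  proof -
    have "f \<xi> \<in> RVx_pow K k" using f(1) that by blast
    then show "length (f \<xi>) = k" "set (f \<xi>) \<subseteq> RVx K" by (simp_all add: RVx_pow_iff)
  qed
  have GfS: "?Gf \<subseteq> RVx_pow K (n + k)"
  proof
    fix a assume "a \<in> ?Gf"
    then obtain \<xi> where x: "a = \<xi> @ f \<xi>" "\<xi> \<in> R" by blast
    then show "a \<in> RVx_pow K (n + k)" using lR[OF x(2)] lf[OF x(2)] by (simp add: RVx_pow_iff)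
  qed
  have GfD: "RD (n + k) ?Gf" by (rule iffD1[OF definableRV_RD[OF GfS] f(2)])
  have gf: "\<xi> @ \<eta> \<in> ?Gf \<longleftrightarrow> \<xi> \<in> R \<and> \<eta> = f \<xi>" if l: "length \<xi> = n" for \<xi> \<eta>
  proof
    assume "\<xi> @ \<eta> \<in> ?Gf"
    then obtain \<xi>' where x: "\<xi> @ \<eta> = \<xi>' @ f \<xi>'" "\<xi>' \<in> R" by blast
    then show "\<xi> \<in> R \<and> \<eta> = f \<xi>" using l lR(1)[OF x(2)] by simp
  next
    assume "\<xi> \<in> R \<and> \<eta> = f \<xi>"
    then show "\<xi> @ \<eta> \<in> ?Gf" by blast
  qed
  \<comment> \<open>The graph of \<open>f\<close> has a single point over \<open>\<xi>\<close>,
    hence a finite fibre.\<close>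
  have fcl: "set (f \<xi>) \<subseteq> cl (set \<xi>)" if "\<xi> \<in> R" for \<xi>
  proof (rule finite_fibre_cl[OF GfD lR(1)[OF that]])
    have e: "{\<eta>. \<xi> @ \<eta> \<in> ?Gf} = {f \<xi>}" unfolding gf[OF lR(1)[OF that]] using that by simp
    show "\<xi> @ f \<xi> \<in> ?Gf" using that by blast
    show "finite {\<eta>. \<xi> @ \<eta> \<in> ?Gf}" unfolding e by simp
  qed
  have 6: "dimRV K {} (f ` R) \<le> dimRV K {} R"
    by (rule dim_image_le[OF R(1) f(1)], rule pg.rnk_le) (use lR lf fcl in simp_all)
  have 4: "dimRV K {} R = ereal (real n) \<longleftrightarrow> (\<exists>\<xi>\<in>R. full_dimensional K n \<xi>)"
  proof -
    have "rnk cl {} \<xi> = n \<longleftrightarrow> full_dimensional K n \<xi>" if "\<xi> \<in> R" for \<xi>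
      unfolding full_dimensional_iff[OF subsetD[OF R(1) that]] indl_rnk lR(1)[OF that] ..
    then have b: "(\<exists>\<xi>\<in>R. rnk cl {} \<xi> = n) \<longleftrightarrow> (\<exists>\<xi>\<in>R. full_dimensional K n \<xi>)" by (rule bex_cong[OF refl])
    have "\<forall>\<xi>\<in>R. rnk cl {} \<xi> \<le> n" using rnk_le_length[of cl "{}"] lR(1) by (intro ballI) metis
    then show ?thesis unfolding dim_iff[OF finite.emptyI empty_subsetI R(1)] b by blast
  qed
  have 5: "dimRV K' (pt ` h ` A) {\<xi> \<in> RVx_pow K' n. sat_eq K' \<phi> \<xi>} = dimRV K {} R"
    if h: "A \<subseteq> carrier K" "valued_field K'" "elementary K (carrier K) h K'" "saturated K' (h ` A)"
      "R = {\<xi> \<in> RVx_pow K n. sat_eq K \<phi> \<xi>}" for A and K' :: "('b, 'f, 'r) vstr" and h \<phi>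
  proof -
    \<comment> \<open>An elementary embedding preserves in particular formulas at the empty
      tuple.\<close>
    have ee: "sat K \<phi> [] \<longleftrightarrow> sat K' \<phi> []" for \<phi>
      using h(3)[unfolded elementary_def, THEN conjunct2, rule_format, of "[]" \<phi>] by simp
    interpret p: spair K T K' by unfold_locales (rule h(2) ee)+
    have "h ` A \<subseteq> carrier K'" using h(1,3) unfolding elementary_def by blast
    then show ?thesis unfolding h(5) by (rule p.dim_transfer[OF p.RD2_sat_eq _ h(4)])
  qed
  have 7: "definableRV K n {} {\<xi> \<in> R. dimRV K (set \<xi>) (F \<xi>) = ereal (real q)} \<and>
      dimRV K {} {\<xi> @ \<eta> | \<xi> \<eta>. \<xi> \<in> {\<xi> \<in> R. dimRV K (set \<xi>) (F \<xi>) = ereal (real q)} \<and> \<eta> \<in> F \<xi>} =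
      ereal (real q) + dimRV K {} {\<xi> \<in> R. dimRV K (set \<xi>) (F \<xi>) = ereal (real q)}"
    if F: "\<forall>\<xi>\<in>R. F \<xi> \<subseteq> RVx_pow K n'" "definableRV K (n + n') {} {\<xi> @ \<eta> | \<xi> \<eta>. \<xi> \<in> R \<and> \<eta> \<in> F \<xi>}"
    for n' and F :: "'a imag list \<Rightarrow> 'a imag list set" and q :: nat
  proof -
    let ?G = "{\<xi> @ \<eta> | \<xi> \<eta>. \<xi> \<in> R \<and> \<eta> \<in> F \<xi>}"
    let ?Rq = "{\<xi> \<in> R. dimRV K (set \<xi>) (F \<xi>) = ereal (real q)}"
    have "?G \<subseteq> RVx_pow K (n + n')"
    proof
      fix a assume "a \<in> ?G"
      then obtain \<xi> \<eta> where h: "a = \<xi> @ \<eta>" "\<xi> \<in> R" "\<eta> \<in> F \<xi>" by blast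
      then have "\<eta> \<in> RVx_pow K n'" using F(1) by blast
      then show "a \<in> RVx_pow K (n + n')" using h(1) lR[OF h(2)] by (simp add: RVx_pow_iff)
    qed
    then have "RD (n + n') ?G" using F(2) definableRV_RD by blast
    then have "RD n ?Rq" by (rule dim_family[OF RD, rotated]) (use F(1) in blast)
    moreover have sub: "?Rq \<subseteq> RVx_pow K n" using R(1) by blast
    ultimately have "definableRV K n {} ?Rq" using definableRV_RD by blast
    moreover have "dimRV K {} {\<xi> @ \<eta> | \<xi> \<eta>. \<xi> \<in> ?Rq \<and> \<eta> \<in> F \<xi>} = dimRV K {} ?Rq + ereal (real q)"
      by (rule dim_fibred[OF sub]) (use F(1) in blast)+
    ultimately show ?thesis by (simp only: add.commute)
  qed
  have 8: "dimRV K {} R = dimRV K {} (f ` R) + ereal (real q)"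
    if q: "\<forall>\<xi>\<in>f ` R. dimRV K (set \<xi>) {\<zeta> \<in> R. f \<zeta> = \<xi>} = ereal (real q)" for q :: nat
  proof -
    \<comment> \<open>Written with the value first, the graph fibres \<open>R\<close> over its
      image, and its fibres are those of \<open>f\<close>; additivity applies to it.\<close>
    have e: "{\<xi> @ \<eta> | \<xi> \<eta>. \<xi> \<in> f ` R \<and> \<eta> \<in> {\<zeta> \<in> R. f \<zeta> = \<xi>}} = (\<lambda>\<zeta>. f \<zeta> @ \<zeta>) ` R" (is "?L = ?I")
    proof (intro equalityI subsetI)
      fix a assume "a \<in> ?L"
      then obtain \<xi> \<eta> where "a = \<xi> @ \<eta>" "\<eta> \<in> R" "f \<eta> = \<xi>" by blast
      then show "a \<in> ?I" by (intro image_eqI[of _ _ \<eta>]) simp_all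
    next
      fix a assume "a \<in> ?I"
      then obtain \<zeta> where "a = f \<zeta> @ \<zeta>" "\<zeta> \<in> R" by (rule imageE)
      then show "a \<in> ?L" by (intro CollectI exI[of _ "f \<zeta>"] exI[of _ \<zeta>]) simp
    qed
    have "dimRV K {} {\<xi> @ \<eta> | \<xi> \<eta>. \<xi> \<in> f ` R \<and> \<eta> \<in> {\<zeta> \<in> R. f \<zeta> = \<xi>}} = dimRV K {} (f ` R) + ereal (real q)"
    proof (rule dim_fibred[OF f(1)])
      show "{\<zeta> \<in> R. f \<zeta> = \<xi>} \<subseteq> RVx_pow K n" for \<xi> using R(1) by blast
    qed (rule bspec[OF q])
    moreover have "dimRV K {} ((\<lambda>\<zeta>. f \<zeta> @ \<zeta>) ` R) = dimRV K {} R"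
    proof (rule dim_image[OF R(1)])
      show "(\<lambda>\<zeta>. f \<zeta> @ \<zeta>) ` R \<subseteq> RVx_pow K (k + n)"
      proof (rule image_subsetI)
        fix \<zeta> assume z: "\<zeta> \<in> R"
        show "f \<zeta> @ \<zeta> \<in> RVx_pow K (k + n)" using lR[OF z] lf[OF z] by (simp add: RVx_pow_iff)
      qed
      fix \<zeta> assume z: "\<zeta> \<in> R"
      \<comment> \<open>Moving the value behind its argument uses that rank ignores the order; in
        that place it adds nothing.\<close>
      have "rnk cl {} (f \<zeta> @ \<zeta>) = rnk cl {} (\<zeta> @ f \<zeta>)" using pg.rnk_swap_append[of "{}" "f \<zeta>" \<zeta>] lR(2)[OF z] lf(2)[OF z] by simp
      also have "\<dots> = rnk cl {} \<zeta>" by (rule cop.rnk_absorb) (use fcl[OF z] in simp)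
      finally show "rnk cl {} (f \<zeta> @ \<zeta>) = rnk cl {} \<zeta>" .
    qed
    ultimately show ?thesis unfolding e by simp
  qed
  have 9: "dimRV K {} R = dimRV K {} (f ` R)" if fin: "\<forall>\<xi>. finite {\<zeta> \<in> R. f \<zeta> = \<xi>}"
  proof -
    \<comment> \<open>The graph with exchanged blocks: its fibres over values are the finite fibres
      of \<open>f\<close>, so that argument and value lie in the closure of each other and have
      equal rank.\<close>
    let ?Gs = "{y @ x | x y. x @ y \<in> ?Gf \<and> length x = n}"
    have Gs: "RD (k + n) ?Gs" by (rule RD_swap[OF GfD])
    have gs: "y @ x \<in> ?Gs \<longleftrightarrow> x \<in> R \<and> y = f x" if ly: "length y = k" for x y
    proof
      assume "y @ x \<in> ?Gs"
      then obtain x' y' where h: "y @ x = y' @ x'" "x' @ y' \<in> ?Gf" "length x' = n" by blast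
      have x: "x' \<in> R" "y' = f x'" using h(2) unfolding gf[OF h(3)] by blast+
      show "x \<in> R \<and> y = f x" using h(1) x ly lf(1)[OF x(1)] by simp
    next
      assume "x \<in> R \<and> y = f x"
      then have x: "x \<in> R" "y = f x" by blast+
      then have "x @ y \<in> ?Gf" by blast
      then show "y @ x \<in> ?Gs" using lR(1)[OF x(1)] by blast
    qed
    have zcl: "set \<zeta> \<subseteq> cl (set (f \<zeta>))" if z: "\<zeta> \<in> R" for \<zeta>
    proof (rule finite_fibre_cl[OF Gs lf(1)[OF z]])
      have "{\<eta>. \<eta> \<in> R \<and> f \<zeta> = f \<eta>} = {\<eta> \<in> R. f \<eta> = f \<zeta>}" by (simp only: eq_commute)
      then show "finite {\<eta>. f \<zeta> @ \<eta> \<in> ?Gs}" unfolding gs[OF lf(1)[OF z]] using spec[OF fin, of "f \<zeta>"] by metis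
      show "f \<zeta> @ \<zeta> \<in> ?Gs" unfolding gs[OF lf(1)[OF z]] using z by simp
    qed
    have "rnk cl {} (f \<zeta>) = rnk cl {} \<zeta>" if z: "\<zeta> \<in> R" for \<zeta>
      using pg.rnk_le[of "{}" \<zeta> "f \<zeta>"] pg.rnk_le[of "{}" "f \<zeta>" \<zeta>] lR(2)[OF z] lf(2)[OF z] fcl[OF z] zcl[OF z] by simp
    then show ?thesis using dim_image[OF R(1) f(1)] by simp
  qed
  have 3: "\<exists>\<P>. finite \<P> \<and> partition_on R \<P> \<and>
        (\<forall>Q\<in>\<P>. definableRV K n {} Q \<and>
           (\<exists>I. I \<subseteq> {..<n} \<and> ereal (real (card I)) = dimRV K {} R \<and> (\<forall>\<eta>. finite {\<xi> \<in> Q. nths \<xi> I = \<eta>})))"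
  proof -
    have D: "definableRV K n {} Q" if "RD n Q" for Q
      using definableRV_RD[of Q n] that unfolding RD_def by blast
    obtain \<P> where P: "finite \<P>" "partition_on R \<P>" "\<forall>Q\<in>\<P>. RD n Q \<and> (\<exists>I. I \<subseteq> {..<n} \<and>
        ereal (real (card I)) = dimRV K {} R \<and> (\<forall>\<eta>. finite {\<xi> \<in> Q. nths \<xi> I = \<eta>}))"
      using finite_to_one_partition[OF RD] by (elim exE conjE)
    show ?thesis
      by (rule exI[of _ \<P>], intro conjI ballI P(1,2), rule D) (drule bspec[OF P(3)], erule conjunct1, drule bspec[OF P(3)], erule conjunct2)
  qed
  show ?thesis
    unfolding Let_def
    by (intro conjI allI impI;
        (rule dim_pos_iff[OF RD] dimRV_Un 3 4 6 dim_product[OF R(1) SD] | (rule 5; assumption) |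
         (rule 7[THEN conjunct1]; assumption) | (rule 7[THEN conjunct2]; assumption) |
         (rule 8; assumption) | (rule 9; assumption) | (rule dim_coset[OF RD]; assumption)))
qed

end
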